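(* The operator $A$ has a local spectral function on each of its regular spectral curves.
   Context: Setting. Let $a>0$ and let $w,p,q:\mathbb R\to\mathbb R$ be measurable and $a$-periodic, with $w,q,p^{-1}$ integrable over $(0,a)$, $w\neq0$ a.e. and $p>0$ a.e. Put $\mathfrak a(f):=\frac1w\big(-(pf')'+qf\big)$. $L^2_{|w|}(\mathbb R)$ has scalar product $(f,g)=\int_{\mathbb R}f\overline g|w|\,dx$. The maximal operator $A$ is $Af:=\mathfrak a(f)$, $\operatorname{dom}A=\{f\in L^2_{|w|}(\mathbb R): f,pf'\in AC_{\rm loc}(\mathbb R),\ \mathfrak a(f)\in L^2_{|w|}(\mathbb R)\}$. For $\lambda\in\mathbb C$, $\varphi_\lambda,\psi_\lambda$ are the solutions of $\mathfrak a(u)=\lambda u$ with $\varphi_\lambda(0)=1$, $(p\varphi_\lambda')(0)=0$, $\psi_\lambda(0)=0$, $(p\psi_\lambda')(0)=1$; $D(\lambda)=\varphi_\lambda(a)+(p\psi_\lambda')(a)$ is the Floquet discriminant and $\dot D$ its complex derivative. A curve is a continuous map $\gamma:\mathcal J\to\mathbb C$ on a real interval $\mathcal J$, identified with its image; it is analytic if it is injective and analytic at each interior point of $\mathcal J$. A regular spectral curve of $A$ is an analytic curve $\gamma:\mathcal J\to\sigma(A)$ such that $\dot D(\gamma(t))\ne0$ for all $t\in\mathcal J$. Local spectral function. Let $\Xi\subset\mathbb C$ be Borel-measurable and $T$ a closed linear operator in a Banach space $X$. $\mathfrak B_0(\Xi)$ is the system of Borel subsets of $\Xi$ whose closure is contained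 in $\Xi$; $\mathcal B(X)$ is the set of bounded everywhere defined operators on $X$. A mapping $E:\mathfrak B_0(\Xi)\to\mathcal B(X)$ is a local spectral function of $T$ on $\Xi$ if for all $\Delta,\Delta_1,\Delta_2,\ldots\in\mathfrak B_0(\Xi)$: (S1) $E(\Delta)$ is a projection in the double-commutant of the resolvent of $T$ (which maps to a (closed) subspace of $\operatorname{dom}T$ if $\Delta$ is bounded); (S2) $E$ is strongly $\sigma$-additive: if $\Delta_1,\Delta_2,\ldots$ are mutually disjoint and $\bigcup_{k}\Delta_k\in\mathfrak B_0(\Xi)$, then $\sum_{k=1}^nE(\Delta_k)f\to E(\bigcup_k\Delta_k)f$ as $n\to\infty$ for every $f\in X$; (S3) $E(\Delta_1\cap\Delta_2)=E(\Delta_1)E(\Delta_2)$; (S4) $\sigma(T|E(\Delta)X)\subset\overline{\sigma(T)\cap\Delta}$; (S5) $\sigma(T|(I-E(\Delta))X)\subset\overline{\sigma(T)\setminus\Delta}$. *)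

theory Defs
  imports "HOL-Analysis.Analysis"
begin

section \<open>Complex vector spaces\<close>

class complex_vector = ab_group_add +
  fixes scaleC :: "complex \<Rightarrow> 'a \<Rightarrow> 'a"  (infixr "*\<^sub>C" 75)
  assumes scaleC_add_right: "c *\<^sub>C (x + y) = c *\<^sub>C x + c *\<^sub>C y"
    and scaleC_add_left: "(c + d) *\<^sub>C x = c *\<^sub>C x + d *\<^sub>C x"
    and scaleC_scaleC: "c *\<^sub>C d *\<^sub>C x = (c * d) *\<^sub>C x"
    and scaleC_one: "1 *\<^sub>C x = x"

global_interpretation complex_vector: vector_space "scaleC :: complex \<Rightarrow> 'a \<Rightarrow> 'a::complex_vector"
  by unfold_locales (simp_all add: scaleC_add_right scaleC_add_left scaleC_scaleC scaleC_one)


section \<open>Closed operators in a complex Banach space\<close>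

text \<open>The Banach space is a subspace \<open>X\<close> of the vector space given by the type, with a norm
  \<open>nrm\<close> that is only meaningful on \<open>X\<close>: the spaces that occur here depend on a weight function,
  and the closed subspaces \<open>E \<Delta> ` X\<close> have to be Banach spaces as well.
  An operator in \<open>X\<close> is a domain \<open>D\<close> together with a function whose values outside \<open>D\<close> are
  irrelevant.\<close>

locale complex_banach =
  fixes nrm :: "'v::complex_vector \<Rightarrow> real" and X :: "'v set"
  assumes subspace: "complex_vector.subspace X"
    and norm_nonneg: "x \<in> X \<Longrightarrow> 0 \<le> nrm x"
    and norm_eq_0: "x \<in> X \<Longrightarrow> nrm x = 0 \<longleftrightarrow> x = 0"
    and norm_triangle: "x \<in> X \<Longrightarrow> y \<in> X \<Longrightarrow> nrm (x + y) \<le> nrm x + nrm y"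
    and norm_scaleC: "x \<in> X \<Longrightarrow> nrm (c *\<^sub>C x) = cmod c * nrm x"
    and complete: "range s \<subseteq> X \<Longrightarrow>
      (\<And>e. 0 < e \<Longrightarrow> \<exists>N. \<forall>m\<ge>N. \<forall>n\<ge>N. nrm (s m - s n) < e) \<Longrightarrow>
      \<exists>x\<in>X. (\<lambda>n. nrm (s n - x)) \<longlonglongrightarrow> 0"

definition clinear_on :: "'v::complex_vector set \<Rightarrow> ('v \<Rightarrow> 'v) \<Rightarrow> bool" where
  "clinear_on D T \<longleftrightarrow>
    (\<forall>x\<in>D. \<forall>y\<in>D. T (x + y) = T x + T y) \<and> (\<forall>c. \<forall>x\<in>D. T (c *\<^sub>C x) = c *\<^sub>C T x)"

definition bounded_operators :: "('v::complex_vector \<Rightarrow> real) \<Rightarrow> 'v set \<Rightarrow> ('v \<Rightarrow> 'v) set" where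
  "bounded_operators nrm X =
    {B. B ` X \<subseteq> X \<and> clinear_on X B \<and> (\<exists>K. \<forall>x\<in>X. nrm (B x) \<le> K * nrm x)}"

definition closed_operator ::
    "('v::complex_vector \<Rightarrow> real) \<Rightarrow> 'v set \<Rightarrow> 'v set \<Rightarrow> ('v \<Rightarrow> 'v) \<Rightarrow> bool" where
  "closed_operator nrm X D T \<longleftrightarrow>
    complex_vector.subspace D \<and> D \<subseteq> X \<and> T ` D \<subseteq> X \<and> clinear_on D T \<and>
    (\<forall>s x y. range s \<subseteq> D \<and> x \<in> X \<and> y \<in> X \<and>
        (\<lambda>n. nrm (s n - x)) \<longlonglongrightarrow> 0 \<and> (\<lambda>n. nrm (T (s n) - y)) \<longlonglongrightarrow> 0 \<longrightarrow>
      x \<in> D \<and> T x = y)"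

definition resolvent_set ::
    "('v::complex_vector \<Rightarrow> real) \<Rightarrow> 'v set \<Rightarrow> 'v set \<Rightarrow> ('v \<Rightarrow> 'v) \<Rightarrow> complex set" where
  "resolvent_set nrm X D T =
    {l. bij_betw (\<lambda>x. T x - l *\<^sub>C x) D X \<and>
        the_inv_into D (\<lambda>x. T x - l *\<^sub>C x) \<in> bounded_operators nrm X}"

definition resolvent :: "'v::complex_vector set \<Rightarrow> ('v \<Rightarrow> 'v) \<Rightarrow> complex \<Rightarrow> 'v \<Rightarrow> 'v" where
  "resolvent D T l = the_inv_into D (\<lambda>x. T x - l *\<^sub>C x)"

definition spectrum ::
    "('v::complex_vector \<Rightarrow> real) \<Rightarrow> 'v set \<Rightarrow> 'v set \<Rightarrow> ('v \<Rightarrow> 'v) \<Rightarrow> complex set" where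
  "spectrum nrm X D T = - resolvent_set nrm X D T"

text \<open>The restriction of \<open>T\<close> to a closed subspace \<open>Y\<close> of \<open>X\<close>, as an operator in \<open>Y\<close>, has domain
  \<open>D \<inter> Y\<close>.\<close>

abbreviation spectrum_restriction ::
    "('v::complex_vector \<Rightarrow> real) \<Rightarrow> 'v set \<Rightarrow> ('v \<Rightarrow> 'v) \<Rightarrow> 'v set \<Rightarrow> complex set" where
  "spectrum_restriction nrm D T Y \<equiv> spectrum nrm Y (D \<inter> Y) T"

definition commutant ::
    "('v::complex_vector \<Rightarrow> real) \<Rightarrow> 'v set \<Rightarrow> ('v \<Rightarrow> 'v) set \<Rightarrow> ('v \<Rightarrow> 'v) set" where
  "commutant nrm X S = {B \<in> bounded_operators nrm X. \<forall>C\<in>S. \<forall>x\<in>X. B (C x) = C (B x)}"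

definition double_commutant_resolvent ::
    "('v::complex_vector \<Rightarrow> real) \<Rightarrow> 'v set \<Rightarrow> 'v set \<Rightarrow> ('v \<Rightarrow> 'v) \<Rightarrow> ('v \<Rightarrow> 'v) set" where
  "double_commutant_resolvent nrm X D T =
    commutant nrm X (commutant nrm X (resolvent D T ` resolvent_set nrm X D T))"


section \<open>Local spectral functions\<close>

definition borel0 :: "complex set \<Rightarrow> complex set set" where
  "borel0 \<Xi> = {\<Delta> \<in> sets borel. \<Delta> \<subseteq> \<Xi> \<and> closure \<Delta> \<subseteq> \<Xi>}"

text \<open>In (S1), closedness of the subspace \<open>E \<Delta> ` X\<close> is automatic, as it is the range of a bounded
  projection. Values of \<open>E\<close> outside \<open>borel0 \<Xi>\<close> are irrelevant.\<close>

definition local_spectral_function ::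
    "('v::complex_vector \<Rightarrow> real) \<Rightarrow> 'v set \<Rightarrow> 'v set \<Rightarrow> ('v \<Rightarrow> 'v) \<Rightarrow> complex set \<Rightarrow>
     (complex set \<Rightarrow> 'v \<Rightarrow> 'v) \<Rightarrow> bool" where
  "local_spectral_function nrm X D T \<Xi> E \<longleftrightarrow>
    complex_banach nrm X \<and> closed_operator nrm X D T \<and> \<Xi> \<in> sets borel \<and>
    \<comment> \<open>(S1)\<close>
    (\<forall>\<Delta>\<in>borel0 \<Xi>. E \<Delta> \<in> double_commutant_resolvent nrm X D T \<and>
        (\<forall>x\<in>X. E \<Delta> (E \<Delta> x) = E \<Delta> x) \<and> (bounded \<Delta> \<longrightarrow> E \<Delta> ` X \<subseteq> D)) \<and>
    \<comment> \<open>(S2)\<close>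
    (\<forall>\<Delta>::nat \<Rightarrow> complex set. range \<Delta> \<subseteq> borel0 \<Xi> \<and> disjoint_family \<Delta> \<and> (\<Union>k. \<Delta> k) \<in> borel0 \<Xi> \<longrightarrow>
        (\<forall>f\<in>X. (\<lambda>n. nrm ((\<Sum>k<n. E (\<Delta> k) f) - E (\<Union>k. \<Delta> k) f)) \<longlonglongrightarrow> 0)) \<and>
    \<comment> \<open>(S3)\<close>
    (\<forall>\<Delta>\<^sub>1\<in>borel0 \<Xi>. \<forall>\<Delta>\<^sub>2\<in>borel0 \<Xi>. \<forall>x\<in>X. E (\<Delta>\<^sub>1 \<inter> \<Delta>\<^sub>2) x = E \<Delta>\<^sub>1 (E \<Delta>\<^sub>2 x)) \<and>
    \<comment> \<open>(S4)\<close>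
    (\<forall>\<Delta>\<in>borel0 \<Xi>. spectrum_restriction nrm D T (E \<Delta> ` X)
        \<subseteq> closure (spectrum nrm X D T \<inter> \<Delta>)) \<and>
    \<comment> \<open>(S5)\<close>
    (\<forall>\<Delta>\<in>borel0 \<Xi>. spectrum_restriction nrm D T ((\<lambda>x. x - E \<Delta> x) ` X)
        \<subseteq> closure (spectrum nrm X D T - \<Delta>))"


section \<open>The weighted space of square integrable functions\<close>

quotient_type ae_fun = "real \<Rightarrow> complex" / "\<lambda>f g. AE x in lebesgue. f x = g x"
  morphisms ae_rep ae_class
proof (rule equivpI)
  show "reflp (\<lambda>f g::real \<Rightarrow> complex. AE x in lebesgue. f x = g x)"
    by (simp add: reflp_def)
  show "symp (\<lambda>f g::real \<Rightarrow> complex. AE x in lebesgue. f x = g x)"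
    by (auto simp: symp_def elim: eventually_mono)
  show "transp (\<lambda>f g::real \<Rightarrow> complex. AE x in lebesgue. f x = g x)"
    by (auto simp: transp_def elim: eventually_elim2)
qed

instantiation ae_fun :: complex_vector
begin

lift_definition zero_ae_fun :: ae_fun is "\<lambda>x. 0" .

lift_definition plus_ae_fun :: "ae_fun \<Rightarrow> ae_fun \<Rightarrow> ae_fun" is "\<lambda>f g x. f x + g x"
  by (auto elim: eventually_elim2)

lift_definition minus_ae_fun :: "ae_fun \<Rightarrow> ae_fun \<Rightarrow> ae_fun" is "\<lambda>f g x. f x - g x"
  by (auto elim: eventually_elim2)

lift_definition uminus_ae_fun :: "ae_fun \<Rightarrow> ae_fun" is "\<lambda>f x. - f x"
  by (auto elim: eventually_mono)

lift_definition scaleC_ae_fun :: "complex \<Rightarrow> ae_fun \<Rightarrow> ae_fun" is "\<lambda>c f x. c * f x"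
  by (auto elim: eventually_mono)

instance
  by standard (transfer; simp add: algebra_simps)+

end

text \<open>Since \<open>w\<close> will be nonzero almost everywhere, the null sets of \<open>\<bar>w\<bar> dx\<close> are those of
  Lebesgue measure, so the elements of the weighted space are elements of type \<open>ae_fun\<close>.\<close>

definition sq_integrable :: "(real \<Rightarrow> real) \<Rightarrow> (real \<Rightarrow> complex) set" where
  "sq_integrable w =
    {f \<in> borel_measurable lebesgue. integrable lebesgue (\<lambda>x. (cmod (f x))\<^sup>2 * \<bar>w x\<bar>)}"

definition L2 :: "(real \<Rightarrow> real) \<Rightarrow> ae_fun set" where
  "L2 w = ae_class ` sq_integrable w"

definition L2_inner :: "(real \<Rightarrow> real) \<Rightarrow> ae_fun \<Rightarrow> ae_fun \<Rightarrow> complex" where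
  "L2_inner w F G = (LINT x|lebesgue. ae_rep F x * cnj (ae_rep G x) * complex_of_real \<bar>w x\<bar>)"

definition L2_norm :: "(real \<Rightarrow> real) \<Rightarrow> ae_fun \<Rightarrow> real" where
  "L2_norm w F = sqrt (Re (L2_inner w F F))"


section \<open>The differential expression\<close>

definition abs_continuous_on :: "real \<Rightarrow> real \<Rightarrow> (real \<Rightarrow> complex) \<Rightarrow> bool" where
  "abs_continuous_on c d f \<longleftrightarrow>
    (\<forall>\<epsilon>>0. \<exists>\<delta>>0. \<forall>(n::nat) u v.
      (\<forall>i<n. c \<le> u i \<and> u i \<le> v i \<and> v i \<le> d) \<and>
      (\<forall>i<n. \<forall>j<n. i \<noteq> j \<longrightarrow> {u i<..<v i} \<inter> {u j<..<v j} = {}) \<and>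
      (\<Sum>i<n. v i - u i) < \<delta>
      \<longrightarrow> (\<Sum>i<n. cmod (f (v i) - f (u i))) < \<epsilon>)"

definition AC_loc :: "(real \<Rightarrow> complex) set" where
  "AC_loc = {f. \<forall>c d. abs_continuous_on c d f}"

text \<open>For \<open>f\<close> in \<open>AC_loc\<close>, the function \<open>p f'\<close> is only defined almost everywhere; to say that it
  belongs to \<open>AC_loc\<close> means that it agrees almost everywhere with an element of \<open>AC_loc\<close>. The
  latter is unique because it is continuous, and point values such as \<open>(p f') 0\<close> refer to it.\<close>

definition is_quasi_deriv ::
    "(real \<Rightarrow> real) \<Rightarrow> (real \<Rightarrow> complex) \<Rightarrow> (real \<Rightarrow> complex) \<Rightarrow> bool" where
  "is_quasi_deriv p f g \<longleftrightarrow> g \<in> AC_loc \<and>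
    (AE x in lebesgue. g x = complex_of_real (p x) * vector_derivative f (at x))"

definition quasi_deriv :: "(real \<Rightarrow> real) \<Rightarrow> (real \<Rightarrow> complex) \<Rightarrow> real \<Rightarrow> complex" where
  "quasi_deriv p f = (THE g. is_quasi_deriv p f g)"

text \<open>The functions \<open>f\<close> with both \<open>f\<close> and \<open>p f'\<close> locally absolutely continuous.\<close>

definition SL_domain :: "(real \<Rightarrow> real) \<Rightarrow> (real \<Rightarrow> complex) set" where
  "SL_domain p = {f \<in> AC_loc. \<exists>g. is_quasi_deriv p f g}"

definition SL_expr ::
    "(real \<Rightarrow> real) \<Rightarrow> (real \<Rightarrow> real) \<Rightarrow> (real \<Rightarrow> real) \<Rightarrow> (real \<Rightarrow> complex) \<Rightarrow> real \<Rightarrow> complex" where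
  "SL_expr w p q f x = 1 / complex_of_real (w x) *
    (- vector_derivative (quasi_deriv p f) (at x) + complex_of_real (q x) * f x)"


section \<open>The maximal operator\<close>

definition max_dom :: "(real \<Rightarrow> real) \<Rightarrow> (real \<Rightarrow> real) \<Rightarrow> (real \<Rightarrow> real) \<Rightarrow> ae_fun set" where
  "max_dom w p q =
    {ae_class f |f. f \<in> sq_integrable w \<and> f \<in> SL_domain p \<and> SL_expr w p q f \<in> sq_integrable w}"

text \<open>A class has at most one locally absolutely continuous representative.\<close>

definition max_op ::
    "(real \<Rightarrow> real) \<Rightarrow> (real \<Rightarrow> real) \<Rightarrow> (real \<Rightarrow> real) \<Rightarrow> ae_fun \<Rightarrow> ae_fun" where
  "max_op w p q F = ae_class (SL_expr w p q (THE f. f \<in> AC_loc \<and> ae_class f = F))"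

definition max_spectrum ::
    "(real \<Rightarrow> real) \<Rightarrow> (real \<Rightarrow> real) \<Rightarrow> (real \<Rightarrow> real) \<Rightarrow> complex set" where
  "max_spectrum w p q = spectrum (L2_norm w) (L2 w) (max_dom w p q) (max_op w p q)"


section \<open>Floquet discriminant and regular spectral curves\<close>

definition SL_solution ::
    "(real \<Rightarrow> real) \<Rightarrow> (real \<Rightarrow> real) \<Rightarrow> (real \<Rightarrow> real) \<Rightarrow> complex \<Rightarrow> (real \<Rightarrow> complex) \<Rightarrow> bool" where
  "SL_solution w p q l u \<longleftrightarrow> u \<in> SL_domain p \<and> (AE x in lebesgue. SL_expr w p q u x = l * u x)"

definition sol_phi ::
    "(real \<Rightarrow> real) \<Rightarrow> (real \<Rightarrow> real) \<Rightarrow> (real \<Rightarrow> real) \<Rightarrow> complex \<Rightarrow> real \<Rightarrow> complex" where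
  "sol_phi w p q l = (THE u. SL_solution w p q l u \<and> u 0 = 1 \<and> quasi_deriv p u 0 = 0)"

definition sol_psi ::
    "(real \<Rightarrow> real) \<Rightarrow> (real \<Rightarrow> real) \<Rightarrow> (real \<Rightarrow> real) \<Rightarrow> complex \<Rightarrow> real \<Rightarrow> complex" where
  "sol_psi w p q l = (THE u. SL_solution w p q l u \<and> u 0 = 0 \<and> quasi_deriv p u 0 = 1)"

definition discriminant ::
    "real \<Rightarrow> (real \<Rightarrow> real) \<Rightarrow> (real \<Rightarrow> real) \<Rightarrow> (real \<Rightarrow> real) \<Rightarrow> complex \<Rightarrow> complex" where
  "discriminant a w p q l = sol_phi w p q l a + quasi_deriv p (sol_psi w p q l) a"

definition curve_analytic_at :: "(real \<Rightarrow> complex) \<Rightarrow> real \<Rightarrow> bool" where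
  "curve_analytic_at \<gamma> t\<^sub>0 \<longleftrightarrow>
    (\<exists>(c::nat \<Rightarrow> complex) r. r > 0 \<and>
      (\<forall>t. \<bar>t - t\<^sub>0\<bar> < r \<longrightarrow> (\<lambda>n. c n * complex_of_real (t - t\<^sub>0) ^ n) sums \<gamma> t))"

definition analytic_curve :: "real set \<Rightarrow> (real \<Rightarrow> complex) \<Rightarrow> bool" where
  "analytic_curve J \<gamma> \<longleftrightarrow> is_interval J \<and> continuous_on J \<gamma> \<and> inj_on \<gamma> J \<and>
    (\<forall>t\<in>interior J. curve_analytic_at \<gamma> t)"

definition regular_spectral_curve ::
    "real \<Rightarrow> (real \<Rightarrow> real) \<Rightarrow> (real \<Rightarrow> real) \<Rightarrow> (real \<Rightarrow> real) \<Rightarrow>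
     real set \<Rightarrow> (real \<Rightarrow> complex) \<Rightarrow> bool" where
  "regular_spectral_curve a w p q J \<gamma> \<longleftrightarrow> analytic_curve J \<gamma> \<and>
    \<gamma> ` J \<subseteq> max_spectrum w p q \<and> (\<forall>t\<in>J. deriv (discriminant a w p q) (\<gamma> t) \<noteq> 0)"

end

(* Let S be the sum of the translations by a and -a, a bounded operator with spectrum [-2,2] that commutes
with A, and let D be the discriminant. If v is any solution of (A - l) v = h, then
Q(l) h = v(. + a) + v(. - a) - D(l) v depends only on h. It is a bounded operator with
(A - l) Q(l) = S - D(l) and Q(l) (A - l) = S - D(l) on dom A, so the resolvent is Q(l) (S - D(l))^-1 when
D(l) is not in [-2,2]. The Floquet transform gives a bounded Borel functional calculus of S. On a regular
spectral curve D is injective; let lam be its inverse. On the fiber S = s the operator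
T(s) = Q(lam s) / D'(lam s) is a projection, and E(Delta) is the integral of T(s) over D(Delta) with respect
to the spectral measure of S. This needs the curve to be bounded: for large l the discriminant can lie in
[-2,2] only for real l, where sqrt (4 - D(l)^2) <= C |l D'(l)|, so that a bounded change of
arccos (D / 2) allows only a bounded change of ln |l|. *)
theory Submission
  imports Defs "HOL-Probability.Probability" "HOL-Complex_Analysis.Complex_Analysis" "HOL-Real_Asymp.Real_Asymp"
begin

text \<open>Since \<open>w\<close> may change sign, \<open>A\<close> need not be symmetric in the
  space with weight |w|, so no spectral theorem is available for it. The translations are unitary
  there, and the calculus of \<open>S\<close> takes over, with the \<open>Q l\<close> as
  operator-valued coefficients. A fiber S = s is not a subspace, because \<open>S\<close> has no
  eigenvectors; a statement on a fiber therefore means an estimate by a multiple of norm (S x - s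
  x). Such an error disappears in Riemann sums over cells of diameter 1/n: the spectral projections
  of disjoint cells are orthogonal and commute with the integrand, so the errors do not add up. This
  does not settle the double commutant: an operator \<open>B\<close> that commutes with the
  resolvents of \<open>A\<close> is not known to commute with \<open>S\<close>. But the commutators
  of \<open>B\<close> with \<open>S\<close> and with \<open>Q l\<close> are related to each other as
  S - disc l and \<open>Q l\<close> are, which is enough for the spectral projections to annihilate
  them on both sides; here the errors do add up, and the number of cells has to be counted.\<close>

abbreviation (input) "cor == complex_of_real"
abbreviation (input) "lint == integrable lebesgue"
abbreviation (input) "sint == set_integrable lebesgue"
abbreviation (input) "lmeas == borel_measurable lebesgue"
abbreviation (input) tends (infix "---->" 60) where "X ----> L == X \<longlonglongrightarrow> L"
abbreviation (input) Leb (binder "LEB " 60) where "Leb f == integral\<^sup>L lebesgue f"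
syntax "_Sleb" :: "pttrn => real set => 'a => 'a" ("(3LEB (_):(_)./ _)" [0,110,60] 60)
translations "LEB x:A. f" => "CONST set_lebesgue_integral (CONST lebesgue) A (%x. f)"
syntax "_AEleb" :: "pttrn => bool => bool" ("AE _./ _" [0,10] 10)
translations "AE x. P" => "CONST eventually (%x. P) (CONST ae_filter (CONST lebesgue))"

section \<open>Absolutely continuous functions\<close>

lemma integrable_imp_set_integrable:
 fixes f :: "'a => 'b::{banach, second_countable_topology}"
 shows "integrable M f ==> A : sets M ==> set_integrable M A f"
 unfolding set_integrable_def by (rule integrable_mult_indicator)

text \<open>With \<open>abs c = 1\<close>, translations and the reflection are treated together, and
  the Jacobian factor is 1.\<close>

lemma lebesgue_distr_affine:
 fixes c t :: real
 assumes c: "abs c = 1"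
 shows "distr lebesgue lebesgue (%x. t + c * x) = lebesgue"
  and "(%x. t + c * x) : lebesgue \<rightarrow>\<^sub>M lebesgue"
proof -
 show "(%x. t + c * x) : lebesgue \<rightarrow>\<^sub>M lebesgue"
  using lebesgue_affine_measurable[of "%_. c" t] c by auto
 have "density (distr lebesgue lebesgue (%x. t + c * x)) (%_. 1) = distr lebesgue lebesgue (%x. t + c * x)"
  by (rule measure_eqI) (auto simp: emeasure_density)
 then show "distr lebesgue lebesgue (%x. t + c * x) = lebesgue"
  using lebesgue_real_affine[of c t] c by (simp add: one_ennreal_def[symmetric] ennreal_1[symmetric] del: ennreal_1)
qed

lemma AE_affine:
 fixes c t :: real
 assumes c: "abs c = 1" and "AE x. P x"
 shows "AE x. P (t + c * x)"
proof -
 have "AE x in distr lebesgue lebesgue (%x. t + c * x). P x"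
  by (subst lebesgue_distr_affine(1)[OF c]) (rule assms(2))
 then show ?thesis by (rule AE_distrD[OF lebesgue_distr_affine(2)[OF c]])
qed

lemma AE_shift: "AE x. P x ==> AE x. P (x + (t::real))"
 using AE_affine[of 1 P t] by (simp add: add.commute)

definition loc_int :: "(real => 'a::{banach, second_countable_topology}) => bool" where
 "loc_int g \<longleftrightarrow> (ALL c d. sint {c..d} g)"

text \<open>The working form of absolute continuity: the fundamental theorem of calculus serves as
  the definition. The equivalence with the epsilon-delta definition of \<open>AC_loc\<close> is
  given by \<open>prim_AC\<close> and \<open>AC_prim_vector_derivative\<close>.\<close>

definition prim :: "(real => complex) => (real => complex) => bool" where
 "prim f g \<longleftrightarrow> loc_int g & (ALL x y. x <= y --> f y - f x = (LEB t:{x..y}. g t))"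

lemma loc_intD: "loc_int g ==> sint {c..d} g"
 by (simp add: loc_int_def)

lemma primD: "prim f g ==> x <= y ==> f y - f x = (LEB t:{x..y}. g t)"
 by (simp add: prim_def)

lemma loc_int_Re: "loc_int g ==> loc_int (%x. Re (g x))"
 unfolding loc_int_def set_integrable_def
 by (auto dest!: spec intro: integrable_Re
   simp: Re_divide_numeral scaleR_complex.simps[symmetric] simp del: scaleR_complex.simps)

text \<open>Lebesgue's differentiation theorem is used for averages over [x, x + h] only; the
  averages to the left come from the same theorem applied to the reflected function at -x.\<close>

lemma prim_derivative_AE:
 assumes "prim f g"
 shows "AE x. (f has_vector_derivative g x) (at x)"
proof -
 have gi: "sint {y..z} g" for y z using assms by (simp add: prim_def loc_int_def)
 then have i: "g integrable_on {y..z}" for y z using set_lebesgue_integral_eq_integral(1) by blast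
 have f: "f z - f y = integral {y..z} g" if "y <= z" for y z
  using primD[OF assms that] set_lebesgue_integral_eq_integral(2)[OF gi] by simp
 have i': "(%x. g (- x)) integrable_on {y..z}" for y z using Henstock_Kurzweil_Integration.integrable_reflect_real[where f=g and a="-z" and b="-y"] i by simp
 obtain N where N: "negligible N" "!!x e. x ~: N ==> 0 < e ==>
   EX d>0. ALL h. 0 < h & h < d --> cmod (integral {x..x + h} g /\<^sub>R h - g x) < e"
  using integrable_ccontinuous_explicit[of g] i by (auto simp: cbox_interval)
 obtain N' where N': "negligible N'" "!!x e. x ~: N' ==> 0 < e ==>
   EX d>0. ALL h. 0 < h & h < d --> cmod (integral {x..x + h} (%x. g (- x)) /\<^sub>R h - g (- x)) < e"
  using integrable_ccontinuous_explicit[of "%x. g (- x)"] i' by (auto simp: cbox_interval)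
 have "AE x. x ~: N" "AE x. x ~: N'" using N(1) N'(1) by (simp_all add: AE_not_in negligible_iff_null_sets)
 then have "AE x. x ~: N" "AE x. - x ~: N'" using AE_affine[of "-1" "%x. x ~: N'" 0] by simp_all
 then show ?thesis
 proof eventually_elim
  case (elim x)
  show ?case unfolding has_vector_derivative_def has_derivative_at_alt
  proof (intro conjI allI impI)
   show "bounded_linear (%h. h *\<^sub>R g x)" by (rule bounded_linear_scaleR_left)
   fix e :: real assume e: "0 < e"
   have q: "cmod (z - h *\<^sub>R g x) <= e * h" if "cmod (z /\<^sub>R h - g x) < e" "0 < h" for z h
   proof -
    have "z - h *\<^sub>R g x = h *\<^sub>R (z /\<^sub>R h - g x)" using that by (simp add: scaleR_diff_right)
    then show ?thesis using that by (simp add: mult.commute del: scaleR_diff_right)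
   qed
   obtain d where d: "0 < d" "!!h. 0 < h ==> h < d ==> cmod (f (x + h) - f x - h *\<^sub>R g x) <= e * h"
    using N(2)[OF elim(1) e] q f[of x "x + h" for h] by (metis less_add_same_cancel1 less_imp_le)
   have "integral {- x..- x + h} (%x. g (- x)) = f x - f (x - h)" if "0 < h" for h
    using f[of "x - h" x] that Henstock_Kurzweil_Integration.integral_reflect_real[where a="x - h" and b=x and f=g] by simp
   then obtain d' where d': "0 < d'" "!!h. 0 < h ==> h < d' ==> cmod (f x - f (x - h) - h *\<^sub>R g x) <= e * h"
    using N'(2)[OF elim(2) e] q by (metis minus_minus)
   show "EX d>0. ALL y. norm (y - x) < d --> norm (f y - f x - (y - x) *\<^sub>R g x) <= e * norm (y - x)"
   proof (intro exI[of _ "min d d'"] conjI allI impI)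
    fix y assume "norm (y - x) < min d d'"
    then show "norm (f y - f x - (y - x) *\<^sub>R g x) <= e * norm (y - x)"
     using d(2)[of "y - x"] d'(2)[of "x - y"] norm_minus_cancel[of "f y - f x - (y - x) *\<^sub>R g x"]
     by (cases x y rule: linorder_cases) (auto simp: algebra_simps)
   qed (use d d' in auto)
  qed
 qed
qed

text \<open>Measurability of \<open>h\<close> is part of the conclusion and comes from the
  completeness of Lebesgue measure.\<close>

lemma set_integral_cong_AE_lebesgue:
 fixes g h :: "real => 'a::euclidean_space"
 assumes g: "sint S g" and ae: "AE x. x : S --> h x = g x"
 shows "sint S h & (LEB t:S. h t) = (LEB t:S. g t)"
proof -
 obtain N where N: "N : null_sets lebesgue" "{x. ~ (x : S --> h x = g x)} <= N"
  using ae by (auto simp: eventually_ae_filter)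
 then have n: "negligible {x. ~ (x : S --> h x = g x)}" by (metis negligible_iff_null_sets negligible_subset)
 have h: "sint S h"
  by (rule absolutely_integrable_spike[OF g n]) auto
 have "integral S g = integral S h" by (rule integral_spike[OF n]) auto
 then show ?thesis using h set_lebesgue_integral_eq_integral(2)[OF h] set_lebesgue_integral_eq_integral(2)[OF g] by simp
qed

lemma AE_not_eq: "AE x. x ~= (c::real)"
 by (rule AE_I'[of "{c}"]) (auto simp: negligible_iff_null_sets[symmetric])

lemma set_integral_Icc_split:
 fixes g :: "real => 'a::euclidean_space"
 assumes "x <= y" "y <= z" "sint {x..y} g" "sint {y..z} g"
 shows "sint {x..z} g"
  "(LEB t:{x..z}. g t) = (LEB t:{x..y}. g t) + (LEB t:{y..z}. g t)"
proof -
 have u: "{x..y} Un {y..z} = {x..z}" using assms(1,2) by auto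
 show i: "sint {x..z} g" using set_integrable_Un[OF assms(3,4)] u by simp
 show "(LEB t:{x..z}. g t) = (LEB t:{x..y}. g t) + (LEB t:{y..z}. g t)"
  using Henstock_Kurzweil_Integration.integral_combine[OF assms(1,2) set_lebesgue_integral_eq_integral(1)[OF i]]
  by (simp add: set_lebesgue_integral_eq_integral(2)[OF i] set_lebesgue_integral_eq_integral(2)[OF assms(3)]
    set_lebesgue_integral_eq_integral(2)[OF assms(4)])
qed

lemma loc_int_add: "loc_int g ==> loc_int h ==> loc_int (%x. g x + h x)"
 and loc_int_diff: "loc_int g ==> loc_int h ==> loc_int (%x. g x - h x)"
 unfolding loc_int_def by (auto intro: set_integral_add set_integral_diff)

lemma loc_int_cmult:
 fixes g :: "real => 'a::{real_normed_field, banach, second_countable_topology}"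
 shows "loc_int g ==> loc_int (%x. c * g x)"
 unfolding loc_int_def by (auto intro: set_integrable_mult_right)

lemma prim_cong_AE:
 assumes f: "prim f g" and ae: "AE x. h x = g x" shows "prim f h"
proof -
 have "sint {x..y} h & (LEB t:{x..y}. h t) = (LEB t:{x..y}. g t)" for x y
  by (rule set_integral_cong_AE_lebesgue) (use f ae in "auto simp: prim_def loc_int_def elim: eventually_mono")
 then show ?thesis using f by (simp add: prim_def loc_int_def)
qed

lemma prim_add: "prim f f' ==> prim g g' ==> prim (%x. f x + g x) (%x. f' x + g' x)"
 and prim_diff: "prim f f' ==> prim g g' ==> prim (%x. f x - g x) (%x. f' x - g' x)"
 unfolding prim_def
 by (auto intro: loc_int_add loc_int_diff simp: loc_int_def set_integral_add(2) set_integral_diff(2) algebra_simps)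

lemma prim_cmult: "prim f f' ==> prim (%x. c * f x) (%x. c * f' x)"
 unfolding prim_def by (auto intro: loc_int_cmult simp: right_diff_distrib[symmetric])

section \<open>Families of non-overlapping intervals and absolute continuity\<close>

definition is_family :: "'i set => real => real => ('i => real) => ('i => real) => bool" where
 "is_family I x y u v \<longleftrightarrow> finite I & (ALL i:I. x <= u i & u i <= v i & v i <= y) &
   (ALL i:I. ALL j:I. i ~= j --> {u i<..<v i} Int {u j<..<v j} = {})"

abbreviation var_sum :: "(real => complex) => 'i set => ('i => real) => ('i => real) => real" where
 "var_sum f I u v == \<Sum>i\<in>I. cmod (f (v i) - f (u i))"

lemma AC_loc_iff: "f : AC_loc \<longleftrightarrow> (ALL c d. ALL e>0. EX de>0. ALL (n::nat) u v.
  is_family {..<n} c d u v & (\<Sum>i<n. v i - u i) < de --> var_sum f {..<n} u v < e)"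
 by (simp add: AC_loc_def abs_continuous_on_def is_family_def lessThan_def conj_assoc)

text \<open>The index type is free because intervals are later indexed by sets (in a Vitali type
  covering) and by pairs (in a family of families).\<close>

lemma AC_loc_family:
 assumes f: "f : AC_loc" and e: "0 < e"
 shows "EX de>0. ALL (I :: 'i set) u v. is_family I c d u v --> (\<Sum>i\<in>I. v i - u i) < de --> var_sum f I u v < e"
proof -
 obtain de where de: "de > 0" "!!(n::nat) u v. is_family {..<n} c d u v ==> (\<Sum>i<n. v i - u i) < de ==> var_sum f {..<n} u v < e"
  using f[unfolded AC_loc_iff, THEN spec, THEN spec, THEN spec, THEN mp, OF e, of c d] by blast
 have "var_sum f I u v < e" if I: "is_family I c d u v" and s: "(\<Sum>i\<in>I. v i - u i) < de" for I :: "'i set" and u v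
 proof -
  obtain b where b: "bij_betw b {..<card I} I"
   using ex_bij_betw_nat_finite[of I] I atLeast0LessThan unfolding is_family_def by metis
  have "is_family {..<card I} c d (u \<circ> b) (v \<circ> b)"
   unfolding is_family_def comp_def
  proof (intro conjI ballI impI)
   fix i j assume "i : {..<card I}" "j : {..<card I}" "i ~= j"
   then have "b i : I" "b j : I" "b i ~= b j" using bij_betwE[OF b] inj_onD[OF bij_betw_imp_inj_on[OF b]] by blast+
   then show "{u (b i)<..<v (b i)} Int {u (b j)<..<v (b j)} = {}" using I by (simp add: is_family_def)
  qed (use I bij_betwE[OF b] in "auto simp: is_family_def")
  then show ?thesis using de(2)[of "card I" "u \<circ> b" "v \<circ> b"] s
   sum.reindex_bij_betw[OF b, of "%i. cmod (f (v i) - f (u i))"] sum.reindex_bij_betw[OF b, of "%i. v i - u i"] by simp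
 qed
 then show ?thesis using de(1) by blast
qed

lemma AC_loc_continuous:
 assumes f: "f : AC_loc" shows "continuous_on UNIV f"
 unfolding continuous_on_iff
proof (intro ballI allI impI)
 fix x e :: real assume e: "0 < e"
 obtain de where de: "de > 0" "!!(I :: nat set) u v. is_family I (x - 1) (x + 1) u v ==> (\<Sum>i\<in>I. v i - u i) < de ==> var_sum f I u v < e"
  using AC_loc_family[OF f e] by blast
 have "dist (f y) (f x) < e" if "dist y x < min de 1" for y
  using de(2)[of "{0}" "%_. min x y" "%_. max x y"] that
  by (cases "x <= y") (auto simp: is_family_def dist_norm norm_minus_commute)
 then show "EX d>0. ALL y:UNIV. dist y x < d --> dist (f y) (f x) < e" using de(1) by (intro exI[of _ "min de 1"]) auto
qed

text \<open>Two dominating functions are allowed so that products are covered, and the constant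
  \<open>L\<close> has to exist only on each bounded interval.\<close>

lemma AC_loc_dominated:
 assumes f: "f : AC_loc" and g: "g : AC_loc"
  and F: "!!c d. EX L. ALL x:{c..d}. ALL y:{c..d}. cmod (F y - F x) <= L * (cmod (f y - f x) + cmod (g y - g x))"
 shows "F : AC_loc"
 unfolding AC_loc_iff
proof (intro allI impI)
 fix c d e :: real assume e: "0 < e"
 obtain L where L: "!!x y. x : {c..d} ==> y : {c..d} ==> cmod (F y - F x) <= L * (cmod (f y - f x) + cmod (g y - g x))"
  using F[of c d] by blast
 define B where "B = abs L + 1"
 have B: "0 < B" "L <= B" by (auto simp: B_def)
 have e2: "0 < e / (2 * B)" using e B by simp
 obtain de1 where de1: "de1 > 0" "!!(I::nat set) u v. is_family I c d u v ==> (\<Sum>i\<in>I. v i - u i) < de1 ==> var_sum f I u v < e / (2 * B)"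
  using AC_loc_family[OF f e2] by blast
 obtain de2 where de2: "de2 > 0" "!!(I::nat set) u v. is_family I c d u v ==> (\<Sum>i\<in>I. v i - u i) < de2 ==> var_sum g I u v < e / (2 * B)"
  using AC_loc_family[OF g e2] by blast
 have "var_sum F {..<n} u v < e" if A: "is_family {..<n} c d u v" and s: "(\<Sum>i<n. v i - u i) < min de1 de2" for n :: nat and u v
 proof -
  have "var_sum F {..<n} u v <= (\<Sum>i<n. B * (cmod (f (v i) - f (u i)) + cmod (g (v i) - g (u i))))"
  proof (rule sum_mono)
   fix i assume "i : {..<n}"
   then have "u i : {c..d}" "v i : {c..d}" using A by (force simp: is_family_def)+
   then show "cmod (F (v i) - F (u i)) <= B * (cmod (f (v i) - f (u i)) + cmod (g (v i) - g (u i)))"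
    by (rule order_trans[OF L mult_right_mono[OF B(2)]]) auto
  qed
  also have "... = B * var_sum f {..<n} u v + B * var_sum g {..<n} u v"
   by (simp add: sum.distrib sum_distrib_left distrib_left)
  also have "... < B * (e / (2 * B)) + B * (e / (2 * B))"
   by (intro add_strict_mono mult_strict_left_mono de1(2) de2(2) B A) (use s in auto)
  finally show ?thesis using B by simp
 qed
 then show "EX de>0. ALL n u v. is_family {..<n::nat} c d u v & (\<Sum>i<n. v i - u i) < de --> var_sum F {..<n} u v < e"
  using de1(1) de2(1) by (intro exI[of _ "min de1 de2"]) auto
qed

lemma family_length:
 assumes I: "is_family I x y u v" and U: "(\<Union>i\<in>I. {u i<..<v i}) <= U" "U : sets lebesgue"
 shows "ennreal (\<Sum>i\<in>I. v i - u i) <= emeasure lebesgue U"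
proof -
 have "ennreal (\<Sum>i\<in>I. v i - u i) = (\<Sum>i\<in>I. emeasure lebesgue {u i<..<v i})"
  using I by (subst sum_ennreal[symmetric]) (auto simp: is_family_def intro!: sum.cong)
 also have "... = emeasure lebesgue (\<Union>i\<in>I. {u i<..<v i})"
  using I by (intro sum_emeasure) (auto simp: disjoint_family_on_def is_family_def)
 also have "... <= emeasure lebesgue U" by (rule emeasure_mono[OF U])
 finally show ?thesis .
qed

lemma family_length_Icc:
 assumes I: "is_family I x y u v" and xy: "x <= y"
 shows "(\<Sum>i\<in>I. v i - u i) <= y - x"
proof -
 have "(\<Union>i\<in>I. {u i<..<v i}) <= {x..y}" using I by (force simp: is_family_def)
 from family_length[OF I this] show ?thesis using xy by (simp add: ennreal_le_iff)
qed

text \<open>Split |g| at height \<open>N\<close>: the bounded part contributes at most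
  \<open>N\<close> times the total length, and the excess \<open>h\<close> has integral below e/2
  wherever the intervals lie.\<close>

lemma prim_AC:
 assumes f: "prim f g"
 shows "f : AC_loc"
 unfolding AC_loc_iff
proof (intro allI impI)
 fix c d e :: real assume e: "0 < e"
 have gi: "sint {x..y} g" for x y using f by (simp add: prim_def loc_int_def)
 define k where "k x = indicator {c..d} x * norm (g x)" for x
 have k: "lint k" using set_integrable_norm[OF gi[of c d]] by (simp add: k_def[abs_def] set_integrable_def)
 have [measurable]: "k : lmeas" using k by auto
 have k0: "0 <= k x" for x by (simp add: k_def)
 have "(%n. LEB x. k x - min (k x) (real n)) ----> (LEB x::real. (0::real))"
 proof (rule integral_dominated_convergence[where w=k])
  show "AE x. (%n. k x - min (k x) (real n)) ----> 0"
  proof (rule AE_I2, rule tendsto_eventually)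
   fix x
   obtain n0 :: nat where "k x < real n0" using reals_Archimedean2 by blast
   then show "\<forall>\<^sub>F n in sequentially. k x - min (k x) (real n) = 0"
    by (intro eventually_sequentiallyI[of n0]) auto
  qed
 qed (use k k0 in auto)
 then have "\<forall>\<^sub>F n in sequentially. (LEB x. k x - min (k x) (real n)) < e / 2" using e by (intro order_tendstoD(2)) auto
 then obtain N where N: "0 < N" "(LEB x. k x - min (k x) (real N)) < e / 2"
  using eventually_happens'[OF sequentially_bot eventually_conj[OF eventually_gt_at_top[of 0]]] by blast
 define h where "h x = k x - min (k x) (real N)" for x
 have h: "lint h" unfolding h_def[abs_def] by (rule Bochner_Integration.integrable_bound[OF k]) (auto simp: k0)
 have int: "lint (%x. indicator {s..t} x * h x)" for s t
  using integrable_mult_indicator[OF _ h, of "{s..t}"] by simp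
 have "var_sum f {..<n} u v < e" if fam: "is_family {..<n} c d u v" and len: "(\<Sum>i<n. v i - u i) < e / (2 * real N)" for n :: nat and u v
 proof -
  have "cmod (f (v i) - f (u i)) <= (LEB x. indicator {u i..v i} x * h x) + real N * (v i - u i)" if i: "i < n" for i
  proof -
   have uv: "c <= u i" "u i <= v i" "v i <= d" using fam i by (auto simp: is_family_def)
   have "cmod (f (v i) - f (u i)) <= (LEB x. indicator {u i..v i} x * norm (g x))"
    using set_integral_norm_bound[OF gi, of "u i" "v i"] primD[OF f uv(2)] by (simp add: set_lebesgue_integral_def)
   also have "... <= (LEB x. indicator {u i..v i} x * h x + real N * indicator {u i..v i} x)"
   proof (rule integral_mono)
    show "lint (%x. indicator {u i..v i} x * norm (g x))"
     using set_integrable_norm[OF gi[of "u i" "v i"]] by (simp add: set_integrable_def)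
    show "lint (%x. indicator {u i..v i} x * h x + real N * indicator {u i..v i} x)"
     using int uv by (intro Bochner_Integration.integrable_add) auto
   qed (use uv in "auto simp: h_def k_def indicator_def")
   also have "... = (LEB x. indicator {u i..v i} x * h x) + real N * (v i - u i)"
    using int uv by (subst Bochner_Integration.integral_add) auto
   finally show ?thesis .
  qed
  then have "var_sum f {..<n} u v <= (\<Sum>i<n. (LEB x. indicator {u i..v i} x * h x) + real N * (v i - u i))"
   by (intro sum_mono) auto
  also have "... = (LEB x. (\<Sum>i<n. indicator {u i..v i} x * h x)) + real N * (\<Sum>i<n. v i - u i)"
   using int by (subst Bochner_Integration.integral_sum) (simp_all only: sum.distrib sum_distrib_left)
  also have "(LEB x. (\<Sum>i<n. indicator {u i..v i} x * h x)) <= (LEB x. h x)"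
  proof (rule integral_mono_AE[OF Bochner_Integration.integrable_sum[OF int] h])
   \<comment> \<open>Closed intervals of the family may share end points; off this finite set their
     indicators agree with those of the disjoint open intervals and sum to at most 1.\<close>
   have "AE x. x ~: u ` {..<n} Un v ` {..<n}"
    by (rule AE_I'[of "u ` {..<n} Un v ` {..<n}"]) (auto simp: negligible_iff_null_sets[symmetric] intro!: negligible_Un negligible_finite)
   then show "AE x. (\<Sum>i<n. indicator {u i..v i} x * h x) <= h x"
   proof eventually_elim
    case (elim x)
    have "(\<Sum>i<n. indicat_real {u i..v i} x) = (\<Sum>i<n. indicat_real {u i<..<v i} x)"
     using elim by (intro sum.cong refl) (auto simp: indicator_def less_le)
    also have "... = indicator (\<Union>i\<in>{..<n}. {u i<..<v i}) x"
     using fam by (intro indicator_UN_disjoint[symmetric]) (auto simp: disjoint_family_on_def is_family_def)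
    also have "... <= 1" by (auto simp: indicator_def)
    finally show ?case unfolding sum_distrib_right[symmetric]
     by (intro mult_left_le_one_le) (auto simp: h_def sum_nonneg simp del: sum_of_bool_eq)
   qed
  qed
  also have "(LEB x. h x) < e / 2" using N by (simp add: h_def[abs_def])
  also have "real N * (\<Sum>i<n. v i - u i) < real N * (e / (2 * real N))" using len N by (intro mult_strict_left_mono) auto
  finally show ?thesis using N by simp
 qed
 then show "EX de>0. ALL n u v. is_family {..<n::nat} c d u v & (\<Sum>i<n. v i - u i) < de --> var_sum f {..<n} u v < e"
  using e N(1) by (intro exI[of _ "e / (2 * real N)"]) auto
qed

text \<open>The density is the Radon-Nikodym derivative of the Stieltjes measure of
  \<open>F\<close>; absolute continuity of \<open>F\<close> makes Lebesgue null sets null for this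
  measure.\<close>

lemma AC_monotone_has_density:
 fixes F :: "real => real"
 assumes mono: "!!x y. x <= y ==> F x <= F y" and ac: "(%x. cor (F x)) : AC_loc"
 obtains g where "prim (%x. cor (F x)) g"
proof -
 have cont: "continuous_on UNIV F" using continuous_on_Re[OF AC_loc_continuous[OF ac]] by simp
 define nu where "nu = interval_measure F"
 have snu: "sets nu = sets borel" "space nu = UNIV" by (simp_all add: nu_def)
 have Icc: "emeasure nu {x..y} = ennreal (F y - F x)" if "x <= y" for x y
  unfolding nu_def using that mono cont by (intro emeasure_interval_measure_Icc) auto
 \<comment> \<open>A bounded null set is covered by countably many non-overlapping intervals inside
   an open set of measure below \<open>de\<close>. Absolute continuity bounds the
   \<open>nu\<close>-mass of each finite subfamily by \<open>e\<close>, and continuity from below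
   gives the same bound for the union.\<close>
 have null: "emeasure nu S <= ennreal e" if S: "S : null_sets lborel" "S <= cbox (- real K) (real K)" and e: "0 < e" for S K e
 proof (cases "K = 0")
  case True
  then show ?thesis using emeasure_mono[of S "{0..0}" nu] S(2) Icc[of 0 0] by (simp add: snu)
 next
  case False
  obtain de where de: "de > 0" "!!(I :: real set set) u v. is_family I (- real K) (real K) u v ==> (\<Sum>i\<in>I. v i - u i) < de ==> var_sum (%x. cor (F x)) I u v < e"
   using AC_loc_family[OF ac e] by blast
  have Sl: "S : null_sets lebesgue" using S(1) by (rule null_sets_completionI)
  obtain U where U: "open U" "S <= U" "emeasure lebesgue (U - S) < ennreal de"
   using sets_lebesgue_outer_open[OF null_setsD2[OF Sl] de(1)] by metis
  have Um: "U : sets lebesgue" by (rule sets_completionI_sets) (simp add: U(1))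
  have Ude: "emeasure lebesgue U < ennreal de" using U(3) emeasure_Diff_null_set[OF Sl Um] by simp
  \<comment> \<open>Each interval of the covering lies in the gauge set of one of its points in
    \<open>S\<close>; since \<open>S\<close> lies in \<open>U\<close>, this value of the gauge
    forces the interval into \<open>U\<close>.\<close>
  define gm where "gm x = (if x : U then U else UNIV)" for x
  have ga: "gauge gm" using U(1) by (auto simp: gauge_def gm_def)
  have ne: "box (- real K) (real K) ~= {}" using False by (simp add: box_eq_empty)
  obtain \<D> where \<D>: "countable \<D>" "\<Union>\<D> <= cbox (- real K) (real K)" "!!X. X : \<D> ==> interior X ~= {} & (EX a b. X = cbox a b)"
   "pairwise (%A B. interior A Int interior B = {}) \<D>" "!!X. X : \<D> ==> EX x:S Int X. X <= gm x" "S <= \<Union>\<D>"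
   by (rule covering_lemma[OF S(2) ne ga], rule that; assumption)
  define u v where "u X = Inf X" and "v X = Sup X" for X :: "real set"
  have X: "u X <= v X" "X = {u X..v X}" "X <= U" "interior X = {u X<..<v X}" if XD: "X : \<D>" for X
  proof -
   obtain a b where ab: "X = {a..b}" "interior X ~= {}" using \<D>(3)[OF XD] by auto
   then have "a < b" by simp
   then show "u X <= v X" "X = {u X..v X}" "interior X = {u X<..<v X}" by (auto simp: ab(1) u_def v_def)
   show "X <= U" using \<D>(5)[OF XD] U(2) by (auto simp: gm_def split: if_splits)
  qed
  have fin: "emeasure nu (\<Union>\<F>) <= ennreal e" if \<F>: "finite \<F>" "\<F> <= \<D>" for \<F>
  proof -
   have fam: "is_family \<F> (- real K) (real K) u v"
    unfolding is_family_def
   proof (intro conjI ballI impI \<F>(1))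
    fix i assume "i : \<F>"
    then have i: "i : \<D>" using \<F>(2) by blast
    then have "i <= {- real K..real K}" using \<D>(2) by auto
    then show "- real K <= u i" "u i <= v i" "v i <= real K" using X(1)[OF i] X(2)[OF i] by (metis atLeastatMost_subset_iff not_le order_refl)+
    fix j assume "j : \<F>" "i ~= j"
    then show "{u i<..<v i} Int {u j<..<v j} = {}" using pairwiseD[OF \<D>(4) i, of j] X(4)[OF i] X(4)[of j] \<F>(2) by auto
   qed
   have "(\<Union>X\<in>\<F>. {u X<..<v X}) <= U" using X(3,4) \<F>(2) interior_subset by blast
   from le_less_trans[OF family_length[OF fam this Um] Ude] have "(\<Sum>X\<in>\<F>. v X - u X) < de"
    using de(1) fam by (simp add: ennreal_less_iff is_family_def sum_nonneg)
   from de(2)[OF fam this] have s: "(\<Sum>X\<in>\<F>. abs(F (v X) - F (u X))) < e"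
    unfolding of_real_diff[symmetric] norm_of_real by simp
   have b: "X : sets nu & emeasure nu X = ennreal (abs(F (v X) - F (u X)))" if "X : \<F>" for X
    using X(1,2)[of X] that \<F>(2) mono[of "u X" "v X"] Icc[of "u X" "v X"] by (metis abs_of_nonneg atLeastAtMost_borel diff_ge_0_iff_ge snu(1) subsetD)
   have "emeasure nu (\<Union>\<F>) <= (\<Sum>X\<in>\<F>. emeasure nu X)"
    using emeasure_subadditive_finite[OF \<F>(1), of "%X. X" nu] b by auto
   also have "... = ennreal (\<Sum>X\<in>\<F>. abs(F (v X) - F (u X)))" using b by (subst sum_ennreal[symmetric]) auto
   also have "... <= ennreal e" using s by (intro ennreal_leI) auto
   finally show ?thesis .
  qed
  show ?thesis
  proof (cases "\<D> = {}")
   case False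
   define A where "A n = \<Union>(from_nat_into \<D> ` {..n})" for n :: nat
   have ran: "from_nat_into \<D> k : \<D>" for k using False by (rule from_nat_into)
   have "(\<Union>n. A n) = \<Union>(range (from_nat_into \<D>))" by (auto simp: A_def)
   then have "S <= (\<Union>n. A n)" using \<D>(6) range_from_nat_into[OF False \<D>(1)] by simp
   moreover have Am: "range A <= sets nu" using X(2)[OF ran] unfolding snu A_def by (auto intro!: sets.finite_Union) (metis atLeastAtMost_borel)
   ultimately have "emeasure nu S <= emeasure nu (\<Union>n. A n)" by (intro emeasure_mono) auto
   also have "... = (SUP n. emeasure nu (A n))"
    by (rule SUP_emeasure_incseq[OF Am, symmetric]) (auto simp: incseq_def A_def; force)
   also have "... <= ennreal e" by (rule SUP_least) (use ran in "auto simp: A_def intro!: fin")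
   finally show ?thesis .
  qed (use \<D>(6) in simp)
 qed
 have "absolutely_continuous lborel nu"
  unfolding absolutely_continuous_def
 proof (rule subsetI)
  fix N :: "real set" assume N: "N : null_sets lborel"
  have "N Int cbox (- real K) (real K) : null_sets nu" for K
  proof -
   have n: "N Int cbox (- real K) (real K) : null_sets lborel" using N by (intro null_set_Int2) auto
   have "emeasure nu (N Int cbox (- real K) (real K)) <= 0" by (rule ennreal_le_epsilon) (use null[OF n Int_lower2] in simp)
   then show ?thesis using n by (auto simp: snu null_sets_def)
  qed
  then have "(\<Union>K. N Int cbox (- real K) (real K)) : null_sets nu" by (rule null_sets_UN)
  moreover have "EX K. x : cbox (- real K) (real K)" for x using real_arch_simple[of "abs x"] by (force simp: abs_le_iff)
  then have "(\<Union>K. N Int cbox (- real K) (real K)) = N" by blast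
  ultimately show "N : null_sets nu" by simp
 qed
 then obtain h where h: "h : borel_measurable lborel" "density lborel h = nu"
  using sigma_finite_measure.Radon_Nikodym[OF sigma_finite_lborel, of nu] snu by auto
 have [measurable]: "h : borel_measurable borel" using h(1) by simp
 \<comment> \<open>\<open>enn2real\<close> sends infinity to 0, which is harmless: \<open>h\<close>
   is infinite at most on a null set, because bounded intervals have finite
   \<open>nu\<close>-mass.\<close>
 define g where "g x = cor (enn2real (h x))" for x
 have g: "has_bochner_integral lebesgue (%t. indicator {x..y} t *\<^sub>R g t) (cor (F y - F x))" if xy: "x <= y" for x y
 proof -
  have 1: "(\<integral>\<^sup>+t. h t * indicator {x..y} t \<partial>lborel) = ennreal (F y - F x)"
   using Icc[OF xy] h emeasure_density[of h lborel "{x..y}"] by auto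
  have "AE t in lborel. h t * indicator {x..y} t ~= \<infinity>"
   by (rule nn_integral_PInf_AE) (use h 1 in auto)
  then have "AE t in lborel. ennreal (indicator {x..y} t *\<^sub>R enn2real (h t)) = h t * indicator {x..y} t"
   by eventually_elim (auto simp: indicator_def less_top split: if_splits)
  from nn_integral_cong_AE[OF this] 1 have "(\<integral>\<^sup>+t. ennreal (indicator {x..y} t *\<^sub>R enn2real (h t)) \<partial>lborel) = ennreal (F y - F x)"
   by simp
  then have "has_bochner_integral lborel (%t. indicator {x..y} t *\<^sub>R enn2real (h t)) (F y - F x)"
   by (intro has_bochner_integral_nn_integral) (use mono[OF xy] in auto)
  from has_bochner_integral_of_real[OF this, where 'a=complex]
  have i: "has_bochner_integral lborel (%t. indicator {x..y} t *\<^sub>R g t) (cor (F y - F x))" by (simp add: g_def scaleR_conv_of_real)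
  then show ?thesis using integrable_completion[OF borel_measurable_has_bochner_integral[OF i]] integral_completion[OF borel_measurable_has_bochner_integral[OF i]]
   by (simp add: has_bochner_integral_iff)
 qed
 have "sint {c..d} g" for c d
  using g[of c d] by (cases "c <= d") (auto simp: set_integrable_def has_bochner_integral_iff)
 then have "prim (%x. cor (F x)) g"
  using g by (auto simp: prim_def loc_int_def set_lebesgue_integral_def has_bochner_integral_iff)
 then show ?thesis by (rule that)
qed

text \<open>The choices of the \<open>a i\<close> are independent, so the suprema can be taken one
  at a time.\<close>

lemma sum_Sup_le:
 fixes A :: "nat => real set"
 assumes "!!i. i < n ==> A i ~= {}" "!!a. (!!i. i < n ==> a i : A i) ==> (\<Sum>i<n. a i) <= B"
 shows "(\<Sum>i<n. Sup (A i)) <= B"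
 using assms
proof (induction n arbitrary: B)
 case (Suc n)
 have "x <= B - (\<Sum>i<n. Sup (A i))" if x: "x : A n" for x
 proof -
  have "(\<Sum>i<n. Sup (A i)) <= B - x"
  proof (rule Suc.IH)
   fix a assume a: "!!i. i < n ==> a i : A i"
   have "(\<Sum>i<Suc n. (a(n := x)) i) <= B" by (rule Suc.prems(2)) (use a x in "auto simp: less_Suc_eq")
   then show "(\<Sum>i<n. a i) <= B - x" by simp
  qed (use Suc.prems(1) in auto)
  then show ?thesis by simp
 qed
 then have "Sup (A n) <= B - (\<Sum>i<n. Sup (A i))" using Suc.prems(1)[of n] by (intro cSup_least) auto
 then show ?case by simp
qed simp

section \<open>Variation: reduction to monotone functions\<close>

definition variation :: "(real => complex) => real => real => real" where
 "variation f x y = Sup {var_sum f I u v |(I :: nat set) u v. is_family I x y u v}"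

context
 fixes f :: "real => complex"
 assumes f: "f : AC_loc"
begin

text \<open>Every interval is cut at \<open>y\<close> by \<open>min\<close> and \<open>max\<close>;
  an interval on one side of \<open>y\<close> degenerates to a point on the other side and
  contributes nothing there.\<close>

lemma family_split:
 assumes I: "is_family I x z u v" and xyz: "x <= y" "y <= z"
 obtains u1 v1 u2 v2 where "is_family I x y u1 v1" "is_family I y z u2 v2" "var_sum f I u v <= var_sum f I u1 v1 + var_sum f I u2 v2"
proof (rule that[of "%i. min y (u i)" "%i. min y (v i)" "%i. max y (u i)" "%i. max y (v i)"])
 have "{min y (u i)<..<min y (v i)} <= {u i<..<v i}" "{max y (u i)<..<max y (v i)} <= {u i<..<v i}" for i by auto
 then have "{min y (u i)<..<min y (v i)} Int {min y (u j)<..<min y (v j)} = {}" "{max y (u i)<..<max y (v i)} Int {max y (u j)<..<max y (v j)} = {}"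
   if "i : I" "j : I" "i ~= j" for i j using I that unfolding is_family_def by blast+
 then show "is_family I x y (%i. min y (u i)) (%i. min y (v i))" "is_family I y z (%i. max y (u i)) (%i. max y (v i))"
  using I xyz by (auto simp: is_family_def min_le_iff_disj le_max_iff_disj)
 show "var_sum f I u v <= var_sum f I (%i. min y (u i)) (%i. min y (v i)) + var_sum f I (%i. max y (u i)) (%i. max y (v i))"
  unfolding sum.distrib[symmetric]
 proof (rule sum_mono)
  fix i assume "i : I"
  then have "u i <= v i" using I by (auto simp: is_family_def)
  then show "cmod (f (v i) - f (u i)) <= cmod (f (min y (v i)) - f (min y (u i))) + cmod (f (max y (v i)) - f (max y (u i)))"
   using norm_triangle_ineq[of "f y - f (u i)" "f (v i) - f y"] by (auto simp: min_def max_def)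
 qed
qed

text \<open>Absolute continuity bounds the variation by 1 on short intervals around each point;
  boundedness survives concatenation, and \<open>Bolzano\<close> supplies the compactness.\<close>

lemma variation_bounded:
 assumes "x <= y" shows "EX B. ALL (I :: nat set) u v. is_family I x y u v --> var_sum f I u v <= B"
 using assms
proof (induction rule: Bolzano)
 case (trans x y z)
 then obtain B1 B2 where B: "!!(I :: nat set) u v. is_family I x y u v ==> var_sum f I u v <= B1"
  "!!(I :: nat set) u v. is_family I y z u v ==> var_sum f I u v <= B2" by blast
 have "var_sum f I u v <= B1 + B2" if "is_family I x z u v" for I :: "nat set" and u v
  by (rule family_split[OF that trans(3,4)]) (use B in "meson add_mono order_trans")
 then show ?case by blast
next
 case (local t)
 obtain de where de: "de > 0" "!!(I :: nat set) u v. is_family I (t - 1) (t + 1) u v ==> (\<Sum>i\<in>I. v i - u i) < de ==> var_sum f I u v < 1"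
  using AC_loc_family[OF f zero_less_one] by blast
 have "var_sum f I u v <= 1" if ab: "a <= t & t <= b & b - a < min de 1" and I: "is_family I a b u v" for a b and I :: "nat set" and u v
 proof (rule less_imp_le[OF de(2)])
  show "is_family I (t - 1) (t + 1) u v" using I ab by (force simp: is_family_def)
  show "(\<Sum>i\<in>I. v i - u i) < de" using family_length_Icc[OF I] ab by linarith
 qed
 then have "ALL a b. a <= t & t <= b & b - a < min de 1 --> (EX B. ALL (I :: nat set) u v. is_family I a b u v --> var_sum f I u v <= B)" by blast
 then show ?case using de(1) by (intro exI[of _ "min de 1"]) simp
qed

lemma variation_upper:
 assumes I: "is_family (I :: nat set) x y u v" and xy: "x <= y" shows "var_sum f I u v <= variation f x y"
proof -
 obtain B where "!!(I :: nat set) u v. is_family I x y u v ==> var_sum f I u v <= B" using variation_bounded[OF xy] by blast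
 then show ?thesis unfolding variation_def by (intro cSup_upper bdd_aboveI[of _ B]) (use I in auto)
qed

lemma variation_least:
 assumes "!!(I :: nat set) u v. is_family I x y u v ==> var_sum f I u v <= B" shows "variation f x y <= B"
proof -
 have "is_family ({} :: nat set) x y id id" by (simp add: is_family_def)
 then show ?thesis unfolding variation_def by (intro cSup_least) (use assms in blast)+
qed

lemma variation_empty: "y <= x ==> variation f x y = 0"
proof -
 assume yx: "y <= x"
 have "var_sum f I u v = 0" if "is_family I x y u v" for I :: "nat set" and u v
 proof (rule sum.neutral, rule ballI)
  fix i assume "i : I"
  then have "x <= u i" "u i <= v i" "v i <= y" using that by (auto simp: is_family_def)
  then have "v i = u i" using yx by linarith
  then show "cmod (f (v i) - f (u i)) = 0" by simp
 qed
 moreover have "is_family ({} :: nat set) x y id id" by (simp add: is_family_def)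
 ultimately have "{var_sum f I u v |(I :: nat set) u v. is_family I x y u v} = {0}" by (force intro: exI[of _ "{}"])
 then show ?thesis by (simp add: variation_def)
qed

lemma variation_split:
 assumes "x <= y" "y <= z" shows "variation f x z <= variation f x y + variation f y z"
proof (rule variation_least)
 fix I :: "nat set" and u v assume "is_family I x z u v"
 then show "var_sum f I u v <= variation f x y + variation f y z"
  by (rule family_split[OF _ assms]) (use variation_upper assms in "meson add_mono order_trans")
qed

text \<open>The interval [a, b] lies outside [x', y'] and can join any family in [x', y'] as one
  more member. Monotonicity and positivity of the variation are special cases.\<close>

lemma variation_insert:
 assumes x: "x <= x'" "y' <= y" "x <= a" "a <= b" "b <= y" and ab: "b <= x' | y' <= a"
 shows "variation f x' y' + cmod (f b - f a) <= variation f x y"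
proof -
 have "variation f x' y' <= variation f x y - cmod (f b - f a)"
 proof (rule variation_least)
  fix I :: "nat set" and u v assume I: "is_family I x' y' u v"
  then obtain n where n: "n ~: I" using ex_new_if_finite[of I] by (auto simp: is_family_def)
  have "is_family (insert n I) x y (u(n := a)) (v(n := b))"
   unfolding is_family_def
  proof (intro conjI ballI impI)
   fix i j assume ij: "i : insert n I" "j : insert n I" "i ~= j"
   have "v i <= a | b <= u i" if "i : I" for i using I that ab by (force simp: is_family_def)
   from this[of i] this[of j] show "{(u(n := a)) i<..<(v(n := b)) i} Int {(u(n := a)) j<..<(v(n := b)) j} = {}"
    using ij I n by (auto simp: is_family_def)
  qed (use I x n in "force simp: is_family_def")+
  from variation_upper[OF this] have "var_sum f (insert n I) (u(n := a)) (v(n := b)) <= variation f x y" using x by auto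
  moreover have "var_sum f (insert n I) (u(n := a)) (v(n := b)) = cmod (f b - f a) + var_sum f I u v"
   using n I by (auto simp: is_family_def intro!: sum.cong)
  ultimately show "var_sum f I u v <= variation f x y - cmod (f b - f a)" by simp
 qed
 then show ?thesis by simp
qed

text \<open>On each side of 0 one of the terms vanishes by \<open>variation_empty\<close>, so this
  is the variation counted from 0 with a sign.\<close>

definition "signed_variation x = variation f 0 x - variation f x 0"

text \<open>The factor 2 accounts for 0 lying between \<open>x\<close> and \<open>y\<close>: each of
  the two halves is bounded by the whole variation.\<close>

lemma signed_variation:
 assumes xy: "x <= y"
 shows "cmod (f y - f x) <= signed_variation y - signed_variation x & signed_variation y - signed_variation x <= 2 * variation f x y"
proof -
 have pos: "0 <= variation f s t" if "s <= t" for s t using variation_insert[of s s s t s s] that variation_empty[of s s] by simp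
 consider "0 <= x" | "y <= 0" | "x < 0" "0 < y" by linarith
 then show ?thesis
 proof cases
  case 1
  then show ?thesis
   using xy variation_insert[of 0 0 x y x y] variation_split[of 0 x y] pos[OF xy] by (auto simp: signed_variation_def variation_empty)
 next
  case 2
  then show ?thesis
   using xy variation_insert[of x y 0 0 x y] variation_split[of x y 0] pos[OF xy] by (auto simp: signed_variation_def variation_empty)
 next
  case 3
  then show ?thesis
   using norm_triangle_ineq[of "f y - f 0" "f 0 - f x"] variation_insert[of x x x 0 x 0] variation_insert[of 0 0 0 y 0 y]
    variation_insert[of x 0 y y x x] variation_insert[of x x 0 y y y] variation_empty[of x x] variation_empty[of 0 0]
   by (auto simp: signed_variation_def variation_empty)
 qed
qed

text \<open>Families inside the members of a short family form one short family, indexed by pairs;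
  \<open>sum_Sup_le\<close> then turns the bound for all such choices into one for the sum of the
  variations.\<close>

lemma signed_variation_AC: "(%x. cor (signed_variation x)) : AC_loc"
 unfolding AC_loc_iff
proof (intro allI impI)
 fix c d e :: real assume "0 < e"
 then have "0 < e / 3" by simp
 from AC_loc_family[OF f this] obtain de where de: "de > 0"
  "!!(I :: (nat \<times> nat) set) u v. is_family I c d u v ==> (\<Sum>i\<in>I. v i - u i) < de ==> var_sum f I u v < e / 3" by blast
 have "var_sum (%x. cor (signed_variation x)) {..<n} u v < e"
  if fam: "is_family {..<n} c d u v" and len: "(\<Sum>i<n. v i - u i) < de" for n :: nat and u v
 proof -
  have uv: "c <= u i" "u i <= v i" "v i <= d" if "i < n" for i using fam that by (auto simp: is_family_def)
  have "var_sum (%x. cor (signed_variation x)) {..<n} u v <= (\<Sum>i<n. 2 * variation f (u i) (v i))"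
  proof (rule sum_mono)
   fix i assume "i : {..<n}"
   then show "cmod (cor (signed_variation (v i)) - cor (signed_variation (u i))) <= 2 * variation f (u i) (v i)"
    using signed_variation[OF uv(2), of i] norm_ge_zero[of "f (v i) - f (u i)"] unfolding of_real_diff[symmetric] norm_of_real lessThan_iff by linarith
  qed
  also have "... = 2 * (\<Sum>i<n. variation f (u i) (v i))" by (simp add: sum_distrib_left)
  also have "(\<Sum>i<n. variation f (u i) (v i)) <= e / 3"
   unfolding variation_def
  proof (rule sum_Sup_le)
   fix i
   have "is_family ({} :: nat set) (u i) (v i) id id" by (simp add: is_family_def)
   then show "{var_sum f I a b |(I :: nat set) a b. is_family I (u i) (v i) a b} ~= {}" by blast
  next
   fix s assume "!!i. i < n ==> s i : {var_sum f I a b |(I :: nat set) a b. is_family I (u i) (v i) a b}"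
   then have "ALL i. EX I a b. i < n --> is_family (I :: nat set) (u i) (v i) a b & s i = var_sum f I a b" by blast
   then obtain I a b where I: "!!i. i < n ==> is_family (I i :: nat set) (u i) (v i) (a i) (b i)" "!!i. i < n ==> s i = var_sum f (I i) (a i) (b i)"
    by metis
   define J where "J = Sigma {..<n} I"
   have fI: "finite (I i)" if "i < n" for i using I(1)[OF that] by (simp add: is_family_def)
   have S: "(\<Sum>i<n. \<Sum>j\<in>I i. h i j) = (\<Sum>x\<in>J. h (fst x) (snd x))" for h :: "nat => nat => real"
    unfolding J_def using fI by (subst sum.Sigma) (auto simp: case_prod_beta)
   have "is_family J c d (%x. a (fst x) (snd x)) (%x. b (fst x) (snd x))"
    unfolding is_family_def
   proof (intro conjI ballI impI)
    show "finite J" using fI by (auto simp: J_def)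
    fix x assume "x : J"
    then obtain i j where x: "x = (i, j)" "i < n" "j : I i" by (auto simp: J_def)
    then have ab: "u i <= a i j" "a i j <= b i j" "b i j <= v i" using I(1)[OF x(2)] by (auto simp: is_family_def)
    then show "c <= a (fst x) (snd x)" "a (fst x) (snd x) <= b (fst x) (snd x)" "b (fst x) (snd x) <= d" using uv[OF x(2)] x(1) by auto
    fix y assume "y : J" and ne: "x ~= y"
    then obtain i' j' where y: "y = (i', j')" "i' < n" "j' : I i'" by (auto simp: J_def)
    then have ab': "u i' <= a i' j'" "b i' j' <= v i'" using I(1)[OF y(2)] by (auto simp: is_family_def)
    show "{a (fst x) (snd x)<..<b (fst x) (snd x)} Int {a (fst y) (snd y)<..<b (fst y) (snd y)} = {}"
    proof (cases "i = i'")
     case True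
     then show ?thesis using I(1)[OF x(2)] x y ne by (auto simp: is_family_def)
    next
     case False
     then have "{u i<..<v i} Int {u i'<..<v i'} = {}" using fam x(2) y(2) by (auto simp: is_family_def)
     moreover have "{a i j<..<b i j} <= {u i<..<v i}" "{a i' j'<..<b i' j'} <= {u i'<..<v i'}" using ab ab' by auto
     ultimately show ?thesis unfolding x(1) y(1) fst_conv snd_conv by blast
    qed
   qed
   moreover have "(\<Sum>i<n. \<Sum>j\<in>I i. b i j - a i j) <= (\<Sum>i<n. v i - u i)"
    using family_length_Icc[OF I(1)] uv by (intro sum_mono) auto
   ultimately have "var_sum f J (%x. a (fst x) (snd x)) (%x. b (fst x) (snd x)) < e / 3" using len by (intro de(2)) (auto simp: S)
   then show "(\<Sum>i<n. s i) <= e / 3" using I(2) S[of "%i j. cmod (f (b i j) - f (a i j))"] by simp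
  qed
  finally show ?thesis using `0 < e` by simp
 qed
 then show "EX de>0. ALL n u v. is_family {..<n::nat} c d u v & (\<Sum>i<n. v i - u i) < de --> var_sum (%x. cor (signed_variation x)) {..<n} u v < e"
  using de(1) by blast
qed

text \<open>If \<open>\<bar>h y - h x\<bar> \<le> \<bar>f y - f x\<bar>\<close> and \<open>V\<close> is the signed variation of \<open>f\<close>, then \<open>V\<close> and \<open>V - h\<close> are monotone and
  absolutely continuous.\<close>

lemma dominated_has_density:
 fixes h :: "real => real"
 assumes h: "!!x y. abs(h y - h x) <= cmod (f y - f x)"
 obtains g where "prim (%x. cor (h x)) g"
proof -
 have V: "abs(h y - h x) <= signed_variation y - signed_variation x" if "x <= y" for x y using h conjunct1[OF signed_variation[OF that]] by (rule order_trans)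
 have "signed_variation x <= signed_variation y" if "x <= y" for x y using V[OF that] by linarith
 from AC_monotone_has_density[OF this signed_variation_AC]
 obtain g1 where g1: "prim (%x. cor (signed_variation x)) g1" by blast
 have "(%x. cor (signed_variation x - h x)) : AC_loc"
 proof (rule AC_loc_dominated[OF signed_variation_AC f], intro exI[of _ 1] ballI)
  fix x y
  show "cmod (cor (signed_variation y - h y) - cor (signed_variation x - h x))
    <= 1 * (cmod (cor (signed_variation y) - cor (signed_variation x)) + cmod (f y - f x))"
   unfolding of_real_diff[symmetric] norm_of_real using h[of y x] by simp
 qed
 moreover have "signed_variation x - h x <= signed_variation y - h y" if "x <= y" for x y using V[OF that] by linarith
 ultimately obtain g2 where "prim (%x. cor (signed_variation x - h x)) g2"
  using AC_monotone_has_density[of "%x. signed_variation x - h x"] by blast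
 from prim_diff[OF g1 this] show ?thesis by (intro that) simp
qed

text \<open>Real and imaginary part oscillate no more than \<open>f\<close>, so both have densities,
  which \<open>prim_derivative_AE\<close> identifies with the derivatives.\<close>

lemma AC_prim_vector_derivative: "prim f (%x. vector_derivative f (at x))"
proof -
 obtain g1 where g1: "prim (%x. cor (Re (f x))) g1"
  by (rule dominated_has_density[of "%x. Re (f x)"]) (use abs_Re_le_cmod in "simp flip: minus_complex.simps(1)")
 obtain g2 where g2: "prim (%x. cor (Im (f x))) g2"
  by (rule dominated_has_density[of "%x. Im (f x)"]) (use abs_Im_le_cmod in "simp flip: minus_complex.simps(2)")
 from prim_add[OF g1 prim_cmult[OF g2, of \<i>]] have p: "prim f (%x. g1 x + \<i> * g2 x)" by (simp flip: complex_eq)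
 show ?thesis by (rule prim_cong_AE[OF p], use prim_derivative_AE[OF p] in eventually_elim) (rule vector_derivative_at)
qed

end

section \<open>Locally integrable functions and the calculus of primitives\<close>

lemma borel_measurable_affine:
 fixes c t :: real
 assumes c: "abs c = 1" and "f : lmeas"
 shows "(%x. f (t + c * x)) : lmeas"
 using measurable_compose[OF lebesgue_distr_affine(2)[OF c] assms(2)] .

lemma borel_measurable_shift:
 "f : lmeas ==> (%x. f (x + (t::real))) : lmeas"
 using borel_measurable_affine[of 1 f t] by (simp add: add.commute)

lemma integral_affine:
 fixes c t :: real and f :: "real => 'b::{banach, second_countable_topology}"
 assumes c: "abs c = 1" and f: "lint f"
 shows "lint (%x. f (t + c * x))"
  and "(LEB x. f (t + c * x)) = (LEB x. f x)"
proof -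
 have f': "integrable (distr lebesgue lebesgue (%x. t + c * x)) f"
  using f by (simp add: lebesgue_distr_affine(1)[OF c])
 show "lint (%x. f (t + c * x))"
  by (rule integrable_distr[OF lebesgue_distr_affine(2)[OF c] f'])
 have "(LINT x|distr lebesgue lebesgue (%x. t + c * x). f x) = (LEB x. f (t + c * x))"
  by (rule integral_distr[OF lebesgue_distr_affine(2)[OF c]]) (use f in auto)
 then show "(LEB x. f (t + c * x)) = (LEB x. f x)"
  by (simp add: lebesgue_distr_affine(1)[OF c])
qed

lemma integral_shift:
 fixes f :: "real => 'b::{banach, second_countable_topology}"
 assumes "lint f"
 shows "lint (%x. f (x + t))" "(LEB x. f (x + t)) = (LEB x. f x)"
 using integral_affine[of 1 f t] assms by (simp_all add: add.commute)

lemma loc_int_measurable: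
 fixes g :: "real => 'a::{banach, second_countable_topology}"
 assumes "loc_int g" shows "g : lmeas"
proof (rule borel_measurable_LIMSEQ_metric)
 show "(%x. indicator {-real n..real n} x *\<^sub>R g x) : lmeas" for n :: nat
  using loc_intD[OF assms, of "-real n" "real n"] by (auto simp: set_integrable_def)
 fix x :: real
 obtain n0 :: nat where "abs x < real n0" using reals_Archimedean2 by blast
 then have "\<forall>\<^sub>F n in sequentially. indicator {-real n..real n} x *\<^sub>R g x = g x"
  unfolding eventually_sequentially by (intro exI[of _ n0]) (auto simp: indicator_def)
 then show "(%n. indicator {-real n..real n} x *\<^sub>R g x) ----> g x" by (rule tendsto_eventually)
qed

lemma loc_int_bound:
 fixes g :: "real => 'a::{banach, second_countable_topology}" and h :: "real => 'b::{banach, second_countable_topology}"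
 assumes g: "loc_int g" and h: "h : lmeas"
  and b: "!!c d. EX C. AE x. x : {c..d} --> norm (h x) <= C * norm (g x)"
 shows "loc_int h"
 unfolding loc_int_def set_integrable_def
proof (intro allI)
 fix c d
 obtain C where C: "AE x. x : {c..d} --> norm (h x) <= C * norm (g x)" using b by blast
 have "lint (%x. C *\<^sub>R (indicator {c..d} x *\<^sub>R g x))"
  using loc_intD[OF g, of c d] unfolding set_integrable_def by (rule integrable_scaleR_right)
 then show "lint (%x. indicator {c..d} x *\<^sub>R h x)"
 proof (rule Bochner_Integration.integrable_bound)
  show "(%x. indicator {c..d} x *\<^sub>R h x) : lmeas"
   using h by (intro borel_measurable_scaleR borel_measurable_indicator) auto
  show "AE x. norm (indicator {c..d} x *\<^sub>R h x) <= norm (C *\<^sub>R (indicator {c..d} x *\<^sub>R g x))"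
   using C
  proof eventually_elim
   case (elim x)
   have "C * norm (g x) <= abs C * norm (g x)" by (intro mult_right_mono) auto
   then show ?case using elim by (auto simp: indicator_def)
  qed
 qed
qed

lemma loc_int_norm: "loc_int g ==> loc_int (%x. norm (g x))"
 unfolding loc_int_def by (auto intro: set_integrable_norm)

lemma loc_int_abs: "loc_int (g :: real => real) ==> loc_int (%x. abs(g x))"
 using loc_int_norm[of g] by simp

lemma loc_int_of_real: "loc_int (g :: real => real) ==> loc_int (%x. cor (g x))"
 proof (rule loc_int_bound[of g])
 assume "loc_int g"
 then have "g : lmeas" by (rule loc_int_measurable)
 then show "(%x. cor (g x)) : lmeas" by measurable
qed (auto intro: exI[of _ 1])

lemma loc_int_continuous_mult:
 fixes f g :: "real => complex"
 assumes f: "continuous_on UNIV f" and g: "loc_int g"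
 shows "loc_int (%x. f x * g x)"
proof (rule loc_int_bound[OF g])
 have "f : borel_measurable borel" using f by (rule borel_measurable_continuous_onI)
 then have "f : lmeas" by (simp add: measurable_completion)
 then show "(%x. f x * g x) : lmeas" using loc_int_measurable[OF g] by measurable
 fix c d :: real
 have "compact (f ` {c..d})" using f by (intro compact_continuous_image continuous_on_subset[OF f]) auto
 then obtain B where "ALL y:f ` {c..d}. norm y <= B" using compact_imp_bounded bounded_iff by blast
 then show "EX C. AE x. x : {c..d} --> cmod (f x * g x) <= C * cmod (g x)"
  by (intro exI[of _ B] AE_I2) (auto simp: norm_mult mult_right_mono)
qed

lemma periodic_int_mult:
 fixes a :: real
 assumes per: "!!x. g (x + a) = g x" shows "g (x + real_of_int k * a) = g x"
proof -
 have 1: "g (x + real n * a) = g x" for n x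
 proof (induction n)
  case (Suc n)
  have "x + real (Suc n) * a = (x + real n * a) + a" by (simp add: algebra_simps)
  then show ?case using per Suc by metis
 qed simp
 show ?thesis
  using 1[of x "nat k"] 1[of "x + real_of_int k * a" "nat (- k)"] by (cases "0 <= k") auto
qed

text \<open>The integral over each translated cell [k a, (k + 1) a] exists by translation. An
  interval shorter than \<open>a\<close> around a point is covered by three consecutive cells, and
  \<open>Bolzano\<close> glues.\<close>

lemma loc_int_periodic:
 fixes g :: "real => real"
 assumes a: "0 < a" and per: "!!x. g (x + a) = g x" and i: "sint {0<..<a} g"
 shows "loc_int g"
proof -
 have "sint {0..a} g" using i absolutely_integrable_on_open_interval[where f=g and a=0 and b=a] by simp
 then have i0: "lint (%x. indicator {0..a} x *\<^sub>R g x)" by (simp add: set_integrable_def)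
 have ik: "sint {real_of_int k * a..real_of_int (k+1) * a} g" for k
 proof -
  have "(%x. indicator {0..a} (x + - real_of_int k * a) *\<^sub>R g (x + - real_of_int k * a)) =
   (%x. indicator {real_of_int k * a..real_of_int (k+1) * a} x *\<^sub>R g x)"
   using periodic_int_mult[of g, OF per, of _ "-k"] by (auto simp: fun_eq_iff indicator_def algebra_simps)
  then show ?thesis using integral_shift(1)[OF i0, of "- real_of_int k * a"] by (simp add: set_integrable_def)
 qed
 have "sint {c..d} g" if "c <= d" for c d
  using that
 proof (induction rule: Bolzano)
  case (local t)
  define k where "k = \<lfloor>t / a\<rfloor>"
  have "real_of_int k * a <= t" "t <= real_of_int (k + 1) * a"
   using a floor_divide_lower[of a t] floor_divide_upper[of a t] by (auto simp: k_def)
  then have "{c..d} <= {real_of_int (k - 1) * a..real_of_int (k - 1 + 1) * a} Un {real_of_int k * a..real_of_int (k + 1) * a}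
    Un {real_of_int (k + 1) * a..real_of_int (k + 1 + 1) * a}" if "c <= t & t <= d & d - c < a" for c d
   using that by (auto simp: algebra_simps)
  then have "ALL c d. c <= t & t <= d & d - c < a --> sint {c..d} g"
   using set_integrable_subset[OF set_integrable_Un[OF set_integrable_Un[OF ik[of "k - 1"] ik[of k]] ik[of "k + 1"]]] by auto
  then show ?case using a by blast
 qed (rule set_integral_Icc_split)
 then have "sint {c..d} g" for c d by (cases "c <= d") (auto simp: set_integrable_def)
 then show ?thesis by (simp add: loc_int_def)
qed

lemma prim_loc_int: "prim f g ==> loc_int g" by (simp add: prim_def)

lemma prim_unique:
 assumes "prim f g" "prim f h" shows "AE x. g x = h x"
 using prim_derivative_AE[OF assms(1)] prim_derivative_AE[OF assms(2)]
 by eventually_elim (rule vector_derivative_unique_at)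

text \<open>Product and exponential rule reduce by this to the pointwise rules at almost every
  point, once absolute continuity is known from \<open>AC_loc_dominated\<close>.\<close>

lemma prim_from_derivative:
 assumes "f : AC_loc" "AE x. (f has_vector_derivative g x) (at x)"
 shows "prim f g"
 by (rule prim_cong_AE[OF AC_prim_vector_derivative[OF assms(1)]])
   (use assms(2) in eventually_elim, simp add: vector_derivative_at)

lemma prim_continuous: "prim f g ==> continuous_on UNIV f"
 by (rule AC_loc_continuous[OF prim_AC])

lemma prim_bounded: assumes "prim f f'" obtains B where "0 < B" "!!x. x : {c..d} ==> cmod (f x) <= B"
proof -
 have "bounded (f ` {c..d})"
  using continuous_on_subset[OF prim_continuous[OF assms]] by (intro compact_imp_bounded compact_continuous_image) auto
 then show ?thesis using that unfolding bounded_pos by blast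
qed

lemma prim_mult:
 assumes f: "prim f f'" and g: "prim g g'"
 shows "prim (%x. f x * g x) (%x. f x * g' x + f' x * g x)"
proof (rule prim_from_derivative)
 show "(%x. f x * g x) : AC_loc"
 proof (rule AC_loc_dominated[OF prim_AC[OF f] prim_AC[OF g]])
  fix c d
  obtain B C where B: "0 < B" "!!x. x : {c..d} ==> cmod (f x) <= B" and C: "0 < C" "!!x. x : {c..d} ==> cmod (g x) <= C"
   using prim_bounded[OF f] prim_bounded[OF g] by metis
  have "cmod (f y * g y - f x * g x) <= (B + C) * (cmod (f y - f x) + cmod (g y - g x))" if "x : {c..d}" "y : {c..d}" for x y
  proof -
   have "f y * g y - f x * g x = f y * (g y - g x) + g x * (f y - f x)" by (simp add: algebra_simps)
   then have "cmod (f y * g y - f x * g x) <= cmod (f y) * cmod (g y - g x) + cmod (g x) * cmod (f y - f x)"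
    by (metis norm_mult norm_triangle_ineq)
   also have "... <= B * cmod (g y - g x) + C * cmod (f y - f x)" using that by (intro add_mono mult_right_mono B C) auto
   also have "... <= (B + C) * (cmod (f y - f x) + cmod (g y - g x))" using B(1) C(1) by (simp add: algebra_simps)
   finally show ?thesis .
  qed
  then show "EX L. ALL x:{c..d}. ALL y:{c..d}. cmod (f y * g y - f x * g x) <= L * (cmod (f y - f x) + cmod (g y - g x))" by blast
 qed
 show "AE x. ((%x. f x * g x) has_vector_derivative f x * g' x + f' x * g x) (at x)"
  using prim_derivative_AE[OF f] prim_derivative_AE[OF g]
  by eventually_elim (rule has_vector_derivative_mult)
qed

lemma prim_exp:
 assumes f: "prim f f'" shows "prim (%x. exp (f x)) (%x. f' x * exp (f x))"
proof (rule prim_from_derivative)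
 show "(%x. exp (f x)) : AC_loc"
 proof (rule AC_loc_dominated[OF prim_AC[OF f] prim_AC[OF f]])
  fix c d
  obtain B where B: "0 < B" "!!x. x : {c..d} ==> cmod (f x) <= B" using prim_bounded[OF f, of c d] by blast
  have "cmod (exp z - exp z') <= exp B * cmod (z - z')" if "z : cball 0 B" "z' : cball 0 B" for z z' :: complex
   by (rule field_differentiable_bound[where S="cball 0 B" and f'=exp])
    (use that in "auto intro!: derivative_eq_intros intro: order_trans[OF complex_Re_le_cmod]")
  note lip = this
  have "cmod (exp (f y) - exp (f x)) <= exp B * (cmod (f y - f x) + cmod (f y - f x))" if "x : {c..d}" "y : {c..d}" for x y
   by (rule order_trans[of _ "exp B * cmod (f y - f x)"]) (use B that lip in "simp_all add: distrib_left")
  then show "EX L. ALL x:{c..d}. ALL y:{c..d}. cmod (exp (f y) - exp (f x)) <= L * (cmod (f y - f x) + cmod (f y - f x))" by blast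
 qed
 show "AE x. ((%x. exp (f x)) has_vector_derivative f' x * exp (f x)) (at x)"
  using prim_derivative_AE[OF f]
  by eventually_elim (rule field_vector_diff_chain_at[of f _ _ exp, unfolded comp_def]; simp add: DERIV_exp)
qed

lemma prim_affine:
 assumes f: "prim f g" and c: "abs c = 1"
 shows "prim (%x. f (t + c * x)) (%x. of_real c * g (t + c * x))"
 unfolding prim_def
proof (intro conjI allI impI)
 have c2: "c = 1 | c = -1" using c by (auto simp: abs_if split: if_splits)
 define l r where "l x y = (if c = 1 then t + x else t - y)" and "r x y = (if c = 1 then t + y else t - x)" for x y
 have ind: "indicator {l x y..r x y} (t + c * s) = (indicator {x..y} s :: real)" for x y s
  using c2 by (auto simp: l_def r_def indicator_def)
 have gi: "lint (%s. indicator {x..y} s *\<^sub>R g s)" for x y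
  using loc_intD[OF prim_loc_int[OF f], of x y] by (simp add: set_integrable_def)
 have si: "sint {x..y} (%x. g (t + c * x))" 
  and eq: "(LEB s:{x..y}. g (t + c * s)) = (LEB s:{l x y..r x y}. g s)" for x y
  using integral_affine[OF c gi[of "l x y" "r x y"], of t] by (simp_all add: ind set_integrable_def set_lebesgue_integral_def)
 show "loc_int (%x. of_real c * g (t + c * x))"
  using si by (intro loc_int_cmult) (simp add: loc_int_def)
 fix x y :: real assume xy: "x <= y"
 have "f (r x y) - f (l x y) = (LEB s:{l x y..r x y}. g s)"
  by (rule primD[OF f]) (use xy in "auto simp: l_def r_def")
 then show "f (t + c * y) - f (t + c * x) = (LEB s:{x..y}. of_real c * g (t + c * s))"
  using c2 eq[of x y] by (auto simp: l_def r_def algebra_simps set_lebesgue_integral_def split: if_splits)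
qed

lemma prim_shift: "prim f g ==> prim (%x. f (x + t)) (%x. g (x + t))"
 using prim_affine[of f g 1 t] by (simp add: add.commute)

lemma prim_reflect: "prim f g ==> prim (%x. f (- x)) (%x. - g (- x))"
 using prim_affine[of f g "-1" 0] by simp

lemma prim_cnj:
 assumes "prim f g" shows "prim (%x. cnj (f x)) (%x. cnj (g x))"
proof -
 have i: "lint (%t. indicator {x..y} t *\<^sub>R g t)" for x y
  using loc_intD[OF prim_loc_int[OF assms], of x y] by (simp add: set_integrable_def)
 have e: "cnj (indicator {x..y} t *\<^sub>R g t) = indicator {x..y} t *\<^sub>R cnj (g t)" for x y and t :: real
  by (simp add: indicator_def)
 have "lint (%t. indicator {x..y} t *\<^sub>R cnj (g t))"
  "(LEB t:{x..y}. cnj (g t)) = cnj (LEB t:{x..y}. g t)" for x y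
  using integrable_cnj[OF i[of x y]] Bochner_Integration.integral_cnj[of lebesgue "%t. indicator {x..y} t *\<^sub>R g t"] i[of x y]
  by (simp_all only: e set_lebesgue_integral_def)
 then show ?thesis using primD[OF assms] 
  unfolding prim_def loc_int_def set_integrable_def by (auto simp flip: complex_cnj_diff)
qed

definition oriented_integral :: "real => real => (real => complex) => complex" where
 "oriented_integral c x g = (if c <= x then (LEB t:{c..x}. g t) else - (LEB t:{x..c}. g t))"

lemma prim_oriented_integral:
 assumes g: "loc_int g" shows "prim (%x. al + oriented_integral c x g) g"
 unfolding prim_def
proof (intro conjI allI impI g)
 have add: "(LEB t:{x..z}. g t) = (LEB t:{x..y}. g t) + (LEB t:{y..z}. g t)" if "x <= y" "y <= z" for x y z
  using set_integral_Icc_split(2)[OF that loc_intD[OF g] loc_intD[OF g]] .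
 fix x y :: real assume xy: "x <= y"
 consider "c <= x" | "x < c" "c <= y" | "y < c" by linarith
 then show "al + oriented_integral c y g - (al + oriented_integral c x g) = (LEB t:{x..y}. g t)"
 proof cases
  case 1 then show ?thesis using add[of c x y] xy by (simp add: oriented_integral_def)
 next
  case 2 then show ?thesis using add[of x c y] xy by (simp add: oriented_integral_def)
 next
  case 3 then show ?thesis using add[of x y c] xy by (simp add: oriented_integral_def)
 qed
qed

lemma oriented_integral_refl [simp]: "oriented_integral c c g = 0"
proof -
 have "(LEB t:{c..c}. g t) = (LEB t::real. 0)"
  unfolding set_lebesgue_integral_def
 proof (rule integral_cong_AE)
  show "AE x. indicat_real {c..c} x *\<^sub>R g x = 0" using AE_not_eq[of c] by eventually_elim auto
  show "(%x. indicat_real {c..c} x *\<^sub>R g x) : lmeas"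
  proof -
   have "(%x. indicat_real {c..c} x *\<^sub>R g x) = (%x. indicat_real {c} x *\<^sub>R g c)" by (auto simp: indicator_def)
   then show ?thesis by (auto intro!: borel_measurable_scaleR borel_measurable_indicator)
  qed
 qed auto
 then show ?thesis by (simp add: oriented_integral_def)
qed

lemma prim_norm_le:
 assumes f: "prim f g" and xy: "x <= y" and h: "loc_int h" and b: "AE t. t : {x..y} --> cmod (g t) <= h t"
 shows "cmod (f y - f x) <= (LEB t:{x..y}. h t)"
 unfolding primD[OF f xy] set_lebesgue_integral_def
proof (rule order_trans[OF integral_norm_bound], rule integral_mono_AE)
 show "lint (%t. cmod (indicat_real {x..y} t *\<^sub>R g t))"
  using loc_intD[OF prim_loc_int[OF f], of x y] unfolding set_integrable_def by (rule integrable_norm)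
 show "lint (%t. indicat_real {x..y} t *\<^sub>R h t)"
  using loc_intD[OF h, of x y] by (simp add: set_integrable_def)
 show "AE t. cmod (indicat_real {x..y} t *\<^sub>R g t) <= indicat_real {x..y} t *\<^sub>R h t"
  using b by eventually_elim (auto simp: indicator_def)
qed

section \<open>Linear systems\<close>

lemma set_integral_mono_loc:
 fixes g h :: "real => real"
 assumes "loc_int g" "loc_int h" "!!t. x <= t ==> t <= y ==> g t <= h t"
 shows "(LEB t:{x..y}. g t) <= (LEB t:{x..y}. h t)"
 by (rule set_integral_mono) (use assms loc_intD in auto)

lemma set_integral_nonneg_loc:
 fixes g :: "real => real"
 assumes "!!t. x <= t ==> t <= y ==> 0 <= g t"
 shows "0 <= (LEB t:{x..y}. g t)"
 unfolding set_lebesgue_integral_def by (rule integral_nonneg_AE) (use assms in "auto simp: indicator_def")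

lemma set_integral_subset_mono:
 fixes g :: "real => real"
 assumes g: "loc_int g" "!!t. 0 <= g t" and "x' <= x" "y <= y'"
 shows "(LEB t:{x..y}. g t) <= (LEB t:{x'..y'}. g t)"
 unfolding set_lebesgue_integral_def
 by (rule integral_mono) (use assms loc_intD[OF g(1)] in "auto simp: indicator_def set_integrable_def")

lemma loc_int_zero: "loc_int (%_. 0)"
 by (simp add: loc_int_def set_integrable_def)

lemma loc_int_mult_continuous:
 fixes f g :: "real => real"
 assumes f: "continuous_on UNIV f" and g: "loc_int g"
 shows "loc_int (%x. g x * f x)"
proof -
 have "loc_int (%x. cor (f x) * cor (g x))"
  by (intro loc_int_continuous_mult loc_int_of_real g continuous_intros f)
 from loc_int_Re[OF this] show ?thesis by (simp add: mult.commute)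
qed

context
 fixes k :: "real => real" and c :: real
 assumes k: "loc_int k" "!!x. 0 <= k x"
begin

text \<open>The primitive of \<open>k\<close> that vanishes at \<open>c\<close>, taken as the real
  part of a complex integral so that the calculus of \<open>prim\<close> applies to it.\<close>

definition cumul :: "real => real" where "cumul x = Re (oriented_integral c x (%t. cor (k t)))"

lemma cumul_eq: "c <= x ==> cumul x = (LEB t:{c..x}. k t)"
 unfolding cumul_def oriented_integral_def set_lebesgue_integral_def
 by (simp add: scaleR_conv_of_real of_real_mult[symmetric] del: of_real_mult)

lemma prim_cumul: "prim (%x. cor (cumul x)) (%t. cor (k t))"
proof -
 have "cor (cumul x) = 0 + oriented_integral c x (%t. cor (k t))" for x
 proof -
  have "Im (oriented_integral c x (%t. cor (k t))) = 0"
   unfolding oriented_integral_def set_lebesgue_integral_def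
   by (simp add: scaleR_conv_of_real of_real_mult[symmetric] del: of_real_mult)
  then show ?thesis by (simp add: cumul_def complex_eq_iff)
 qed
 then show ?thesis using prim_oriented_integral[OF loc_int_of_real[OF k(1)], of 0 c] by simp
qed

lemma cumul_continuous: "continuous_on UNIV cumul"
 using continuous_on_Re[OF prim_continuous[OF prim_cumul]] by simp

text \<open>The weight turns the Volterra operator into a contraction on bounded functions.\<close>

lemma weight_bound:
 assumes fy: "loc_int fy" and B: "0 <= B" and le: "!!t. cmod (fy t) <= B * (k t * exp (4 * abs(cumul t)))"
 shows "cmod (oriented_integral c x fy) <= B / 4 * exp (4 * abs(cumul x))"
proof -
 let ?c = complex_of_real
 have p: "prim (%x. 0 + oriented_integral c x fy) fy" by (rule prim_oriented_integral[OF fy])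
 have ex: "loc_int (%t. k t * exp (s * cumul t))" for s
  by (intro loc_int_mult_continuous k continuous_intros cumul_continuous)
 \<comment> \<open>\<open>s\<close> will be 4 to the right of \<open>c\<close> and -4 to the left,
   where \<open>cumul\<close> is nonpositive.\<close>
 have e: "s * (LEB t:{y..z}. k t * exp (s * cumul t)) = exp (s * cumul z) - exp (s * cumul y)" if "y <= z" for s y z
 proof -
  have "?c (exp (s * cumul z)) - ?c (exp (s * cumul y)) = (LEB t:{y..z}. ?c (s * (k t * exp (s * cumul t))))"
   using primD[OF prim_exp[OF prim_cmult[OF prim_cumul, of "?c s"]] that] exp_of_real[of "s * cumul t" for t, where 'a=complex]
   by (simp add: mult.assoc)
  then have "?c (exp (s * cumul z) - exp (s * cumul y)) = ?c (LEB t:{y..z}. s * (k t * exp (s * cumul t)))"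
   by (simp only: of_real_diff set_integral_complex_of_real)
  then show ?thesis by (simp only: of_real_eq_iff set_integral_mult_right)
 qed
 have c0: "cumul c = 0" by (simp add: cumul_def)
 have mono: "cumul y <= cumul z" if "y <= z" for y z
 proof -
  have "?c (cumul z - cumul y) = ?c (LEB t:{y..z}. k t)"
   using primD[OF prim_cumul that] by (simp only: of_real_diff set_integral_complex_of_real)
  then have "cumul z - cumul y = (LEB t:{y..z}. k t)" by (simp only: of_real_eq_iff)
  then show ?thesis using set_integral_nonneg_loc[of y z k, OF k(2)] by simp
 qed
 show ?thesis
 proof (cases "c <= x")
  case True
  have "AE t. t : {c..x} --> cmod (fy t) <= B * (k t * exp (4 * cumul t))"
   using le mono[of c] c0 by (intro AE_I2) (metis abs_of_nonneg atLeastAtMost_iff)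
  from prim_norm_le[OF p True loc_int_cmult[OF ex[of 4], of B] this]
  have "cmod (oriented_integral c x fy) <= (LEB t:{c..x}. B * (k t * exp (4 * cumul t)))" by simp
  also have "... = B / 4 * (4 * (LEB t:{c..x}. k t * exp (4 * cumul t)))" by simp
  also have "... <= B / 4 * exp (4 * abs(cumul x))" unfolding e[OF True] using B mono[OF True] c0 by (intro mult_left_mono) auto
  finally show ?thesis .
 next
  case False
  then have x: "x <= c" by simp
  have "AE t. t : {x..c} --> cmod (fy t) <= B * (k t * exp (- 4 * cumul t))"
   using le mono[of _ c] c0 by (intro AE_I2) (metis abs_of_nonpos atLeastAtMost_iff mult_minus_left mult_minus_right)
  from prim_norm_le[OF p x loc_int_cmult[OF ex[of "- 4"], of B] this]
  have "cmod (oriented_integral c x fy) <= (LEB t:{x..c}. B * (k t * exp (- 4 * cumul t)))" by (simp add: norm_minus_commute)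
  also have "... = - (B / 4) * (- 4 * (LEB t:{x..c}. k t * exp (- 4 * cumul t)))" by simp
  also have "... <= B / 4 * exp (4 * abs(cumul x))" unfolding e[OF x] using B mono[OF x] c0 by (simp add: algebra_simps)
  finally show ?thesis .
 qed
qed

text \<open>With \<open>G\<close> the right-hand side of the hypothesis, G exp (- cumul) has the
  derivative exp (- cumul) k (f - G), which is not positive.\<close>

lemma gronwall:
 assumes f: "continuous_on UNIV f" and A: "0 <= A"
  and le: "!!x. c <= x ==> x <= d ==> f x <= A + (LEB t:{c..x}. k t * f t)"
  and x: "c <= x" "x <= d"
 shows "f x <= A * exp (cumul x)"
proof -
 let ?c = complex_of_real
 define G where "G x = ?c A + oriented_integral c x (%t. ?c (k t * f t))" for x
 have i: "loc_int (%t. ?c (k t * f t))" by (intro loc_int_of_real loc_int_mult_continuous k f)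
 have G: "prim G (%t. ?c (k t * f t))" unfolding G_def using prim_oriented_integral[OF i] .
 have Gr: "G t = ?c (A + (LEB t:{c..t}. k t * f t))" if "c <= t" for t
  using that unfolding G_def oriented_integral_def by (simp add: set_integral_complex_of_real del: of_real_mult)
 have "prim (%x. - 1 * ?c (cumul x)) (%t. - 1 * ?c (k t))" by (rule prim_cmult[OF prim_cumul])
 from prim_mult[OF G prim_exp[OF this]]
 have P: "prim (%x. G x * exp (- ?c (cumul x))) (%x. exp (- ?c (cumul x)) * ?c (k x) * (?c (f x) - G x))"
  by (simp add: algebra_simps)
 define R where "R t = exp (- cumul t) * k t * (f t - (A + (LEB t:{c..t}. k t * f t)))" for t
 have E: "exp (- ?c z) = ?c (exp (- z))" for z by (metis exp_of_real of_real_minus)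
 have c: "G c = ?c A" "cumul c = 0" by (simp_all add: G_def cumul_def)
 have "G x * exp (- ?c (cumul x)) - G c * exp (- ?c (cumul c)) = (LEB t:{c..x}. ?c (R t))"
  unfolding primD[OF P x(1)] set_lebesgue_integral_def
  by (intro Bochner_Integration.integral_cong refl) (auto simp: indicator_def Gr E R_def)
 also have "... = ?c (LEB t:{c..x}. R t)" by (rule set_integral_complex_of_real)
 finally have "?c ((A + (LEB t:{c..x}. k t * f t)) * exp (- cumul x) - A) = ?c (LEB t:{c..x}. R t)"
  unfolding Gr[OF x(1)] c E by simp
 then have "(A + (LEB t:{c..x}. k t * f t)) * exp (- cumul x) - A = (LEB t:{c..x}. R t)"
  by (simp only: of_real_eq_iff)
 moreover have "0 <= (LEB t:{c..x}. - R t)"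
  by (rule set_integral_nonneg_loc) (use le x k(2) in "auto simp: R_def intro!: mult_nonneg_nonpos")
 ultimately have "(A + (LEB t:{c..x}. k t * f t)) * exp (- cumul x) <= A"
  by (simp add: set_lebesgue_integral_def)
 then have "A + (LEB t:{c..x}. k t * f t) <= A * exp (cumul x)" by (simp add: exp_minus field_simps)
 then show ?thesis using le[OF x] by simp
qed

end

definition linear_system :: "(real => complex) => (real => complex) => (real => complex) => (real => complex) =>
  (real => complex) => (real => complex) => bool" where
 "linear_system bt gm rh sg u v \<longleftrightarrow> prim u (%x. bt x * v x + rh x) & prim v (%x. gm x * u x + sg x)"

lemma linear_system_reflect:
 "linear_system bt gm rh sg u v ==>
  linear_system (%x. - bt (-x)) (%x. - gm (-x)) (%x. - rh (-x)) (%x. - sg (-x)) (%x. u (-x)) (%x. v (-x))"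
 unfolding linear_system_def using prim_reflect by fastforce

lemma linear_system_bound:
 assumes sys: "linear_system bt gm rh sg u v" and k: "loc_int k" "!!x. 0 <= k x"
  and bk: "AE x. cmod (bt x) + cmod (gm x) <= k x"
  and s: "loc_int s" "!!x. 0 <= s x" "AE x. cmod (rh x) + cmod (sg x) <= s x"
  and x: "c <= x" "x <= d"
 shows "cmod (u x) + cmod (v x) <= (cmod (u c) + cmod (v c) + (LEB t:{c..d}. s t)) * exp (LEB t:{c..d}. k t)"
proof -
 define A where "A = cmod (u c) + cmod (v c) + (LEB t:{c..d}. s t)"
 have A: "0 <= A" unfolding A_def by (intro add_nonneg_nonneg set_integral_nonneg_loc s) auto
 have u: "prim u (%x. bt x * v x + rh x)" and v: "prim v (%x. gm x * u x + sg x)"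
  using sys by (auto simp: linear_system_def)
 have cu: "continuous_on UNIV u" "continuous_on UNIV v" using u v by (auto intro: prim_continuous)
 have "cmod (u x) + cmod (v x) <= A * exp (cumul k c x)"
 proof (rule gronwall[OF k, where d=d and f="%x. cmod (u x) + cmod (v x)"])
  show "continuous_on UNIV (%x. cmod (u x) + cmod (v x))" by (intro continuous_intros cu)
  fix x assume x: "c <= x" "x <= d"
  have li: "loc_int (%t. k t * cmod (u t))" "loc_int (%t. k t * cmod (v t))"
   by (intro loc_int_mult_continuous k continuous_intros cu)+
  have li2: "loc_int (%t. cmod (bt t * v t + rh t))" "loc_int (%t. cmod (gm t * u t + sg t))"
   using u v by (auto intro: loc_int_norm prim_loc_int)
  have "cmod (u x - u c) + cmod (v x - v c) <= (LEB t:{c..x}. cmod (bt t * v t + rh t)) + (LEB t:{c..x}. cmod (gm t * u t + sg t))"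
   by (intro add_mono prim_norm_le[OF u] prim_norm_le[OF v] x li2) auto
  also have "... = (LEB t:{c..x}. cmod (bt t * v t + rh t) + cmod (gm t * u t + sg t))"
   by (intro set_integral_add(2)[symmetric] loc_intD li2)
  also have "... <= (LEB t:{c..x}. s t + k t * (cmod (u t) + cmod (v t)))"
  proof (rule set_integral_mono_AE)
   show "sint {c..x} (%t. cmod (bt t * v t + rh t) + cmod (gm t * u t + sg t))"
    by (intro loc_intD loc_int_add li2)
   show "sint {c..x} (%t. s t + k t * (cmod (u t) + cmod (v t)))"
    unfolding distrib_left by (intro loc_intD loc_int_add s li)
   show "AE t\<in>{c..x} in lebesgue. cmod (bt t * v t + rh t) + cmod (gm t * u t + sg t) <= s t + k t * (cmod (u t) + cmod (v t))"
    using bk s(3)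
   proof eventually_elim
    case (elim t)
    have "cmod (bt t * v t + rh t) + cmod (gm t * u t + sg t) <= (cmod (bt t) * cmod (v t) + cmod (rh t)) + (cmod (gm t) * cmod (u t) + cmod (sg t))"
     by (intro add_mono) (metis norm_mult norm_triangle_ineq)+
    also have "... <= s t + (cmod (bt t) + cmod (gm t)) * (cmod (u t) + cmod (v t))"
     using elim(2) by (simp add: algebra_simps add_increasing2)
    also have "... <= s t + k t * (cmod (u t) + cmod (v t))"
     using elim(1) by (intro add_left_mono mult_right_mono) auto
    finally show ?case by simp
   qed
  qed
  also have "... = (LEB t:{c..x}. s t) + (LEB t:{c..x}. k t * (cmod (u t) + cmod (v t)))"
   by (rule set_integral_add(2)) (unfold distrib_left, intro loc_intD loc_int_add s li, intro loc_intD loc_int_add s li)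
  finally have "cmod (u x - u c) + cmod (v x - v c) <= (LEB t:{c..x}. s t) + (LEB t:{c..x}. k t * (cmod (u t) + cmod (v t)))" .
  moreover have "(LEB t:{c..x}. s t) <= (LEB t:{c..d}. s t)"
   using x by (intro set_integral_subset_mono s) auto
  moreover have "cmod (u x) <= cmod (u x - u c) + cmod (u c)" "cmod (v x) <= cmod (v x - v c) + cmod (v c)"
   by (metis norm_triangle_sub add.commute)+
  ultimately show "cmod (u x) + cmod (v x) <= A + (LEB t:{c..x}. k t * (cmod (u t) + cmod (v t)))"
   by (simp add: A_def)
 qed (use A x in auto)
 also have "... <= A * exp (LEB t:{c..d}. k t)"
  unfolding cumul_eq[OF k x(1)] using x by (intro mult_left_mono A exp_mono) (auto intro!: set_integral_subset_mono k)
 finally show ?thesis by (simp add: A_def)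
qed

lemma loc_int_reflect:
 fixes g :: "real => real"
 assumes g: "loc_int g" shows "loc_int (%t. g (- t))"
 unfolding loc_int_def
proof (intro allI)
 fix x y
 have i: "lint (%t. indicator {-y..-x} t *\<^sub>R g t)"
  using loc_intD[OF g, of "-y" "-x"] by (simp add: set_integrable_def)
 have "indicator {-y..-x} (- t) = (indicator {x..y} t :: real)" for t by (auto simp: indicator_def)
 then show "sint {x..y} (%t. g (- t))"
  using integral_affine(1)[OF _ i, of "-1" 0] by (simp add: set_integrable_def)
qed

text \<open>Banach's fixed point theorem in the bounded continuous functions on the whole line, for
  the solution divided by \<open>E\<close>. The weight makes the Picard map a contraction globally,
  so no local solutions have to be glued.\<close>

lemma linear_system_exists:
 assumes bt: "loc_int bt" and gm: "loc_int gm" and rh: "loc_int rh" and sg: "loc_int sg"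
 obtains u v where "linear_system bt gm rh sg u v" "u c = al" "v c = al'"
proof -
 \<comment> \<open>The inhomogeneities are included in \<open>k\<close>, so that their integrals are
   also bounded by multiples of the weight \<open>E\<close>.\<close>
 define k where "k t = cmod (bt t) + cmod (gm t) + cmod (rh t) + cmod (sg t)" for t
 have k: "loc_int k" "0 <= k x" for x unfolding k_def by (auto intro!: loc_int_add loc_int_norm assms)
 define E where "E x = exp (4 * abs(cumul k c x))" for x
 have Ec: "continuous_on UNIV (%x. cor (E x))" unfolding E_def by (intro continuous_intros cumul_continuous k)
 have E1: "1 <= E x" for x by (simp add: E_def)
 define P where "P bt rh al y x = al + oriented_integral c x (%t. bt t * (cor (E t) * y t) + rh t)"
  for bt rh :: "real => complex" and al y x
 have li: "loc_int (%t. bt t * (cor (E t) * y t) + rh t)"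
  if "continuous_on UNIV y" "loc_int bt" "loc_int rh" for bt rh y
  using loc_int_add[OF loc_int_continuous_mult[OF continuous_on_mult[OF Ec that(1)] that(2)] that(3)] by (simp add: mult.commute)
 have pP: "prim (P bt rh al y) (%t. bt t * (cor (E t) * y t) + rh t)"
  if "continuous_on UNIV y" "loc_int bt" "loc_int rh" for bt rh al y
  unfolding P_def by (rule prim_oriented_integral[OF li[OF that]])
 have wE: "loc_int fy ==> 0 <= B ==> (!!t. cmod (fy t) <= B * (k t * E t)) ==> cmod (oriented_integral c x fy) <= B / 4 * E x" for fy B x
  unfolding E_def by (rule weight_bound[OF k])
 have wb: "cmod (oriented_integral c x (%t. bt t * (cor (E t) * y t) + rh t)) <= (B + C) / 4 * E x"
  if "continuous_on UNIV y" "loc_int bt" "loc_int rh" "!!t. cmod (bt t) <= k t" "!!t. cmod (rh t) <= C * k t" "!!t. cmod (y t) <= B" "0 <= B" "0 <= C"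
  for bt rh y B C x
 proof (rule wE)
  fix t
  have "cmod (bt t * (cor (E t) * y t) + rh t) <= cmod (bt t) * (E t * cmod (y t)) + cmod (rh t)"
   using norm_triangle_ineq[of "bt t * (cor (E t) * y t)" "rh t"] E1[of t] by (simp add: norm_mult)
  also have "... <= k t * (E t * B) + C * k t * E t"
  proof (intro add_mono mult_mono that)
   show "cmod (rh t) <= C * k t * E t" using that(5)[of t] mult_left_mono[OF E1[of t], of "C * k t"] that(8) k(2)[of t] by simp
  qed (use E1[of t] k(2)[of t] that(7) in auto)
  finally show "cmod (bt t * (cor (E t) * y t) + rh t) <= (B + C) * (k t * E t)" by (simp add: algebra_simps)
 qed (use li[OF that(1-3)] that in auto)
 have le_k: "cmod (bt t) <= k t" "cmod (gm t) <= k t" "cmod (rh t) <= 1 * k t" "cmod (sg t) <= 1 * k t" for t by (auto simp: k_def)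
 define T where "T z x = (1 / E x) *\<^sub>R (P bt rh al (%t. snd (apply_bcontfun z t)) x, P gm sg al' (%t. fst (apply_bcontfun z t)) x)"
  for z :: "real \<Rightarrow>\<^sub>C (complex \<times> complex)" and x
 have zc: "continuous_on UNIV (%t. fst (apply_bcontfun z t))" "continuous_on UNIV (%t. snd (apply_bcontfun z t))" for z :: "real \<Rightarrow>\<^sub>C (complex \<times> complex)"
  by (intro continuous_intros continuous_on_apply_bcontfun)+
 have zb: "cmod (fst (apply_bcontfun z t)) <= norm z" "cmod (snd (apply_bcontfun z t)) <= norm z" for z :: "real \<Rightarrow>\<^sub>C (complex \<times> complex)" and t
  using norm_bounded[of z t] norm_fst_le[of "fst (apply_bcontfun z t)" "snd (apply_bcontfun z t)"] norm_snd_le[of "snd (apply_bcontfun z t)" "fst (apply_bcontfun z t)"] by auto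
 have nT: "norm ((1 / E x) *\<^sub>R (y, y')) <= B + B'" if "cmod y <= B * E x" "cmod y' <= B' * E x" for x y y' B B'
 proof -
  have "norm ((1 / E x) *\<^sub>R (y, y')) <= (1 / E x) * (cmod y + cmod y')"
   using norm_Pair_le[of y y'] E1[of x] by (simp add: divide_right_mono del: scaleR_Pair)
  also have "... <= (1 / E x) * (B * E x + B' * E x)" using that E1[of x] by (intro mult_left_mono add_mono) auto
  finally show ?thesis using E1[of x] by (simp add: field_simps del: scaleR_Pair)
 qed
 have T: "T z : bcontfun" for z unfolding bcontfun_def
 proof (intro CollectI conjI)
  have "continuous_on UNIV (%x. 1 / E x)"
   unfolding E_def by (intro continuous_intros cumul_continuous k) auto
  then show "continuous_on UNIV (T z)" unfolding T_def[abs_def]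
   by (intro continuous_on_scaleR continuous_on_Pair prim_continuous[OF pP] zc assms)
  have "norm (T z x) <= (cmod al + (norm z + 1) / 4) + (cmod al' + (norm z + 1) / 4)" for x
   unfolding T_def
  proof (rule nT)
   have *: "cmod (al + y) <= (cmod al + B) * E x" if "cmod y <= B * E x" for al y B
    using norm_triangle_ineq[of al y] that mult_left_mono[OF E1[of x], of "cmod al"] by (simp add: distrib_right)
   show "cmod (P bt rh al (%t. snd (apply_bcontfun z t)) x) <= (cmod al + (norm z + 1) / 4) * E x"
    "cmod (P gm sg al' (%t. fst (apply_bcontfun z t)) x) <= (cmod al' + (norm z + 1) / 4) * E x"
    unfolding P_def by (intro * wb zc zb assms le_k; simp)+
  qed
  then show "bounded (range (T z))" unfolding bounded_iff by blast
 qed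
 \<comment> \<open>Each of the two components contributes 1/4, the factor in
   \<open>weight_bound\<close>.\<close>
 have "dist (Bcontfun (T z)) (Bcontfun (T z')) <= 1 / 2 * dist z z'" for z z'
 proof (rule dist_bound)
  fix x
  have d: "P bt rh al y x - P bt rh al y' x = oriented_integral c x (%t. bt t * (cor (E t) * (y t - y' t)) + 0)"
   if "continuous_on UNIV y" "continuous_on UNIV y'" "loc_int bt" "loc_int rh" for bt rh al y y'
  proof -
   have "(%t. bt t * (cor (E t) * (y t - y' t)) + 0) =
    (%t. (bt t * (cor (E t) * y t) + rh t) - (bt t * (cor (E t) * y' t) + rh t))" by (simp add: algebra_simps)
   then show ?thesis unfolding P_def oriented_integral_def
    using set_integral_diff(2)[OF loc_intD[OF li[OF that(1,3,4)]] loc_intD[OF li[OF that(2,3,4)]]] by simp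
  qed
  have "T z x - T z' x = (1 / E x) *\<^sub>R (P bt rh al (%t. snd (apply_bcontfun z t)) x - P bt rh al (%t. snd (apply_bcontfun z' t)) x,
    P gm sg al' (%t. fst (apply_bcontfun z t)) x - P gm sg al' (%t. fst (apply_bcontfun z' t)) x)"
   by (simp add: T_def scaleR_diff_right)
  also have "norm ... <= (norm (z - z') + 0) / 4 + (norm (z - z') + 0) / 4"
   unfolding d[OF zc(2) zc(2) bt rh] d[OF zc(1) zc(1) gm sg]
   using zb[of "z - z'"] by (intro nT wb continuous_intros zc assms le_k loc_int_zero) simp_all
  finally show "dist (apply_bcontfun (Bcontfun (T z)) x) (apply_bcontfun (Bcontfun (T z')) x) <= 1 / 2 * dist z z'"
   by (simp add: Bcontfun_inverse T dist_norm)
 qed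
 then obtain z where "Bcontfun (T z) = z" using banach_fix_type[of "1/2" "%z. Bcontfun (T z)"] by auto
 then have z: "apply_bcontfun z x = T z x" for x using Bcontfun_inverse[OF T, of z] by simp
 let ?u = "P bt rh al (%t. snd (apply_bcontfun z t))" and ?v = "P gm sg al' (%t. fst (apply_bcontfun z t))"
 have "cor (E t) * fst (apply_bcontfun z t) = ?u t" "cor (E t) * snd (apply_bcontfun z t) = ?v t" for t
  using z[of t] E1[of t] by (simp_all add: T_def scaleR_conv_of_real)
 then have "linear_system bt gm rh sg ?u ?v"
  using pP[OF zc(2) bt rh, of al z] pP[OF zc(1) gm sg, of al' z] by (simp add: linear_system_def)
 then show ?thesis by (rule that) (simp_all add: P_def)
qed

section \<open>The discriminant\<close>

lemma continuous_AE_eq: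
 fixes f g :: "real => complex"
 assumes f: "continuous_on UNIV f" and g: "continuous_on UNIV g" and ae: "AE x. f x = g x"
 shows "f = g"
proof -
 have o: "open {x. f x ~= g x}" by (rule open_Collect_neq[OF f g])
 have "negligible {x. f x ~= g x}"
  using ae by (auto simp: eventually_ae_filter negligible_iff_null_sets[symmetric] intro: negligible_subset)
 then have "{x. f x ~= g x} = {}" using open_not_negligible[OF o] by blast
 then show ?thesis by auto
qed

lemma prim_zero_const: "prim f g ==> AE x. g x = 0 ==> f x = f y"
proof -
 assume f: "prim f g" and "AE x. g x = 0"
 then have "AE x. 0 = g x" by (auto elim: eventually_mono)
 from prim_cong_AE[OF f this] have z: "prim f (%_. 0)" .
 show "f x = f y" using primD[OF z, of x y] primD[OF z, of y x] by (cases "x <= y") (auto simp: set_lebesgue_integral_def)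
qed

locale periodic_SL =
 fixes a :: real and w p q :: "real => real"
 assumes a_pos: "0 < a"
  and w_meas: "w : lmeas" and p_meas: "p : lmeas"
  and q_meas: "q : lmeas"
  and w_per: "!!x. w (x + a) = w x" and p_per: "!!x. p (x + a) = p x" and q_per: "!!x. q (x + a) = q x"
  and w_int: "sint {0<..<a} w" and q_int: "sint {0<..<a} q"
  and p_int: "sint {0<..<a} (%x. 1 / p x)"
  and w_nz: "AE x. w x ~= 0" and p_pos: "AE x. p x > 0"
begin

lemma w_loc: "loc_int w" and q_loc: "loc_int q" and p_loc: "loc_int (%x. 1 / p x)"
 using loc_int_periodic[OF a_pos w_per w_int] loc_int_periodic[OF a_pos q_per q_int]
  loc_int_periodic[OF a_pos _ p_int] p_per by auto

text \<open>The equation (A - l) u = h as a first order system for \<open>u\<close> and its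
  quasi-derivative \<open>v\<close>.\<close>

definition sys :: "complex => (real => complex) => (real => complex) => (real => complex) => bool" where
 "sys l h u v \<longleftrightarrow> prim u (%x. v x / of_real (p x)) &
   prim v (%x. (of_real (q x) - l * of_real (w x)) * u x - of_real (w x) * h x)"

definition wint :: "(real => complex) => bool" where "wint h \<longleftrightarrow> loc_int (%x. of_real (w x) * h x)"

lemma sys_linear_system:
 "sys l h u v \<longleftrightarrow> linear_system (%x. of_real (1 / p x)) (%x. of_real (q x) - l * of_real (w x)) (%_. 0) (%x. - (of_real (w x) * h x)) u v"
 unfolding sys_def linear_system_def by simp

lemma coeff_loc: "loc_int (%x. cor (1 / p x))" "loc_int (%x. cor (q x) - l * of_real (w x))"
 by (intro loc_int_of_real p_loc loc_int_diff q_loc loc_int_cmult w_loc)+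

lemma loc_int_uminus: "loc_int (g :: real => complex) ==> loc_int (%x. - g x)"
 using loc_int_cmult[of g "-1"] by simp

lemma sys_exists:
 assumes "wint h"
 shows "EX u v. sys l h u v & u c = al & v c = bt"
 unfolding sys_linear_system
 by (rule linear_system_exists[OF coeff_loc(1) coeff_loc(2)[of l] loc_int_zero loc_int_uminus[OF assms[unfolded wint_def]], of c al bt])
   (intro exI conjI, assumption+)

lemma wint_continuous: "continuous_on UNIV h ==> wint h"
 unfolding wint_def using loc_int_continuous_mult[OF _ loc_int_of_real[OF w_loc]] by (simp add: mult.commute)

lemma wint_zero: "wint (%_. 0)" by (simp add: wint_def loc_int_zero)

lemma sys_continuous: "sys l h u v ==> continuous_on UNIV u" "sys l h u v ==> continuous_on UNIV v"
 unfolding sys_def by (auto intro: prim_continuous)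

lemma sysD: "sys l h u v ==> prim u (%x. v x / of_real (p x))"
 "sys l h u v ==> prim v (%x. (of_real (q x) - l * of_real (w x)) * u x - of_real (w x) * h x)"
 by (simp_all add: sys_def)

lemma sysI: "prim u f ==> (!!x. f x = v x / of_real (p x)) ==> prim v g ==>
  (!!x. g x = (of_real (q x) - l * of_real (w x)) * u x - of_real (w x) * h x) ==> sys l h u v"
proof -
 assume *: "prim u f" "!!x. f x = v x / of_real (p x)" "prim v g"
  "!!x. g x = (of_real (q x) - l * of_real (w x)) * u x - of_real (w x) * h x"
 have "f = (%x. v x / of_real (p x))" "g = (%x. (of_real (q x) - l * of_real (w x)) * u x - of_real (w x) * h x)"
  using *(2,4) by auto
 then show ?thesis using *(1,3) by (simp add: sys_def)
qed

lemma sys_wint: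
 assumes s: "sys l h u v" shows "wint h"
proof -
 have "loc_int (%x. u x * (of_real (q x) - l * of_real (w x)) - ((of_real (q x) - l * of_real (w x)) * u x - of_real (w x) * h x))"
  by (rule loc_int_diff[OF loc_int_continuous_mult[OF sys_continuous(1)[OF s] coeff_loc(2)] prim_loc_int[OF sysD(2)[OF s]]])
 then show "wint h" by (simp add: wint_def algebra_simps)
qed

lemma sys_add: "sys l h u v ==> sys l h' u' v' ==> sys l (%x. h x + h' x) (%x. u x + u' x) (%x. v x + v' x)"
 by (rule sysI[OF prim_add[OF sysD(1) sysD(1)] _ prim_add[OF sysD(2) sysD(2)]])
   (assumption | simp add: algebra_simps add_divide_distrib)+

lemma sys_diff: "sys l h u v ==> sys l h' u' v' ==> sys l (%x. h x - h' x) (%x. u x - u' x) (%x. v x - v' x)"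
 by (rule sysI[OF prim_diff[OF sysD(1) sysD(1)] _ prim_diff[OF sysD(2) sysD(2)]])
   (assumption | simp add: algebra_simps diff_divide_distrib)+

lemma sys_cmult: "sys l h u v ==> sys l (%x. c * h x) (%x. c * u x) (%x. c * v x)"
 by (rule sysI[OF prim_cmult[OF sysD(1)] _ prim_cmult[OF sysD(2)]])
   (assumption | simp add: algebra_simps)+

lemma sys_shift_param: "sys l h u v ==> sys m (%x. h x + (l - m) * u x) u v"
 by (rule sysI[OF sysD(1) _ sysD(2)])
   (assumption | simp add: algebra_simps)+

lemma sys_translate: "sys l h u v ==> sys l (%x. h (x + a)) (%x. u (x + a)) (%x. v (x + a))"
 by (rule sysI[OF prim_shift[OF sysD(1)] _ prim_shift[OF sysD(2)]])
   (assumption | simp add: w_per q_per p_per)+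

lemma w_per': "w (x - a) = w x" and p_per': "p (x - a) = p x" and q_per': "q (x - a) = q x"
 using w_per[of "x - a"] p_per[of "x - a"] q_per[of "x - a"] by auto

lemma sys_translate':
 assumes "sys l h u v" shows "sys l (%x. h (x - a)) (%x. u (x - a)) (%x. v (x - a))"
 using prim_shift[OF sysD(1)[OF assms], of "-a"] prim_shift[OF sysD(2)[OF assms], of "-a"]
 by (intro sysI[of _ _ _ "%x. (of_real (q (x - a)) - l * of_real (w (x - a))) * u (x - a) - of_real (w (x - a)) * h (x - a)"])
   (simp_all add: w_per' q_per' p_per')

definition kk :: "complex => real => real" where "kk l x = abs(1 / p x) + abs(q x) + cmod l * abs(w x)"

lemma kk: "loc_int (kk l)" "0 <= kk l x"
 unfolding kk_def[abs_def] by (intro loc_int_add loc_int_abs loc_int_cmult p_loc q_loc w_loc) auto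

lemma kk_coeff: "cmod (cor (1 / p x)) + cmod (cor (q x) - l * of_real (w x)) <= kk l x"
 using norm_triangle_ineq4[of "cor (q x)" "l * of_real (w x)"] by (simp add: kk_def norm_mult norm_divide)

lemma sys_bound:
 assumes "sys l h u v" "c <= x" "x <= d"
 shows "cmod (u x) + cmod (v x) <= (cmod (u c) + cmod (v c) + (LEB t:{c..d}. abs(w t) * cmod (h t))) * exp (LEB t:{c..d}. kk l t)"
proof (rule linear_system_bound[OF assms(1)[unfolded sys_linear_system] kk _ _ _ _ assms(2,3)])
 show "loc_int (%t. abs(w t) * cmod (h t))"
  using loc_int_norm[OF sys_wint[OF assms(1), unfolded wint_def]] by (simp add: norm_mult)
qed (auto simp: kk_coeff[simplified] norm_mult)

text \<open>Gronwall's estimate works to the right of \<open>c\<close>; the reflected system covers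
  the left.\<close>

lemma sys_zero_unique:
 assumes s: "sys l (%_. 0) u v" and z: "u c = 0" "v c = 0"
 shows "u x = 0 & v x = 0"
proof (cases "c <= x")
 case True
 have "cmod (u x) + cmod (v x) <= 0" using sys_bound[OF s True order_refl] z by (simp add: set_lebesgue_integral_def)
 then show ?thesis by (smt (verit) norm_ge_zero norm_le_zero_iff)
next
 case False
 have k: "loc_int (%x. kk l (-x))" "!!x. 0 <= kk l (-x)" using kk by (auto intro: loc_int_reflect)
 have "cmod (u (- (-x))) + cmod (v (- (-x))) <= (cmod (u (- (- c))) + cmod (v (- (- c))) + (LEB t:{-c..-x}. 0)) * exp (LEB t:{-c..-x}. kk l (-t))"
  by (rule linear_system_bound[OF linear_system_reflect[OF s[unfolded sys_linear_system]] k])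
   (use False kk_coeff[of "-x" l for x] in "auto simp: loc_int_zero norm_minus_commute norm_divide")
 then have "cmod (u x) + cmod (v x) <= 0" using z by (simp add: set_lebesgue_integral_def)
 then show ?thesis by (smt (verit) norm_ge_zero norm_le_zero_iff)
qed

lemma sys_unique:
 assumes "sys l h u v" "sys l h u' v'" "u c = u' c" "v c = v' c"
 shows "u = u'" "v = v'"
proof -
 have "sys l (%_. 0) (%x. u x - u' x) (%x. v x - v' x)" using sys_diff[OF assms(1,2)] by simp
 from sys_zero_unique[OF this, of c] assms(3,4) show "u = u'" "v = v'" by (auto simp: fun_eq_iff)
qed

definition hom :: "complex => complex => complex => (real => complex) \<times> (real => complex)" where
 "hom l al bt = (SOME uv. sys l (%_. 0) (fst uv) (snd uv) & fst uv 0 = al & snd uv 0 = bt)"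

lemma hom: "sys l (%_. 0) (fst (hom l al bt)) (snd (hom l al bt))" "fst (hom l al bt) 0 = al" "snd (hom l al bt) 0 = bt"
proof -
 obtain u v where "sys l (%_. 0) u v" "u 0 = al" "v 0 = bt"
  using sys_exists[OF wint_zero, of l 0 al bt] by (elim exE conjE) (rule that)
 then have "EX uv. sys l (%_. 0) (fst uv) (snd uv) & fst uv 0 = al & snd uv 0 = bt" by (intro exI[of _ "(u, v)"]) auto
 note * = someI_ex[OF this, folded hom_def]
 show "sys l (%_. 0) (fst (hom l al bt)) (snd (hom l al bt))" by (rule conjunct1[OF *])
 show "fst (hom l al bt) 0 = al" "snd (hom l al bt) 0 = bt" using conjunct2[OF *] by simp_all
qed

abbreviation "ph l == fst (hom l 1 0)"
abbreviation "ph' l == snd (hom l 1 0)"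
abbreviation "ps l == fst (hom l 0 1)"
abbreviation "ps' l == snd (hom l 0 1)"

definition disc :: "complex => complex" where "disc l = ph l a + ps' l a"

lemma hom_rep:
 assumes "sys l (%_. 0) u v"
 shows "u x = u 0 * ph l x + v 0 * ps l x" "v x = u 0 * ph' l x + v 0 * ps' l x"
proof -
 have "sys l (%_. 0) (%x. u 0 * ph l x + v 0 * ps l x) (%x. u 0 * ph' l x + v 0 * ps' l x)"
  using sys_add[OF sys_cmult[OF hom(1)[of l 1 0], of "u 0"] sys_cmult[OF hom(1)[of l 0 1], of "v 0"]] by simp
 note * = sys_unique[OF assms this, of 0]
 show "u x = u 0 * ph l x + v 0 * ps l x" by (rule fun_cong[OF *(1)]) (simp_all add: hom)
 show "v x = u 0 * ph' l x + v 0 * ps' l x" by (rule fun_cong[OF *(2)]) (simp_all add: hom)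
qed

lemma wronskian_const:
 assumes "sys l (%_. 0) u v" "sys l (%_. 0) u1 v1"
 shows "u x * v1 x - v x * u1 x = u y * v1 y - v y * u1 y"
proof (rule prim_zero_const)
 show "prim (%x. u x * v1 x - v x * u1 x)
  (%x. (u x * ((of_real (q x) - l * of_real (w x)) * u1 x - of_real (w x) * 0) + v x / of_real (p x) * v1 x) -
   (v x * (v1 x / of_real (p x)) + ((of_real (q x) - l * of_real (w x)) * u x - of_real (w x) * 0) * u1 x))"
  by (rule prim_diff[OF prim_mult[OF sysD(1)[OF assms(1)] sysD(2)[OF assms(2)]] prim_mult[OF sysD(2)[OF assms(1)] sysD(1)[OF assms(2)]]])
qed (auto simp: algebra_simps)

lemma monodromy_det: "ph l a * ps' l a - ph' l a * ps l a = 1"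
 using wronskian_const[OF hom(1)[of l 1 0] hom(1)[of l 0 1], of a 0] by (simp add: hom)

text \<open>This is the Cayley-Hamilton theorem for the monodromy matrix, which has trace
  \<open>disc l\<close> and, by \<open>monodromy_det\<close>, determinant 1. It makes the initial
  data of a solution vanish, hence the solution itself.\<close>

lemma hom_step:
 assumes s: "sys l (%_. 0) u v"
 shows "u (x + a) + u (x - a) = disc l * u x" "v (x + a) + v (x - a) = disc l * v x"
proof -
 have s1: "sys l (%_. 0) (%x. u (x + a)) (%x. v (x + a))" using sys_translate[OF s] by simp
 have s2: "sys l (%_. 0) (%x. u (x + a + a)) (%x. v (x + a + a))" using sys_translate[OF s1] by simp
 have S: "sys l (%_. 0) (%x. u (x + a + a) + u x - disc l * u (x + a)) (%x. v (x + a + a) + v x - disc l * v (x + a))" (is "sys _ _ ?U ?V")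
  using sys_diff[OF sys_add[OF s2 s] sys_cmult[OF s1, of "disc l"]] by simp
 have e: "u (a + a) = u a * ph l a + v a * ps l a" "v (a + a) = u a * ph' l a + v a * ps' l a"
  "u a = u 0 * ph l a + v 0 * ps l a" "v a = u 0 * ph' l a + v 0 * ps' l a"
  using hom_rep[OF s1, of a] hom_rep[OF s, of a] by simp_all
 have d: "ph l a * ps' l a = 1 + ph' l a * ps l a" using monodromy_det[of l] by (simp add: algebra_simps)
 have "u (a + a) + u 0 - disc l * u a = u 0 * (1 + ph' l a * ps l a - ph l a * ps' l a)"
  unfolding e disc_def by (simp add: algebra_simps)
 then have U0: "?U 0 = 0" by (simp add: d)
 have "v (a + a) + v 0 - disc l * v a = v 0 * (1 + ph' l a * ps l a - ph l a * ps' l a)"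
  unfolding e disc_def by (simp add: algebra_simps)
 then have V0: "?V 0 = 0" by (simp add: d)
 have "?U (x - a) = 0 & ?V (x - a) = 0" by (rule sys_zero_unique[OF S U0 V0])
 then show "u (x + a) + u (x - a) = disc l * u x" "v (x + a) + v (x - a) = disc l * v x" by simp_all
qed

end

lemma field_derivative_quadratic:
 fixes f :: "complex => complex"
 assumes "!!l. cmod (l - l0) <= 1 ==> cmod (f l - f l0 - (l - l0) * y) <= C * (cmod (l - l0))^2"
 shows "(f has_field_derivative y) (at l0)"
 unfolding has_field_derivative_def has_derivative_at_alt
proof (intro conjI allI impI)
 show "bounded_linear ((*) y)" by (rule bounded_linear_mult_right)
 fix e :: real assume e: "0 < e"
 show "EX d>0. ALL l. norm (l - l0) < d --> norm (f l - f l0 - y * (l - l0)) <= e * norm (l - l0)"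
 proof (intro exI[of _ "min 1 (e / (abs C + 1))"] conjI allI impI)
  fix l assume l: "norm (l - l0) < min 1 (e / (abs C + 1))"
  have "norm (f l - f l0 - y * (l - l0)) <= C * (cmod (l - l0))^2" using assms[of l] l by (simp add: mult.commute)
  also have "... <= ((abs C + 1) * cmod (l - l0)) * cmod (l - l0)"
   unfolding power2_eq_square mult.assoc by (intro mult_right_mono) auto
  also have "... <= e * cmod (l - l0)"
   using l by (intro mult_right_mono) (auto simp: field_simps)
  finally show "norm (f l - f l0 - y * (l - l0)) <= e * norm (l - l0)" .
 qed (use e in auto)
qed

context periodic_SL
begin

lemma w_abs_loc: "loc_int (%t. abs(w t))" by (rule loc_int_abs[OF w_loc])

lemma weighted_integral_bound:
 assumes h: "wint h" and B: "!!t. c <= t ==> t <= d ==> cmod (h t) <= B"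
 shows "(LEB t:{c..d}. abs(w t) * cmod (h t)) <= B * (LEB t:{c..d}. abs(w t))"
proof -
 have "(LEB t:{c..d}. abs(w t) * cmod (h t)) <= (LEB t:{c..d}. B * abs(w t))"
 proof (rule set_integral_mono_loc)
  show "loc_int (%t. abs(w t) * cmod (h t))" using loc_int_norm[OF h[unfolded wint_def]] by (simp add: norm_mult)
  fix t assume "c <= t" "t <= d"
  then show "abs(w t) * cmod (h t) <= B * abs(w t)" using mult_left_mono[OF B[of t], of "abs(w t)"] by (simp add: mult.commute)
 qed (intro loc_int_cmult w_abs_loc)
 then show ?thesis by simp
qed

lemma sys_bound_zero:
 assumes "sys l h u v" "u c = 0" "v c = 0" "c <= x" "x <= d"
 shows "cmod (u x) + cmod (v x) <= (LEB t:{c..d}. abs(w t) * cmod (h t)) * exp (LEB t:{c..d}. kk l t)"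
 using sys_bound[OF assms(1,4,5)] assms(2,3) by simp

lemma kk_integral: "(LEB t:{c..d}. kk l t) = (LEB t:{c..d}. abs(1 / p t) + abs(q t)) + cmod l * (LEB t:{c..d}. abs(w t))"
proof -
 have "(LEB t:{c..d}. kk l t) = (LEB t:{c..d}. abs(1 / p t) + abs(q t)) + (LEB t:{c..d}. cmod l * abs(w t))"
  unfolding kk_def by (intro set_integral_add loc_intD loc_int_add loc_int_abs loc_int_cmult p_loc q_loc w_loc)
 then show ?thesis by simp
qed

lemma kk_integral_mono: "cmod l <= cmod m ==> (LEB t:{c..d}. kk l t) <= (LEB t:{c..d}. kk m t)"
 unfolding kk_integral by (intro add_left_mono mult_right_mono set_integral_nonneg_loc) auto

text \<open>\<open>y\<close> solves the equation differentiated in the parameter. The difference of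
  the solutions for \<open>l\<close> and \<open>l0\<close> is O(l - l0); the remainder solves the
  equation with right-hand side (l - l0) times this difference and is therefore quadratic.\<close>

lemma hom_has_derivative:
 assumes y: "sys l0 (fst (hom l0 al bt)) y y'" "y 0 = 0" "y' 0 = 0" and x: "0 <= x"
 shows "((%l. fst (hom l al bt) x) has_field_derivative y x) (at l0)"
  and "((%l. snd (hom l al bt) x) has_field_derivative y' x) (at l0)"
proof -
 define u where "u l = fst (hom l al bt)" for l
 define v where "v l = snd (hom l al bt)" for l
 have uv: "sys l (%_. 0) (u l) (v l)" "u l 0 = al" "v l 0 = bt" for l using hom by (simp_all add: u_def v_def)
 define W where "W = (LEB t:{0..x}. abs(w t))"
 define K where "K = exp (LEB t:{0..x}. kk l0 t)"
 define B where "B = (cmod al + cmod bt) * exp (LEB t:{0..x}. kk (of_real (cmod l0 + 1)) t)"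
 have W: "0 <= W" unfolding W_def by (intro set_integral_nonneg_loc) auto
 have K: "0 <= K" by (simp add: K_def)
 have B: "cmod (u l t) <= B" if l: "cmod (l - l0) <= 1" and t: "0 <= t" "t <= x" for l t
 proof -
  have "cmod (u l t) + cmod (v l t) <= (cmod al + cmod bt) * exp (LEB t:{0..x}. kk l t)"
   using sys_bound[OF uv(1) t, of l] uv by (simp add: set_lebesgue_integral_def)
  also have "... <= B" unfolding B_def
  proof (intro mult_left_mono exp_mono)
   have "cmod l <= cmod l0 + 1" using l norm_triangle_sub[of l l0] by simp
   also have "... = cmod (of_real (cmod l0 + 1))" by (simp add: norm_of_real del: of_real_add)
   finally show "(LEB t:{0..x}. kk l t) <= (LEB t:{0..x}. kk (of_real (cmod l0 + 1)) t)"
    by (rule kk_integral_mono)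
  qed auto
  finally show ?thesis using norm_ge_zero[of "v l t"] by linarith
 qed
 have g: "sys l0 (%x. (l - l0) * u l x) (%x. u l x - u l0 x) (%x. v l x - v l0 x)" for l
  using sys_diff[OF sys_shift_param[OF uv(1)[of l], of l0] uv(1)[of l0]] by simp
 have gb: "cmod (u l t - u l0 t) <= cmod (l - l0) * (B * W * K)" if l: "cmod (l - l0) <= 1" and t: "0 <= t" "t <= x" for l t
 proof -
  have "cmod (u l t - u l0 t) + cmod (v l t - v l0 t) <= (LEB t:{0..x}. abs(w t) * cmod ((l - l0) * u l t)) * K"
   unfolding K_def by (rule sys_bound_zero[OF g _ _ t]) (simp_all add: uv)
  also have "... <= (cmod (l - l0) * B * W) * K" unfolding W_def
   by (intro mult_right_mono weighted_integral_bound sys_wint[OF g] K)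
    (auto simp: norm_mult intro!: mult_left_mono B l)
  finally have "cmod (u l t - u l0 t) + cmod (v l t - v l0 t) <= cmod (l - l0) * (B * W * K)" by (simp add: mult.assoc)
  then show ?thesis using norm_ge_zero[of "v l t - v l0 t"] by linarith
 qed
 have r: "cmod (u l x - u l0 x - (l - l0) * y x) + cmod (v l x - v l0 x - (l - l0) * y' x) <= (B * W * K * W * K) * (cmod (l - l0))^2"
  if l: "cmod (l - l0) <= 1" for l
 proof -
  have s: "sys l0 (%x. (l - l0) * u l x - (l - l0) * u l0 x) (%x. u l x - u l0 x - (l - l0) * y x) (%x. v l x - v l0 x - (l - l0) * y' x)"
   using sys_diff[OF g sys_cmult[OF y(1)]] by (simp add: u_def)
  have "cmod (u l x - u l0 x - (l - l0) * y x) + cmod (v l x - v l0 x - (l - l0) * y' x) <=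
   (LEB t:{0..x}. abs(w t) * cmod ((l - l0) * u l t - (l - l0) * u l0 t)) * K"
   unfolding K_def by (rule sys_bound_zero[OF s _ _ x order_refl]) (simp_all add: uv y)
  also have "... <= (cmod (l - l0) * (cmod (l - l0) * (B * W * K)) * W) * K" unfolding W_def[symmetric]
  proof (intro mult_right_mono K)
   show "(LEB t:{0..x}. abs(w t) * cmod ((l - l0) * u l t - (l - l0) * u l0 t)) <= cmod (l - l0) * (cmod (l - l0) * (B * W * K)) * W"
    unfolding W_def
   proof (rule weighted_integral_bound[OF sys_wint[OF s]])
    fix t assume "0 <= t" "t <= x"
    then show "cmod ((l - l0) * u l t - (l - l0) * u l0 t) <= cmod (l - l0) * (cmod (l - l0) * (B * (LEB t:{0..x}. abs(w t)) * K))"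
     unfolding right_diff_distrib[symmetric] norm_mult W_def[symmetric] by (intro mult_left_mono gb l) auto
   qed
  qed
  finally show ?thesis by (simp add: power2_eq_square algebra_simps)
 qed
 show "((%l. fst (hom l al bt) x) has_field_derivative y x) (at l0)"
  by (rule field_derivative_quadratic[of _ _ _ "B * W * K * W * K"])
   (use r norm_ge_zero in "fastforce simp: u_def v_def intro: order_trans[rotated]")
 show "((%l. snd (hom l al bt) x) has_field_derivative y' x) (at l0)"
  by (rule field_derivative_quadratic[of _ _ _ "B * W * K * W * K"])
   (use r norm_ge_zero in "fastforce simp: u_def v_def intro: order_trans[rotated]")
qed

lemma disc_has_derivative:
 assumes "sys l (ph l) y1 y1'" "y1 0 = 0" "y1' 0 = 0" "sys l (ps l) y2 y2'" "y2 0 = 0" "y2' 0 = 0"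
 shows "(disc has_field_derivative (y1 a + y2' a)) (at l)"
 unfolding disc_def[abs_def]
 by (intro DERIV_add hom_has_derivative(1)[OF assms(1-3)] hom_has_derivative(2)[OF assms(4-6)]) (use a_pos in auto)

lemma disc_holomorphic: "disc holomorphic_on UNIV"
 unfolding holomorphic_on_def
proof
 fix l
 obtain y1 y1' where 1: "sys l (ph l) y1 y1'" "y1 0 = 0" "y1' 0 = 0"
  using sys_exists[OF wint_continuous[OF sys_continuous(1)[OF hom(1)[of l 1 0]]], of l 0 0 0] by (elim exE conjE) (rule that)
 obtain y2 y2' where 2: "sys l (ps l) y2 y2'" "y2 0 = 0" "y2' 0 = 0"
  using sys_exists[OF wint_continuous[OF sys_continuous(1)[OF hom(1)[of l 0 1]]], of l 0 0 0] by (elim exE conjE) (rule that)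
 show "disc field_differentiable at l within UNIV"
  using disc_has_derivative[OF 1 2] unfolding field_differentiable_def by auto
qed

lemma quasi_deriv_iff:
 assumes f: "f : AC_loc"
 shows "is_quasi_deriv p f g \<longleftrightarrow> g : AC_loc & prim f (%x. g x / of_real (p x))"
proof -
 note d = AC_prim_vector_derivative[OF f]
 have 1: "AE x. (g x = of_real (p x) * vector_derivative f (at x)) = (g x / of_real (p x) = vector_derivative f (at x))"
  using p_pos by eventually_elim (auto simp: field_simps)
 have "(AE x. g x = of_real (p x) * vector_derivative f (at x)) \<longleftrightarrow>
   (AE x. g x / of_real (p x) = vector_derivative f (at x))"
 proof
  assume "AE x. g x = of_real (p x) * vector_derivative f (at x)"
  then show "AE x. g x / of_real (p x) = vector_derivative f (at x)" using 1 by eventually_elim simp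
 next
  assume "AE x. g x / of_real (p x) = vector_derivative f (at x)"
  then show "AE x. g x = of_real (p x) * vector_derivative f (at x)" using 1 by eventually_elim simp
 qed
 moreover have "(AE x. g x / of_real (p x) = vector_derivative f (at x)) \<longleftrightarrow> prim f (%x. g x / of_real (p x))"
  using prim_cong_AE[OF d, of "%x. g x / of_real (p x)"] prim_unique[OF _ d, of "%x. g x / of_real (p x)"] by (rule iffI)
 ultimately show ?thesis by (auto simp: is_quasi_deriv_def)
qed

lemma quasi_deriv_eq:
 assumes "prim u (%x. v x / of_real (p x))" "v : AC_loc"
 shows "quasi_deriv p u = v" "u : SL_domain p"
proof -
 have u: "u : AC_loc" using assms(1) by (rule prim_AC)
 have v: "is_quasi_deriv p u v" using assms by (simp add: quasi_deriv_iff[OF u])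
 show "quasi_deriv p u = v"
  unfolding quasi_deriv_def
 proof (rule the_equality[where P="is_quasi_deriv p u", OF v])
  fix g assume g: "is_quasi_deriv p u g"
  have "AE x. g x = v x" using g v unfolding is_quasi_deriv_def by (auto elim: eventually_elim2)
  moreover have "continuous_on UNIV g" "continuous_on UNIV v"
   using g v prim_continuous[OF AC_prim_vector_derivative] by (auto simp: is_quasi_deriv_def)
  ultimately show "g = v" by (intro continuous_AE_eq)
 qed
 show "u : SL_domain p" using u v by (auto simp: SL_domain_def)
qed

lemma SL_domainE:
 assumes "u : SL_domain p"
 obtains v where "prim u (%x. v x / of_real (p x))" "v : AC_loc" "quasi_deriv p u = v"
proof -
 from assms obtain v where u: "u : AC_loc" and v: "is_quasi_deriv p u v" by (auto simp: SL_domain_def)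
 then have *: "prim u (%x. v x / of_real (p x))" "v : AC_loc" using quasi_deriv_iff[OF u] by auto
 then show ?thesis using quasi_deriv_eq[OF *] that by blast
qed

lemma SL_expr_sys:
 assumes "sys l h u v"
 shows "u : SL_domain p" "quasi_deriv p u = v" "AE x. SL_expr w p q u x = l * u x + h x"
proof -
 note s = sysD[OF assms]
 show *: "u : SL_domain p" "quasi_deriv p u = v" using quasi_deriv_eq[OF s(1) prim_AC[OF s(2)]] by auto
 show "AE x. SL_expr w p q u x = l * u x + h x"
  using prim_derivative_AE[OF s(2)] w_nz
 proof eventually_elim
  case (elim x)
  then have "vector_derivative v (at x) = (of_real (q x) - l * of_real (w x)) * u x - of_real (w x) * h x" by (simp add: vector_derivative_at)
  then show ?case using elim(2) by (simp add: SL_expr_def *(2) field_simps)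
 qed
qed

lemma sys_SL_expr:
 assumes u: "u : SL_domain p" and ae: "AE x. SL_expr w p q u x = l * u x + h x"
 shows "sys l h u (quasi_deriv p u)"
proof -
 obtain v where v: "prim u (%x. v x / of_real (p x))" "v : AC_loc" "quasi_deriv p u = v" using SL_domainE[OF u] .
 have "AE x. (of_real (q x) - l * of_real (w x)) * u x - of_real (w x) * h x = vector_derivative v (at x)"
  using ae w_nz
 proof eventually_elim
  case (elim x)
  then have "- vector_derivative v (at x) + of_real (q x) * u x = of_real (w x) * (l * u x + h x)"
   by (simp add: SL_expr_def v(3) field_simps)
  then show ?case by (simp add: algebra_simps)
 qed
 from prim_cong_AE[OF AC_prim_vector_derivative[OF v(2)] this]
 show ?thesis using v by (simp add: sys_def)
qed

lemma SL_solution_iff: "SL_solution w p q l u \<longleftrightarrow> sys l (%_. 0) u (quasi_deriv p u)"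
 unfolding SL_solution_def using SL_expr_sys[of l "%_. 0" u] sys_SL_expr[of u l "%_. 0"] by auto

lemma sol_eq: "SL_solution w p q l u & u 0 = al & quasi_deriv p u 0 = bt \<longleftrightarrow> u = fst (hom l al bt)"
proof
 assume "SL_solution w p q l u & u 0 = al & quasi_deriv p u 0 = bt"
 then show "u = fst (hom l al bt)"
  using sys_unique(1)[OF _ hom(1)[of l al bt], of u "quasi_deriv p u" 0] by (auto simp: SL_solution_iff hom)
next
 assume u: "u = fst (hom l al bt)"
 then show "SL_solution w p q l u & u 0 = al & quasi_deriv p u 0 = bt"
  using SL_expr_sys(2)[OF hom(1)] hom by (simp add: SL_solution_iff)
qed

lemma discriminant_eq: "discriminant a w p q l = disc l"
 unfolding discriminant_def sol_phi_def sol_psi_def sol_eq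
 using SL_expr_sys(2)[OF hom(1)] by (simp add: disc_def)

end

section \<open>Functional calculus of the shift\<close>

text \<open>Ties the complex scalar multiplication to real normed spaces, so that bounded operators,
  limits and continuity are those of the libraries.\<close>

class cnormed = complex_vector + real_normed_vector +
 assumes scaleR_scaleC: "r *\<^sub>R x = cor r *\<^sub>C x"
  and norm_scaleC: "norm (c *\<^sub>C x) = cmod c * norm x"

interpretation sc: bounded_bilinear "scaleC :: complex => 'a::cnormed => 'a"
proof
 show "EX K. ALL a b. norm (a *\<^sub>C (b::'a)) <= norm a * norm b * K" by (rule exI[of _ 1]) (simp add: norm_scaleC)
qed (simp_all add: scaleC_add_left scaleC_add_right scaleR_scaleC scaleC_scaleC scaleR_conv_of_real mult.commute)

lemmas [tendsto_intros] = sc.tendsto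
lemmas [continuous_intros] = sc.continuous_on

lemma scaleC_simps [simp]: "1 *\<^sub>C x = x" "0 *\<^sub>C x = 0" "c *\<^sub>C 0 = 0" "(- c) *\<^sub>C x = - (c *\<^sub>C x)" "c *\<^sub>C (- x) = - (c *\<^sub>C x)"
 by (simp_all add: scaleC_one complex_vector.scale_minus_left)

lemmas scaleC_algebra = scaleC_add_left scaleC_add_right scaleC_scaleC complex_vector.scale_right_diff_distrib complex_vector.scale_left_diff_distrib

instantiation blinfun :: (real_normed_vector, cnormed) cnormed
begin

lift_definition scaleC_blinfun :: "complex => 'a \<Rightarrow>\<^sub>L 'b => 'a \<Rightarrow>\<^sub>L 'b" is "%c f x. c *\<^sub>C f x"
 by (rule sc.bounded_linear_right[THEN bounded_linear_compose])

instance
proof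
 fix c d :: complex and r :: real and f g :: "'a \<Rightarrow>\<^sub>L 'b"
 have s: "blinfun_apply (c *\<^sub>C h) x = c *\<^sub>C h x" for c h and x :: 'a by transfer simp
 show "c *\<^sub>C (f + g) = c *\<^sub>C f + c *\<^sub>C g" "(c + d) *\<^sub>C f = c *\<^sub>C f + d *\<^sub>C f" "c *\<^sub>C d *\<^sub>C f = (c * d) *\<^sub>C f" "1 *\<^sub>C f = f"
   "r *\<^sub>R f = cor r *\<^sub>C f"
  by (rule blinfun_eqI, simp add: s blinfun.add_left blinfun.scaleR_left scaleC_add_right scaleC_add_left scaleC_scaleC scaleR_scaleC)+
 have le: "norm (c *\<^sub>C h) <= cmod c * norm h" for c and h :: "'a \<Rightarrow>\<^sub>L 'b"
  by (rule norm_blinfun_bound) (auto simp: s norm_scaleC mult.assoc intro: mult_left_mono norm_blinfun)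
 show "norm (c *\<^sub>C f) = cmod c * norm f"
 proof (cases "c = 0")
  case False
  have "f = (1 / c) *\<^sub>C (c *\<^sub>C f)" using False by (intro blinfun_eqI) (simp add: s scaleC_scaleC)
  then have "norm f <= cmod (1 / c) * norm (c *\<^sub>C f)" using le[of "1 / c" "c *\<^sub>C f"] by simp
  then show ?thesis using le[of c f] False by (simp add: norm_divide field_simps)
 qed (use le[of 0 f] in simp)
qed

end

lemma blinfun_scaleC [simp]: "blinfun_apply (c *\<^sub>C f) x = c *\<^sub>C f x" by transfer simp

text \<open>The inner product is the real one. Multiplication by \<open>cis a\<close> is isometric,
  hence orthogonal by polarization, so the inner product behaves as the real part of a hermitian one
  (\<open>inner_scaleC_right\<close>).\<close>

class chilbert = cnormed + real_inner + banach

lemma inner_polar: "4 * inner x (y :: 'a::real_inner) = (norm (x + y))^2 - (norm (x - y))^2"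
 by (simp add: power2_norm_eq_inner algebra_simps inner_commute)

lemma inner_isometry:
 fixes f :: "'a::real_inner => 'b::real_inner"
 assumes "f (x + y) = f x + f y" "f (x - y) = f x - f y" "!!x. norm (f x) = norm x"
 shows "inner (f x) (f y) = inner x y"
 using inner_polar[of "f x" "f y"] inner_polar[of x y] assms(3)[of "x + y"] assms(3)[of "x - y"] by (simp add: assms(1,2))

lemma inner_cis: "inner (cis a *\<^sub>C x) (cis a *\<^sub>C (y :: 'a::chilbert)) = inner x y"
 by (rule inner_isometry) (simp_all add: scaleC_algebra norm_scaleC)

lemma inner_scaleC_right: "inner x (c *\<^sub>C (y :: 'a::chilbert)) = inner (cnj c *\<^sub>C x) y"
proof -
 have i: "inner x (\<i> *\<^sub>C y) = inner (- (\<i> *\<^sub>C x)) y" for x y :: 'a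
  using inner_cis[of "pi/2" "- (\<i> *\<^sub>C x)" y] by (simp add: scaleC_scaleC)
 have e: "c *\<^sub>C y = Re c *\<^sub>R y + Im c *\<^sub>R (\<i> *\<^sub>C y)" for c and y :: 'a
  by (simp add: scaleR_scaleC scaleC_scaleC scaleC_add_left[symmetric] complex_eq mult.commute)
 show ?thesis unfolding e[of c y] e[of "cnj c" x] by (simp add: inner_add_left inner_diff_left inner_add_right i)
qed

lemma inner_eq_cos: "inner (cis a *\<^sub>C x) (cis b *\<^sub>C (y :: 'a::chilbert)) = cos (a - b) * inner x y + sin (a - b) * inner (\<i> *\<^sub>C x) y"
proof -
 have "cis (- b) * cis a = cor (cos (a - b)) + cor (sin (a - b)) * \<i>"
  by (simp add: cis_mult complex_eq_iff)
 then have "cis (- b) *\<^sub>C cis a *\<^sub>C x = cos (a - b) *\<^sub>R x + sin (a - b) *\<^sub>R (\<i> *\<^sub>C x)"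
  by (simp add: scaleC_scaleC scaleC_add_left scaleR_scaleC)
 then show ?thesis by (simp add: inner_scaleC_right cis_cnj inner_add_left)
qed

abbreviation circ :: "real measure" where "circ == lebesgue_on {-pi..pi}"

lemma circ_integrable: "continuous_on UNIV f ==> integrable circ (f :: real => real)"
 by (rule continuous_imp_integrable_real) (auto intro: continuous_on_subset)

lemma trig_integral:
 fixes n :: int
 shows "(LINT t|circ. cos (n * t)) = (if n = 0 then 2 * pi else 0)" "(LINT t|circ. sin (n * t)) = 0"
proof -
 have i: "(LINT t|circ. F' t) = F pi - F (-pi)" if "!!t. (F has_real_derivative F' t) (at t)" "continuous_on UNIV F'" for F F' :: "real => real"
 proof -
  have "(F' has_integral (F pi - F (-pi))) {-pi..pi}"
   by (rule fundamental_theorem_of_calculus) (use that(1) in "auto simp: has_real_derivative_iff_has_vector_derivative intro: has_vector_derivative_at_within")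
  then show ?thesis using lebesgue_integral_eq_integral[OF circ_integrable[OF that(2)]] by (simp add: integral_unique)
 qed
 have "(LINT t|circ. cos (n * t)) = 0" "(LINT t|circ. sin (n * t)) = 0" if "n ~= 0"
  by (subst i[where F="%t. sin (n * t) / n"] i[where F="%t. - cos (n * t) / n"];
   use that in "auto intro!: derivative_eq_intros continuous_intros simp: sin_int_times_real mult.commute[of _ pi]")+
 then show "(LINT t|circ. cos (n * t)) = (if n = 0 then 2 * pi else 0)" "(LINT t|circ. sin (n * t)) = 0"
  by (cases "n = 0"; simp add: lebesgue_on_UNIV_eq measure_restrict_space)+
qed

definition clin :: "('h::chilbert \<Rightarrow>\<^sub>L 'h) => bool" where "clin T \<longleftrightarrow> (ALL c x. T (c *\<^sub>C x) = c *\<^sub>C T x)"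

text \<open>A unitary bilateral shift with wandering subspace \<open>W\<close>. For the periodic
  problem, \<open>tau n\<close> is the translation by \<open>n\<close> periods and \<open>W\<close>
  consists of the functions supported in one period cell.\<close>

locale shift =
 fixes tau :: "int => 'h::chilbert \<Rightarrow>\<^sub>L 'h" and W :: "'h set"
 assumes tau_add: "tau (m + n) x = tau m (tau n x)" and tau_0: "tau 0 x = x"
  and tau_norm: "norm (tau n x) = norm x" and tau_clin: "clin (tau n)"
  and W_scale: "w : W ==> c *\<^sub>C w : W"
  and wandering: "w : W ==> w' : W ==> n ~= 0 ==> inner (tau n w) w' = 0"
  and dense: "0 < e ==> EX w N. (ALL n. w n : W) & norm (x - (\<Sum>n\<in>{-int N..int N}. tau n (w n))) < e"
begin

lemma tau_scale: "tau n (c *\<^sub>C x) = c *\<^sub>C tau n x" using tau_clin by (simp add: clin_def)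

definition S :: "'h \<Rightarrow>\<^sub>L 'h" where "S = tau 1 + tau (-1)"

lemma S_apply: "S x = tau 1 x + tau (-1) x" by (simp add: S_def blinfun.add_left)

lemma S_scale: "S (c *\<^sub>C x) = c *\<^sub>C S x" by (simp add: S_apply tau_scale scaleC_add_right)

lemma inner_tau: "inner (tau n x) (tau n y) = inner x y"
 by (rule inner_isometry) (simp_all add: blinfun.add_right blinfun.diff_right tau_norm)

lemma inner_tau_swap: "inner (tau n x) y = inner x (tau (-n) y)"
 using inner_tau[of n x "tau (-n) y"] tau_add[of n "-n" y] tau_0[of y] by simp

lemma S_symmetric: "inner (S x) y = inner x (S y)"
 by (simp add: S_apply inner_add_left inner_add_right inner_tau_swap)

text \<open>\<open>floquet y z\<close>: the finite sum \<open>y = \<Sum>\<^sub>n tau n w\<^sub>n\<close> has the transform \<open>z t = \<Sum>\<^sub>n exp (i n t) w\<^sub>n\<close>,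
  under which \<open>S\<close> becomes multiplication by \<open>2 cos t\<close>.\<close>

inductive floquet :: "'h => (real => 'h) => bool" where
 zero: "floquet 0 (%_. 0)"
| tau: "w : W ==> floquet (tau n w) (%t. cis (real_of_int n * t) *\<^sub>C w)"
| add: "floquet y z ==> floquet y' z' ==> floquet (y + y') (%t. z t + z' t)"

lemma floquet_continuous: "floquet y z ==> continuous_on UNIV z"
 by (induction rule: floquet.induct) (auto intro!: continuous_intros simp: cis_conv_exp)

lemma floquet_tau: "floquet y z ==> floquet (tau m y) (%t. cis (real_of_int m * t) *\<^sub>C z t)"
proof (induction rule: floquet.induct)
 case zero show ?case using floquet.zero by (simp add: blinfun.zero_right)
next
 case (tau w n)
 show ?case using floquet.tau[OF tau, of "m + n"] by (simp add: tau_add scaleC_scaleC cis_mult algebra_simps)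
next
 case (add y z y' z')
 show ?case using floquet.add[OF add(3,4)] by (simp add: blinfun.add_right scaleC_add_right)
qed

lemma floquet_scale: "floquet y z ==> floquet (c *\<^sub>C y) (%t. c *\<^sub>C z t)"
proof (induction rule: floquet.induct)
 case zero show ?case using floquet.zero by simp
next
 case (tau w n)
 show ?case using floquet.tau[OF W_scale[OF tau], of n c] by (simp add: tau_scale scaleC_scaleC mult.commute)
next
 case (add y z y' z')
 show ?case using floquet.add[OF add(3,4)] by (simp add: scaleC_add_right)
qed

lemma floquet_S: "floquet y z ==> floquet (S y) (%t. cor (2 * cos t) *\<^sub>C z t)"
proof -
 have "cor (2 * cos t) = cis (real_of_int 1 * t) + cis (real_of_int (-1) * t)" for t by (simp add: complex_eq_iff)
 moreover assume "floquet y z"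
 ultimately show ?thesis using floquet.add[OF floquet_tau[of y z 1] floquet_tau[of y z "-1"]] by (simp only: S_apply scaleC_add_left)
qed

text \<open>Parseval's identity: the orthogonality of the translates of \<open>W\<close> corresponds
  to that of the exponentials.\<close>

lemma floquet_inner:
 assumes y: "floquet y z" and y': "floquet y' z'" shows "(LINT t|circ. inner (z t) (z' t)) = 2 * pi * inner y y'"
proof -
 have i: "integrable circ (%t. inner (z t) (z' t))" if "floquet y z" "floquet y' z'" for y z y' z'
  by (intro circ_integrable continuous_intros floquet_continuous[OF that(1)] floquet_continuous[OF that(2)])
 show ?thesis using y
 proof (induction rule: floquet.induct)
  case t: (tau w n)
  show ?case using y'
  proof (induction rule: floquet.induct)
   case (tau w' m)
   have "inner (tau n w) (tau m w') = (if n = m then inner w w' else 0)"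
    using wandering[OF t tau, of "n - m"] inner_tau_swap[of m w' "tau n w"] tau_add[of "-m" n w] tau_0[of w]
    by (auto simp: inner_commute)
   moreover have "integrable circ (%t. cos (real_of_int (n - m) * t) * c)" "integrable circ (%t. sin (real_of_int (n - m) * t) * c)" for c
    by (intro circ_integrable continuous_intros)+
   ultimately show ?case unfolding inner_eq_cos left_diff_distrib[symmetric] of_int_diff[symmetric]
    by (simp add: trig_integral del: of_int_diff)
  next
   case (add a b a' b')
   then show ?case using i[OF floquet.tau[OF t]] by (simp add: inner_add_right algebra_simps)
  qed simp
 next
  case (add a b a' b')
  then show ?case using i y' by (simp add: inner_add_left algebra_simps)
 qed simp
qed

lemma floquet_norm: "floquet y z ==> (LINT t|circ. (norm (z t))^2) = 2 * pi * (norm y)^2"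
 using floquet_inner[of y z y z] by (simp add: power2_norm_eq_inner)

lemma floquet_dense: assumes e: "0 < e" obtains y z where "floquet y z" "norm (x - y) < e"
proof -
 obtain w N where w: "!!n. w n : W" "norm (x - (\<Sum>n\<in>{-int N..int N}. tau n (w n))) < e" using dense[OF e] by blast
 have "EX z. floquet (\<Sum>n\<in>I. tau n (w n)) z" if "finite I" for I
  using that by (induction I rule: finite_induct) (auto intro: floquet.zero floquet.add floquet.tau[OF w(1)])
 then show ?thesis using that w(2) by blast
qed

lemma dense_tendsto:
 assumes T: "!!n. norm (T n :: 'h \<Rightarrow>\<^sub>L 'h) <= C" and y: "!!y z. floquet y z ==> (%n. T n y) ----> 0"
 shows "(%n. T n x) ----> 0"
proof (rule LIMSEQ_I)
 fix e :: real assume e: "0 < e"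
 have C: "0 <= C" using T[of 0] norm_ge_zero order_trans by blast
 then obtain y z where yz: "floquet y z" "norm (x - y) < e / (2 * (C + 1))" using floquet_dense[of "e / (2 * (C + 1))"] e by auto
 then have Cxy: "(C + 1) * norm (x - y) < e / 2" using C by (simp add: field_simps)
 obtain N where N: "!!n. N <= n ==> norm (T n y) < e / 2" using LIMSEQ_D[OF y[OF yz(1)], of "e / 2"] e by auto
 show "EX N. ALL n>=N. norm (T n x - 0) < e"
 proof (intro exI allI impI)
  fix n assume n: "N <= n"
  have "norm (T n (x - y)) <= C * norm (x - y)" using norm_blinfun[of "T n" "x - y"] mult_right_mono[OF T[of n] norm_ge_zero] by (rule order_trans)
  also have "... <= (C + 1) * norm (x - y)" by (simp add: mult_right_mono)
  finally show "norm (T n x - 0) < e" using N[OF n] Cxy norm_triangle_ineq[of "T n (x - y)" "T n y"] by (simp add: blinfun.diff_right)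
 qed
qed

text \<open>The polynomial p(S), evaluated by Horner's scheme so that induction over
  \<open>pCons\<close> yields all computation rules.\<close>

definition pop :: "complex poly => 'h \<Rightarrow>\<^sub>L 'h" where "pop p = foldr (%c T. c *\<^sub>C id_blinfun + (S o\<^sub>L T)) (coeffs p) 0"

lemma pop_0 [simp]: "pop 0 = 0" by (simp add: pop_def)

lemma pop_pCons: "pop (pCons c p) x = c *\<^sub>C x + S (pop p x)"
 by (cases "c = 0 & p = 0") (auto simp: pop_def cCons_def blinfun.add_left blinfun.zero_right)

lemma pop_add: "pop (p + q) x = pop p x + pop q x"
 by (induction p q rule: poly_induct2) (simp_all add: pop_pCons scaleC_add_left blinfun.add_right)

lemma pop_smult: "pop (smult c p) x = c *\<^sub>C pop p x"
 by (induction p) (simp_all add: pop_pCons scaleC_algebra S_scale)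

lemma pop_diff: "pop (p - q) x = pop p x - pop q x"
 using pop_add[of p "- q" x] pop_smult[of "-1" q x] by simp

lemma pop_mult: "pop (p * q) x = pop p (pop q x)"
 by (induction p) (simp_all add: pop_pCons pop_add pop_smult)

lemma pop_commute: fixes T :: "'h \<Rightarrow>\<^sub>L 'h" shows "(!!x. T (S x) = S (T x)) ==> clin T ==> T (pop p x) = pop p (T x)"
 by (induction p) (simp_all add: pop_pCons blinfun.add_right blinfun.zero_right clin_def)

lemma pop_adjoint: "inner (pop p x) y = inner x (pop (map_poly cnj p) y)"
 by (induction p arbitrary: y)
  (simp_all add: pop_pCons map_poly_pCons inner_add_left inner_add_right inner_scaleC_right S_symmetric clin_def S_scale pop_commute[of S, symmetric])

lemma pop_floquet: "floquet y z ==> floquet (pop p y) (%t. poly p (cor (2 * cos t)) *\<^sub>C z t)"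
proof (induction p)
 case 0 then show ?case using floquet.zero by simp
next
 case (pCons c p)
 then show ?case using floquet.add[OF floquet_scale floquet_S[OF pCons(2)]]
  by (simp add: pop_pCons scaleC_algebra)
qed

end

lemma polynomial_approximation:
 fixes g :: "real => complex"
 assumes g: "continuous_on {-2..2} g" and e: "0 < e"
 shows "EX p. ALL s:{-2..2}. cmod (poly p (cor s) - g s) <= e"
proof -
 have r: "EX p. ALL s:{-2..2}. cmod (poly p (cor s) - cor (f s)) <= e / 2" if f: "continuous_on {-2..2} f" for f :: "real => real"
 proof -
  obtain h where h: "real_polynomial_function h" "!!s. s : {-2..2} ==> abs(f s - h s) < e / 2"
   using Stone_Weierstrass_real_polynomial_function[OF compact_Icc f, of "e / 2"] e by auto
  obtain b n where b: "h = (%x. \<Sum>i\<le>n. b i * x ^ i)" using h(1) real_polynomial_function_iff_sum by blast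
  have "poly (\<Sum>i\<le>n. monom (cor (b i)) i) (cor s) - cor (f s) = cor (h s - f s)" for s
   by (simp add: b poly_sum poly_monom)
  then show ?thesis using h(2) by (intro exI[of _ "\<Sum>i\<le>n. monom (cor (b i)) i"]) (simp add: abs_minus_commute less_imp_le del: of_real_diff)
 qed
 obtain p q where p: "ALL s:{-2..2}. cmod (poly p (cor s) - cor (Re (g s))) <= e / 2"
  and q: "ALL s:{-2..2}. cmod (poly q (cor s) - cor (Im (g s))) <= e / 2"
  using r[of "%s. Re (g s)"] r[of "%s. Im (g s)"] g by (auto intro: continuous_intros)
 have "cmod (poly (p + smult \<i> q) (cor s) - g s) <= e" if "s : {-2..2}" for s
 proof -
  have "poly (p + smult \<i> q) (cor s) - g s = (poly p (cor s) - cor (Re (g s))) + \<i> * (poly q (cor s) - cor (Im (g s)))"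
   by (simp add: complex_eq_iff)
  then show ?thesis
   using norm_triangle_le[of "poly p (cor s) - cor (Re (g s))" "\<i> * (poly q (cor s) - cor (Im (g s)))" e]
    bspec[OF p that] bspec[OF q that] by (simp only: norm_mult) simp
 qed
 then show ?thesis by blast
qed

text \<open>Off 0 and the end points, t is plus or minus arccos (s / 2), and this differentiable map
  sends null sets to null sets. So exceptional null sets in the variable s remain null in the
  Floquet variable; in particular no single s carries mass.\<close>

lemma two_cos_preimage_negligible:
 assumes N: "negligible N" shows "negligible {t. 2 * cos t : N & -pi < t & t < pi & t ~= 0}"
proof -
 have *: "negligible ((%s. c * arccos (s / 2)) ` (N Int {-2<..<2}))" for c :: real
  by (rule negligible_differentiable_image_negligible)
   (use N in "auto intro!: negligible_subset[OF N] derivative_eq_intros exI differentiable_at_withinI simp: differentiable_on_def real_differentiable_def")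
 have "t : (%s. 1 * arccos (s / 2)) ` (N Int {-2<..<2}) Un (%s. -1 * arccos (s / 2)) ` (N Int {-2<..<2})"
  if t: "2 * cos t : N" "-pi < t" "t < pi" "t ~= 0" for t
 proof -
  have 1: "-1 < cos t" "cos t < 1" using cos_monotone_0_pi[of 0 "abs t"] cos_monotone_0_pi[of "abs t" pi] t by auto
  have "t = arccos (2 * cos t / 2) | t = - arccos (2 * cos t / 2)" using arccos_cos[of t] arccos_cos[of "-t"] t by (cases "0 <= t") auto
  then show ?thesis using 1 t(1) by (auto intro!: image_eqI)
 qed
 then show ?thesis by (intro negligible_subset[OF negligible_Un[OF *[of 1] *[of "-1"]]] subsetI) blast
qed

text \<open>Borel functions that are bounded on [-2, 2]; by \<open>calc_cong\<close> only this
  interval matters for the calculus.\<close>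

definition bfun :: "(real => complex) => bool" where
 "bfun v \<longleftrightarrow> v : borel_measurable borel & (EX B. ALL s. abs s <= 2 --> cmod (v s) <= B)"

text \<open>Bounded convergence almost everywhere in the Floquet variable t, where s = 2 cos t: the
  convergence that the calculus turns into strong convergence of operators.\<close>

definition bconv :: "(nat => real => complex) => (real => complex) => bool" where
 "bconv f v \<longleftrightarrow> (ALL n. f n : borel_measurable borel) & (EX B. ALL n. ALL s. abs s <= 2 --> cmod (f n s) <= B) &
  (AE t in circ. (%n. f n (2 * cos t)) ----> v (2 * cos t))"

abbreviation polyf :: "complex poly => real => complex" where "polyf p s == poly p (cor s)"

lemma two_cos_mem: "abs(2 * cos t) <= (2::real)"
 using abs_cos_le_one[of t] by (simp add: abs_mult)

lemma bfunI: "v : borel_measurable borel ==> (!!s. abs s <= 2 ==> cmod (v s) <= B) ==> bfun v"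
 unfolding bfun_def by blast

lemma bfun_continuous: assumes v: "continuous_on UNIV v" shows "bfun v"
proof -
 have "bounded (v ` {-2..2})" by (intro compact_imp_bounded compact_continuous_image continuous_on_subset[OF v]) auto
 then obtain B where "ALL x:v ` {-2..2}. cmod x <= B" unfolding bounded_iff by blast
 then show ?thesis by (intro bfunI[of _ B] borel_measurable_continuous_onI v) (auto simp: abs_le_iff)
qed

lemma bfun_poly: "bfun (polyf p)" by (intro bfun_continuous continuous_intros)

lemma bfun_const: "bfun (%_. c)" by (intro bfun_continuous continuous_intros)

lemma bfun_indicator: "A : sets borel ==> bfun (indicator A)" by (rule bfunI[of _ 1]) (auto simp: indicator_def)

lemma bconvI:
 assumes "!!n. f n : borel_measurable borel" "!!n s. abs s <= 2 ==> cmod (f n s) <= B" "!!s. abs s <= 2 ==> (%n. f n s) ----> v s"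
 shows "bconv f v"
 unfolding bconv_def using assms two_cos_mem by (intro conjI exI[of _ B]) auto

lemma bconv_const: "bfun v ==> bconv (%_. v) v" by (auto simp: bconv_def bfun_def)

lemma bconv_add: assumes "bconv f u" "bconv g v" shows "bconv (%n s. f n s + g n s) (%s. u s + v s)"
 unfolding bconv_def
proof (intro conjI)
 obtain B C where "!!n s. abs s <= 2 ==> cmod (f n s) <= B" "!!n s. abs s <= 2 ==> cmod (g n s) <= C"
  using assms unfolding bconv_def by metis
 then show "EX B. ALL n. ALL s. abs s <= 2 --> cmod (f n s + g n s) <= B" by (intro exI[of _ "B + C"]) (meson norm_triangle_mono)
 show "AE t in circ. (%n. f n (2 * cos t) + g n (2 * cos t)) ----> u (2 * cos t) + v (2 * cos t)"
  using assms unfolding bconv_def by (auto elim!: eventually_elim2 intro: tendsto_add)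
qed (use assms in "auto simp: bconv_def intro!: borel_measurable_add borel_measurable_times")

lemma bconv_mult: assumes "bconv f u" "bconv g v" shows "bconv (%n s. f n s * g n s) (%s. u s * v s)"
 unfolding bconv_def
proof (intro conjI)
 obtain B C where "!!n s. abs s <= 2 ==> cmod (f n s) <= B" "!!n s. abs s <= 2 ==> cmod (g n s) <= C"
  using assms unfolding bconv_def by metis
 then show "EX B. ALL n. ALL s. abs s <= 2 --> cmod (f n s * g n s) <= B"
  by (intro exI[of _ "B * C"]) (simp add: norm_mult mult_mono' order_trans[OF norm_ge_zero])
 show "AE t in circ. (%n. f n (2 * cos t) * g n (2 * cos t)) ----> u (2 * cos t) * v (2 * cos t)"
  using assms unfolding bconv_def by (auto elim!: eventually_elim2 intro: tendsto_mult)
qed (use assms in "auto simp: bconv_def intro!: borel_measurable_add borel_measurable_times")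

lemma bfun_add: "bfun u ==> bfun v ==> bfun (%s. u s + v s)"
 using bconv_add[of "%_. u" u "%_. v" v] bconv_const by (auto simp: bconv_def bfun_def)

lemma bfun_mult: "bfun u ==> bfun v ==> bfun (%s. u s * v s)"
 using bconv_mult[of "%_. u" u "%_. v" v] bconv_const by (auto simp: bconv_def bfun_def)

lemma bfun_diff: "bfun u ==> bfun v ==> bfun (%s. u s - v s)"
 using bfun_add[of u "%s. -1 * v s"] bfun_mult[OF bfun_const[of "-1"], of v] by simp

lemma bconv_subseq: assumes f: "bconv f v" and r: "!!n. n <= r n" shows "bconv (%n. f (r n)) v"
proof -
 have "filterlim r sequentially sequentially" by (rule filterlim_at_top_mono[OF filterlim_ident]) (simp add: r)
 then show ?thesis using f unfolding bconv_def by (auto elim!: eventually_mono intro: filterlim_compose)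
qed

text \<open>A measurable function is almost everywhere a limit of continuous ones. Projection onto
  the disc of radius \<open>B\<close> bounds these without disturbing the limit, and Weierstrass'
  theorem replaces them by polynomials.\<close>

lemma bconv_poly: assumes v: "bfun v" shows "EX p. bconv (%n. polyf (p n)) v"
proof -
 obtain B where B: "!!s. abs s <= 2 ==> cmod (v s) <= B" using v unfolding bfun_def by blast
 then have B0: "0 <= B" using norm_ge_zero order_trans by (metis abs_zero zero_le_numeral)
 have "v : lmeas" using v by (simp add: bfun_def measurable_completion)
 then have "v measurable_on {-2..2}" by (intro lebesgue_measurable_imp_measurable_on) auto
 then obtain N g where N: "negligible N" "!!n. continuous_on UNIV (g n)"
  and g: "!!s. s ~: N ==> (%n. g n s) ----> (if s : {-2..2} then v s else 0)" unfolding measurable_on_def by (metis (full_types))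
 let ?c = "closest_point (cball 0 B)"
 have c: "continuous_on UNIV ?c" using B0 by (intro continuous_on_closest_point) auto
 have "ALL n. EX p. ALL s:{-2..2}. cmod (polyf p s - ?c (g n s)) <= inverse (Suc n)"
  by (intro allI polynomial_approximation continuous_on_compose2[OF c] continuous_on_subset[OF N(2)]) auto
 then obtain p where "!!n. ALL s:{-2..2}. cmod (polyf (p n) s - ?c (g n s)) <= inverse (Suc n)" by metis
 then have p: "abs s <= 2 ==> cmod (polyf (p n) s - ?c (g n s)) <= inverse (Suc n)" for n s by (auto simp: abs_le_iff)
 have cb: "cmod (?c z) <= B" for z using closest_point_in_set[of "cball 0 B" z] B0 by simp
 have "bconv (%n. polyf (p n)) v"
  unfolding bconv_def
 proof (intro conjI exI[of _ "B + 1"] allI impI)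
  show "cmod (polyf (p n) s) <= B + 1" if "abs s <= 2" for n s
   using p[OF that, of n] cb[of "g n s"] norm_triangle_sub[of "polyf (p n) s" "?c (g n s)"] le_imp_inverse_le[of 1 "Suc n"] by simp
  have "(%n. polyf (p n) s) ----> v s" if s: "abs s <= 2" "s ~: N" for s
  proof -
   have "(%n. g n s) ----> v s" using g[OF s(2)] s(1) by (simp add: abs_le_iff)
   then have "(%n. ?c (g n s)) ----> ?c (v s)" using c by (auto simp: continuous_on_eq_continuous_at intro: isCont_tendsto_compose)
   moreover have "?c (v s) = v s" using B[OF s(1)] by (intro closest_point_self) simp
   moreover have "(%n. polyf (p n) s - ?c (g n s)) ----> 0"
    by (rule Lim_null_comparison[OF _ LIMSEQ_inverse_real_of_nat]) (use p[OF s(1)] in auto)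
   ultimately show ?thesis using Lim_transform by fastforce
  qed
  then have "{t : {-pi..pi}. ~ (%n. polyf (p n) (2 * cos t)) ----> v (2 * cos t)} <= {t. 2 * cos t : N & -pi < t & t < pi & t ~= 0} Un {-pi, 0, pi}"
   using two_cos_mem by fastforce
  then have "negligible {t : {-pi..pi}. ~ (%n. polyf (p n) (2 * cos t)) ----> v (2 * cos t)}"
   by (rule negligible_subset[OF negligible_Un[OF two_cos_preimage_negligible[OF N(1)]], rotated]) simp
  then show "AE t in circ. (%n. polyf (p n) (2 * cos t)) ----> v (2 * cos t)"
   by (auto simp: AE_restrict_space_iff negligible_iff_null_sets intro!: AE_I')
 qed (use bfun_poly in "simp add: bfun_def")
 then show ?thesis by (rule exI[of _ p])
qed

context shift
begin

lemma floquet_measurable: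
 assumes yz: "floquet y z" and u: "u : borel_measurable borel"
 shows "(%t. (cmod (u (2 * cos t)))^2 * (norm (z t))^2) : borel_measurable circ"
proof -
 have "z : borel_measurable borel" by (rule borel_measurable_continuous_onI[OF floquet_continuous[OF yz]])
 with u have "(%t. (cmod (u (2 * cos t)))^2 * (norm (z t))^2) : borel_measurable borel" by measurable
 then show ?thesis by (simp add: measurable_completion measurable_restrict_space1)
qed

lemma floquet_bconv:
 assumes f: "bconv f (%_. 0)" and yz: "floquet y z"
 shows "(%n. LINT t|circ. (cmod (f n (2 * cos t)))^2 * (norm (z t))^2) ----> 0"
proof -
 obtain B where B: "!!n s. abs s <= 2 ==> cmod (f n s) <= B" using f unfolding bconv_def by blast
 have "(%n. LINT t|circ. (cmod (f n (2 * cos t)))^2 * (norm (z t))^2) ----> (LINT t|circ. 0)"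
 proof (rule integral_dominated_convergence[where w="%t. B^2 * (norm (z t))^2"])
  show "integrable circ (%t. B^2 * (norm (z t))^2)" by (intro circ_integrable continuous_intros floquet_continuous[OF yz])
  have "AE t in circ. (%n. f n (2 * cos t)) ----> 0" using f by (simp add: bconv_def)
  then show "AE t in circ. (%n. (cmod (f n (2 * cos t)))^2 * (norm (z t))^2) ----> 0"
  proof eventually_elim
   case (elim t)
   then show ?case by (auto intro!: tendsto_eq_intros)
  qed
  show "AE t in circ. norm ((cmod (f n (2 * cos t)))^2 * (norm (z t))^2) <= B^2 * (norm (z t))^2" for n
   using B[OF two_cos_mem, of n] by (intro AE_I2) (simp add: mult_right_mono power_mono)
 qed (use f in "auto simp: bconv_def intro: floquet_measurable[OF yz]")
 then show ?thesis by simp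
qed

lemma pop_norm_floquet: "floquet y z ==> (LINT t|circ. (cmod (polyf p (2 * cos t)))^2 * (norm (z t))^2) = 2 * pi * (norm (pop p y))^2"
 using floquet_norm[OF pop_floquet] by (simp add: norm_scaleC power_mult_distrib)

lemma dense_norm_le:
 fixes T :: "'h \<Rightarrow>\<^sub>L 'h"
 assumes B: "0 <= B" and y: "!!y z. floquet y z ==> norm (T y) <= B * norm y"
 shows "norm T <= B"
proof (rule norm_blinfun_bound[OF B])
 fix x
 have "EX y z. floquet y z & norm (x - y) < inverse (real (Suc n))" for n by (rule floquet_dense[of "inverse (real (Suc n))" x]) auto
 then obtain y where y': "!!n. EX z. floquet (y n) z" "!!n. norm (x - y n) < inverse (real (Suc n))" by metis
 have "(%n. x - y n) ----> 0" by (rule Lim_null_comparison[OF _ LIMSEQ_inverse_real_of_nat]) (intro always_eventually allI less_imp_le y'(2))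
 then have "(%n. x - (x - y n)) ----> x - 0" by (intro tendsto_intros)
 then have l: "y ----> x" by simp
 show "norm (T x) <= B * norm x"
  by (rule LIMSEQ_le[OF tendsto_norm[OF blinfun.tendsto[OF tendsto_const l]] tendsto_mult[OF tendsto_const tendsto_norm[OF l]]])
   (use y y'(1) in blast)
qed

lemma norm_le_of_floquet:
 assumes yz: "floquet y z" and B: "0 <= B" "!!s. abs s <= 2 ==> cmod (v s) <= B"
  and e: "(LINT t|circ. (cmod (v (2 * cos t)))^2 * (norm (z t))^2) = 2 * pi * (norm y')^2"
 shows "norm y' <= B * norm (y :: 'h)"
proof (rule power2_le_imp_le)
 have "2 * pi * (norm y')^2 <= (LINT t|circ. B^2 * (norm (z t))^2)"
  unfolding e[symmetric] by (rule integral_mono')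
   (use B(2)[OF two_cos_mem] in "auto intro!: circ_integrable continuous_intros floquet_continuous[OF yz] mult_right_mono power_mono")
 also have "... = 2 * pi * (B * norm y)^2" by (simp add: floquet_norm[OF yz] power_mult_distrib)
 finally show "(norm y')^2 <= (B * norm y)^2" by simp
qed (use B(1) in simp)

lemma pop_norm: assumes B: "0 <= B" "!!s. abs s <= 2 ==> cmod (polyf p s) <= B" shows "norm (pop p) <= B"
proof (rule dense_norm_le[OF B(1)])
 fix y z assume yz: "floquet y z"
 show "norm (pop p y) <= B * norm y"
 proof (rule norm_le_of_floquet[of y z B "polyf p"])
  show "(LINT t|circ. (cmod (polyf p (2 * cos t)))^2 * (norm (z t))^2) = 2 * pi * (norm (pop p y))^2" by (rule pop_norm_floquet[OF yz])
 qed (fact yz B)+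
qed

lemma pop_apply_norm: assumes B: "0 <= B" "!!s. abs s <= 2 ==> cmod (polyf p s) <= B" shows "norm (pop p x) <= B * norm x"
proof -
 have "norm (pop p) <= B" by (rule pop_norm) (fact B)+
 from order_trans[OF norm_blinfun mult_right_mono[OF this norm_ge_zero]] show ?thesis .
qed

lemma bconv_bound: assumes "bconv f v" shows "EX B>=0. ALL n s. abs s <= 2 --> cmod (f n s) <= B"
proof -
 obtain B where B: "ALL n s. abs s <= 2 --> cmod (f n s) <= B" using assms unfolding bconv_def by blast
 moreover have "0 <= B" using order_trans[OF norm_ge_zero, of "f 0 0" B] B by simp
 ultimately show ?thesis by blast
qed

lemma tendsto_0_of_square: assumes "(%n. 2 * pi * (norm (g n :: 'h))^2) ----> 0" shows "g ----> 0"
proof -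
 have "(%n. sqrt (2 * pi * (norm (g n))^2 / (2 * pi))) ----> sqrt (0 / (2 * pi))" by (intro tendsto_intros assms) simp
 then show ?thesis by (simp add: tendsto_norm_zero_iff)
qed

lemma pop_tendsto_0:
 assumes p: "bconv (%n. polyf (p n)) (%_. 0)" shows "(%n. pop (p n) x) ----> 0"
proof -
 obtain B where B: "0 <= B" "!!n s. abs s <= 2 ==> cmod (polyf (p n) s) <= B" using bconv_bound[OF p] by blast
 show ?thesis
 proof (rule dense_tendsto[of _ B])
  fix y z assume yz: "floquet y z"
  show "(%n. pop (p n) y) ----> 0"
   using floquet_bconv[OF p yz] unfolding pop_norm_floquet[OF yz] by (rule tendsto_0_of_square)
 qed (use pop_norm B in blast)
qed

lemma bconv_diff_0: assumes "bconv f v" "bconv g v" shows "bconv (%n s. f n s - g n s) (%_. 0)"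
 using bconv_add[OF assms(1) bconv_mult[OF bconv_const[OF bfun_const[of "-1"]] assms(2)]] by simp

text \<open>If the sequence were not Cauchy, differences along two subsequences would stay away from
  0, although the polynomials belonging to them converge boundedly to 0.\<close>

lemma pop_convergent:
 assumes p: "bconv (%n. polyf (p n)) v" shows "convergent (%n. pop (p n) x)"
proof (rule Cauchy_convergent, rule ccontr)
 assume "~ Cauchy (%n. pop (p n) x)"
 then obtain e where e: "0 < e" "ALL N. EX m>=N. EX n>=N. ~ norm (pop (p m) x - pop (p n) x) < e" unfolding Cauchy_iff by blast
 then obtain m n where mn: "!!N. N <= m N" "!!N. N <= n N" "!!N. ~ norm (pop (p (m N)) x - pop (p (n N)) x) < e" by metis
 have "bconv (%N. polyf (p (m N) - p (n N))) (%_. 0)" using bconv_diff_0[OF bconv_subseq[OF p mn(1)] bconv_subseq[OF p mn(2)]] by simp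
 from LIMSEQ_D[OF pop_tendsto_0[OF this] e(1)] show False using mn(3) by (auto simp: pop_diff)
qed

text \<open>The polynomial sequence is an arbitrary choice; by \<open>calc_limit\<close> the limit
  does not depend on it.\<close>

definition calc :: "(real => complex) => 'h \<Rightarrow>\<^sub>L 'h" where
 "calc v = Blinfun (%x. lim (%n. pop ((SOME p. bconv (%n. polyf (p n)) v) n) x))"

lemma calc_limit:
 assumes p: "bconv (%n. polyf (p n)) v" shows "(%n. pop (p n) x) ----> calc v x"
proof -
 define q where "q = (SOME p. bconv (%n. polyf (p n)) v)"
 have q: "bconv (%n. polyf (q n)) v" unfolding q_def by (rule someI[of "%p. bconv (%n. polyf (p n)) v"]) (rule p)
 obtain B where B: "0 <= B" "!!n s. abs s <= 2 ==> cmod (polyf (q n) s) <= B" using bconv_bound[OF q] by blast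
 let ?L = "%x. lim (%n. pop (q n) x)"
 have l: "(%n. pop (q n) x) ----> ?L x" for x using pop_convergent[OF q] by (simp add: convergent_LIMSEQ_iff)
 have "bounded_linear ?L"
 proof (rule bounded_linear_intro)
  fix x y :: 'h and r :: real
  show "?L (x + y) = ?L x + ?L y" using tendsto_add[OF l l] by (intro limI) (simp add: blinfun.add_right)
  show "?L (r *\<^sub>R x) = r *\<^sub>R ?L x" using tendsto_scaleR[OF tendsto_const l] by (intro limI) (simp add: blinfun.scaleR_right)
  have "norm (pop (q n) x) <= norm x * B" for n
   using pop_apply_norm[OF B] by (simp add: mult.commute)
  then show "norm (?L x) <= norm x * B" by (intro LIMSEQ_le_const2[OF tendsto_norm[OF l]]) auto
 qed
 then have "calc v x = ?L x" by (simp add: calc_def q_def[symmetric] bounded_linear_Blinfun_apply)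
 moreover have "(%n. pop (p n - q n) x) ----> 0" using bconv_diff_0[OF p q] by (intro pop_tendsto_0) simp
 ultimately show ?thesis using tendsto_add[OF `(%n. pop (p n - q n) x) ----> 0` l[of x]] by (simp add: pop_diff)
qed

lemma calc_eqI: "bconv (%n. polyf (p n)) v ==> (%n. pop (p n) x) ----> y ==> calc v x = y"
 using LIMSEQ_unique calc_limit by blast

lemma calc_poly: "calc (polyf p) x = pop p x"
 by (rule calc_eqI[OF bconv_const[OF bfun_poly]]) simp

lemma calc_add: assumes "bfun u" "bfun v" shows "calc (%s. u s + v s) x = calc u x + calc v x"
proof -
 obtain p q where p: "bconv (%n. polyf (p n)) u" and q: "bconv (%n. polyf (q n)) v" using assms bconv_poly by metis
 show ?thesis by (rule calc_eqI[of "%n. p n + q n"]) (use bconv_add[OF p q] tendsto_add[OF calc_limit[OF p] calc_limit[OF q]] in "simp_all add: pop_add")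
qed

text \<open>Parseval's identity for polynomials passes to the limit by dominated convergence; it
  bounds the operator on the dense set of finite sums and hence everywhere.\<close>

lemma calc_norm: assumes B: "0 <= B" "!!s. abs s <= 2 ==> cmod (v s) <= B" and v: "v : borel_measurable borel"
 shows "norm (calc v) <= B"
  and "floquet y z ==> (LINT t|circ. (cmod (v (2 * cos t)))^2 * (norm (z t))^2) = 2 * pi * (norm (calc v y))^2"
proof -
 have bv: "bfun v" by (rule bfunI[OF v B(2)])
 obtain p where p: "bconv (%n. polyf (p n)) v" using bconv_poly[OF bv] by blast
 show e: "(LINT t|circ. (cmod (v (2 * cos t)))^2 * (norm (z t))^2) = 2 * pi * (norm (calc v y))^2" if yz: "floquet y z" for y z
 proof (rule LIMSEQ_unique)
  show "(%n. LINT t|circ. (cmod (polyf (p n) (2 * cos t)))^2 * (norm (z t))^2) ----> 2 * pi * (norm (calc v y))^2"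
   unfolding pop_norm_floquet[OF yz] by (intro tendsto_intros calc_limit[OF p])
  obtain C where C: "0 <= C" "!!n s. abs s <= 2 ==> cmod (polyf (p n) s) <= C" using bconv_bound[OF p] by blast
  show "(%n. LINT t|circ. (cmod (polyf (p n) (2 * cos t)))^2 * (norm (z t))^2) ----> (LINT t|circ. (cmod (v (2 * cos t)))^2 * (norm (z t))^2)"
  proof (rule integral_dominated_convergence[where w="%t. C^2 * (norm (z t))^2"])
   show "integrable circ (%t. C^2 * (norm (z t))^2)" by (intro circ_integrable continuous_intros floquet_continuous[OF yz])
   have "AE t in circ. (%n. polyf (p n) (2 * cos t)) ----> v (2 * cos t)" using p by (simp add: bconv_def)
   then show "AE t in circ. (%n. (cmod (polyf (p n) (2 * cos t)))^2 * (norm (z t))^2) ----> (cmod (v (2 * cos t)))^2 * (norm (z t))^2"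
    by eventually_elim (rule tendsto_mult[OF tendsto_power[OF tendsto_norm] tendsto_const])
   show "AE t in circ. norm ((cmod (polyf (p n) (2 * cos t)))^2 * (norm (z t))^2) <= C^2 * (norm (z t))^2" for n
    using C(2)[OF two_cos_mem, of n] by (intro AE_I2) (simp add: mult_right_mono power_mono)
  qed (rule floquet_measurable[OF yz v], rule floquet_measurable[OF yz], use bfun_poly in "simp add: bfun_def")
 qed
 show "norm (calc v) <= B" by (rule dense_norm_le[OF B(1) norm_le_of_floquet[OF _ B e]])
qed

lemma calc_apply_norm: "0 <= B ==> (!!s. abs s <= 2 ==> cmod (v s) <= B) ==> v : borel_measurable borel ==> norm (calc v x) <= B * norm x"
 using order_trans[OF norm_blinfun mult_right_mono[OF calc_norm(1) norm_ge_zero]] .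

lemma calc_mult: assumes "bfun u" "bfun v" shows "calc (%s. u s * v s) x = calc u (calc v x)"
proof -
 obtain p q where p: "bconv (%n. polyf (p n)) u" and q: "bconv (%n. polyf (q n)) v" using assms bconv_poly by metis
 obtain B where B: "0 <= B" "!!n s. abs s <= 2 ==> cmod (polyf (p n) s) <= B" using bconv_bound[OF p] by blast
 have "(%n. pop (p n) (pop (q n) x - calc v x)) ----> 0"
 proof (rule Lim_null_comparison[rotated])
  show "(%n. B * norm (pop (q n) x - calc v x)) ----> 0" by (rule tendsto_eq_rhs[OF tendsto_mult[OF tendsto_const tendsto_norm[OF tendsto_diff[OF calc_limit[OF q] tendsto_const]]]]) simp
 qed (intro always_eventually allI pop_apply_norm[OF B])
 from tendsto_add[OF this calc_limit[OF p, of "calc v x"]]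
 have "(%n. pop (p n * q n) x) ----> calc u (calc v x)" by (simp only: pop_mult blinfun.diff_right diff_add_cancel add_0_left)
 then show ?thesis by (rule calc_eqI[rotated]) (use bconv_mult[OF p q] in simp)
qed

lemma calc_commute:
 fixes T :: "'h \<Rightarrow>\<^sub>L 'h"
 assumes "!!x. T (S x) = S (T x)" "clin T" "bfun v" shows "T (calc v x) = calc v (T x)"
proof -
 obtain p where p: "bconv (%n. polyf (p n)) v" using bconv_poly[OF assms(3)] by blast
 have "(%n. T (pop (p n) x)) ----> T (calc v x)" by (intro blinfun.tendsto tendsto_const calc_limit[OF p])
 then show ?thesis unfolding pop_commute[OF assms(1,2)] by (rule calc_eqI[OF p, symmetric])
qed

lemma calc_scale: "bfun v ==> calc v (c *\<^sub>C x) = c *\<^sub>C calc v x"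
 using calc_commute[of "c *\<^sub>C id_blinfun" v x] by (simp add: S_scale clin_def scaleC_scaleC mult.commute)

lemma clin_calc: "bfun v ==> clin (calc v)" by (simp add: clin_def calc_scale)

lemma calc_S_commute: "bfun v ==> calc v (S x) = S (calc v x)"
 using calc_commute[of S v x] by (simp add: clin_def S_scale)

lemma calc_const: "calc (%_. c) x = c *\<^sub>C x"
 using calc_poly[of "[:c:]" x] by (simp add: pop_pCons blinfun.zero_right)

lemma calc_cmult: "bfun v ==> calc (%s. c * v s) x = c *\<^sub>C calc v x"
 using calc_mult[OF bfun_const, of v c x] by (simp add: calc_const)

lemma calc_diff: "bfun u ==> bfun v ==> calc (%s. u s - v s) x = calc u x - calc v x"
 using calc_add[of u "%s. -1 * v s" x] calc_cmult[of v "-1" x] bfun_mult[OF bfun_const[of "-1"], of v] by simp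

lemma calc_S: "calc cor x = S x"
 using calc_poly[of "[:0, 1:]" x] by (simp add: pop_pCons blinfun.zero_right)

lemma calc_cong: assumes "bfun u" "bfun v" "!!s. abs s <= 2 ==> u s = v s" shows "calc u x = calc v x"
proof -
 have "norm (calc (%s. u s - v s) x) <= 0 * norm x" by (rule calc_apply_norm) (use assms bfun_diff[of u v] in "auto simp: bfun_def")
 then show ?thesis using calc_diff[OF assms(1,2)] by simp
qed

text \<open>The source of the strong sigma-additivity in (S2).\<close>

lemma calc_tendsto: assumes "!!n. bfun (f n)" "bfun v" "bconv f v" shows "(%n. calc (f n) x) ----> calc v x"
proof -
 let ?g = "%n s. f n s - v s"
 have g: "bconv ?g (%_. 0)" by (rule bconv_diff_0[OF assms(3) bconv_const[OF assms(2)]])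
 obtain B where B: "0 <= B" "!!n s. abs s <= 2 ==> cmod (?g n s) <= B" using bconv_bound[OF g] by blast
 have m: "?g n : borel_measurable borel" for n using g by (simp add: bconv_def)
 have "(%n. calc (?g n) x) ----> 0"
 proof (rule dense_tendsto[of _ B])
  show "norm (calc (?g n)) <= B" for n by (rule calc_norm(1)[OF B m])
  fix y z assume yz: "floquet y z"
  show "(%n. calc (?g n) y) ----> 0"
   by (rule tendsto_0_of_square) (use floquet_bconv[OF g yz] calc_norm(2)[OF B m yz] in simp)
 qed
 from tendsto_add[OF this tendsto_const[of "calc v x"]] show ?thesis using assms by (simp add: calc_diff)
qed

lemma calc_adjoint: assumes v: "bfun v" shows "inner (calc v x) y = inner x (calc (%s. cnj (v s)) y)"
proof -
 obtain p where p: "bconv (%n. polyf (p n)) v" using bconv_poly[OF v] by blast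
 have "(%n. pop (map_poly cnj (p n)) y) ----> calc (%s. cnj (v s)) y"
  by (rule calc_limit) (use p bfun_poly in "auto simp: bconv_def bfun_def lim_cnj simp del: poly_map_poly_cnj", auto simp: lim_cnj)
 from LIMSEQ_unique[OF tendsto_inner[OF calc_limit[OF p] tendsto_const] tendsto_inner[OF tendsto_const this, of x, folded pop_adjoint]]
 show ?thesis .
qed

text \<open>\<open>p\<close> is 1 - ((t - s) / 4)^2, which is 1 at t = s and of modulus below 1
  elsewhere in [-2, 2]. Its powers leave an eigenvector fixed, but they converge boundedly to 0
  almost everywhere, since the set 2 cos t = s is null.\<close>

lemma S_injective: assumes "S x = cor s *\<^sub>C x" "abs s <= 2" shows "x = 0"
proof -
 define p where "p = [:1 - (cor s / 4)^2, cor s / 8, - 1 / 16:]"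
 have p: "polyf p t = cor (1 - ((t - s) / 4)^2)" for t
  by (simp add: p_def power2_eq_square field_simps)
 have "pop p x = ((1 - (cor s / 4)^2) + cor s * (cor s / 8 + cor s * (- 1 / 16))) *\<^sub>C x"
  unfolding p_def by (simp only: pop_pCons pop_0 blinfun.zero_left blinfun.zero_right add_0_right blinfun.add_right S_scale assms(1) scaleC_add_left scaleC_scaleC distrib_left mult.assoc mult.commute mult.left_commute)
 then have "pop p x = x" by (simp add: power2_eq_square field_simps)
 then have e: "pop (p ^ n) x = x" for n by (induction n) (simp_all add: pop_mult one_pCons pop_pCons blinfun.zero_right)
 have "(%n. pop (p ^ n) x) ----> 0"
 proof (rule pop_tendsto_0)
  have b: "abs(1 - ((t - s) / 4)^2) <= 1" "t ~= s ==> abs(1 - ((t - s) / 4)^2) < 1" if "abs t <= 2" for t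
  proof -
   have "abs((t - s) / 4) <= 1" using that assms(2) by simp
   then have "((t - s) / 4)^2 <= 1" by (simp only: abs_square_le_1)
   then show "abs(1 - ((t - s) / 4)^2) <= 1" "t ~= s ==> abs(1 - ((t - s) / 4)^2) < 1" using zero_less_power2[of "(t - s) / 4"] by auto
  qed
  have "{t : {-pi..pi}. ~ (%n. polyf (p ^ n) (2 * cos t)) ----> 0} <= {t. 2 * cos t : {s} & -pi < t & t < pi & t ~= 0} Un {-pi, 0, pi}"
   using b(2)[OF two_cos_mem] by (auto simp: poly_power p norm_power simp del: of_real_diff of_real_mult intro!: LIMSEQ_power_zero) blast
  then have "negligible {t : {-pi..pi}. ~ (%n. polyf (p ^ n) (2 * cos t)) ----> 0}"
   by (rule negligible_subset[OF negligible_Un[OF two_cos_preimage_negligible], rotated 2]) simp_all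
  then have "AE t in circ. (%n. polyf (p ^ n) (2 * cos t)) ----> 0"
   by (auto simp: AE_restrict_space_iff negligible_iff_null_sets intro!: AE_I')
  moreover have "ALL n t. abs t <= 2 --> cmod (polyf (p ^ n) t) <= 1"
   using b(1) by (auto simp: poly_power p norm_power simp del: of_real_diff intro!: power_le_one)
  ultimately show "bconv (%n. polyf (p ^ n)) (%_. 0)" using bfun_poly unfolding bconv_def bfun_def by blast
 qed
 then show ?thesis using e by (simp add: LIMSEQ_const_iff)
qed

end

section \<open>Spectral projections of the shift and integrals of operator functions\<close>

context shift
begin

text \<open>By \<open>cm_apply_calc\<close> these operators commute with the whole calculus of
  \<open>S\<close>, so they act on each spectral subspace separately. All integrands have values in
  this class.\<close>

definition cm :: "('h \<Rightarrow>\<^sub>L 'h) => bool" where "cm T \<longleftrightarrow> clin T & (ALL x. T (S x) = S (T x))"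

definition pr :: "real set => 'h \<Rightarrow>\<^sub>L 'h" where "pr B = calc (indicator B)"

lemma cm_calc: "bfun v ==> cm (calc v)" by (simp add: cm_def clin_calc calc_S_commute)

lemma cm_pr: "B : sets borel ==> cm (pr B)" by (simp add: pr_def cm_calc bfun_indicator)

lemma cm_apply_calc: "cm T ==> bfun v ==> T (calc v x) = calc v (T x)" by (simp add: cm_def calc_commute)

lemma cm_apply_pr: "cm T ==> B : sets borel ==> T (pr B x) = pr B (T x)" by (simp add: pr_def cm_apply_calc bfun_indicator)

lemma cm_intros: "cm T ==> cm U ==> cm (T + U)" "cm T ==> cm U ==> cm (T - U)" "cm T ==> cm (c *\<^sub>C T)" "cm T ==> cm U ==> cm (T o\<^sub>L U)" "cm id_blinfun" "cm S" "cm 0"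
 by (simp_all add: cm_def clin_def blinfun.add_left blinfun.diff_left blinfun.add_right blinfun.diff_right scaleC_algebra S_scale mult.commute)

lemma cm_scale: "cm T ==> T (c *\<^sub>C x) = c *\<^sub>C T x" by (simp add: cm_def clin_def)

lemma cm_limit: assumes l: "f ----> T" and f: "!!n. cm (f n)" shows "cm T"
proof -
 have a: "(%n. f n x) ----> T x" for x by (intro blinfun.tendsto l tendsto_const)
 have "T (c *\<^sub>C x) = c *\<^sub>C T x" for c x
  by (rule LIMSEQ_unique[OF a]) (use f sc.tendsto[OF tendsto_const a] in "simp add: cm_scale")
 moreover have "T (S x) = S (T x)" for x
  by (rule LIMSEQ_unique[OF a]) (use f blinfun.tendsto[OF tendsto_const a] in "simp add: cm_def")
 ultimately show ?thesis by (simp add: cm_def clin_def)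
qed

lemma pr_pr: "A : sets borel ==> B : sets borel ==> pr A (pr B x) = pr (A Int B) x"
 unfolding pr_def using calc_mult[OF bfun_indicator bfun_indicator, of A B x] by (simp add: indicator_inter_arith[abs_def])

lemma pr_empty [simp]: "pr {} x = 0"
proof -
 have "(indicator {} :: real => complex) = (%_. 0)" by (simp add: fun_eq_iff)
 then show ?thesis using calc_const[of 0 x] by (simp add: pr_def)
qed

lemma pr_Un: "A : sets borel ==> B : sets borel ==> A Int B = {} ==> pr (A Un B) x = pr A x + pr B x"
 unfolding pr_def using calc_add[OF bfun_indicator bfun_indicator, of A B x] by (simp add: indicator_add)

lemma pr_sum: "finite J ==> (!!j. j : J ==> B j : sets borel) ==> disjoint_family_on B J ==> (\<Sum>j\<in>J. pr (B j) x) = pr (\<Union>j\<in>J. B j) x"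
proof (induction J rule: finite_induct)
 case (insert i J)
 have "B i Int (\<Union>j\<in>J. B j) = {}" using insert(2,5) by (fastforce simp: disjoint_family_on_def)
 moreover have "(\<Union>j\<in>J. B j) : sets borel" using insert by auto
 ultimately show ?case using insert pr_Un[of "B i" "\<Union>j\<in>J. B j" x] by (auto simp: disjoint_family_on_def)
qed simp

lemma pr_orthogonal: "A : sets borel ==> B : sets borel ==> A Int B = {} ==> inner (pr A x) (pr B y) = 0"
proof -
 assume *: "A : sets borel" "B : sets borel" "A Int B = {}"
 have "(%s. cnj (indicator A s)) = indicator A" by (auto simp: indicator_def)
 then have "inner (pr A x) (pr B y) = inner x (pr A (pr B y))"
  unfolding pr_def[of A] by (simp add: calc_adjoint[OF bfun_indicator[OF *(1)]])
 then show ?thesis using * by (simp add: pr_pr)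
qed

lemma pr_norm: "B : sets borel ==> norm (pr B) <= 1"
 unfolding pr_def by (rule calc_norm) (auto simp: indicator_def)

lemma pr_apply_norm: "B : sets borel ==> norm (pr B x) <= norm x"
 using order_trans[OF norm_blinfun mult_right_mono[OF pr_norm norm_ge_zero]] by simp

lemma pr_pythagoras:
 assumes "finite J" "!!j. j : J ==> B j : sets borel" "disjoint_family_on B J"
 shows "(norm (\<Sum>j\<in>J. pr (B j) (z j)))^2 = (\<Sum>j\<in>J. (norm (pr (B j) (z j)))^2)"
 by (rule norm_sum_Pythagorean[OF assms(1)])
  (use assms in "auto simp: pairwise_def orthogonal_def disjoint_family_on_def intro!: pr_orthogonal")

text \<open>The ranges of the spectral projections of disjoint sets are orthogonal and invariant under the \<open>V j\<close>, so the bounds of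
  the \<open>V j\<close> do not add up.\<close>

lemma block_bound:
 assumes J: "finite J" "!!j. j : J ==> B j : sets borel" "disjoint_family_on B J" and V: "!!j. j : J ==> cm (V j)"
  and C: "0 <= C" "!!j. j : J ==> norm (V j (pr (B j) x)) <= C * norm (pr (B j) x)"
 shows "norm (\<Sum>j\<in>J. V j (pr (B j) x)) <= C * norm x"
proof (rule power2_le_imp_le)
 note P = pr_pythagoras[OF J]
 have "(norm (\<Sum>j\<in>J. V j (pr (B j) x)))^2 = (\<Sum>j\<in>J. (norm (V j (pr (B j) x)))^2)"
  using P[of "%j. V j x"] J(2) V by (simp add: cm_apply_pr)
 also have "... <= (\<Sum>j\<in>J. (C * norm (pr (B j) x))^2)" by (intro sum_mono power_mono C) auto
 also have "... = C^2 * (norm (pr (\<Union>j\<in>J. B j) x))^2"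
  using P[of "%_. x"] by (simp add: pr_sum[OF J] power_mult_distrib sum_distrib_left[symmetric])
 also have "... <= (C * norm x)^2" unfolding power_mult_distrib
  by (intro mult_left_mono power_mono pr_apply_norm sets.finite_UN J) auto
 finally show "(norm (\<Sum>j\<in>J. V j (pr (B j) x)))^2 <= (C * norm x)^2" .
qed (use C in simp)

text \<open>The quantitative substitute for a fiber: on the spectral subspace of a small set,
  \<open>S\<close> is nearly the scalar \<open>t\<close>.\<close>

lemma fiber_small:
 assumes B: "B : sets borel" and e: "0 <= e" "!!s. s : B ==> abs(s - t) <= e"
 shows "norm (S (pr B x) - cor t *\<^sub>C pr B x) <= e * norm (pr B x)"
proof -
 let ?v = "%s. (cor s - cor t) * indicator B s"
 have b: "bfun cor" "bfun (%s. cor s - cor t)" by (intro bfun_continuous continuous_intros)+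
 have v: "bfun ?v" by (rule bfun_mult[OF b(2) bfun_indicator[OF B]])
 have "S (pr B x) - cor t *\<^sub>C pr B x = calc (%s. cor s - cor t) (pr B (pr B x))"
  by (simp add: calc_diff[OF b(1) bfun_const] calc_S calc_const pr_pr B)
 also have "... = calc ?v (pr B x)" unfolding pr_def[of B] by (simp add: calc_mult[OF b(2) bfun_indicator[OF B]])
 also have "norm ... <= e * norm (pr B x)"
  using v e by (intro calc_apply_norm) (auto simp: bfun_def indicator_def simp flip: of_real_diff)
 finally show ?thesis .
qed

lemma calc_sum: assumes "!!i. i : I ==> bfun (f i)" shows "bfun (%s. \<Sum>i\<in>I. f i s)" "calc (%s. \<Sum>i\<in>I. f i s) x = (\<Sum>i\<in>I. calc (f i) x)"
proof -
 have "bfun (%s. \<Sum>i\<in>I. f i s) & calc (%s. \<Sum>i\<in>I. f i s) x = (\<Sum>i\<in>I. calc (f i) x)"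
  using assms by (induction I rule: infinite_finite_induct) (auto simp: bfun_const calc_const calc_add intro: bfun_add)
 then show "bfun (%s. \<Sum>i\<in>I. f i s)" "calc (%s. \<Sum>i\<in>I. f i s) x = (\<Sum>i\<in>I. calc (f i) x)" by auto
qed

text \<open>A simple Borel map of \<open>K\<close> into itself selects the tags of a Riemann sum.\<close>

definition smp :: "real set => (real => real) => bool" where
 "smp K sg \<longleftrightarrow> finite (sg ` K) & sg ` K <= K & (ALL t. {s:K. sg s = t} : sets borel)"

lemma smpD: assumes "smp K sg" shows "finite (sg ` K)" "s : K ==> sg s : K" "{s:K. sg s = t} : sets borel"
 using assms unfolding smp_def by blast+

definition rsum :: "real set => (real => 'h \<Rightarrow>\<^sub>L 'h) => (real => real) => 'h \<Rightarrow>\<^sub>L 'h" where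
 "rsum K F sg = (\<Sum>t\<in>sg ` K. F t o\<^sub>L pr {s:K. sg s = t})"

lemma blinfun_sum: "blinfun_apply (\<Sum>i\<in>I. f i) x = (\<Sum>i\<in>I. f i x)"
 by (induction I rule: infinite_finite_induct) (auto simp: blinfun.add_left blinfun.zero_left)

lemma rsum_apply: "rsum K F sg x = (\<Sum>t\<in>sg ` K. F t (pr {s:K. sg s = t} x))"
 by (simp add: rsum_def blinfun_sum)

lemma rsum_pr: "smp K sg ==> K : sets borel ==> rsum K F sg (pr K x) = rsum K F sg x"
 by (auto simp: rsum_apply pr_pr smpD intro!: sum.cong arg_cong2[where f=blinfun_apply] arg_cong[where f=pr])

lemma rsum_refine:
 assumes sg: "smp K sg" and ta: "smp K' ta" and B: "B : sets borel" "B <= K" "B <= K'"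
 shows "rsum K F sg (pr B x) = (\<Sum>t\<in>sg ` K. \<Sum>u\<in>ta ` K'. F t (pr {s:B. sg s = t & ta s = u} x))"
proof -
 have "pr {s:K. sg s = t} (pr B x) = (\<Sum>u\<in>ta ` K'. pr {s:B. sg s = t & ta s = u} x)" for t
 proof -
  have e: "{s:B. sg s = t & ta s = u} = {s:K. sg s = t} Int B Int {s:K'. ta s = u}" for u using B by auto
  have "(\<Sum>u\<in>ta ` K'. pr {s:B. sg s = t & ta s = u} x) = pr (\<Union>u\<in>ta ` K'. {s:B. sg s = t & ta s = u}) x"
   by (rule pr_sum) (use smpD[OF sg] smpD[OF ta] B(1) in "auto simp: e disjoint_family_on_def")
  also have "(\<Union>u\<in>ta ` K'. {s:B. sg s = t & ta s = u}) = {s:K. sg s = t} Int B" using B by auto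
  finally show ?thesis using smpD(3)[OF sg] B(1) by (simp add: pr_pr)
 qed
 then show ?thesis by (simp add: rsum_apply blinfun.sum_right)
qed

text \<open>On the common refinement of two tagged partitions the difference of the sums is an
  operator F t - G u on each cell, and by \<open>block_bound\<close> the largest of these norms
  bounds the total.\<close>

lemma rsum_compare_restrict:
 assumes sg: "smp K sg" and ta: "smp K' ta" and cm: "!!s. s : K ==> cm (F s)" "!!s. s : K' ==> cm (G s)"
  and B: "B : sets borel" "B <= K" "B <= K'"
  and e: "0 <= e" "!!s. s : B ==> norm (F (sg s) - G (ta s)) <= e"
 shows "norm (rsum K F sg (pr B x) - rsum K' G ta (pr B x)) <= e * norm x"
proof -
 let ?B = "%(t, u). {s:B. sg s = t & ta s = u}"
 let ?V = "%(t, u). F t - G u"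
 have "rsum K' G ta (pr B x) = (\<Sum>t\<in>sg ` K. \<Sum>u\<in>ta ` K'. G u (pr {s:B. sg s = t & ta s = u} x))"
  unfolding rsum_refine[OF ta sg B(1,3,2)] by (subst sum.swap) (simp add: conj_commute)
 then have eq: "rsum K F sg (pr B x) - rsum K' G ta (pr B x) = (\<Sum>j\<in>sg ` K \<times> ta ` K'. ?V j (pr (?B j) x))"
  unfolding rsum_refine[OF sg ta B] by (simp add: sum_subtractf[symmetric] sum.cartesian_product case_prod_beta blinfun.diff_left)
 show ?thesis
  unfolding eq
 proof (rule block_bound[OF _ _ _ _ e(1)])
  fix j assume j: "j : sg ` K \<times> ta ` K'"
  have "?B j = B Int {s:K. sg s = fst j} Int {s:K'. ta s = snd j}" using B by (auto split: prod.splits)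
  then show "?B j : sets borel" using smpD(3)[OF sg] smpD(3)[OF ta] B(1) by simp
  obtain t u where "j = (t, u)" "t : K" "u : K'" using j smpD(2)[OF sg] smpD(2)[OF ta] by blast
  then show "cm (?V j)" using cm by (simp add: cm_intros(2))
  show "norm (?V j (pr (?B j) x)) <= e * norm (pr (?B j) x)"
  proof (cases "?B j = {}")
   case False
   then obtain s where "s : B" "j = (sg s, ta s)" by (cases j) auto
   then have "norm (?V j) <= e" using e(2) by simp
   from order_trans[OF norm_blinfun mult_right_mono[OF this norm_ge_zero]] show ?thesis .
  qed (simp add: blinfun.zero_right)
 qed (use smpD(1)[OF sg] smpD(1)[OF ta] in "auto simp: disjoint_family_on_def")
qed

lemma rsum_compare:
 assumes "smp K sg" "smp K ta" "!!s. s : K ==> cm (F s)" "!!s. s : K ==> cm (G s)" "K : sets borel"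
  and e: "0 <= e" "!!s. s : K ==> norm (F (sg s) - G (ta s)) <= e"
 shows "norm (rsum K F sg - rsum K G ta) <= e"
proof (rule norm_blinfun_bound[OF e(1)])
 fix x
 show "norm ((rsum K F sg - rsum K G ta) x) <= e * norm x"
  using rsum_compare_restrict[of K sg K ta F G K e x] rsum_pr[of K _ _ x] assms by (simp add: blinfun.diff_left)
qed

lemma rsum_linear: "rsum K (%s. F s + G s) sg = rsum K F sg + rsum K G sg" "rsum K (%s. c *\<^sub>C F s) sg = c *\<^sub>C rsum K F sg" "rsum K (%s. V o\<^sub>L F s) sg = V o\<^sub>L rsum K F sg"
 by (rule blinfun_eqI, simp add: rsum_apply blinfun.add_left sum.distrib complex_vector.scale_sum_right blinfun.sum_right)+

lemma cm_rsum: "smp K sg ==> (!!s. s : K ==> cm (F s)) ==> cm (rsum K F sg)"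
proof -
 assume *: "smp K sg" "!!s. s : K ==> cm (F s)"
 have "cm (sum f I)" if "!!i. i : I ==> cm (f i)" for f and I :: "real set"
  using that by (induction I rule: infinite_finite_induct) (auto intro: cm_intros)
 then show ?thesis using * unfolding rsum_def smp_def by (metis (no_types, lifting) cm_intros(4) cm_pr subsetD)
qed

text \<open>The values of \<open>G\<close> commute with the projections, so terms from two different
  cells cancel.\<close>

lemma rsum_mult:
 assumes sg: "smp K sg" and F: "!!s. s : K ==> cm (F s)" and G: "!!s. s : K ==> cm (G s)"
 shows "rsum K F sg o\<^sub>L rsum K G sg = rsum K (%s. F s o\<^sub>L G s) sg"
proof (rule blinfun_eqI)
 fix x
 let ?B = "%t. {s:K. sg s = t}"
 have B: "?B t : sets borel" for t using sg by (simp add: smp_def)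
 have "pr (?B t) (rsum K G sg x) = G t (pr (?B t) x)" if t: "t : sg ` K" for t
 proof -
  have "pr (?B t) (rsum K G sg x) = (\<Sum>u\<in>sg ` K. if u = t then G t (pr (?B t) x) else 0)"
   unfolding rsum_apply blinfun.sum_right
  proof (rule sum.cong)
   fix u assume "u : sg ` K"
   then have "cm (G u)" using sg G by (auto simp: smp_def)
   then have "pr (?B t) (G u (pr (?B u) x)) = G u (pr (?B t Int ?B u) x)" by (simp add: cm_apply_pr[symmetric] B pr_pr)
   moreover have "?B t Int ?B u = (if u = t then ?B t else {})" by auto
   ultimately show "pr (?B t) (G u (pr (?B u) x)) = (if u = t then G t (pr (?B t) x) else 0)" by (simp add: blinfun.zero_right)
  qed simp
  then show ?thesis using t sg by (simp add: smp_def sum.delta)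
 qed
 then show "(rsum K F sg o\<^sub>L rsum K G sg) x = rsum K (%s. F s o\<^sub>L G s) sg x" by (simp add: rsum_apply[of K F] rsum_apply[of K "%s. F s o\<^sub>L G s"])
qed

text \<open>All points of \<open>K\<close> in a cell [m / (n + 1), (m + 1) / (n + 1)) get the same
  tag, which is chosen in \<open>K\<close> because the integrand is only considered there.\<close>

definition tag :: "real set => nat => real => real" where
 "tag K n s = (SOME t. t : K & \<lfloor>real (Suc n) * t\<rfloor> = \<lfloor>real (Suc n) * s\<rfloor>)"

lemma tag: assumes s: "s : K" shows "tag K n s : K" "abs(tag K n s - s) < 1 / real (Suc n)"
proof -
 have *: "tag K n s : K & \<lfloor>real (Suc n) * tag K n s\<rfloor> = \<lfloor>real (Suc n) * s\<rfloor>" unfolding tag_def by (rule someI[of _ s]) (simp add: s)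
 then show "tag K n s : K" by simp
 have "abs(real (Suc n) * tag K n s - real (Suc n) * s) < 1" using * by linarith
 then have "real (Suc n) * abs(tag K n s - s) < 1" unfolding right_diff_distrib[symmetric] abs_mult by simp
 then show "abs(tag K n s - s) < 1 / real (Suc n)" by (simp add: pos_less_divide_eq mult.commute del: of_nat_Suc)
qed

lemma smp_tag: assumes K: "bounded K" "K : sets borel" shows "smp K (tag K n)"
proof -
 define h where "h m = (SOME t. t : K & \<lfloor>real (Suc n) * t\<rfloor> = m)" for m
 have h: "tag K n s = h \<lfloor>real (Suc n) * s\<rfloor>" for s by (simp add: h_def tag_def)
 obtain B where B: "!!s. s : K ==> abs s <= B" using K(1) by (auto simp: bounded_iff)
 have "\<lfloor>real (Suc n) * s\<rfloor> : {- \<lceil>real (Suc n) * B\<rceil> - 1..\<lceil>real (Suc n) * B\<rceil>}" if "s : K" for s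
 proof -
  have "abs(real (Suc n) * s) <= real (Suc n) * B" unfolding abs_mult using B[OF that] by (intro mult_mono) auto
  then show ?thesis unfolding atLeastAtMost_iff by linarith
 qed
 then have "finite ((%s. \<lfloor>real (Suc n) * s\<rfloor>) ` K)" by (intro finite_subset[OF _ finite_atLeastAtMost_int]) blast
 then have "finite (tag K n ` K)" unfolding h using finite_imageI by (metis (mono_tags, lifting) image_cong image_image)
 moreover have "{s:K. tag K n s = t} : sets borel" for t
 proof -
  have "(%s. h \<lfloor>real (Suc n) * s\<rfloor> = t) : measurable borel (count_space UNIV)"
   by (intro measurable_compose[where g="%m. h m = t", OF _ measurable_count_space]) measurable
  then have "{s : space borel. h \<lfloor>real (Suc n) * s\<rfloor> = t} : sets borel" by measurable
  moreover have "{s:K. tag K n s = t} = K Int {s : space borel. h \<lfloor>real (Suc n) * s\<rfloor> = t}" by (auto simp: h)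
  ultimately show ?thesis using K(2) by simp
 qed
 moreover have "tag K n ` K <= K" using tag(1) by blast
 ultimately show ?thesis by (simp add: smp_def)
qed

text \<open>The number of cells enters in \<open>P_CC\<close>, where orthogonality alone does not
  control the sum over the cells.\<close>

lemma card_tag: assumes K: "K <= {-2..2}" shows "card (tag K n ` K) <= 4 * Suc n + 1"
proof -
 let ?f = "%s. \<lfloor>real (Suc n) * s\<rfloor>"
 have "?f ` K <= {- int (2 * Suc n)..int (2 * Suc n)}"
 proof (intro image_subsetI)
  fix s assume "s : K"
  then have "-2 <= s" "s <= 2" using K by auto
  then have "real (Suc n) * -2 <= real (Suc n) * s" "real (Suc n) * s <= real (Suc n) * 2" by (intro mult_left_mono; simp)+
  then show "?f s : {- int (2 * Suc n)..int (2 * Suc n)}" by (simp add: le_floor_iff floor_le_iff)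
 qed
 then have f: "finite (?f ` K)" "card (?f ` K) <= card {- int (2 * Suc n)..int (2 * Suc n)}" by (blast intro: finite_subset card_mono)+
 have "tag K n ` K = (%m. SOME t. t : K & \<lfloor>real (Suc n) * t\<rfloor> = m) ` ?f ` K" by (simp add: tag_def image_image)
 then show ?thesis using card_image_le[OF f(1), of "%m. SOME t. t : K & \<lfloor>real (Suc n) * t\<rfloor> = m"] f(2) by simp
qed

definition opfun :: "real set => (real => 'h \<Rightarrow>\<^sub>L 'h) => bool" where
 "opfun K F \<longleftrightarrow> compact K & K <= {-2..2} & continuous_on K F & (ALL s:K. cm (F s))"

definition opint :: "real set => (real => 'h \<Rightarrow>\<^sub>L 'h) => 'h \<Rightarrow>\<^sub>L 'h" where "opint K F = lim (%n. rsum K F (tag K n))"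

lemma opfun_smp: "opfun K F ==> smp K (tag K n)"
 by (intro smp_tag) (auto simp: opfun_def compact_imp_bounded borel_compact)

lemma tag_fine: assumes F: "opfun K F" and e: "0 < e" shows "EX N. ALL n>=N. ALL s:K. norm (F (tag K n s) - F s) <= e"
proof -
 have "uniformly_continuous_on K F" using F by (auto simp: opfun_def intro: compact_uniformly_continuous)
 then obtain d where d: "0 < d" "!!s t. s : K ==> t : K ==> dist t s < d ==> dist (F t) (F s) < e"
  using e unfolding uniformly_continuous_on_def by metis
 obtain N where N: "1 / real (Suc N) < d" using d(1) by (metis nat_approx_posE)
 have "abs(tag K n s - s) < d" if "N <= n" "s : K" for n s
  using tag(2)[OF that(2), of n] N frac_le[of 1 1 "Suc N" "Suc n"] that(1) by simp
 then show ?thesis using d(2) tag(1) by (intro exI[of _ N]) (force simp: dist_norm intro: less_imp_le)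
qed

text \<open>Uniform continuity on the compact set and \<open>rsum_compare\<close> make the Riemann
  sums Cauchy in operator norm, although the spectral measure itself is only strongly
  additive.\<close>

lemma opint: assumes F: "opfun K F" shows "(%n. rsum K F (tag K n)) ----> opint K F"
proof -
 have "Cauchy (%n. rsum K F (tag K n))"
 proof (rule CauchyI)
  fix e :: real assume e: "0 < e"
  then obtain N where N: "!!n s. N <= n ==> s : K ==> norm (F (tag K n s) - F s) <= e / 4" using tag_fine[OF F, of "e / 4"] by auto
  have "norm (rsum K F (tag K m) - rsum K F (tag K n)) < e" if "N <= m" "N <= n" for m n
  proof -
   have "norm (F (tag K m s) - F (tag K n s)) <= e / 2" if "s : K" for s
    using norm_diff_triangle_le[OF N[OF `N <= m` that] N[OF `N <= n` that, unfolded norm_minus_commute[of _ "F s"]]] by simp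
   then have "norm (rsum K F (tag K m) - rsum K F (tag K n)) <= e / 2"
    by (intro rsum_compare opfun_smp[OF F]) (use F e in "auto simp: opfun_def borel_compact")
   then show ?thesis using e by simp
  qed
  then show "EX N. ALL m>=N. ALL n>=N. norm (rsum K F (tag K m) - rsum K F (tag K n)) < e" by blast
 qed
 then show ?thesis unfolding opint_def by (simp add: Cauchy_convergent convergent_LIMSEQ_iff[symmetric])
qed

lemma opint_eqI: "opfun K F ==> (%n. rsum K F (tag K n)) ----> T ==> opint K F = T"
 using LIMSEQ_unique opint by blast

lemma opfun_intros:
 "opfun K F ==> opfun K G ==> opfun K (%s. F s + G s)" "opfun K F ==> opfun K G ==> opfun K (%s. F s - G s)"
 "opfun K F ==> continuous_on K c ==> opfun K (%s. c s *\<^sub>C F s)" "opfun K F ==> opfun K G ==> opfun K (%s. F s o\<^sub>L G s)"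
 "compact K ==> K <= {-2..2} ==> cm V ==> opfun K (%_. V)"
 unfolding opfun_def by (simp_all add: cm_intros continuous_on_add continuous_on_diff sc.continuous_on continuous_on_const
  bounded_bilinear.continuous_on[OF bounded_bilinear_blinfun_compose])

lemma cm_opint: "opfun K F ==> cm (opint K F)"
 by (rule cm_limit[OF opint]) (auto intro!: cm_rsum opfun_smp simp: opfun_def)

lemma opint_add: "opfun K F ==> opfun K G ==> opint K (%s. F s + G s) = opint K F + opint K G"
 by (rule opint_eqI[OF opfun_intros(1)]) (auto simp: rsum_linear intro!: tendsto_add opint)

lemma opint_cmult: "opfun K F ==> opint K (%s. c *\<^sub>C F s) = c *\<^sub>C opint K F"
 by (rule opint_eqI[OF opfun_intros(3)]) (auto simp: rsum_linear intro!: sc.tendsto opint)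

lemma opint_diff: "opfun K F ==> opfun K G ==> opint K (%s. F s - G s) = opint K F - opint K G"
 using opint_add[of K F "%s. (-1) *\<^sub>C G s"] opint_cmult[of K G "-1"] opfun_intros(3)[of K G "%_. - 1 :: complex"] by (simp add: continuous_on_const)

lemma opint_compose: "opfun K F ==> cm V ==> opint K (%s. V o\<^sub>L F s) = V o\<^sub>L opint K F"
 by (rule opint_eqI[OF opfun_intros(4)[OF opfun_intros(5)]])
  (auto simp: rsum_linear opfun_def intro!: bounded_bilinear.tendsto[OF bounded_bilinear_blinfun_compose] opint[unfolded opfun_def])

lemma opint_mult: assumes F: "opfun K F" and G: "opfun K G" shows "opint K (%s. F s o\<^sub>L G s) = opint K F o\<^sub>L opint K G"
proof (rule opint_eqI[OF opfun_intros(4)[OF F G]])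
 have "(%n. rsum K F (tag K n) o\<^sub>L rsum K G (tag K n)) ----> (opint K F o\<^sub>L opint K G)"
  by (intro bounded_bilinear.tendsto[OF bounded_bilinear_blinfun_compose] opint F G)
 then show "(%n. rsum K (%s. F s o\<^sub>L G s) (tag K n)) ----> (opint K F o\<^sub>L opint K G)"
  by (subst rsum_mult[symmetric]) (use F G opfun_smp in "auto simp: opfun_def")
qed

lemma opint_commute:
 fixes L :: "'h \<Rightarrow>\<^sub>L 'h"
 assumes F: "opfun K F" and L: "cm L" and c: "!!s x. s : K ==> L (F s x) = F s (L x)"
 shows "L (opint K F x) = opint K F (L x)"
proof -
 have l: "(%n. rsum K F (tag K n) x) ----> opint K F x" for x by (intro blinfun.tendsto opint F tendsto_const)
 have e: "L (rsum K F (tag K n) x) = rsum K F (tag K n) (L x)" for n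
  unfolding rsum_apply blinfun.sum_right
 proof (intro sum.cong refl)
  fix t assume t: "t : tag K n ` K"
  have "smp K (tag K n)" by (rule opfun_smp[OF F])
  then have "t : K" "{s:K. tag K n s = t} : sets borel" using t by (auto simp: smp_def)
  then show "L (F t (pr {s:K. tag K n s = t} x)) = F t (pr {s:K. tag K n s = t} (L x))" by (simp add: c cm_apply_pr[OF L])
 qed
 have "(%n. L (rsum K F (tag K n) x)) ----> L (opint K F x)" by (intro blinfun.tendsto tendsto_const l)
 then show ?thesis unfolding e by (rule LIMSEQ_unique[OF _ l])
qed

lemma opint_norm: assumes F: "opfun K F" and C: "0 <= C" "!!s. s : K ==> norm (F s) <= C" shows "norm (opint K F) <= C"
proof (rule LIMSEQ_le_const2[OF tendsto_norm[OF opint[OF F]]])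
 have "norm (rsum K F (tag K n) - rsum K (%_. 0) (tag K n)) <= C" for n
  by (rule rsum_compare[OF opfun_smp[OF F] opfun_smp[OF F]]) (use F C tag(1) cm_intros in "auto simp: opfun_def borel_compact")
 moreover have "rsum K (%_. 0) (tag K n) = 0" for n by (simp add: rsum_def)
 ultimately show "EX N. ALL n>=N. norm (rsum K F (tag K n)) <= C" by simp
qed

text \<open>The integrals over two compact sets agree on the spectral subspace of a common subset,
  so sets with different closures can be compared within one larger compact set.\<close>

lemma opint_restrict:
 assumes F: "opfun K F" and K': "compact K'" "K' <= K" and B: "B : sets borel" "B <= K'"
 shows "opint K' F (pr B x) = opint K F (pr B x)"
proof -
 have F': "opfun K' F" using F K' by (auto simp: opfun_def intro: continuous_on_subset)
 have "(%n. rsum K' F (tag K' n) (pr B x) - rsum K F (tag K n) (pr B x)) ----> 0"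
 proof (rule LIMSEQ_I)
  fix e :: real assume e: "0 < e"
  define d where "d = e / (2 * (norm x + 1))"
  have d: "0 < d" unfolding d_def by (intro divide_pos_pos mult_pos_pos add_nonneg_pos e) simp_all
  obtain N where N: "!!n s. N <= n ==> s : K' ==> norm (F (tag K' n s) - F s) <= d / 2" using tag_fine[OF F', of "d / 2"] d by auto
  obtain M where M: "!!n s. M <= n ==> s : K ==> norm (F (tag K n s) - F s) <= d / 2" using tag_fine[OF F, of "d / 2"] d by auto
  have "norm (rsum K' F (tag K' n) (pr B x) - rsum K F (tag K n) (pr B x)) < e" if n: "max N M <= n" for n
  proof -
   have "norm (F (tag K' n s) - F (tag K n s)) <= d" if "s : B" for s
    using norm_diff_triangle_le[OF N[of n s] M[of n s, unfolded norm_minus_commute[of _ "F s"]]] n that B K' by auto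
   then have "norm (rsum K' F (tag K' n) (pr B x) - rsum K F (tag K n) (pr B x)) <= d * norm x"
    by (intro rsum_compare_restrict opfun_smp[OF F] opfun_smp[OF F'] B) (use F F' d B K' in "auto simp: opfun_def")
   also have "... < d * (norm x + 1)" using d by simp
   also have "... = e / 2" using norm_ge_zero[of x] by (simp add: d_def field_simps del: norm_ge_zero)
   finally show ?thesis using e by simp
  qed
  then show "EX N. ALL n>=N. norm (rsum K' F (tag K' n) (pr B x) - rsum K F (tag K n) (pr B x) - 0) < e" by (intro exI[of _ "max N M"]) simp
 qed
 from LIMSEQ_unique[OF this tendsto_diff[OF blinfun.tendsto[OF opint[OF F'] tendsto_const] blinfun.tendsto[OF opint[OF F] tendsto_const]]]
 show ?thesis by simp
qed

text \<open>Consistency of the two calculi: for a scalar integrand the Riemann sums are the calculus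
  of step functions that converge uniformly.\<close>

lemma opint_scalar:
 assumes K: "compact K" "K <= {-2..2}" and c: "continuous_on K c"
 shows "bfun (%s. indicator K s * c s)" "opint K (%s. c s *\<^sub>C id_blinfun) = calc (%s. indicator K s * c s)"
proof -
 have Kb: "K : sets borel" by (rule borel_compact[OF K(1)])
 obtain B where B: "!!s. s : K ==> cmod (c s) <= B" using compact_imp_bounded[OF compact_continuous_image[OF c K(1)]] by (auto simp: bounded_iff)
 have "(%s. if s : K then c s else 0) : borel_measurable borel" by (rule borel_measurable_continuous_on_if[OF Kb c]) auto
 moreover have "(%s. if s : K then c s else 0) = (%s. indicator K s * c s)" by (auto simp: indicator_def)
 ultimately have m: "(%s. indicator K s * c s) : borel_measurable borel" by simp
 show b: "bfun (%s. indicator K s * c s)" by (rule bfunI[OF m, of "max 0 B"]) (use B in "force simp: indicator_def")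
 have o: "opfun K (%s. c s *\<^sub>C id_blinfun)" by (intro opfun_intros K c cm_intros)
 show "opint K (%s. c s *\<^sub>C id_blinfun) = calc (%s. indicator K s * c s)"
 proof (rule opint_eqI[OF o], rule LIMSEQ_I)
  fix e :: real assume e: "0 < e"
  have "uniformly_continuous_on K c" by (rule compact_uniformly_continuous[OF c K(1)])
  then obtain d where d: "0 < d" "!!s t. s : K ==> t : K ==> dist t s < d ==> dist (c t) (c s) < e / 2"
   using e unfolding uniformly_continuous_on_def by (metis half_gt_zero)
  obtain N where N: "1 / real (Suc N) < d" using d(1) by (metis nat_approx_posE)
  have "norm (rsum K (%s. c s *\<^sub>C id_blinfun) (tag K n) - calc (%s. indicator K s * c s)) <= e / 2" if n: "N <= n" for n
  proof -
   let ?sg = "tag K n"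
   let ?g = "%s. \<Sum>t\<in>?sg ` K. c t * indicator {s:K. ?sg s = t} s"
   have sm: "smp K ?sg" by (rule opfun_smp[OF o])
   then have g: "bfun ?g" "rsum K (%s. c s *\<^sub>C id_blinfun) ?sg x = calc ?g x" for x
    using calc_sum[where f="%t s. c t * indicator {s:K. ?sg s = t} s" and I="?sg ` K"]
    by (simp_all add: smp_def rsum_apply calc_cmult bfun_mult bfun_const bfun_indicator pr_def)
   have gs: "?g s = indicator K s * c (?sg s)" for s
    using sm by (cases "s : K") (auto simp: smp_def indicator_def if_distrib sum.delta cong: if_cong)
   have "abs(?sg s - s) < d" if "s : K" for s
    using tag(2)[OF that, of n] N frac_le[of 1 1 "Suc N" "Suc n"] n by simp
   then have "norm (calc (%s. ?g s - indicator K s * c s)) <= e / 2"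
    using bfun_diff[OF g(1) b] unfolding gs
   proof (intro calc_norm(1))
    fix s
    show "cmod (indicator K s * c (?sg s) - indicator K s * c s) <= e / 2"
     using d(2)[of s "?sg s"] tag(1)[of s K n] `!!s. s : K ==> \<bar>?sg s - s\<bar> < d`[of s] e
     by (cases "s : K") (simp_all add: dist_norm)
   qed (use e in "simp_all add: bfun_def")
   moreover have "rsum K (%s. c s *\<^sub>C id_blinfun) ?sg - calc (%s. indicator K s * c s) = calc (%s. ?g s - indicator K s * c s)"
    by (rule blinfun_eqI) (simp add: blinfun.diff_left g calc_diff[OF g(1) b])
   ultimately show ?thesis by simp
  qed
  then show "EX N. ALL n>=N. norm (rsum K (%s. c s *\<^sub>C id_blinfun) (tag K n) - calc (%s. indicator K s * c s)) < e" using e by (intro exI[of _ N]) fastforce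
 qed
qed

text \<open>The precise form of vanishing on the fiber. On a cell of diameter 1 / (n + 1) such an
  integrand has norm at most C / (n + 1), and by \<open>block_bound\<close> the cells do not add
  up.\<close>

lemma opint_zero:
 assumes F: "opfun K F" and C: "0 <= C" "!!s x. s : K ==> norm (F s x) <= C * norm (S x - cor s *\<^sub>C x)"
 shows "opint K F = 0"
proof (rule LIMSEQ_unique[OF opint[OF F]], rule Lim_null_comparison[rotated])
 show "(%n. C * inverse (real (Suc n))) ----> 0" using tendsto_mult[OF tendsto_const LIMSEQ_inverse_real_of_nat] by simp
 have "norm (rsum K F (tag K n) x) <= C * inverse (real (Suc n)) * norm x" for n x
  unfolding rsum_apply
 proof (rule block_bound)
  let ?B = "%t. {s:K. tag K n s = t}"
  have sm: "smp K (tag K n)" by (rule opfun_smp[OF F])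
  then show B: "?B t : sets borel" "finite (tag K n ` K)" for t by (simp_all add: smp_def)
  fix t assume "t : tag K n ` K"
  then have t: "t : K" using sm by (auto simp: smp_def)
  then show "cm (F t)" using F by (simp add: opfun_def)
  have "norm (F t (pr (?B t) x)) <= C * norm (S (pr (?B t) x) - cor t *\<^sub>C pr (?B t) x)" by (rule C(2)[OF t])
  also have "norm (S (pr (?B t) x) - cor t *\<^sub>C pr (?B t) x) <= inverse (real (Suc n)) * norm (pr (?B t) x)"
   using tag(2) by (intro fiber_small B) (auto simp: inverse_eq_divide abs_minus_commute simp del: of_nat_Suc intro: less_imp_le)
  finally show "norm (F t (pr (?B t) x)) <= C * inverse (real (Suc n)) * norm (pr (?B t) x)" using C(1) by (simp add: mult_left_mono mult.assoc)
 qed (use C in "auto simp: disjoint_family_on_def")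
 then show "\<forall>\<^sub>F n in sequentially. norm (rsum K F (tag K n)) <= C * inverse (real (Suc n))"
  using C(1) by (intro always_eventually allI norm_blinfun_bound) auto
qed

end

section \<open>Operators whose resolvent is built from the shift\<close>

definition spec :: "complex set" where "spec = cor ` {-2..2}"

lemma spec_closed: "closed spec"
 unfolding spec_def by (intro compact_imp_closed compact_continuous_image continuous_intros) auto

lemma spec_iff: "l : spec \<longleftrightarrow> (EX s. l = cor s & abs s <= 2)"
 by (auto simp: spec_def abs_le_iff)

text \<open>All that the construction of the spectral function takes from the differential equation.
  Since A - l is always injective (\<open>A_injective\<close>), a spectral point can only come from
  a failure of surjectivity; \<open>surj_deriv\<close> detects it where \<open>deriv disc\<close>
  does not vanish.\<close>

locale shift_pencil = shift tau W for tau :: "int => 'h::chilbert \<Rightarrow>\<^sub>L 'h" and W +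
 fixes DA :: "'h set" and A :: "'h => 'h" and Q :: "complex => 'h \<Rightarrow>\<^sub>L 'h" and disc :: "complex => complex"
 assumes DA_subspace: "complex_vector.subspace DA"
  and A_add: "x : DA ==> y : DA ==> A (x + y) = A x + A y" and A_scale: "x : DA ==> A (c *\<^sub>C x) = c *\<^sub>C A x"
  and Q_clin: "clin (Q l)"
  and Q_lip: "EX K>=0. ALL l:cball 0 R. ALL m:cball 0 R. norm (Q l - Q m) <= K * cmod (l - m)"
  and Q_DA: "Q l x : DA" and A_Q: "A (Q l x) - l *\<^sub>C Q l x = S x - disc l *\<^sub>C x"
  and Q_A: "x : DA ==> Q l (A x - l *\<^sub>C x) = S x - disc l *\<^sub>C x"
  and disc_holo: "disc holomorphic_on UNIV"
  and surj_deriv: "disc l : spec ==> (!!y. EX x:DA. A x - l *\<^sub>C x = y) ==> deriv disc l = 0"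
  and regular_point: "EX l. disc l ~: spec"
begin

lemma DA_intros: "0 : DA" "x : DA ==> y : DA ==> x + y : DA" "x : DA ==> c *\<^sub>C x : DA" "x : DA ==> y : DA ==> x - y : DA"
 using DA_subspace complex_vector.subspace_0 complex_vector.subspace_add complex_vector.subspace_scale complex_vector.subspace_diff by blast+

lemma A_diff: "x : DA ==> y : DA ==> A (x - y) = A x - A y"
 using A_add[OF _ DA_intros(3), of x y "-1"] A_scale[of y "-1"] by simp

lemma AQ: "A (Q l x) = l *\<^sub>C Q l x + (S x - disc l *\<^sub>C x)"
 using A_Q[of l x] by (simp add: algebra_simps)

lemma Q_scale: "Q l (c *\<^sub>C x) = c *\<^sub>C Q l x" using Q_clin by (simp add: clin_def)

text \<open>Evaluate Q l (A - l) Q l in two ways.\<close>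

lemma cm_Q: "cm (Q l)"
proof -
 have "Q l (S x - disc l *\<^sub>C x) = S (Q l x) - disc l *\<^sub>C Q l x" for x using Q_A[OF Q_DA[of l x], of l] A_Q[of l x] by simp
 then show ?thesis by (simp add: cm_def Q_clin blinfun.diff_right Q_scale)
qed

lemma Q_continuous: "continuous_on U Q"
proof -
 have "continuous (at l) Q" for l
 proof -
  obtain K where K: "0 <= K" "!!m. m : cball 0 (cmod l + 1) ==> norm (Q l - Q m) <= K * cmod (l - m)"
   using Q_lip[of "cmod l + 1"] by fastforce
  have "\<forall>\<^sub>F m in at l. norm (Q m - Q l) <= K * cmod (m - l)"
   unfolding eventually_at
  proof (intro exI[of _ 1] conjI ballI impI)
   fix m assume "m ~= l & dist m l < 1"
   then have "m : cball 0 (cmod l + 1)" using norm_triangle_ineq[of l "m - l"] by (simp add: dist_norm)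
   from K(2)[OF this] show "norm (Q m - Q l) <= K * cmod (m - l)" by (simp add: norm_minus_commute)
  qed simp
  moreover have "((%m. K * cmod (m - l)) \<longlongrightarrow> 0) (at l)" by (rule tendsto_eq_intros refl | simp)+
  ultimately have "((%m. Q m - Q l) \<longlongrightarrow> 0) (at l)" by (rule Lim_null_comparison)
  then show ?thesis unfolding continuous_at by (rule LIM_zero_cancel)
 qed
 then show ?thesis by (simp add: continuous_at_imp_continuous_on)
qed

lemma resolvent_function:
 assumes "z ~: spec"
 shows "bfun (%s. 1 / (cor s - z))" "abs s <= 2 ==> cor s ~= z"
proof -
 have "spec ~= {}" by (auto simp: spec_def)
 then have d: "0 < infdist z spec" using assms spec_closed in_closed_iff_infdist_zero infdist_nonneg[of z spec] by (auto simp: less_le)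
 show "bfun (%s. 1 / (cor s - z))"
 proof (rule bfunI)
  fix s :: real assume "abs s <= 2"
  then have "infdist z spec <= cmod (cor s - z)" using infdist_le[of "cor s" spec z] by (auto simp: spec_iff dist_norm norm_minus_commute)
  then show "cmod (1 / (cor s - z)) <= 1 / infdist z spec" using d by (simp add: norm_divide frac_le)
 qed simp
 show "abs s <= 2 ==> cor s ~= z" using assms by (auto simp: spec_iff)
qed

definition res :: "complex => 'h \<Rightarrow>\<^sub>L 'h" where
 "res l = Q l o\<^sub>L calc (%s. 1 / (cor s - disc l))"

lemma calc_minus: "bfun (%s. cor s - z)" "calc (%s. cor s - z) x = S x - z *\<^sub>C x"
proof -
 have "bfun cor" by (intro bfun_continuous continuous_intros)
 then show "bfun (%s. cor s - z)" "calc (%s. cor s - z) x = S x - z *\<^sub>C x"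
  by (simp_all add: bfun_diff bfun_const calc_diff calc_S calc_const)
qed

lemma calc_inverse:
 assumes z: "z ~: spec"
 shows "calc (%s. 1 / (cor s - z)) (S x - z *\<^sub>C x) = x"
  "S (calc (%s. 1 / (cor s - z)) x) - z *\<^sub>C calc (%s. 1 / (cor s - z)) x = x"
proof -
 note b = resolvent_function(1)[OF z] calc_minus(1)[of z]
 have "calc (%s. 1 / (cor s - z) * (cor s - z)) x = calc (%_. 1) x" for x
  using resolvent_function(2)[OF z] by (intro calc_cong bfun_mult b bfun_const) auto
 then show "calc (%s. 1 / (cor s - z)) (S x - z *\<^sub>C x) = x"
  unfolding calc_mult[OF b] calc_minus(2) by (simp add: calc_const)
 then show "S (calc (%s. 1 / (cor s - z)) x) - z *\<^sub>C calc (%s. 1 / (cor s - z)) x = x"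
  by (simp add: blinfun.diff_right calc_S_commute[OF b(1)] calc_scale[OF b(1)])
qed

text \<open>Applying \<open>Q l\<close> to A x - l x = 0 gives S x = disc l x. For
  \<open>disc l\<close> in [-2, 2] this is excluded by \<open>S_injective\<close>, otherwise by the
  invertibility of S - disc l.\<close>

lemma A_injective: assumes x: "x : DA" and e: "A x = l *\<^sub>C x" shows "x = 0"
proof (cases "disc l : spec")
 case True
 then show ?thesis using S_injective[of x] Q_A[OF x, of l] e by (auto simp: spec_iff blinfun.zero_right)
next
 case False
 then show ?thesis using calc_inverse(1)[OF False, of x] Q_A[OF x, of l] e by (simp add: blinfun.zero_right)
qed

lemma A_shift_inj: assumes "x : DA" "y : DA" "A x - l *\<^sub>C x = A y - l *\<^sub>C y" shows "x = y"
 using A_injective[OF DA_intros(4)[OF assms(1,2)], of l] assms by (simp add: A_diff scaleC_algebra algebra_simps)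

lemma A_shift_linear: "x : DA ==> y : DA ==> A (x + y) - l *\<^sub>C (x + y) = (A x - l *\<^sub>C x) + (A y - l *\<^sub>C y)"
 "x : DA ==> A (c *\<^sub>C x) - l *\<^sub>C (c *\<^sub>C x) = c *\<^sub>C (A x - l *\<^sub>C x)"
 by (simp_all add: A_add A_scale scaleC_algebra mult.commute)

text \<open>Because A - l is injective, a bounded right inverse that preserves \<open>Y\<close> must
  be the resolvent in \<open>Y\<close>; its linearity follows from injectivity as well.\<close>

lemma resolvent_setI:
 assumes Y: "complex_vector.subspace Y" and AY: "!!x. x : DA ==> x : Y ==> A x : Y"
  and V: "!!y. y : Y ==> V y : DA" "!!y. y : Y ==> V y : Y" "!!y. y : Y ==> A (V y) - l *\<^sub>C V y = y"
  and K: "!!y. y : Y ==> norm (V y) <= K * norm y"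
 shows "l : resolvent_set norm Y (DA Int Y) A" "y : Y ==> resolvent (DA Int Y) A l y = V y"
proof -
 let ?f = "%x. A x - l *\<^sub>C x"
 have Ysc: "c *\<^sub>C x : Y" "x + z : Y" "x - z : Y" if "x : Y" "z : Y" for c x z
  by (intro complex_vector.subspace_scale[OF Y(1)] complex_vector.subspace_add[OF Y(1)] complex_vector.subspace_diff[OF Y(1)] that)+
 have inj: "inj_on ?f (DA Int Y)" by (rule inj_onI) (use A_shift_inj in blast)
 have img: "?f ` (DA Int Y) = Y"
 proof (intro equalityI subsetI)
  fix y assume "y : Y"
  then show "y : ?f ` (DA Int Y)" using V(1,2) V(3)[OF `y : Y`, symmetric] by (intro image_eqI[of _ _ "V y"]) auto
 qed (use AY Ysc in auto)
 have inv: "the_inv_into (DA Int Y) ?f y = V y" if y: "y : Y" for y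
  by (rule the_inv_into_f_eq[OF inj]) (use V[OF y] in auto)
 then show "y : Y ==> resolvent (DA Int Y) A l y = V y" by (simp add: resolvent_def)
 have "V (x + y) = V x + V y" if "x : Y" "y : Y" for x y
  by (rule A_shift_inj[of _ _ l]) (use V that Ysc A_shift_linear(1)[of "V x" "V y" l] DA_intros in auto)
 moreover have "V (c *\<^sub>C x) = c *\<^sub>C V x" if "x : Y" for c x
  by (rule A_shift_inj[of _ _ l]) (use V that Ysc[OF that that] A_shift_linear(2)[where x="V x" and c=c and l=l] DA_intros in auto)
 ultimately have "the_inv_into (DA Int Y) ?f : bounded_operators norm Y"
  using inv V K Ysc by (auto simp: bounded_operators_def clinear_on_def intro!: exI[of _ K])
 then show "l : resolvent_set norm Y (DA Int Y) A" using inj img by (simp add: resolvent_set_def bij_betw_def)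
qed

lemma res_props:
 assumes l: "disc l ~: spec"
 shows "res l x : DA" "A (res l x) - l *\<^sub>C res l x = x" "cm (res l)" "l : resolvent_set norm UNIV DA A" "resolvent DA A l x = res l x"
proof -
 note b = resolvent_function(1)[OF l]
 show r1: "res l x : DA" for x by (simp add: res_def Q_DA)
 show r2: "A (res l x) - l *\<^sub>C res l x = x" for x
  unfolding res_def by (simp add: A_Q calc_inverse(2)[OF l])
 show "cm (res l)" unfolding res_def by (intro cm_intros cm_Q cm_calc b)
 have "l : resolvent_set norm UNIV (DA Int UNIV) A" "resolvent (DA Int UNIV) A l x = res l x" for x
  using resolvent_setI[where Y=UNIV and V="res l" and l=l and K="norm (res l)"] r1 r2 norm_blinfun[of "res l"] complex_vector.subspace_UNIV by blast+
 then show "l : resolvent_set norm UNIV DA A" "resolvent DA A l x = res l x" by simp_all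
qed

lemma spectrum_disc: "l : spectrum norm UNIV DA A ==> disc l : spec"
 using res_props(4) by (auto simp: spectrum_def)

lemma disc_spectrum: assumes "disc l : spec" "deriv disc l ~= 0" shows "l : spectrum norm UNIV DA A"
proof (rule ccontr)
 assume "l ~: spectrum norm UNIV DA A"
 then have *: "(%x. A x - l *\<^sub>C x) ` DA = UNIV" by (simp add: spectrum_def resolvent_set_def bij_betw_def)
 have "EX x:DA. A x - l *\<^sub>C x = y" for y
 proof -
  have "y : (%x. A x - l *\<^sub>C x) ` DA" unfolding * by (rule UNIV_I)
  then show ?thesis by auto
 qed
 from surj_deriv[OF assms(1) this] show False using assms(2) by simp
qed

text \<open>Up to a shift, \<open>A\<close> is the inverse of a bounded operator, the resolvent at a
  regular point.\<close>

lemma A_closed: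
 assumes s: "!!n. s n : DA" and l: "s ----> x" "(%n. A (s n)) ----> y"
 shows "x : DA" "A x = y"
proof -
 obtain l where l': "disc l ~: spec" using regular_point by blast
 note r = res_props[OF l']
 have e: "res l (A (s n) - l *\<^sub>C s n) = s n" for n by (rule A_shift_inj[OF r(1) s r(2)])
 have "(%n. res l (A (s n) - l *\<^sub>C s n)) ----> res l (y - l *\<^sub>C x)" by (intro blinfun.tendsto sc.tendsto tendsto_diff tendsto_const l)
 then have x: "x = res l (y - l *\<^sub>C x)" unfolding e using l(1) LIMSEQ_unique by blast
 show "x : DA" by (subst x) (rule r(1))
 have "A x - l *\<^sub>C x = y - l *\<^sub>C x" by (subst (1 2) x) (rule r(2))
 then show "A x = y" by simp
qed

lemma closed_A: "closed_operator norm UNIV DA A"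
proof -
 have "x : DA & A x = y" if "range s <= DA" "(%n. norm (s n - x)) ----> 0" "(%n. norm (A (s n) - y)) ----> 0" for s x y
  using A_closed[of s x y] that by (auto simp: tendsto_norm_zero_iff LIM_zero_iff)
 then show ?thesis unfolding closed_operator_def clinear_on_def using DA_subspace by (auto simp: A_add A_scale)
qed

text \<open>The counterpart of the resolvent identity, with a right-hand side that makes sense also
  where S - disc l is not invertible. It results from Q l (A - l) Q m, evaluated from both
  sides.\<close>

lemma Q_product: "Q l (S x - disc m *\<^sub>C x) - Q m (S x - disc l *\<^sub>C x) = (l - m) *\<^sub>C Q l (Q m x)"
proof -
 have "Q l (A (Q m x) - l *\<^sub>C Q m x) = S (Q m x) - disc l *\<^sub>C Q m x" by (rule Q_A[OF Q_DA])
 moreover have "Q m (S x) = S (Q m x)" using cm_Q by (simp add: cm_def)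
 ultimately show ?thesis by (simp add: AQ blinfun.diff_right blinfun.add_right Q_scale scaleC_algebra algebra_simps)
qed

text \<open>On the fiber \<open>S = disc l\<close> the operator \<open>Q l / disc' l\<close> is idempotent: divide the previous identity by \<open>l - m\<close> and let
  \<open>m\<close> tend to \<open>l\<close>.\<close>

lemma Q_square:
 assumes K: "!!m. m : cball 0 (cmod l + 1) ==> norm (Q l - Q m) <= K * cmod (l - m)"
 shows "norm (Q l (Q l x) - deriv disc l *\<^sub>C Q l x) <= K * norm (S x - disc l *\<^sub>C x)"
proof (rule tendsto_upperbound)
 let ?y = "S x - disc l *\<^sub>C x"
 let ?dq = "%m. (disc m - disc l) / (m - l)"
 have "(disc has_field_derivative deriv disc l) (at l)" by (rule holomorphic_derivI[OF disc_holo open_UNIV UNIV_I])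
 then have dq: "(?dq \<longlongrightarrow> deriv disc l) (at l)" by (simp add: has_field_derivative_iff)
 have "(Q \<longlongrightarrow> Q l) (at l)" using Q_continuous[of UNIV] by (simp add: continuous_on_def)
 then show "((%m. norm (Q l (Q m x) - ?dq m *\<^sub>C Q l x)) \<longlongrightarrow> norm (Q l (Q l x) - deriv disc l *\<^sub>C Q l x)) (at l)"
  by (intro tendsto_norm tendsto_diff blinfun.tendsto sc.tendsto tendsto_const dq)
 show "\<forall>\<^sub>F m in at l. norm (Q l (Q m x) - ?dq m *\<^sub>C Q l x) <= K * norm ?y"
  unfolding eventually_at
 proof (intro exI[of _ 1] conjI ballI impI)
  fix m assume m: "m ~= l & dist m l < 1"
  then have d: "l - m ~= 0" and mb: "m : cball 0 (cmod l + 1)" using norm_triangle_ineq[of l "m - l"] by (auto simp: dist_norm)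
  have dd: "(l - m) * ?dq m = disc l - disc m" using m by (simp add: field_simps)
  have "(l - m) *\<^sub>C (Q l (Q m x) - ?dq m *\<^sub>C Q l x) = (Q l - Q m) ?y"
   unfolding complex_vector.scale_right_diff_distrib scaleC_scaleC dd Q_product[symmetric]
   by (simp add: blinfun.diff_left blinfun.diff_right Q_scale scaleC_algebra)
  then have "cmod (l - m) * norm (Q l (Q m x) - ?dq m *\<^sub>C Q l x) = norm ((Q l - Q m) ?y)" by (metis norm_scaleC)
  also have "... <= cmod (l - m) * (K * norm ?y)"
   using order_trans[OF norm_blinfun mult_right_mono[OF K[OF mb] norm_ge_zero], of ?y] by (simp add: mult_ac)
  finally show "norm (Q l (Q m x) - ?dq m *\<^sub>C Q l x) <= K * norm ?y" using d by (simp add: mult_le_cancel_left_pos)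
 qed simp
qed simp

end

section \<open>The spectral function of a regular arc\<close>

locale regular_arc = shift_pencil tau W DA A Q disc
 for tau :: "int => 'h::chilbert \<Rightarrow>\<^sub>L 'h" and W DA A Q disc +
 fixes Xi :: "complex set"
 assumes Xi_borel: "Xi : sets borel" and Xi_bounded: "bounded Xi" and Xi_spectrum: "Xi <= spectrum norm UNIV DA A"
  and Xi_inj: "inj_on disc Xi" and Xi_deriv: "l : Xi ==> deriv disc l ~= 0"
begin

definition img :: "complex set => real set" where "img D = {s. cor s : disc ` D}"

definition lam :: "real => complex" where "lam s = the_inv_into Xi disc (cor s)"

lemma img_lam: assumes "D <= Xi" "s : img D" shows "lam s : D" "disc (lam s) = cor s"
proof -
 obtain l where l: "l : D" "cor s = disc l" using assms(2) by (auto simp: img_def)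
 then have "lam s = l" unfolding lam_def l(2) using assms(1) by (intro the_inv_into_f_f[OF Xi_inj]) auto
 then show "lam s : D" "disc (lam s) = cor s" using l by auto
qed

lemma Xi_disc: "l : Xi ==> disc l : spec" using Xi_spectrum spectrum_disc by blast

lemma img_I: assumes "D <= Xi" "l : D" shows "EX s:img D. lam s = l & disc l = cor s"
proof -
 obtain s where s: "disc l = cor s" using Xi_disc[of l] assms by (auto simp: spec_def)
 then have "s : img D" using assms(2) by (force simp: img_def)
 moreover have "lam s = l" unfolding lam_def s[symmetric] using assms by (intro the_inv_into_f_f[OF Xi_inj]) auto
 ultimately show ?thesis using s by blast
qed

lemma img_subset: assumes "D <= Xi" shows "img D <= {-2..2}"
 using img_lam[OF assms] Xi_disc assms by (force simp: spec_iff abs_le_iff)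

lemma img_restrict: assumes "D <= D'" "D' <= Xi" shows "img D = {s : img D'. lam s : D}"
proof
 show "img D <= {s : img D'. lam s : D}" using assms img_lam[of D] by (auto simp: img_def)
 show "{s : img D'. lam s : D} <= img D" using img_lam(2)[OF assms(2)] by (auto simp: img_def intro: image_eqI[OF sym])
qed

lemma img_mono: "D <= D' ==> img D <= img D'" by (auto simp: img_def)

lemma img_UN: "img (\<Union>k\<in>K. D k) = (\<Union>k\<in>K. img (D k))" by (auto simp: img_def)

lemma img_Int: assumes "D <= Xi" "D' <= Xi" shows "img (D Int D') = img D Int img D'"
 using img_restrict[of D "D Un D'"] img_restrict[of D' "D Un D'"] img_restrict[of "D Int D'" "D Un D'"] assms by auto

lemma borel0D: "D : borel0 Xi ==> D : sets borel" "D : borel0 Xi ==> D <= Xi" "D : borel0 Xi ==> closure D <= Xi"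
 "D : borel0 Xi ==> compact (closure D)"
 using bounded_subset[OF Xi_bounded] by (auto simp: borel0_def compact_closure)

lemma borel0_subset: "D : borel0 Xi ==> D' : sets borel ==> D' <= D ==> D' : borel0 Xi"
 using closure_mono[of D' D] by (auto simp: borel0_def)

lemma disc_continuous: "continuous_on U disc" "continuous_on U (deriv disc)"
 using disc_holo holomorphic_deriv[OF disc_holo open_UNIV] by (auto intro: continuous_on_subset[OF holomorphic_on_imp_continuous_on])

abbreviation arc :: "complex set => bool" where "arc K == compact K & K <= Xi"

text \<open>A continuous injection on a compact set has a continuous inverse. Members of
  \<open>borel0 Xi\<close> have compact closure in \<open>Xi\<close> because \<open>Xi\<close> is
  bounded, so this is the continuity that their integrals require.\<close>

lemma arc_img: assumes K: "arc K" shows "compact (img K)" "continuous_on (img K) lam"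
proof -
 have "img K = Re ` disc ` K"
 proof
  show "Re ` disc ` K <= img K" using img_I[of K] K by fastforce
  show "img K <= Re ` disc ` K" by (auto simp: img_def) (metis Re_complex_of_real image_eqI)
 qed
 then show "compact (img K)" using K by (auto intro!: compact_continuous_image continuous_intros disc_continuous)
 have "continuous_on (disc ` K) (the_inv_into Xi disc)"
  by (rule continuous_on_inv[OF disc_continuous(1)]) (use K in "auto intro!: the_inv_into_f_f[OF Xi_inj]")
 then show "continuous_on (img K) lam" unfolding lam_def
  by (rule continuous_on_compose2[OF _ continuous_on_of_real[OF continuous_on_id]]) (auto simp: img_def)
qed

lemma lam_compose: assumes "arc K" "continuous_on K f" shows "continuous_on (img K) (%s. f (lam s))"
 by (rule continuous_on_compose2[OF assms(2) arc_img(2)[OF assms(1)]]) (use img_lam(1) assms in blast)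

lemma img_borel: assumes D: "D : borel0 Xi" shows "img D : sets borel"
proof -
 have K: "arc (closure D)" using borel0D[OF D] by simp
 have Kb: "img (closure D) : sets borel" by (rule borel_compact[OF arc_img(1)[OF K]])
 have "lam : borel_measurable (restrict_space borel (img (closure D)))" by (rule borel_measurable_continuous_on_restrict[OF arc_img(2)[OF K]])
 from measurable_sets[OF this borel0D(1)[OF D]]
 have "lam -` D Int img (closure D) : sets borel" using Kb by (simp add: sets_restrict_space_iff space_restrict_space)
 moreover have "lam -` D Int img (closure D) = img D" unfolding img_restrict[OF closure_subset borel0D(3)[OF D]] by auto
 ultimately show ?thesis by simp
qed

definition T :: "real => 'h \<Rightarrow>\<^sub>L 'h" where "T s = (1 / deriv disc (lam s)) *\<^sub>C Q (lam s)"

lemma inverse_deriv_continuous: "arc K ==> continuous_on K (%l. 1 / deriv disc l)"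
 using Xi_deriv by (intro continuous_intros disc_continuous) blast

lemma arc_subset: "arc K ==> img K <= {-2..2}" by (rule img_subset) simp

lemma opfun_T: assumes K: "arc K" and f: "continuous_on K f" shows "opfun (img K) (%s. f (lam s) *\<^sub>C T s)"
proof (intro opfun_intros)
 show "opfun (img K) T" unfolding T_def[abs_def] opfun_def
  using arc_img(1)[OF K] arc_subset[OF K] lam_compose[OF K inverse_deriv_continuous[OF K]] lam_compose[OF K Q_continuous]
  by (auto intro: sc.continuous_on cm_intros cm_Q)
qed (rule lam_compose[OF K f])

lemma opfun_T1: "arc K ==> opfun (img K) T" using opfun_T[of K "%_. 1"] by simp

definition P :: "complex set => 'h \<Rightarrow>\<^sub>L 'h" where "P K = opint (img K) T"

text \<open>The integrand has to be continuous on a compact set, while \<open>D\<close> is only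
  Borel; hence the integral over the closure, cut down by the spectral projection of
  \<open>S\<close>.\<close>

definition E :: "complex set => 'h \<Rightarrow>\<^sub>L 'h" where "E D = P (closure D) o\<^sub>L pr (img D)"

lemma E_apply: "E D x = P (closure D) (pr (img D) x)" by (simp add: E_def)

lemma cm_P: "arc K ==> cm (P K)" unfolding P_def by (rule cm_opint[OF opfun_T1])

lemma cm_E: "D : borel0 Xi ==> cm (E D)"
 unfolding E_def using borel0D by (intro cm_intros cm_P cm_pr img_borel) auto

lemma E_restrict:
 assumes D: "D : borel0 Xi" and K: "arc K" "D <= K" shows "E D x = P K (pr (img D) x)"
proof -
 have "closure D <= K" using K by (intro closure_minimal compact_imp_closed) auto
 then show ?thesis unfolding E_apply P_def
  by (intro opint_restrict opfun_T1 K arc_img(1) img_mono img_borel D closure_subset) (use borel0D[OF D] in auto)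
qed

text \<open>Each \<open>T s\<close> acts on the fiber \<open>S = s\<close> as a projection onto the eigenspace of \<open>A\<close> for \<open>lam s\<close>.\<close>

lemma P_idem: assumes K: "arc K" shows "P K (P K x) = P K x"
proof -
 note F = opfun_T1[OF K]
 obtain R where R: "Xi <= cball 0 R" using Xi_bounded by (auto simp: bounded_iff subset_iff)
 obtain L where L: "0 <= L" "ALL l:cball 0 (R + 1). ALL m:cball 0 (R + 1). norm (Q l - Q m) <= L * cmod (l - m)" using Q_lip by blast
 obtain M where M: "!!l. l : K ==> cmod (1 / deriv disc l) <= M"
  using compact_imp_bounded[OF compact_continuous_image[OF inverse_deriv_continuous[OF K]]] K by (auto simp: bounded_iff)
 have "opint (img K) (%s. (T s o\<^sub>L T s) - T s) = 0"
 proof (rule opint_zero[where C="M^2 * L"])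
  fix s x assume s: "s : img K"
  let ?l = "lam s" and ?d = "1 / deriv disc (lam s)"
  have l: "?l : K" "?l : Xi" "disc ?l = cor s" using img_lam[OF _ s] K by auto
  then have lR: "cmod ?l <= R" using R by auto
  have "((T s o\<^sub>L T s) - T s) x = (?d * ?d) *\<^sub>C (Q ?l (Q ?l x) - deriv disc ?l *\<^sub>C Q ?l x)"
   using Xi_deriv[OF l(2)] by (simp add: T_def Q_scale blinfun.diff_left scaleC_scaleC complex_vector.scale_right_diff_distrib)
  then have "norm (((T s o\<^sub>L T s) - T s) x) = (cmod ?d)^2 * norm (Q ?l (Q ?l x) - deriv disc ?l *\<^sub>C Q ?l x)"
   by (simp only: norm_scaleC norm_mult power2_eq_square)
  also have "... <= M^2 * (L * norm (S x - disc ?l *\<^sub>C x))"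
  proof (intro mult_mono power_mono M[OF l(1)] Q_square)
   fix m :: complex assume "m : cball 0 (cmod ?l + 1)"
   then show "norm (Q ?l - Q m) <= L * cmod (?l - m)" using L(2) lR by auto
  qed auto
  finally show "norm (((T s o\<^sub>L T s) - T s) x) <= M^2 * L * norm (S x - cor s *\<^sub>C x)" by (simp add: l(3) mult.assoc)
 qed (use L in "simp_all add: opfun_intros F")
 then have "opint (img K) T o\<^sub>L opint (img K) T = opint (img K) T" using opint_diff[OF opfun_intros(4)[OF F F] F] opint_mult[OF F F] by simp
 from arg_cong[OF this, of "%T. T x"] show ?thesis by (simp add: P_def)
qed

lemma A_sum: "(!!i. i : I ==> f i : DA) ==> sum f I : DA & A (sum f I) = (\<Sum>i\<in>I. A (f i))"
 using A_scale[OF DA_intros(1), of 0] by (induction I rule: infinite_finite_induct) (auto simp: A_add DA_intros)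

text \<open>\<open>A\<close> is closed and may therefore be taken under the limit of the Riemann
  sums.\<close>

lemma A_opint:
 assumes F: "opfun K F" and H: "opfun K H" and FH: "!!s x. s : K ==> F s x : DA & A (F s x) = H s x"
 shows "opint K F x : DA" "A (opint K F x) = opint K H x"
proof -
 have "rsum K F (tag K n) x : DA & A (rsum K F (tag K n) x) = rsum K H (tag K n) x" for n
 proof -
  have "F t (pr B y) : DA & A (F t (pr B y)) = H t (pr B y)" if "t : tag K n ` K" for t B y using FH tag(1)[of _ K n] that by blast
  then show ?thesis unfolding rsum_apply using A_sum[of "tag K n ` K" "%t. F t (pr {s : K. tag K n s = t} x)"] by simp
 qed
 then have "rsum K F (tag K n) x : DA" "(%n. A (rsum K F (tag K n) x)) ----> opint K H x" for n
  using blinfun.tendsto[OF opint[OF H] tendsto_const] by simp_all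
 from A_closed[OF this(1) blinfun.tendsto[OF opint[OF F] tendsto_const] this(2)]
 show "opint K F x : DA" "A (opint K F x) = opint K H x" by auto
qed

text \<open>A T s is lam s T s plus a multiple of S - s, and the latter integrates to 0 by
  \<open>opint_zero\<close>. So \<open>A\<close> acts under the integral as multiplication by
  \<open>lam s\<close>; the factor \<open>f\<close> will be a resolvent kernel.\<close>

lemma A_opint_T:
 assumes K: "arc K" and f: "continuous_on K f"
 shows "opint (img K) (%s. f (lam s) *\<^sub>C T s) x : DA"
  "A (opint (img K) (%s. f (lam s) *\<^sub>C T s) x) = opint (img K) (%s. (lam s * f (lam s)) *\<^sub>C T s) x"
proof -
 let ?c = "%s. f (lam s) * (1 / deriv disc (lam s))"
 let ?G = "%s. ?c s *\<^sub>C (S - cor s *\<^sub>C id_blinfun)"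
 have lf: "continuous_on K (%l. l * f l)" by (intro continuous_intros f)
 note H = opfun_T[OF K lf]
 have c: "continuous_on (img K) ?c"
  by (rule lam_compose[OF K continuous_on_mult[OF f inverse_deriv_continuous[OF K]]])
 note S = opfun_intros(5)[OF arc_img(1)[OF K] arc_subset[OF K]]
 have G: "opfun (img K) ?G" by (intro opfun_intros(2,3) S c cm_intros continuous_intros)
 obtain M where M: "!!s. s : img K ==> cmod (?c s) <= M"
  using compact_imp_bounded[OF compact_continuous_image[OF c arc_img(1)[OF K]]] by (auto simp: bounded_iff)
 have G0: "opint (img K) ?G = 0"
 proof (rule opint_zero[OF G, of "max 0 M"])
  show "norm (?G s x) <= max 0 M * norm (S x - cor s *\<^sub>C x)" if "s : img K" for s x
   using M[OF that] by (simp only: blinfun_scaleC norm_scaleC blinfun.diff_left id_blinfun.rep_eq) (simp add: mult_right_mono le_max_iff_disj)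
 qed simp
 have "f (lam s) *\<^sub>C T s x : DA & A (f (lam s) *\<^sub>C T s x) = ((lam s * f (lam s)) *\<^sub>C T s + ?G s) x" if s: "s : img K" for s x
  using img_lam(2)[OF conjunct2[OF K] s]
  by (simp add: T_def A_scale DA_intros Q_DA AQ scaleC_add_right scaleC_scaleC blinfun.add_left blinfun.diff_left mult_ac)
 then show "opint (img K) (%s. f (lam s) *\<^sub>C T s) x : DA"
  "A (opint (img K) (%s. f (lam s) *\<^sub>C T s) x) = opint (img K) (%s. (lam s * f (lam s)) *\<^sub>C T s) x"
  using A_opint[OF opfun_T[OF K f] opfun_intros(1)[OF H G], of x] G0 opint_add[OF H G] by simp_all
qed

lemma P_DA: "arc K ==> P K x : DA"
 using A_opint_T(1)[of K "%_. 1"] by (simp add: P_def)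

lemma E_DA: "D : borel0 Xi ==> E D x : DA"
 using borel0D by (simp add: E_apply P_DA)

text \<open>The left-hand side of \<open>Q_product\<close> is antisymmetric in \<open>l\<close> and
  \<open>m\<close>.\<close>

lemma Q_commute: "Q l (Q m x) = Q m (Q l x)"
proof (cases "l = m")
 case False
 have "(l - m) *\<^sub>C Q l (Q m x) = - ((m - l) *\<^sub>C Q m (Q l x))"
  using Q_product[of l x m] Q_product[of m x l] by (metis minus_diff_eq)
 then have "(l - m) *\<^sub>C Q l (Q m x) = (l - m) *\<^sub>C Q m (Q l x)" by (simp flip: complex_vector.scale_minus_left)
 then show ?thesis using False by (simp add: complex_vector.scale_cancel_left)
qed simp

lemma E_commute_op:
 fixes L :: "'h \<Rightarrow>\<^sub>L 'h"
 assumes D: "D : borel0 Xi" and L: "cm L" "!!l x. L (Q l x) = Q l (L x)" shows "L (E D x) = E D (L x)"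
proof -
 have K: "arc (closure D)" using borel0D[OF D] by simp
 have "L (P (closure D) x) = P (closure D) (L x)" for x
  unfolding P_def by (rule opint_commute[OF opfun_T1[OF K] L(1)]) (simp add: T_def cm_scale[OF L(1)] L(2))
 then show ?thesis by (simp add: E_apply cm_apply_pr[OF L(1) img_borel[OF D]])
qed

lemma E_Q: "D : borel0 Xi ==> Q l (E D x) = E D (Q l x)"
 by (rule E_commute_op) (auto simp: cm_Q Q_commute)

lemma E_res: "D : borel0 Xi ==> disc l ~: spec ==> E D (res l x) = res l (E D x)"
 by (simp add: res_def E_Q[symmetric] cm_apply_calc[OF cm_E] resolvent_function)

lemma E_scale: "D : borel0 Xi ==> E D (c *\<^sub>C x) = c *\<^sub>C E D x" by (rule cm_scale[OF cm_E])

lemma E_A: assumes D: "D : borel0 Xi" and x: "x : DA" shows "A (E D x) = E D (A x)"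
proof -
 obtain l where l: "disc l ~: spec" using regular_point by blast
 let ?y = "A x - l *\<^sub>C x"
 have "res l ?y = x" by (rule A_shift_inj[OF res_props(1)[OF l] x res_props(2)[OF l]])
 then have "A (E D x) - l *\<^sub>C E D x = E D ?y" using E_res[OF D l, of ?y] res_props(2)[OF l, of "E D ?y"] by simp
 then show ?thesis by (simp add: blinfun.diff_right E_scale[OF D])
qed

lemma E_bounded_operator: "D : borel0 Xi ==> blinfun_apply (E D) : bounded_operators norm UNIV"
 unfolding bounded_operators_def clinear_on_def using norm_blinfun[of "E D"]
 by (auto simp: blinfun.add_right E_scale mult.commute intro!: exI[of _ "norm (E D)"])

text \<open>Both projections are computed in one compact set, where \<open>P\<close> is idempotent
  and commutes with the spectral projections of \<open>S\<close>.\<close>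

lemma E_mult: assumes D: "D : borel0 Xi" and D': "D' : borel0 Xi" shows "E (D Int D') x = E D (E D' x)"
proof -
 let ?K = "closure D Un closure D'"
 have K: "arc ?K" using borel0D[OF D] borel0D[OF D'] by auto
 have sub: "D <= ?K" "D' <= ?K" "D Int D' <= ?K" using closure_subset by blast+
 have I: "D Int D' : borel0 Xi" by (rule borel0_subset[OF D]) (use borel0D(1) D D' in auto)
 have "E D (E D' x) = P ?K (P ?K (pr (img D) (pr (img D') x)))"
  by (simp add: E_restrict[OF D K sub(1)] E_restrict[OF D' K sub(2)] cm_apply_pr[OF cm_P[OF K] img_borel[OF D]])
 also have "... = P ?K (pr (img (D Int D')) x)"
  by (simp add: P_idem[OF K] pr_pr img_borel D D' img_Int borel0D)
 finally show ?thesis by (simp add: E_restrict[OF I K sub(3)])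
qed

lemma E_idem: "D : borel0 Xi ==> E D (E D x) = E D x" using E_mult[of D D] by simp

text \<open>With all integrals written over the closure of the union, only the strong additivity of
  the spectral projections of \<open>S\<close> remains.\<close>

lemma E_additive:
 assumes D: "!!k. D k : borel0 Xi" and d: "disjoint_family D" and U: "(\<Union>k. D k) : borel0 Xi"
 shows "(%n. \<Sum>k<(n::nat). E (D k) f) ----> E (\<Union>k. D k) f"
proof -
 let ?K = "closure (\<Union>k. D k)" and ?I = "%k. img (D k)"
 have K: "arc ?K" using borel0D[OF U] by simp
 have dd: "disjoint_family_on ?I J" for J
 proof -
  have "?I i Int ?I j = {}" if "i ~= j" for i j
   using d that img_Int[OF borel0D(2)[OF D] borel0D(2)[OF D], of i j] by (auto simp: disjoint_family_on_def img_def)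
  then show ?thesis by (auto simp: disjoint_family_on_def)
 qed
 have "D k <= ?K" for k using closure_subset[of "\<Union>k. D k"] by blast
 then have s: "(\<Sum>k<n. E (D k) f) = P ?K (pr (\<Union>k<n. ?I k) f)" for n :: nat
  using pr_sum[of "{..<n}" ?I f] by (simp add: E_restrict[OF D K] blinfun.sum_right[symmetric] dd img_borel D)
 have "(%n. pr (\<Union>k<n. ?I k) f) ----> pr (\<Union>k. ?I k) f"
  unfolding pr_def
 proof (rule calc_tendsto)
  show "bfun (indicator (\<Union>k. ?I k))" "bfun (indicator (\<Union>k<n. ?I k))" for n :: nat
   using img_borel[OF D] by (auto intro!: bfun_indicator)
  show "bconv (%n. indicator (\<Union>k<n. ?I k)) (indicator (\<Union>k. ?I k))"
  proof (rule bconvI[where B=1])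
   show "(%n. indicator (\<Union>k<n. ?I k) s) ----> indicator (\<Union>k. ?I k) s" for s
    by (rule LIMSEQ_indicator_UN)
  qed (use img_borel[OF D] in "auto simp: indicator_def intro!: borel_measurable_indicator")
 qed
 then show ?thesis unfolding s E_apply[of "\<Union>k. D k"] img_UN by (rule blinfun.tendsto[OF tendsto_const])
qed

end

section \<open>The double commutant of the resolvent\<close>

context regular_arc
begin

context
 fixes B :: "'h \<Rightarrow>\<^sub>L 'h" and D :: "complex set"
 assumes B: "clin B" "!!x. x : DA ==> B x : DA" "!!x. x : DA ==> A (B x) = B (A x)" and D: "D : borel0 Xi"
begin

definition CC :: "'h \<Rightarrow>\<^sub>L 'h" where "CC = (B o\<^sub>L S) - (S o\<^sub>L B)"

definition FF :: "complex => 'h \<Rightarrow>\<^sub>L 'h" where "FF m = (B o\<^sub>L Q m) - (Q m o\<^sub>L B)"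

lemma B_scale: "B (c *\<^sub>C x) = c *\<^sub>C B x" using B(1) by (simp add: clin_def)

lemma CC_FF: "CC x = B (S x) - S (B x)" "FF m x = B (Q m x) - Q m (B x)"
 by (simp_all add: CC_def FF_def blinfun.diff_left)

lemma FF_DA: "FF m x : DA" by (simp add: CC_FF DA_intros B Q_DA)

text \<open>\<open>B\<close> commutes with \<open>A\<close> and with scalars, so
  \<open>disc m\<close> drops out of the commutators: \<open>FF m\<close> is to \<open>CC\<close>
  what \<open>Q m\<close> is to S - disc m. The same holds with the factors reversed
  (\<open>FF_A\<close>).\<close>

lemma A_FF: "A (FF m x) - m *\<^sub>C FF m x = CC x"
 by (simp add: CC_FF A_diff B Q_DA AQ blinfun.add_right blinfun.diff_right B_scale complex_vector.scale_right_diff_distrib)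

lemma FF_A: assumes x: "x : DA" shows "FF m (A x - m *\<^sub>C x) = CC x"
proof -
 have e: "B (A x - m *\<^sub>C x) = A (B x) - m *\<^sub>C B x" by (simp add: blinfun.diff_right B_scale B(3)[OF x])
 show ?thesis unfolding CC_FF e Q_A[OF x] Q_A[OF B(2)[OF x]] by (simp add: blinfun.diff_right B_scale)
qed

text \<open>Together with \<open>CC_Q\<close>, this shows that the products of \<open>CC\<close>
  with \<open>Q m\<close> in both orders are multiples of S - disc m, hence small on the fiber S =
  disc m.\<close>

lemma Q_CC: "Q m (CC x) = S (FF m x) - disc m *\<^sub>C FF m x"
 using Q_A[OF FF_DA[of m x], of m] A_FF[of m x] by simp

lemma CC_Q: "CC (Q m x) = FF m (S x - disc m *\<^sub>C x)"
 using FF_A[OF Q_DA[of m x], of m] A_Q[of m x] by simp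

text \<open>Both commutators are reduced to a multiple of \<open>S - s\<close> on each of the about \<open>4 n\<close> cells of diameter \<open>1 / n\<close>.\<close>

lemma P_CC: assumes K: "arc K" shows "P K (CC x) = 0" "CC (P K x) = 0"
proof -
 let ?I = "img K"
 define G where "G s = (1 / deriv disc (lam s)) *\<^sub>C FF (lam s)" for s
 have "continuous_on ?I G" unfolding G_def FF_def
  by (intro sc.continuous_on continuous_on_diff bounded_bilinear.continuous_on[OF bounded_bilinear_blinfun_compose] continuous_on_const
   lam_compose[OF K inverse_deriv_continuous[OF K]] lam_compose[OF K Q_continuous])
 then have "bounded (G ` ?I)" by (intro compact_imp_bounded compact_continuous_image arc_img(1)[OF K])
 then obtain M where "ALL y:G ` ?I. norm y <= M" unfolding bounded_iff by blast
 then have M: "norm (G s x) <= max 0 M * norm x" if "s : ?I" for s x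
 proof -
  have "norm (G s) <= max 0 M" using \<open>ALL y:G ` ?I. norm y <= M\<close> that by (simp add: le_max_iff_disj)
  from order_trans[OF norm_blinfun mult_right_mono[OF this norm_ge_zero]] show ?thesis .
 qed
 have T: "T s (CC x) = S (G s x) - cor s *\<^sub>C G s x" "CC (T s x) = G s (S x - cor s *\<^sub>C x)" if "s : ?I" for s x
 proof -
  have c: "CC (c *\<^sub>C x) = c *\<^sub>C CC x" for c x by (simp add: CC_FF B_scale S_scale complex_vector.scale_right_diff_distrib)
  show "T s (CC x) = S (G s x) - cor s *\<^sub>C G s x" "CC (T s x) = G s (S x - cor s *\<^sub>C x)"
   using img_lam(2)[OF _ that] K by (simp_all add: T_def G_def Q_CC CC_Q c S_scale complex_vector.scale_right_diff_distrib scaleC_scaleC mult.commute)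
 qed
 note F = opfun_T1[OF K]
 let ?t = "%n. tag ?I n ` ?I" and ?B = "%n t. {s:?I. tag ?I n s = t}" and ?d = "%n. inverse (real (Suc n))"
 have t: "finite (?t n)" "?B n t : sets borel" "disjoint_family_on (?B n) (?t n)" for n t
  using smpD[OF opfun_smp[OF F]] by (auto simp: disjoint_family_on_def)
 have tI: "t : ?I" if "t : ?t n" for n t using that tag(1) by blast
 have small: "norm (S (pr (?B n t) y) - cor t *\<^sub>C pr (?B n t) y) <= ?d n * norm (pr (?B n t) y)" for n t y
  using tag(2) by (intro fiber_small t) (auto simp: inverse_eq_divide abs_minus_commute simp del: of_nat_Suc intro: less_imp_le)
 \<comment> \<open>A sum over at most 4 (n + 1) + 1 cells of squares of size 1 / (n + 1)^2; it tends
   to 0 like 1 / n.\<close>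
 define b where "b n = real (4 * Suc n + 1) * (max 0 M * norm x * ?d n)^2" for n
 have card: "real (card (?t n)) <= real (4 * Suc n + 1)" for n using card_tag[OF arc_subset[OF K]] of_nat_le_iff by blast
 have b: "(%n. sqrt (b n)) ----> 0"
 proof -
  have "(%n. real (4 * Suc n + 1) * (?d n)^2) ----> 0" by real_asymp
  from tendsto_real_sqrt[OF tendsto_mult[OF tendsto_const[of "(max 0 M * norm x)^2"] this]] show ?thesis
   by (simp add: b_def power_mult_distrib mult_ac del: of_nat_Suc real_sqrt_mult)
 qed
 have "norm (rsum ?I T (tag ?I n) (CC x)) <= sqrt (b n)" for n
 proof (rule real_le_rsqrt)
  let ?y = "%t. S (G t x) - cor t *\<^sub>C G t x"
  have "rsum ?I T (tag ?I n) (CC x) = (\<Sum>t\<in>?t n. pr (?B n t) (?y t))"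
   unfolding rsum_apply using F tI by (intro sum.cong refl) (simp add: T(1)[symmetric] opfun_def cm_apply_pr[OF _ t(2)])
  \<comment> \<open>The projections stand on the left, so the summands are orthogonal. Each is
    bounded by norm x rather than by the part of x in its cell, which is why the cells are
    counted.\<close>
  then have "(norm (rsum ?I T (tag ?I n) (CC x)))^2 = (\<Sum>t\<in>?t n. (norm (pr (?B n t) (?y t)))^2)"
   by (simp add: pr_pythagoras[OF t(1,2,3)])
  also have "... <= (\<Sum>t\<in>?t n. (max 0 M * norm x * ?d n)^2)"
  proof (intro sum_mono power_mono)
   fix t assume s: "t : ?t n"
   have "pr (?B n t) (?y t) = S (pr (?B n t) (G t x)) - cor t *\<^sub>C pr (?B n t) (G t x)"
    using cm_pr[OF t(2)] by (simp add: blinfun.diff_right cm_scale) (simp add: cm_def)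
   also have "norm ... <= ?d n * norm (G t x)" by (rule order_trans[OF small mult_left_mono[OF pr_apply_norm[OF t(2)]]]) simp
   also have "... <= max 0 M * norm x * ?d n" using mult_left_mono[OF M[OF tI[OF s], of x], of "?d n"] by (simp add: mult_ac)
   finally show "norm (pr (?B n t) (?y t)) <= max 0 M * norm x * ?d n" .
  qed simp
  also have "... <= b n" unfolding b_def sum_constant by (intro mult_right_mono card) simp
  finally show "(norm (rsum ?I T (tag ?I n) (CC x)))^2 <= b n" .
 qed
 then have "(%n. rsum ?I T (tag ?I n) (CC x)) ----> 0" by (intro Lim_null_comparison[OF _ b]) simp
 then show "P K (CC x) = 0" unfolding P_def using blinfun.tendsto[OF opint[OF F] tendsto_const] LIMSEQ_unique by blast
 have "norm (CC (rsum ?I T (tag ?I n) x)) <= sqrt (b n)" for n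
 proof (rule real_le_rsqrt)
  have "norm (CC (rsum ?I T (tag ?I n) x)) <= (\<Sum>t\<in>?t n. max 0 M * ?d n * norm (pr (?B n t) x))"
   unfolding rsum_apply blinfun.sum_right
  proof (intro sum_norm_le)
   fix s assume s: "s : ?t n"
   have "norm (CC (T s (pr (?B n s) x))) <= max 0 M * norm (S (pr (?B n s) x) - cor s *\<^sub>C pr (?B n s) x)"
    unfolding T(2)[OF tI[OF s]] by (rule M[OF tI[OF s]])
   also have "... <= max 0 M * (?d n * norm (pr (?B n s) x))" by (intro mult_left_mono small) simp
   finally show "norm (CC (T s (pr (?B n s) x))) <= max 0 M * ?d n * norm (pr (?B n s) x)" by (simp add: mult.assoc)
  qed
  \<comment> \<open>\<open>CC\<close> need not commute with the projections, so the summands are not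
    orthogonal; the Cauchy-Schwarz inequality over the cells replaces Pythagoras.\<close>
  then have "(norm (CC (rsum ?I T (tag ?I n) x)))^2 <= (max 0 M * ?d n)^2 * (\<Sum>t\<in>?t n. norm (pr (?B n t) x))^2"
   unfolding sum_distrib_left[symmetric] power_mult_distrib[symmetric] by (intro power_mono) auto
  also have "... <= (max 0 M * ?d n)^2 * ((\<Sum>t\<in>?t n. (norm (pr (?B n t) x))^2) * real (card (?t n)))"
   by (intro mult_left_mono sum_squared_le_sum_of_squares) simp
  also have "(\<Sum>t\<in>?t n. (norm (pr (?B n t) x))^2) = (norm (pr (\<Union>t\<in>?t n. ?B n t) x))^2"
   using pr_pythagoras[OF t(1,2,3), where z="%_. x"] pr_sum[OF t(1,2,3), where x=x] by simp
  also have "(max 0 M * ?d n)^2 * ((norm (pr (\<Union>t\<in>?t n. ?B n t) x))^2 * real (card (?t n))) <= (max 0 M * ?d n)^2 * ((norm x)^2 * real (4 * Suc n + 1))"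
   by (intro mult_left_mono mult_mono power_mono pr_apply_norm card sets.finite_UN t) auto
  also have "... = b n" by (simp add: b_def power_mult_distrib mult_ac)
  finally show "(norm (CC (rsum ?I T (tag ?I n) x)))^2 <= b n" .
 qed
 then have "(%n. CC (rsum ?I T (tag ?I n) x)) ----> 0" by (intro Lim_null_comparison[OF _ b]) simp
 then show "CC (P K x) = 0" unfolding P_def
  using blinfun.tendsto[OF tendsto_const blinfun.tendsto[OF opint[OF F] tendsto_const]] LIMSEQ_unique by blast
qed

lemma E_CC: "E D (CC x) = 0" "CC (E D x) = 0"
proof -
 have K: "arc (closure D)" using borel0D[OF D] by simp
 show "CC (E D x) = 0" unfolding E_apply by (rule P_CC(2)[OF K])
 show "E D (CC x) = 0" unfolding E_apply cm_apply_pr[OF cm_P[OF K] img_borel[OF D]] by (simp add: P_CC[OF K] blinfun.zero_right)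
qed

text \<open>A - m is injective and maps both expressions to products of \<open>E D\<close> with
  \<open>CC\<close>, which are 0.\<close>

lemma E_FF: "E D (FF m x) = 0" "FF m (E D x) = 0"
proof -
 show "E D (FF m x) = 0"
 proof (rule A_injective[OF E_DA[OF D], of _ m])
  have "A (E D (FF m x)) - m *\<^sub>C E D (FF m x) = E D (A (FF m x) - m *\<^sub>C FF m x)"
   by (simp add: E_A[OF D FF_DA] blinfun.diff_right E_scale[OF D])
  then show "A (E D (FF m x)) = m *\<^sub>C E D (FF m x)" unfolding A_FF by (simp add: E_CC)
 qed
 show "FF m (E D x) = 0"
  using A_injective[OF FF_DA, of m "E D x" m] A_FF[of m "E D x"] by (simp add: E_CC)
qed

text \<open>By the vanishing of the commutators next to \<open>E D\<close>, both B E and E B commute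
  with \<open>S\<close> and all \<open>Q l\<close>, hence with E. Therefore B E = E B E = E
  B.\<close>

lemma E_commutes: "B (E D x) = E D (B x)"
proof -
 note E = cm_E[OF D, unfolded cm_def, THEN conjunct2, rule_format]
 have 1: "E D (B (S x)) = E D (S (B x))" "B (S (E D x)) = S (B (E D x))" for x
  using E_CC[of x] by (simp_all add: CC_FF blinfun.diff_right)
 have 2: "E D (B (Q l x)) = E D (Q l (B x))" "B (Q l (E D x)) = Q l (B (E D x))" for l x
  using E_FF[of l x] by (simp_all add: CC_FF blinfun.diff_right)
 have "(B o\<^sub>L E D) (E D x) = E D ((B o\<^sub>L E D) x)"
  by (rule E_commute_op[OF D]) (simp_all add: cm_def clin_def E_scale[OF D] B_scale E 1 2 E_Q[OF D, symmetric])
 moreover have "(E D o\<^sub>L B) (E D x) = E D ((E D o\<^sub>L B) x)"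
  by (rule E_commute_op[OF D]) (simp_all add: cm_def clin_def E_scale[OF D] B_scale E 1 2 E_Q[OF D])
 ultimately show ?thesis by (simp add: E_idem[OF D])
qed

end

text \<open>An operator that commutes with the resolvent at one regular point preserves the domain
  of \<open>A\<close> and commutes with \<open>A\<close>.\<close>

lemma E_double_commutant:
 assumes D: "D : borel0 Xi" shows "blinfun_apply (E D) : double_commutant_resolvent norm UNIV DA A"
 unfolding double_commutant_resolvent_def commutant_def[of _ _ "commutant _ _ _"]
proof (intro CollectI conjI ballI E_bounded_operator[OF D])
 fix B x assume "B : commutant norm UNIV (resolvent DA A ` resolvent_set norm UNIV DA A)"
 then have c: "clinear_on UNIV B" "EX K. ALL x. norm (B x) <= K * norm x"
  and com: "!!l x. l : resolvent_set norm UNIV DA A ==> B (resolvent DA A l x) = resolvent DA A l (B x)"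
  by (auto simp: commutant_def bounded_operators_def)
 obtain K where "!!x. norm (B x) <= K * norm x" using c(2) by blast
 then have "bounded_linear B"
  using c(1) by (intro bounded_linear_intro[of B K]) (simp_all add: clinear_on_def scaleR_scaleC mult.commute)
 then obtain B' where B': "B = blinfun_apply B'" by (metis bounded_linear_Blinfun_apply)
 have cl: "clin B'" using c(1) by (simp add: clinear_on_def clin_def B')
 obtain l where l: "disc l ~: spec" using regular_point by blast
 note r = res_props[OF l]
 have DA: "B' y : DA & A (B' y) = B' (A y)" if y: "y : DA" for y
 proof -
  let ?z = "A y - l *\<^sub>C y"
  have "res l ?z = y" by (rule A_shift_inj[OF r(1) y r(2)])
  then have "B' y = res l (B' ?z)" using com[OF r(4), of ?z] r(5) by (simp add: B')
  moreover have "B' ?z = B' (A y) - l *\<^sub>C B' y" using cl by (simp add: blinfun.diff_right clin_def)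
  ultimately show ?thesis using r(1,2)[of "B' ?z"] by simp
 qed
 show "E D (B x) = B (E D x)" unfolding B' by (rule E_commutes[OF cl _ _ D, symmetric]) (use DA in auto)
qed

lemma E_range: "D : borel0 Xi ==> y : range (E D) \<longleftrightarrow> E D y = y"
 by (auto simp: E_idem intro: range_eqI[OF sym])

text \<open>For \<open>m\<close> outside the closure of \<open>D\<close> the kernel 1 / (lam s - m)
  is continuous, and the integral of T s / (lam s - m) inverts A - m on the range.\<close>

lemma E_spectrum_range:
 assumes D: "D : borel0 Xi"
 shows "spectrum_restriction norm DA A (range (E D)) <= closure (spectrum norm UNIV DA A Int D)"
proof
 fix m assume m: "m : spectrum_restriction norm DA A (range (E D))"
 have s: "spectrum norm UNIV DA A Int D = D" using Xi_spectrum borel0D(2)[OF D] by blast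
 show "m : closure (spectrum norm UNIV DA A Int D)"
  unfolding s
 proof (rule ccontr)
  assume n: "m ~: closure D"
  let ?K = "closure D"
  let ?f = "%l. 1 / (l - m)"
  have K: "arc ?K" using borel0D[OF D] by simp
  have f: "continuous_on ?K ?f" using n by (intro continuous_intros) auto
  have g: "continuous_on ?K (%l. l * ?f l)" by (intro continuous_intros f)
  note F = opfun_T[OF K f]
  define V where "V = opint (img ?K) (%s. ?f (lam s) *\<^sub>C T s)"
  have V: "V x : DA" "A (V x) - m *\<^sub>C V x = P ?K x" for x
  proof -
   show "V x : DA" unfolding V_def by (rule A_opint_T(1)[OF K f])
   have "P ?K = opint (img ?K) (%s. (lam s * ?f (lam s)) *\<^sub>C T s - m *\<^sub>C (?f (lam s) *\<^sub>C T s))"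
    unfolding P_def opint_def rsum_def
   proof (intro arg_cong[where f=lim] ext sum.cong refl arg_cong2[where f=blinfun_compose])
    fix k t assume "t : tag (img ?K) k ` img ?K"
    then have "lam t : ?K" using img_lam(1)[of ?K] K tag(1) by blast
    then have "lam t - m ~= 0" using n by auto
    then have "lam t * ?f (lam t) - m * ?f (lam t) = 1" by (simp add: diff_divide_distrib[symmetric])
    then show "T t = (lam t * ?f (lam t)) *\<^sub>C T t - m *\<^sub>C ?f (lam t) *\<^sub>C T t"
     by (simp only: scaleC_scaleC complex_vector.scale_left_diff_distrib[symmetric] scaleC_one)
   qed
   then show "A (V x) - m *\<^sub>C V x = P ?K x" unfolding V_def
    using A_opint_T(2)[OF K f, of x] opint_diff[OF opfun_T[OF K g] opfun_intros(3)[OF F continuous_on_const]] opint_cmult[OF F, of m]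
    by (simp add: blinfun.diff_left)
  qed
  have VE: "E D (V x) = V (E D x)" for x
  proof -
   have "(%s. T s o\<^sub>L (?f (lam s) *\<^sub>C T s)) = (%s. (?f (lam s) *\<^sub>C T s) o\<^sub>L T s)"
    by (intro ext blinfun_eqI) (simp add: T_def Q_scale scaleC_scaleC mult_ac)
   then have "P ?K o\<^sub>L V = V o\<^sub>L P ?K"
    unfolding P_def V_def opint_mult[OF opfun_T1[OF K] F, symmetric] opint_mult[OF F opfun_T1[OF K], symmetric] by simp
   from arg_cong[OF this, of "%T. T (pr (img D) x)"] show ?thesis
    using cm_apply_pr[OF cm_opint[OF F] img_borel[OF D], of x] by (simp add: E_apply V_def)
  qed
  have Y: "complex_vector.subspace (range (E D))"
   by (rule complex_vector.subspaceI) (auto simp: E_range[OF D] blinfun.zero_right blinfun.add_right E_scale[OF D] simp del: image_iff)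
  have "m : resolvent_set norm (range (E D)) (DA Int range (E D)) A"
  proof (rule resolvent_setI(1)[OF Y, where V="blinfun_apply V"])
   fix y assume y: "y : range (E D)"
   then have Ey: "E D y = y" by (simp only: E_range[OF D])
   show "A y : range (E D)" if "y : DA" using E_A[OF D that] Ey unfolding E_range[OF D] by simp
   show "V y : DA" by (rule V(1))
   show "V y : range (E D)" unfolding E_range[OF D] VE Ey ..
   show "A (V y) - m *\<^sub>C V y = y" unfolding V using Ey P_idem[OF K, of "pr (img D) y"] by (metis E_apply)
   show "norm (V y) <= norm V * norm y" by (rule norm_blinfun)
  qed
  then show False using m by (simp add: spectrum_def)
 qed
qed

end

text \<open>The inverse function theorem with constants: the lower bound \<open>c\<close> for
  difference quotients and the quadratic remainder \<open>M\<close> are needed to compare a pole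
  with its linearization.\<close>

lemma holomorphic_local_inverse:
 assumes f: "f holomorphic_on UNIV" and d: "deriv f z ~= 0" and e: "0 < e"
 shows "EX r c M. 0 < r & r <= e & 0 < c & 0 <= M & inj_on f (ball z r) & open (f ` ball z r) &
  (ALL l:ball z r. c <= cmod (deriv f l) & (ALL m:ball z r. c * cmod (m - l) <= cmod (f m - f l) &
   cmod (f m - f l - deriv f l * (m - l)) <= M * (cmod (m - l))^2))"
proof -
 note f' = holomorphic_deriv[OF f open_UNIV]
 have D: "(f has_field_derivative deriv f w) (at w within U)" "(deriv f has_field_derivative deriv (deriv f) w) (at w within U)" for w U
  by (rule has_field_derivative_at_within[OF holomorphic_derivI[OF _ open_UNIV UNIV_I]], rule f f')+
 have "bounded (deriv (deriv f) ` cball z 1)"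
  by (intro compact_imp_bounded compact_continuous_image continuous_on_subset[OF holomorphic_on_imp_continuous_on[OF holomorphic_deriv[OF f' open_UNIV]]]) auto
 then obtain M0 where M0: "ALL w:deriv (deriv f) ` cball z 1. cmod w <= M0" unfolding bounded_iff by blast
 define M where "M = max 0 M0"
 have lip: "cmod (deriv f u - deriv f v) <= M * cmod (u - v)" if "u : cball z 1" "v : cball z 1" for u v
  by (rule field_differentiable_bound[OF convex_cball D(2) _ that]) (use M0 in "auto simp: M_def le_max_iff_disj")
 define c where "c = cmod (deriv f z) / 4"
 \<comment> \<open>By this radius f' varies by at most \<open>c\<close>, a quarter of |f' z|, over
   the ball, and the quadratic remainder costs at most c |m - l|.\<close>
 define r where "r = min (min e 1) (c / (2 * (M + 1)))"
 have c: "0 < c" using d by (simp add: c_def)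
 have M: "0 <= M" by (simp add: M_def)
 have r: "0 < r" "r <= e" "r <= 1" using c M e by (simp_all add: r_def)
 have Mr: "M * (2 * r) <= c"
 proof -
  have "(M + 1) * (2 * r) <= (M + 1) * (2 * (c / (2 * (M + 1))))" using M by (intro mult_left_mono) (auto simp: r_def)
  also have "... = c" using M by (simp add: field_simps)
  finally show ?thesis using r(1) by (simp add: algebra_simps)
 qed
 have sub: "ball z r <= cball z 1" using r by auto
 have dl: "2 * c <= cmod (deriv f l)" if l: "l : ball z r" for l
 proof -
  have "cmod (deriv f z - deriv f l) <= M * cmod (z - l)" by (rule lip) (use l sub in auto)
  also have "... <= M * (2 * r)" using l r M by (intro mult_left_mono) (auto simp: dist_norm)
  also note Mr
  finally show ?thesis using norm_triangle_ineq2[of "deriv f z" "deriv f l"] norm_ge_zero[of "deriv f l"] unfolding c_def by linarith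
 qed
 have taylor: "cmod (f m - f l - deriv f l * (m - l)) <= M * (cmod (m - l))^2" if l: "l : ball z r" "m : ball z r" for l m
 proof -
  have "cmod ((f m - deriv f l * m) - (f l - deriv f l * l)) <= (M * cmod (m - l)) * cmod (m - l)"
  proof (rule field_differentiable_bound[OF convex_closed_segment])
   fix w assume w: "w : closed_segment l m"
   show "((%w. f w - deriv f l * w) has_field_derivative (deriv f w - deriv f l)) (at w within closed_segment l m)"
    by (auto intro!: derivative_eq_intros D)
   have "w : ball z r" using closed_segment_subset[OF l convex_ball] w by blast
   then have "cmod (deriv f w - deriv f l) <= M * cmod (w - l)" using sub l by (intro lip) auto
   also have "... <= M * cmod (m - l)" using segment_bound(1)[OF w] M by (intro mult_left_mono) (auto simp: norm_minus_commute)
   finally show "cmod (deriv f w - deriv f l) <= M * cmod (m - l)" .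
  qed auto
  then show ?thesis by (simp add: power2_eq_square algebra_simps)
 qed
 have lower: "c * cmod (m - l) <= cmod (f m - f l)" if l: "l : ball z r" "m : ball z r" for l m
 proof -
  have "cmod (m - l) <= 2 * r" using dist_triangle2[of m l z] l by (auto simp: dist_norm norm_minus_commute)
  then have "M * (cmod (m - l))^2 <= c * cmod (m - l)"
   using mult_right_mono[OF order_trans[OF mult_left_mono[OF _ M] Mr], of "cmod (m - l)" "cmod (m - l)"] by (simp add: power2_eq_square mult.assoc)
  moreover have "2 * c * cmod (m - l) <= cmod (deriv f l * (m - l))" unfolding norm_mult using dl[OF l(1)] by (intro mult_right_mono) auto
  ultimately show ?thesis using taylor[OF l] norm_triangle_ineq2[of "deriv f l * (m - l)" "deriv f l * (m - l) - (f m - f l)"]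
   by (simp add: norm_minus_commute)
 qed
 have inj: "inj_on f (ball z r)" by (rule inj_onI) (use lower c in "force simp: mult_le_0_iff")
 have "open (f ` ball z r)" by (rule open_mapping_thm3[OF holomorphic_on_subset[OF f] open_ball inj]) simp
 moreover have "c <= cmod (deriv f l)" if "l : ball z r" for l using dl[OF that] c by simp
 ultimately show ?thesis using r(1,2) c M inj taylor lower by (intro exI[of _ r] exI[of _ c] exI[of _ M] conjI ballI)
qed

section \<open>The spectrum on the complementary subspace\<close>

context regular_arc
begin

lemma complement_range: "D : borel0 Xi ==> y : (%x. x - E D x) ` UNIV \<longleftrightarrow> E D y = 0"
 by (auto simp: blinfun.diff_right E_idem intro: range_eqI[of _ _ y])

text \<open>The solution lies in the complement by itself: \<open>E D\<close> commutes with
  \<open>A\<close>, so A - m maps E D z to E D y = 0 and is injective.\<close>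

lemma complement_resolvent:
 assumes D: "D : borel0 Xi" and W: "!!y. E D y = 0 ==> EX z:DA. A z - m *\<^sub>C z = y & norm z <= K * norm y"
 shows "m ~: spectrum_restriction norm DA A ((%x. x - E D x) ` UNIV)"
proof -
 let ?Y = "(%x. x - E D x) ` UNIV"
 note R = complement_range[OF D]
 obtain V where V: "!!y. E D y = 0 ==> V y : DA" "!!y. E D y = 0 ==> A (V y) - m *\<^sub>C V y = y" "!!y. E D y = 0 ==> norm (V y) <= K * norm y"
  using W by metis
 have A0: "A 0 = 0" using A_scale[OF DA_intros(1), of 0] by simp
 have sub: "complex_vector.subspace ?Y"
  by (rule complex_vector.subspaceI; unfold R) (simp_all add: blinfun.zero_right blinfun.add_right E_scale[OF D])
 have "m : resolvent_set norm ?Y (DA Int ?Y) A"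
 proof (rule resolvent_setI(1)[OF sub, where V=V])
  show "A x : ?Y" if "x : DA" "x : ?Y" for x using that E_A[OF D that(1)] A0 unfolding R by simp
  fix y assume "y : ?Y"
  then have y: "E D y = 0" unfolding R .
  note Vy = V[OF y]
  show "V y : DA" "A (V y) - m *\<^sub>C V y = y" "norm (V y) <= K * norm y" by (rule Vy)+
  have "A (E D (V y)) - m *\<^sub>C E D (V y) = E D (A (V y) - m *\<^sub>C V y)"
   using E_A[OF D Vy(1)] by (simp add: blinfun.diff_right E_scale[OF D])
  then show "V y : ?Y" unfolding R using A_injective[OF E_DA[OF D], of "V y" m] Vy(2) y by simp
 qed
 then show ?thesis by (simp add: spectrum_def)
qed

text \<open>A uniform bound of the resolvents on the complement turns the resolvent identity into a
  Cauchy estimate. The limit solves the equation at \<open>m\<close>, since \<open>A\<close> is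
  closed.\<close>

lemma res_limit:
 assumes D: "D : borel0 Xi" and l: "l ----> m" "!!n. disc (l n) ~: spec"
  and K: "!!n y. E D y = 0 ==> norm (res (l n) y) <= K * norm y" "0 <= K" and y: "E D y = 0"
 shows "EX z:DA. A z - m *\<^sub>C z = y & norm z <= K * norm y"
proof -
 define z where "z n = res (l n) y" for n
 have z: "z n : DA" "A (z n) - l n *\<^sub>C z n = y" "norm (z n) <= K * norm y" "E D (z n) = 0" for n
  using res_props[OF l(2)[of n]] K y E_res[OF D l(2)[of n], of y] by (simp_all add: z_def blinfun.zero_right)
 have d: "norm (z n - z k) <= K * K * norm y * cmod (l n - l k)" for n k
 proof -
  note r = res_props[OF l(2)[of n]]
  have "z n - z k = (l n - l k) *\<^sub>C res (l n) (z k)"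
  proof (rule A_shift_inj[where l="l n"])
   show "A (z n - z k) - l n *\<^sub>C (z n - z k) = A ((l n - l k) *\<^sub>C res (l n) (z k)) - l n *\<^sub>C (l n - l k) *\<^sub>C res (l n) (z k)"
    unfolding A_shift_linear(2)[OF r(1)] r(2) using z(2)[of n] z(2)[of k]
    by (simp add: A_diff z(1) scaleC_algebra algebra_simps)
  qed (simp_all add: DA_intros z(1) r(1))
  then have "norm (z n - z k) = cmod (l n - l k) * norm (res (l n) (z k))" by (simp only: norm_scaleC)
  also have "... <= cmod (l n - l k) * (K * (K * norm y))"
   using order_trans[OF K(1)[OF z(4)[of k], of n] mult_left_mono[OF z(3)[of k] K(2)]] by (intro mult_left_mono) auto
  finally show ?thesis by (simp add: mult_ac)
 qed
 have "Cauchy z"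
 proof (rule CauchyI)
  fix e :: real assume e: "0 < e"
  let ?C = "K * K * norm y + 1"
  have C: "0 < ?C" using K(2) by (simp add: add_nonneg_pos)
  obtain N where N: "!!n k. N <= n ==> N <= k ==> cmod (l n - l k) < e / ?C"
   using CauchyD[OF LIMSEQ_imp_Cauchy[OF l(1)], of "e / ?C"] e C by auto
  have "norm (z n - z k) < e" if "N <= n" "N <= k" for n k
  proof -
   have "norm (z n - z k) <= ?C * cmod (l n - l k)" by (rule order_trans[OF d]) (simp add: mult_right_mono)
   also have "... < e" using N[OF that] C by (simp add: pos_less_divide_eq mult.commute)
   finally show ?thesis .
  qed
  then show "EX N. ALL n>=N. ALL k>=N. norm (z n - z k) < e" by blast
 qed
 then obtain w where w: "z ----> w" using Cauchy_convergent convergent_def by blast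
 have "(%n. y + l n *\<^sub>C z n) ----> y + m *\<^sub>C w" by (intro tendsto_add tendsto_const sc.tendsto w l(1))
 moreover have "A (z n) = y + l n *\<^sub>C z n" for n using z(2)[of n] by (simp add: algebra_simps)
 ultimately have "(%n. A (z n)) ----> y + m *\<^sub>C w" by simp
 from A_closed[OF z(1) w this] have "w : DA" "A w - m *\<^sub>C w = y" by simp_all
 moreover have "norm w <= K * norm y" by (rule LIMSEQ_le_const2[OF tendsto_norm[OF w]]) (use z(3) in auto)
 ultimately show ?thesis by blast
qed

text \<open>Near an interior point \<open>m\<close> of \<open>D\<close>, the difference of the two resolvent kernels \<open>Q l / (s - disc l)\<close> and
  \<open>T s / (lam s - l)\<close> is bounded uniformly in \<open>s\<close> and \<open>l\<close>: the poles cancel.\<close>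

lemma E_spectrum_complement_interior:
 assumes D: "D : borel0 Xi" and mD: "m : D" and e: "0 < e" "ball m e Int spectrum norm UNIV DA A <= D"
 shows "EX K. ALL y. E D y = 0 --> (EX z:DA. A z - m *\<^sub>C z = y & norm z <= K * norm y)"
proof -
 have mX: "m : Xi" using mD borel0D[OF D] by blast
 obtain r c M where r: "0 < r" "r <= e" "0 < c" "0 <= M" "inj_on disc (ball m r)" "open (disc ` ball m r)"
  and est: "!!l. l : ball m r ==> c <= cmod (deriv disc l)"
   "!!l k. l : ball m r ==> k : ball m r ==> c * cmod (k - l) <= cmod (disc k - disc l) & cmod (disc k - disc l - deriv disc l * (k - l)) <= M * (cmod (k - l))^2"
  using holomorphic_local_inverse[OF disc_holo Xi_deriv[OF mX] e(1)] by blast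
 obtain s0 where s0: "disc m = cor s0" "abs s0 <= 2" using Xi_disc[OF mX] by (auto simp: spec_iff)
 have "disc m : disc ` ball m r" using r(1) by simp
 then obtain et where et: "0 < et" "cball (disc m) et <= disc ` ball m r" using r(6) open_contains_cball by blast
 define I where "I = {-2..2} Int {s0 - et..s0 + et}"
 have Ib: "I : sets borel" "compact I" "I <= {-2..2}" by (auto simp: I_def compact_Int_closed)
 \<comment> \<open>A preimage of \<open>s\<close> in the ball has nonzero derivative, so it is in
   the spectrum by \<open>disc_spectrum\<close>; spectral points of the ball belong to
   \<open>D\<close>.\<close>
 have I: "s : img D" "lam s : ball m r" "disc (lam s) = cor s" if s: "s : I" for s
 proof -
  have "cor s : cball (disc m) et" using s by (auto simp: I_def s0 dist_norm abs_le_iff simp flip: of_real_diff)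
  then obtain l where l: "l : ball m r" "disc l = cor s" using et(2) by force
  have "disc l : spec" "deriv disc l ~= 0" using s est(1)[OF l(1)] r(3) by (auto simp: spec_def I_def l(2))
  then have "l : D" using disc_spectrum e(2) l(1) r(2) by force
  then obtain t where "t : img D" "lam t = l" "disc l = cor t" using img_I borel0D(2)[OF D] by blast
  then show "s : img D" "lam s : ball m r" "disc (lam s) = cor s" using l by auto
 qed
 define K where "K = lam ` I"
 have lc: "continuous_on I lam" using continuous_on_subset[OF arc_img(2)[of "closure D"]] I(1) img_mono[OF closure_subset] borel0D[OF D] by blast
 have KD: "K <= D" using I(1) img_lam(1) borel0D(2)[OF D] by (auto simp: K_def)
 then have K: "arc K" using compact_continuous_image[OF lc Ib(2)] borel0D[OF D] by (auto simp: K_def)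
 have lamI: "lam s : K" if "s : I" for s using that by (simp add: K_def)
 have imgK: "img K = I"
 proof
  show "I <= img K" using I(3) lamI by (force simp: img_def intro: image_eqI[OF sym])
  show "img K <= I"
  proof
   fix s assume "s : img K"
   then obtain t where "t : I" "cor s = disc (lam t)" by (auto simp: img_def K_def)
   then show "s : I" using I(3)[of t] by simp
  qed
 qed
 obtain R where R: "Xi <= cball 0 R" "ball m r <= cball 0 R"
 proof -
  obtain R1 where "Xi <= cball 0 R1" using Xi_bounded by (auto simp: bounded_iff subset_iff)
  moreover obtain R2 where "ball m r <= cball 0 R2" using bounded_ball[of m r] unfolding bounded_iff by (metis mem_cball_0 subsetI)
  ultimately show ?thesis using that[of "max R1 R2"] by force
 qed
 obtain L where L: "0 <= L" "!!l k. l : cball 0 R ==> k : cball 0 R ==> norm (Q l - Q k) <= L * cmod (l - k)" using Q_lip[of R] by blast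
 obtain B where "ALL V:Q ` cball 0 R. norm V <= B"
  using compact_imp_bounded[OF compact_continuous_image[OF Q_continuous compact_cball[of 0 R]]] unfolding bounded_iff by blast
 then have B: "norm (Q l) <= B" if "l : cball 0 R" for l using that by blast
 have B0: "0 <= B" using B[of m] R(2) r(1) norm_ge_zero[of "Q m"] by (meson centre_in_ball order_trans subsetD)
 \<comment> \<open>L / c bounds (Q l - Q (lam s)) / (s - disc l); the other term bounds the
   difference of the reciprocals of the denominator and its linearization, times norm (Q (lam
   s)).\<close>
 define C where "C = L / c + M / (c * c) * B"
 define H where "H l s = (1 / (cor s - disc l)) *\<^sub>C Q l - (1 / (lam s - l)) *\<^sub>C T s" for l s
 have H: "norm (H l s) <= C" if l: "l : ball m r" "disc l ~: spec" and s: "s : I" for l s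
 proof -
  let ?k = "lam s"
  \<comment> \<open>\<open>x\<close> is the denominator of the resolvent kernel and \<open>z\<close>
    its linearization. They differ by O(t^2), while both are at least c t, so 1 / x - 1 / z stays
    bounded.\<close>
  define x where "x = cor s - disc l"
  define z where "z = deriv disc ?k * (?k - l)"
  define t where "t = cmod (?k - l)"
  have x: "c * t <= cmod x" "cmod (x - z) <= M * t^2"
   using est(2)[OF l(1) I(2)[OF s]] est(2)[OF I(2)[OF s] l(1)] I(3)[OF s] norm_minus_commute[of "disc l - disc ?k" "deriv disc ?k * (l - ?k)"]
   by (simp_all add: x_def z_def t_def norm_minus_commute algebra_simps)
  have "?k ~= l" using l(2) I(3)[OF s] s by (auto simp: spec_def I_def)
  then have t0: "0 < t" by (simp add: t_def)
  then have t: "0 < t" "x ~= 0" using x(1) mult_pos_pos[OF r(3) t0] by auto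
  have z: "c * t <= cmod z" unfolding z_def norm_mult t_def using est(1)[OF I(2)[OF s]] by (intro mult_right_mono) auto
  then have z0: "z ~= 0" using mult_pos_pos[OF r(3) t0] by auto
  have g: "cmod (1 / x - 1 / z) <= M / (c * c)"
  proof -
   have "1 / x - 1 / z = (z - x) / (x * z)" using t(2) z0 by (simp add: field_simps)
   then have "cmod (1 / x - 1 / z) = cmod (x - z) / (cmod x * cmod z)" by (simp add: norm_divide norm_mult norm_minus_commute)
   also have "... <= (M * t^2) / ((c * t) * (c * t))" using x z t r(3,4) by (intro frac_le mult_mono) auto
   also have "... = M / (c * c)" using t by (simp add: power2_eq_square)
   finally show ?thesis .
  qed
  have ball: "l : cball 0 R" "?k : cball 0 R" using l(1) I(2)[OF s] R(2) by auto
  have "H l s = (1 / x) *\<^sub>C (Q l - Q ?k) + (1 / x - 1 / z) *\<^sub>C Q ?k"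
   by (simp add: H_def T_def x_def[symmetric] z_def scaleC_algebra mult.commute)
  then have "norm (H l s) <= 1 / cmod x * norm (Q l - Q ?k) + cmod (1 / x - 1 / z) * norm (Q ?k)"
   using norm_triangle_ineq[of "(1 / x) *\<^sub>C (Q l - Q ?k)" "(1 / x - 1 / z) *\<^sub>C Q ?k"] by (simp add: norm_scaleC norm_divide)
  also have "... <= 1 / (c * t) * (L * t) + M / (c * c) * B"
   using L(2)[OF ball] B[OF ball(2)] x(1) t r(3,4) g by (intro add_mono mult_mono frac_le) (auto simp: t_def norm_minus_commute)
  also have "... = C" using t r(3) by (simp add: C_def)
  finally show ?thesis .
 qed
 \<comment> \<open>Approaching with Re (disc l) = s0 keeps \<open>disc l\<close> at distance at
   least \<open>et\<close> from the points of [-2, 2] outside \<open>I\<close>.\<close>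
 have bound: "norm (res l y) <= (B / et + C) * norm y" if l: "l : ball m r" "disc l ~: spec" "Re (disc l) = s0" and y: "E D y = 0" for l y
 proof -
  let ?u = "%s. 1 / (cor s - disc l)" and ?f = "%k. 1 / (k - l)"
  note u = resolvent_function[OF l(2)]
  have lK: "k - l ~= 0" if "k : K" for k using that l(2) I(3) by (auto simp: K_def spec_def I_def)
  have f: "continuous_on K ?f" using lK by (intro continuous_intros) auto
  have uc: "continuous_on I ?u" using u(2) Ib(3) by (intro continuous_intros) (auto simp: abs_le_iff subset_iff)
  note F = opfun_T[OF K f, unfolded imgK]
  note sc = opint_scalar[OF Ib(2,3) uc]
  have o1: "opfun I (%s. ?u s *\<^sub>C id_blinfun)" by (intro opfun_intros Ib uc cm_intros)
  have o2: "opfun I (%s. Q l o\<^sub>L (?u s *\<^sub>C id_blinfun))" by (rule opfun_intros(4)[OF opfun_intros(5)[OF Ib(2,3) cm_Q] o1])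
  have Heq: "H l = (%s. (Q l o\<^sub>L (?u s *\<^sub>C id_blinfun)) - ?f (lam s) *\<^sub>C T s)"
   by (intro ext blinfun_eqI) (simp add: H_def blinfun.diff_left Q_scale)
  define V where "V = opint I (%s. ?f (lam s) *\<^sub>C T s)"
  have V: "res l (P K x) = V x" for x
  proof (rule A_shift_inj[where l=l])
   show "V x : DA" unfolding V_def using A_opint_T(1)[OF K f] by (simp add: imgK)
   have "A (V x) = opint I (%s. T s + l *\<^sub>C (?f (lam s) *\<^sub>C T s)) x"
   proof -
    have "A (V x) = opint I (%s. (lam s * ?f (lam s)) *\<^sub>C T s) x" unfolding V_def using A_opint_T(2)[OF K f] by (simp add: imgK)
    also have "... = opint I (%s. T s + l *\<^sub>C (?f (lam s) *\<^sub>C T s)) x"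
     unfolding opint_def rsum_def
    proof (intro arg_cong2[where f=blinfun_apply] arg_cong[where f=lim] ext sum.cong refl arg_cong2[where f=blinfun_compose])
     fix k t assume "t : tag I k ` I"
     then have "lam t - l ~= 0" using lK[OF lamI] tag(1) by blast
     then have "lam t * ?f (lam t) = 1 + l * ?f (lam t)" by (simp add: field_simps)
     then show "(lam t * ?f (lam t)) *\<^sub>C T t = T t + l *\<^sub>C (?f (lam t) *\<^sub>C T t)" by (simp only: scaleC_add_left scaleC_scaleC scaleC_one)
    qed
    finally show ?thesis .
   qed
   then show "A (res l (P K x)) - l *\<^sub>C res l (P K x) = A (V x) - l *\<^sub>C V x"
    using opint_add[OF opfun_T1[OF K, unfolded imgK] opfun_intros(3)[OF F continuous_on_const]] opint_cmult[OF F, of l] res_props(2)[OF l(2)]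
    by (simp add: V_def P_def imgK blinfun.add_left)
  qed (rule res_props[OF l(2)])
  let ?w = "pr I y"
  have ci: "calc ?u ?w = opint I (%s. ?u s *\<^sub>C id_blinfun) ?w"
  proof -
   have "calc ?u ?w = calc (%s. ?u s * indicator I s) y" unfolding pr_def by (rule calc_mult[symmetric, OF u(1) bfun_indicator[OF Ib(1)]])
   also have "... = calc (%s. indicator I s * ?u s * indicator I s) y"
    by (intro calc_cong bfun_mult u(1) sc(1) bfun_indicator Ib) (simp add: indicator_def)
   also have "... = opint I (%s. ?u s *\<^sub>C id_blinfun) ?w" unfolding sc(2) pr_def by (rule calc_mult[OF sc(1) bfun_indicator[OF Ib(1)]])
   finally show ?thesis .
  qed
  have PE: "P K ?w = 0"
  proof -
   have "P K ?w = P (closure D) ?w" unfolding P_def imgK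
    by (rule opint_restrict[OF opfun_T1 Ib(2) _ Ib(1) order_refl]) (use borel0D[OF D] I(1) img_mono[OF closure_subset] in blast)+
   also have "... = P (closure D) (pr (img D) ?w)"
   proof -
    have "img D Int I = I" using I(1) by blast
    then show ?thesis by (simp add: pr_pr img_borel[OF D] Ib)
   qed
   also have "... = pr I (E D y)" using cm_apply_pr[OF cm_E[OF D] Ib(1)] by (simp add: E_apply)
   finally show ?thesis using y by (simp add: blinfun.zero_right)
  qed
  \<comment> \<open>\<open>P K ?w\<close> is 0, hence so is \<open>V ?w\<close>; subtracting it does
    not change \<open>res l ?w\<close> but cancels the pole.\<close>
  have near: "res l ?w = opint I (H l) ?w"
   using V[of ?w] unfolding PE Heq opint_diff[OF o2 F] opint_compose[OF o1 cm_Q]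
   by (simp add: blinfun.diff_left res_def ci V_def[symmetric] blinfun.zero_right)
  have far: "norm (res l (y - ?w)) <= B / et * norm y"
  proof -
   have "calc ?u (y - ?w) = calc (%s. ?u s * indicator (- I) s) y"
   proof -
    have "y - ?w = calc (%s. 1 - indicator I s) y" by (simp add: pr_def calc_diff bfun_const bfun_indicator Ib calc_const)
    also have "... = pr (- I) y" unfolding pr_def by (rule arg_cong2[where f="%f. blinfun_apply (calc f)"]) (auto simp: indicator_def)
    finally show ?thesis unfolding pr_def using calc_mult[OF u(1) bfun_indicator[of "- I"], of y] Ib(1) by simp
   qed
   also have "norm ... <= 1 / et * norm y"
   proof (rule calc_apply_norm)
    show "(%s. ?u s * indicator (- I) s) : borel_measurable borel" using bfun_mult[OF u(1) bfun_indicator[of "- I"]] Ib(1) by (simp add: bfun_def)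
    fix s :: real assume s: "abs s <= 2"
    show "cmod (?u s * indicator (- I) s) <= 1 / et"
    proof (cases "s : I")
     case False
     then have "et <= abs(Re (cor s - disc l))" using s l(3) by (auto simp: I_def)
     then have "et <= cmod (cor s - disc l)" using abs_Re_le_cmod order_trans by blast
     then show ?thesis using et(1) False by (simp add: norm_divide frac_le)
    qed (use et in simp)
   qed (use et in simp)
   finally have c: "norm (calc ?u (y - ?w)) <= 1 / et * norm y" .
   have "norm (Q l (calc ?u (y - ?w))) <= B * (1 / et * norm y)"
    by (rule order_trans[OF norm_blinfun mult_mono]) (use c B[of l] R(2) l(1) B0 in auto)
   then show ?thesis by (simp add: res_def)
  qed
  have HO: "opfun I (H l)" unfolding Heq by (rule opfun_intros(2)[OF o2 F])
  have C0: "0 <= C" using L r B0 by (simp add: C_def)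
  have "norm (res l ?w) <= C * norm y"
   unfolding near using opint_norm[OF HO C0] H[OF l(1,2)] pr_apply_norm[OF Ib(1), of y] C0
   by (intro order_trans[OF norm_blinfun mult_mono]) auto
  then show ?thesis using far norm_triangle_ineq[of "res l (y - ?w)" "res l ?w"]
   by (simp add: blinfun.add_right[symmetric] distrib_right)
 qed
 \<comment> \<open>The image of the ball contains a disc around \<open>disc m\<close>, in particular
   the vertical segment above it.\<close>
 have "EX l. l : ball m r & disc l = Complex s0 (et / Suc n)" for n
 proof -
  have "disc m - Complex s0 (et / Suc n) = - (\<i> * cor (et / Suc n))" by (simp add: complex_eq_iff s0)
  then have "dist (disc m) (Complex s0 (et / Suc n)) = et / Suc n" using et(1) by (simp only: dist_norm norm_minus_cancel norm_mult norm_of_real) simp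
  also have "... <= et" using et(1) by (simp add: divide_le_eq)
  finally have "Complex s0 (et / Suc n) : disc ` ball m r" using et(2) by auto
  then show ?thesis by force
 qed
 then obtain l where l: "!!n. l n : ball m r" "!!n. disc (l n) = Complex s0 (et / real (Suc n))" by metis
 have ls: "disc (l n) ~: spec" for n using et(1) by (auto simp: l(2) spec_def complex_eq_iff)
 have "(%n. l n - m) ----> 0"
 proof (rule Lim_null_comparison[OF always_eventually], intro allI)
  fix n
  have "disc (l n) - disc m = \<i> * cor (et / Suc n)" by (simp add: complex_eq_iff s0 l)
  then have "cmod (disc (l n) - disc m) = et / Suc n" using et(1) by (simp only: norm_mult norm_of_real) simp
  then have "c * norm (l n - m) <= et / Suc n" using est(2)[of m "l n"] l(1)[of n] r(1) by simp
  then have "norm (l n - m) <= et / Suc n / c" using r(3) by (subst pos_le_divide_eq) (simp_all add: mult.commute del: of_nat_Suc)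
  then show "norm (l n - m) <= et / c * inverse (real (Suc n))" by (simp add: divide_inverse mult_ac)
  show "(%n. et / c * inverse (real (Suc n))) ----> 0" by (rule tendsto_eq_rhs[OF tendsto_mult[OF tendsto_const LIMSEQ_inverse_real_of_nat]]) simp
 qed
 then have lm: "l ----> m" by (rule LIM_zero_cancel)
 have "0 <= B / et + C" using B0 et L r by (simp add: C_def)
 then have "EX z:DA. A z - m *\<^sub>C z = y & norm z <= (B / et + C) * norm y" if "E D y = 0" for y
  by (intro res_limit[OF D lm ls bound[OF l(1) ls]] that) (simp_all add: l(2))
 then show ?thesis by blast
qed

text \<open>A point outside the closure is either regular for \<open>A\<close>, where the full
  resolvent gives the bound, or a point of \<open>D\<close> near which all spectrum belongs to
  \<open>D\<close>.\<close>

lemma E_spectrum_complement: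
 assumes D: "D : borel0 Xi"
 shows "spectrum_restriction norm DA A ((%x. x - E D x) ` UNIV) <= closure (spectrum norm UNIV DA A - D)"
proof (rule subsetI, rule ccontr)
 let ?S = "spectrum norm UNIV DA A"
 fix m assume m: "m : spectrum_restriction norm DA A ((%x. x - E D x) ` UNIV)" and nm: "m ~: closure (?S - D)"
 have "EX K. ALL y. E D y = 0 --> (EX z:DA. A z - m *\<^sub>C z = y & norm z <= K * norm y)"
 proof (cases "m : ?S")
  case True
  then have mD: "m : D" using nm closure_subset[of "?S - D"] by blast
  obtain e where e: "0 < e" "ball m e <= - closure (?S - D)" using nm open_contains_ball[of "- closure (?S - D)"] by blast
  then have "ball m e Int ?S <= D" using closure_subset[of "?S - D"] by blast
  then show ?thesis by (rule E_spectrum_complement_interior[OF D mD e(1)])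
 next
  case False
  then have r: "bij_betw (%x. A x - m *\<^sub>C x) DA UNIV" "the_inv_into DA (%x. A x - m *\<^sub>C x) : bounded_operators norm UNIV"
   by (auto simp: spectrum_def resolvent_set_def)
  then obtain K where K: "!!x. norm (the_inv_into DA (%x. A x - m *\<^sub>C x) x) <= K * norm x" by (auto simp: bounded_operators_def)
  have "EX z:DA. A z - m *\<^sub>C z = y & norm z <= K * norm y" for y
   using K[of y] f_the_inv_into_f_bij_betw[OF r(1), of y] the_inv_into_into[OF bij_betw_imp_inj_on[OF r(1)], of y DA] r(1)
   by (auto simp: bij_betw_def)
  then show ?thesis by blast
 qed
 then show False using complement_resolvent[OF D] m by blast
qed

theorem local_spectral_function_E:
 "local_spectral_function norm UNIV DA A Xi (%D. blinfun_apply (E D))"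
 unfolding local_spectral_function_def
proof (intro conjI ballI allI impI)
 show "complex_banach norm (UNIV :: 'h set)"
 proof
  show "EX x:UNIV. (%n. norm (s n - x)) ----> 0" if "!!e. 0 < e ==> EX N. ALL m>=N. ALL n>=N. norm (s m - s n) < e" for s :: "nat => 'h"
   using that Cauchy_convergent[OF CauchyI, of s] by (auto simp: convergent_def LIM_zero_iff tendsto_norm_zero_iff)
 qed (auto simp: complex_vector.subspace_UNIV norm_scaleC norm_triangle_ineq)
 fix D :: "nat => complex set" and f
 assume D: "range D <= borel0 Xi & disjoint_family D & (\<Union>k. D k) : borel0 Xi"
 have "(%n. \<Sum>k<n. E (D k) f) ----> E (\<Union>k. D k) f" by (rule E_additive) (use D in auto)
 then show "(%n. norm ((\<Sum>k<n. E (D k) f) - E (\<Union>k. D k) f)) ----> 0" by (simp add: tendsto_norm_zero_iff LIM_zero_iff)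
qed (simp_all add: closed_A Xi_borel E_double_commutant E_idem E_DA image_subset_iff E_mult E_spectrum_range E_spectrum_complement)

end

section \<open>The weighted space\<close>

lemma ae_class_eq_iff: "ae_class f = ae_class g \<longleftrightarrow> (AE x. f x = g x)"
 by (rule ae_fun.abs_eq_iff)

lemma ae_class_rep: "ae_class (ae_rep F) = F"
 using Quotient_abs_rep[OF Quotient_ae_fun] .

lemma AE_rep_class: "AE x. ae_rep (ae_class f) x = f x"
 using ae_class_rep[of "ae_class f"] unfolding ae_class_eq_iff .

lemma ae_class_arith:
 "ae_class f + ae_class g = ae_class (%x. f x + g x)" "ae_class f - ae_class g = ae_class (%x. f x - g x)"
 "c *\<^sub>C ae_class f = ae_class (%x. c * f x)" "0 = ae_class (%_. 0)" "- ae_class f = ae_class (%x. - f x)"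
 by (simp_all add: plus_ae_fun.abs_eq minus_ae_fun.abs_eq scaleC_ae_fun.abs_eq zero_ae_fun_def uminus_ae_fun.abs_eq)

lemma borel_measurable_lebesgue_cong_AE:
 fixes f g :: "real => complex"
 assumes f: "f : lmeas" and ae: "AE x. f x = g x"
 shows "g : lmeas"
proof -
 obtain N where N: "N : null_sets lebesgue" "{x. f x ~= g x} <= N" using ae by (auto simp: eventually_ae_filter)
 then have n: "negligible {x. f x ~= g x}" by (metis negligible_iff_null_sets negligible_subset)
 show ?thesis
 proof (rule measurableI)
  fix A :: "complex set" assume A: "A : sets borel"
  have "negligible (sym_diff (f -` A) (g -` A))" by (rule negligible_subset[OF n]) auto
  then show "g -` A Int space lebesgue : sets lebesgue" using sets_negligible_symdiff measurable_sets[OF f A] by simp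
 qed auto
qed

lemma sq_integrableD: "f : sq_integrable w ==> f : lmeas"
 "f : sq_integrable w ==> lint (%x. (cmod (f x))^2 * abs(w x))"
 by (simp_all add: sq_integrable_def)

locale weight =
 fixes w :: "real => real"
 assumes w_measurable: "w : lmeas" and w_nonzero: "AE x. w x ~= 0"
begin

lemma sq_measurable: "f : lmeas ==> (%x. (cmod (f x))^2 * abs(w x)) : lmeas"
 by (intro borel_measurable_times borel_measurable_abs w_measurable) measurable

lemma sq_integrable_cong_AE:
 assumes f: "f : sq_integrable w" and ae: "AE x. f x = g x"
 shows "g : sq_integrable w"
proof -
 have g: "g : lmeas" using borel_measurable_lebesgue_cong_AE[OF sq_integrableD(1)[OF f] ae] .
 have "lint (%x. (cmod (g x))^2 * abs(w x))"
  by (rule integrable_cong_AE_imp[OF sq_integrableD(2)[OF f] sq_measurable[OF g]]) (use ae in "auto elim: eventually_mono")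
 then show ?thesis using g by (simp add: sq_integrable_def)
qed

lemma L2_class: "ae_class f : L2 w \<longleftrightarrow> f : sq_integrable w"
 unfolding L2_def using sq_integrable_cong_AE by (auto simp: ae_class_eq_iff eq_commute elim!: eventually_mono)

lemma sq_integrable_bound:
 assumes "g : lmeas" "lint h" "AE x. (cmod (g x))^2 * abs(w x) <= h x"
 shows "g : sq_integrable w"
proof -
 have "AE x. norm ((cmod (g x))^2 * abs(w x)) <= norm (h x)" using assms(3) by eventually_elim simp
 from Bochner_Integration.integrable_bound[OF assms(2) sq_measurable[OF assms(1)] this] assms(1)
 show ?thesis by (simp add: sq_integrable_def)
qed

lemma sq_integrable_add: assumes f: "f : sq_integrable w" and g: "g : sq_integrable w" shows "(%x. f x + g x) : sq_integrable w"
proof (rule sq_integrable_bound)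
 show "(%x. f x + g x) : lmeas" using f g by (intro borel_measurable_add sq_integrableD(1))
 show "lint (%x. 2 * ((cmod (f x))^2 * abs(w x)) + 2 * ((cmod (g x))^2 * abs(w x)))"
  using f g by (intro Bochner_Integration.integrable_add integrable_mult_right sq_integrableD(2))
 have "(cmod (x + y))^2 <= 2 * (cmod x)^2 + 2 * (cmod y)^2" for x y
  using zero_le_power2[of "cmod (x - y)"] unfolding cmod_power2 by (simp add: power2_eq_square algebra_simps)
 then show "AE x. (cmod (f x + g x))^2 * abs(w x) <= 2 * ((cmod (f x))^2 * abs(w x)) + 2 * ((cmod (g x))^2 * abs(w x))"
  by (intro AE_I2) (metis (no_types) abs_ge_zero distrib_right mult.assoc mult_right_mono)
qed

lemma sq_integrable_cmult: "f : sq_integrable w ==> (%x. c * f x) : sq_integrable w"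
 unfolding sq_integrable_def by (auto simp: norm_mult power_mult_distrib mult.assoc)

lemma sq_integrable_zero: "(%_. 0) : sq_integrable w" by (simp add: sq_integrable_def)

lemma L2_subspace: "complex_vector.subspace (L2 w)"
 by (rule complex_vector.subspaceI)
  (auto simp: L2_def ae_class_arith intro: sq_integrable_add sq_integrable_cmult sq_integrable_zero)

lemma L2_norm_class:
 assumes f: "f : lmeas"
 shows "L2_norm w (ae_class f) = sqrt (LEB x. (cmod (f x))^2 * abs(w x))"
proof -
 have "ae_rep (ae_class f) : lmeas"
  using AE_rep_class[of f] by (intro borel_measurable_lebesgue_cong_AE[OF f]) (auto elim: eventually_mono)
 then have "L2_inner w (ae_class f) (ae_class f) = (LEB x. cor ((cmod (f x))^2 * abs(w x)))"
  unfolding L2_inner_def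
  by (intro integral_cong_AE) (use AE_rep_class[of f] sq_measurable[of f] sq_measurable[of "ae_rep (ae_class f)"] f in "auto simp: complex_norm_square[symmetric] of_real_mult[symmetric] simp del: of_real_mult of_real_power elim!: eventually_mono")
 then show ?thesis by (simp only: L2_norm_def integral_complex_of_real Re_complex_of_real)
qed

lemma L2_norm_sq: "f : lmeas ==> (L2_norm w (ae_class f))^2 = (LEB x. (cmod (f x))^2 * abs(w x))"
 by (simp add: L2_norm_class)

lemma L2E: assumes "F : L2 w" obtains f where "F = ae_class f" "f : sq_integrable w" "f : lmeas"
 using assms sq_integrableD(1) by (auto simp: L2_def)

lemma L2_norm_nonneg: "F : L2 w ==> 0 <= L2_norm w F" by (erule L2E) (simp add: L2_norm_class)

end

interpretation one: weight "%_. 1" by unfold_locales auto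

abbreviation square_integrable :: "(real => complex) set" where "square_integrable == sq_integrable (%_. 1)"

text \<open>The unweighted space becomes a type, so that the classes of Hilbert and Banach spaces
  apply. The weighted space is identified with it through multiplication by sqrt |w|.\<close>

typedef l2 = "L2 (%_. 1)" using complex_vector.subspace_0[OF one.L2_subspace] by blast

setup_lifting type_definition_l2

instantiation l2 :: complex_vector
begin

lift_definition zero_l2 :: l2 is 0 by (rule complex_vector.subspace_0[OF one.L2_subspace])
lift_definition plus_l2 :: "l2 => l2 => l2" is "(+)" by (rule complex_vector.subspace_add[OF one.L2_subspace])
lift_definition minus_l2 :: "l2 => l2 => l2" is "(-)" by (rule complex_vector.subspace_diff[OF one.L2_subspace])
lift_definition uminus_l2 :: "l2 => l2" is "uminus" by (rule complex_vector.subspace_neg[OF one.L2_subspace])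
lift_definition scaleC_l2 :: "complex => l2 => l2" is scaleC by (rule complex_vector.subspace_scale[OF one.L2_subspace])

instance by standard (transfer; simp add: scaleC_add_left scaleC_add_right scaleC_scaleC scaleC_one)+

end

definition cls :: "(real => complex) => l2" where "cls f = Abs_l2 (ae_class f)"

lemma Rep_cls: "f : square_integrable ==> Rep_l2 (cls f) = ae_class f"
 unfolding cls_def by (rule Abs_l2_inverse) (simp add: one.L2_class)

lemma cls_cases: obtains f where "f : square_integrable" "x = cls f"
proof -
 obtain f where "Rep_l2 x = ae_class f" "f : square_integrable" using one.L2E[OF Rep_l2] by metis
 then show ?thesis using that Rep_l2_inverse[of x] by (simp add: cls_def)
qed

lemma square_integrable_diff: "f : square_integrable ==> g : square_integrable ==> (%x. f x - g x) : square_integrable"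
 using one.sq_integrable_add[of f "%x. -1 * g x"] one.sq_integrable_cmult[of g "-1"] by simp

lemma cls_arith:
 assumes f: "f : square_integrable"
 shows "g : square_integrable ==> cls f + cls g = cls (%x. f x + g x)" "g : square_integrable ==> cls f - cls g = cls (%x. f x - g x)"
  "c *\<^sub>C cls f = cls (%x. c * f x)"
 using f by (auto simp: Rep_l2_inject[symmetric] Rep_cls plus_l2.rep_eq minus_l2.rep_eq scaleC_l2.rep_eq ae_class_arith
   one.sq_integrable_add one.sq_integrable_cmult square_integrable_diff)

instantiation l2 :: real_inner
begin

definition inner_l2 :: "l2 => l2 => real" where "inner_l2 x y = (LEB t. inner (ae_rep (Rep_l2 x) t) (ae_rep (Rep_l2 y) t))"
definition norm_l2 :: "l2 => real" where "norm_l2 x = sqrt (inner x x)"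
definition scaleR_l2 :: "real => l2 => l2" where "scaleR_l2 r x = cor r *\<^sub>C x"
definition dist_l2 :: "l2 => l2 => real" where "dist_l2 x y = norm (x - y)"
definition sgn_l2 :: "l2 => l2" where "sgn_l2 x = inverse (norm x) *\<^sub>R x"
definition uniformity_l2 :: "(l2 \<times> l2) filter" where "uniformity_l2 = (INF e\<in>{0<..}. principal {(x, y). dist x y < e})"
definition open_l2 :: "l2 set => bool" where "open_l2 U \<longleftrightarrow> (ALL x:U. eventually (%(x', y). x' = x --> y : U) uniformity)"

lemma inner_integrable: "f : square_integrable ==> g : square_integrable ==> lint (%t. inner (f t) (g t))"
proof (rule Bochner_Integration.integrable_bound)
 assume f: "f : square_integrable" and g: "g : square_integrable"
 show "lint (%t. (cmod (f t))^2 + (cmod (g t))^2)"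
  using sq_integrableD(2)[OF f] sq_integrableD(2)[OF g] by simp
 show "(%t. inner (f t) (g t)) : lmeas" using f g by (intro borel_measurable_inner sq_integrableD(1))
 have "abs(inner z v) <= (cmod z)^2 + (cmod v)^2" for z v
  using Cauchy_Schwarz_ineq2[of z v] sum_squares_bound[of "cmod z" "cmod v"] mult_nonneg_nonneg[OF norm_ge_zero[of z] norm_ge_zero[of v]] by linarith
 then show "AE t. norm (inner (f t) (g t)) <= norm ((cmod (f t))^2 + (cmod (g t))^2)" by simp
qed

lemma inner_cls: assumes f: "f : square_integrable" and g: "g : square_integrable" shows "inner (cls f) (cls g) = (LEB t. inner (f t) (g t))"
proof -
 have m: "ae_rep (Rep_l2 (cls f)) : lmeas" if "f : square_integrable" for f
  using AE_rep_class[of f] unfolding Rep_cls[OF that] by (intro borel_measurable_lebesgue_cong_AE[OF sq_integrableD(1)[OF that]]) (auto elim: eventually_mono)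
 show ?thesis unfolding inner_l2_def
 proof (rule integral_cong_AE)
  show "AE t. inner (ae_rep (Rep_l2 (cls f)) t) (ae_rep (Rep_l2 (cls g)) t) = inner (f t) (g t)"
   using AE_rep_class[of f] AE_rep_class[of g] unfolding Rep_cls[OF f] Rep_cls[OF g] by eventually_elim simp
 qed (use f g m in "auto intro: borel_measurable_inner sq_integrableD(1)")
qed

instance
proof
 fix x y z :: l2 and a b :: real
 show "a *\<^sub>R (x + y) = a *\<^sub>R x + a *\<^sub>R y" "(a + b) *\<^sub>R x = a *\<^sub>R x + b *\<^sub>R x" "a *\<^sub>R b *\<^sub>R x = (a * b) *\<^sub>R x" "1 *\<^sub>R x = x"
  by (simp_all add: scaleR_l2_def scaleC_algebra)
 obtain f g h where c: "f : square_integrable" "x = cls f" "g : square_integrable" "y = cls g" "h : square_integrable" "z = cls h"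
  by (metis cls_cases)
 show "inner x y = inner y x" by (simp add: inner_l2_def inner_commute)
 show "inner (x + y) z = inner x z + inner y z"
  using c by (simp add: cls_arith inner_cls one.sq_integrable_add inner_integrable inner_add_left)
 show "inner (a *\<^sub>R x) y = a * inner x y"
  using c by (simp add: scaleR_l2_def cls_arith inner_cls one.sq_integrable_cmult inner_complex_def right_diff_distrib[symmetric] mult.assoc distrib_left[symmetric])
 show "0 <= inner x x" by (simp add: inner_l2_def)
 have "inner x x = 0 \<longleftrightarrow> (AE t. inner (f t) (f t) = 0)"
  using c integral_nonneg_eq_0_iff_AE[OF inner_integrable[of f f]] by (simp add: inner_cls)
 also have "... \<longleftrightarrow> x = 0" using c by (simp add: Rep_l2_inject[symmetric] Rep_cls zero_l2.rep_eq ae_class_arith(4) ae_class_eq_iff)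
 finally show "inner x x = 0 \<longleftrightarrow> x = 0" .
qed (simp_all add: dist_l2_def sgn_l2_def uniformity_l2_def open_l2_def norm_l2_def)

end

lemma norm_cls: "f : square_integrable ==> norm (cls f) = sqrt (LEB t. (cmod (f t))^2)"
proof -
 have "inner z z = (cmod z)^2" for z by (rule dot_square_norm)
 then show "f : square_integrable ==> ?thesis" by (simp only: norm_l2_def inner_cls)
qed

instance l2 :: cnormed
proof
 fix x :: l2 and c :: complex
 obtain f where "f : square_integrable" "x = cls f" by (rule cls_cases)
 moreover from this have "norm (cls (%t. c * f t)) = sqrt ((cmod c)^2 * (LEB t. (cmod (f t))^2))"
  unfolding norm_cls[OF one.sq_integrable_cmult[OF calculation(1)]] norm_mult power_mult_distrib by simp
 ultimately show "norm (c *\<^sub>C x) = cmod c * norm x" by (simp add: cls_arith norm_cls real_sqrt_mult)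
qed (simp add: scaleR_l2_def)

lemma cls_Fatou:
 assumes f: "!!n. f n : square_integrable" and b: "!!n. norm (cls (f n)) <= B"
  and g: "g : lmeas" and lim: "AE x. (%n. f n x) ----> g x"
 shows "g : square_integrable" "norm (cls g) <= B"
proof -
 have B: "0 <= B" using b[of 0] norm_ge_zero order_trans by blast
 have "(\<integral>\<^sup>+x. ennreal ((cmod (f n x))^2) \<partial>lebesgue) <= ennreal (B^2)" for n
  using nn_integral_eq_integral[OF sq_integrableD(2)[OF f[of n]]] power_mono[OF b[of n] norm_ge_zero, of 2]
  by (simp add: norm_cls[OF f] ennreal_leI)
 then have "liminf (%n. \<integral>\<^sup>+x. ennreal ((cmod (f n x))^2) \<partial>lebesgue) <= ennreal (B^2)" by (intro Liminf_le) auto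
 moreover have "(\<integral>\<^sup>+x. liminf (%n. ennreal ((cmod (f n x))^2)) \<partial>lebesgue) <= liminf (%n. \<integral>\<^sup>+x. ennreal ((cmod (f n x))^2) \<partial>lebesgue)"
  using sq_integrableD(1)[OF f] by (intro nn_integral_liminf) measurable
 moreover have "(\<integral>\<^sup>+x. ennreal ((cmod (g x))^2) \<partial>lebesgue) <= (\<integral>\<^sup>+x. liminf (%n. ennreal ((cmod (f n x))^2)) \<partial>lebesgue)"
 proof (rule nn_integral_mono_AE)
  show "AE x. ennreal ((cmod (g x))^2) <= liminf (%n. ennreal ((cmod (f n x))^2))"
   using lim
  proof eventually_elim
   case (elim x)
   then have "(%n. ennreal ((cmod (f n x))^2)) ----> ennreal ((cmod (g x))^2)" by (intro tendsto_intros)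
   then show ?case using lim_imp_Liminf[of sequentially] by fastforce
  qed
 qed
 ultimately have le: "(\<integral>\<^sup>+x. ennreal ((cmod (g x))^2) \<partial>lebesgue) <= ennreal (B^2)" by (blast intro: order_trans)
 have i: "lint (%x. (cmod (g x))^2)"
  by (rule integrableI_bounded) (use g le in "auto intro: le_less_trans")
 then show gs: "g : square_integrable" using g by (simp add: sq_integrable_def)
 show "norm (cls g) <= B" using le nn_integral_eq_integral[OF i] B by (simp add: norm_cls[OF gs] real_le_lsqrt)
qed

text \<open>Riesz-Fischer: an almost everywhere convergent subsequence supplies the limit, and
  Fatou's lemma turns pointwise into norm convergence.\<close>

instance l2 :: banach
proof
 fix X :: "nat => l2" assume C: "Cauchy X"
 have "ALL n. EX f. f : square_integrable & X n = cls f" using cls_cases by blast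
 then obtain f where f: "!!n. f n : square_integrable" "!!n. X n = cls (f n)" by metis
 note [measurable] = sq_integrableD(1)[OF f(1)]
 \<comment> \<open>A strictly positive square integrable function. Multiplication by it maps the
   sequence to a Cauchy sequence in L1, where an almost everywhere Cauchy subsequence
   exists.\<close>
 define rh where "rh x = cor (sqrt (std_normal_density x))" for x
 have rhpos: "0 < std_normal_density x" for x by (simp add: normal_density_pos)
 have "rh : lmeas" unfolding rh_def[abs_def] by (intro measurable_completion) measurable
 then have rh: "rh : square_integrable"
  unfolding sq_integrable_def by (auto simp: rh_def less_imp_le[OF rhpos] intro!: integrable_completion[THEN iffD2])
 define u where "u i j = (%x. cor (cmod (f i x - f j x)))" for i j
 have u: "u i j : square_integrable" "norm (cls (u i j)) = norm (X i - X j)" for i j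
 proof -
  have d: "(%x. f i x - f j x) : square_integrable" by (intro square_integrable_diff f)
  then show "u i j : square_integrable" by (rule one.sq_integrable_bound[OF _ sq_integrableD(2), rotated]) (auto simp: u_def)
  then show "norm (cls (u i j)) = norm (X i - X j)" using d by (simp add: f cls_arith norm_cls u_def)
 qed
 have int: "(LEB x. cmod (rh x * f i x - rh x * f j x)) <= norm (cls rh) * norm (X i - X j)" for i j
 proof -
  have "(LEB x. cmod (rh x * f i x - rh x * f j x)) = inner (cls rh) (cls (u i j))"
   unfolding inner_cls[OF rh u(1)] by (simp add: rh_def u_def norm_mult right_diff_distrib[symmetric] inner_complex_def less_imp_le[OF rhpos])
  then show ?thesis using norm_cauchy_schwarz[of "cls rh" "cls (u i j)"] u(2) by simp
 qed
 obtain r where r: "strict_mono r" "AE x. Cauchy (%i. rh x * f (r i) x)"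
 proof (rule cauchy_L1_AE_cauchy_subseq)
  show "lint (%x. rh x * f n x)" for n
  proof (rule Bochner_Integration.integrable_bound[OF inner_integrable[OF rh one.sq_integrable_bound[OF _ sq_integrableD(2)[OF f(1)[of n]]]]])
   show "(%x. cor (cmod (f n x))) : lmeas" "(%x. rh x * f n x) : lmeas"
    using sq_integrableD(1)[OF rh] by measurable
  qed (auto simp: rh_def norm_mult inner_complex_def)
  fix e :: real assume "0 < e"
  then have "0 < e / (norm (cls rh) + 1)" by (simp add: add_nonneg_pos)
  from metric_CauchyD[OF C this, unfolded dist_norm] obtain N where N: "!!m n. N <= m ==> N <= n ==> norm (X m - X n) < e / (norm (cls rh) + 1)" by blast
  have "(LEB x. cmod (rh x * f i x - rh x * f j x)) < e" if "N <= i" "N <= j" for i j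
  proof -
   have "norm (cls rh) * norm (X i - X j) <= (norm (cls rh) + 1) * norm (X i - X j)" by (simp add: mult_right_mono)
   also have "... < e" using N[OF that] by (simp add: pos_less_divide_eq add_nonneg_pos mult.commute)
   finally show ?thesis using int[of i j] by simp
  qed
  then show "EX N. ALL i>=N. ALL j>=N. (LEB x. cmod (rh x * f i x - rh x * f j x)) < e" by blast
 qed
 define g where "g x = lim (%i. f (r i) x)" for x
 have g: "g : lmeas" unfolding g_def by measurable
 have lim: "AE x. (%i. f (r i) x) ----> g x"
  using r(2)
 proof eventually_elim
  case (elim x)
  then obtain L where "(%i. rh x * f (r i) x) ----> L" using Cauchy_convergent_iff convergent_def by blast
  then have "(%i. inverse (rh x) * (rh x * f (r i) x)) ----> inverse (rh x) * L" by (rule tendsto_mult_left)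
  moreover have "rh x ~= 0" using rhpos[of x] by (simp add: rh_def)
  ultimately have "(%i. f (r i) x) ----> inverse (rh x) * L" by (simp add: mult.assoc[symmetric])
  then show ?case unfolding g_def by (simp add: limI)
 qed
 have key: "EX N. ALL n>=N. (%x. f n x - g x) : square_integrable & norm (cls (%x. f n x - g x)) <= e" if e: "0 < e" for e
 proof -
  obtain N where N: "!!m n. N <= m ==> N <= n ==> norm (X m - X n) < e" using metric_CauchyD[OF C e, unfolded dist_norm] by blast
  have "(%x. f n x - g x) : square_integrable & norm (cls (%x. f n x - g x)) <= e" if n: "N <= n" for n
  proof -
   have "norm (cls (%x. f n x - f (r (i + N)) x)) <= e" for i
    using N[OF n, of "r (i + N)"] seq_suble[OF r(1), of "i + N"] by (simp add: f cls_arith)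
   moreover have "AE x. (%i. f n x - f (r (i + N)) x) ----> f n x - g x"
    using lim by eventually_elim (intro tendsto_intros LIMSEQ_ignore_initial_segment)
   moreover have "(%x. f n x - g x) : lmeas" using g by measurable
   ultimately show ?thesis using cls_Fatou[of "%i x. f n x - f (r (i + N)) x" e "%x. f n x - g x"] square_integrable_diff f by blast
  qed
  then show ?thesis by blast
 qed
 obtain N where "(%x. f N x - g x) : square_integrable" using key[OF zero_less_one] by blast
 from square_integrable_diff[OF f(1)[of N] this] have gs: "g : square_integrable" by simp
 have "X ----> cls g"
 proof (rule LIMSEQ_I)
  fix e :: real assume "0 < e"
  then obtain N where "ALL n>=N. norm (cls (%x. f n x - g x)) <= e / 2" using key[of "e / 2"] by auto
  then show "EX N. ALL n>=N. norm (X n - cls g) < e" using `0 < e` gs by (intro exI[of _ N]) (auto simp: f cls_arith intro: le_less_trans)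
 qed
 then show "convergent X" by (rule convergentI)
qed

instance l2 :: chilbert ..

section \<open>Transport of local spectral functions along an isometry\<close>

locale isometric_copy =
 fixes nrm :: "'v::complex_vector => real" and X :: "'v set" and U :: "'v => 'h::chilbert" and V :: "'h => 'v"
 assumes X_subspace: "complex_vector.subspace X"
  and V_X: "V z : X" and U_V: "U (V z) = z" and V_U: "x : X ==> V (U x) = x"
  and U_add: "x : X ==> y : X ==> U (x + y) = U x + U y" and U_scale: "x : X ==> U (c *\<^sub>C x) = c *\<^sub>C U x"
  and U_norm: "x : X ==> norm (U x) = nrm x"
begin

lemmas X_closed = complex_vector.subspace_add[OF X_subspace] complex_vector.subspace_scale[OF X_subspace]
 complex_vector.subspace_diff[OF X_subspace] complex_vector.subspace_0[OF X_subspace]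

lemma U_diff: "x : X ==> y : X ==> U (x - y) = U x - U y"
 using U_add[of x "(-1) *\<^sub>C y"] U_scale[of y "-1"] X_closed(2)[of y "-1"] by simp

lemma V_linear: "V (y + z) = V y + V z" "V (c *\<^sub>C y) = c *\<^sub>C V y"
 using V_U[of "V y + V z"] V_U[of "c *\<^sub>C V y"] by (simp_all add: U_add U_scale U_V V_X X_closed)

lemma V_diff: "V (y - z) = V y - V z"
 using V_U[of "V y - V z"] by (simp add: U_diff U_V V_X X_closed)

lemma V_norm: "nrm (V y) = norm y" using U_norm[OF V_X, of y] by (simp add: U_V)

lemma inj_U: "inj_on U X" by (metis V_U inj_onI)

lemma U_image: "U ` X = UNIV" by (metis U_V V_X rangeI surj_def imageI UNIV_eq_I)

lemma image_subspace:
 assumes "!!x y. x : X ==> y : X ==> B (x + y) = B x + B y" "!!x c. x : X ==> B (c *\<^sub>C x) = c *\<^sub>C B x"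
 shows "complex_vector.subspace (B ` X)"
proof (rule complex_vector.subspaceI)
 show "0 : B ` X" using assms(2)[of 0 0] X_closed(4) by (metis complex_vector.scale_zero_left imageI)
qed (use X_closed in "auto simp: assms[symmetric]")

lemma bounded_operators_transport:
 assumes Y: "complex_vector.subspace Y" "Y <= X" and B: "!!y. y : Y ==> B y : Y" "!!y. y : Y ==> B' (U y) = U (B y)"
 shows "B : bounded_operators nrm Y \<longleftrightarrow> B' : bounded_operators norm (U ` Y)"
proof -
 have Yc: "x : Y ==> y : Y ==> x + y : Y" "x : Y ==> c *\<^sub>C x : Y" for x y c
  using Y(1) by (auto simp: complex_vector.subspace_def)
 have X: "x : Y ==> x : X" for x using Y(2) by blast
 have e: "U x = U y \<longleftrightarrow> x = y" if "x : Y" "y : Y" for x y using inj_U that X by (auto dest: inj_onD)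
 have "clinear_on (U ` Y) B' \<longleftrightarrow> clinear_on Y B"
  unfolding clinear_on_def ball_simps
  by (simp add: U_add[symmetric] U_scale[symmetric] X B Yc e cong: ball_cong)
 moreover have "(EX K. ALL x:U ` Y. norm (B' x) <= K * norm x) \<longleftrightarrow> (EX K. ALL x:Y. nrm (B x) <= K * nrm x)"
  by (simp add: B U_norm X cong: ball_cong)
 ultimately show ?thesis using B by (auto simp: bounded_operators_def image_subset_iff)
qed

context
 fixes D Y :: "'v set" and T and T' :: "'h => 'h"
 assumes Y: "complex_vector.subspace Y" "D <= Y" "Y <= X"
  and T: "!!x. x : D ==> T x : X" "!!x. x : D ==> T' (U x) = U (T x)"
begin

lemma shift_transport: "x : D ==> T' (U x) - l *\<^sub>C U x = U (T x - l *\<^sub>C x)" "x : D ==> T x - l *\<^sub>C x : X"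
 using Y T by (auto simp: U_diff U_scale X_closed subset_iff)

lemma bij_transport: "bij_betw (%x. T x - l *\<^sub>C x) D Y \<longleftrightarrow> bij_betw (%y. T' y - l *\<^sub>C y) (U ` D) (U ` Y)"
proof -
 have i: "inj_on U Y" "inj_on U D" using inj_U Y by (auto intro: inj_on_subset)
 have "bij_betw (%y. T' y - l *\<^sub>C y) (U ` D) (U ` Y) \<longleftrightarrow> bij_betw ((%y. T' y - l *\<^sub>C y) \<circ> U) D (U ` Y)"
  by (rule bij_betw_comp_iff[OF inj_on_imp_bij_betw[OF i(2)]])
 also have "... \<longleftrightarrow> bij_betw (U \<circ> (%x. T x - l *\<^sub>C x)) D (U ` Y)"
  by (rule bij_betw_cong) (simp add: shift_transport)
 also have "... \<longleftrightarrow> bij_betw (%x. T x - l *\<^sub>C x) D Y"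
 proof
  assume b: "bij_betw (U \<circ> (%x. T x - l *\<^sub>C x)) D (U ` Y)"
  have "T x - l *\<^sub>C x : Y" if x: "x : D" for x
  proof -
   obtain y where "y : Y" "U (T x - l *\<^sub>C x) = U y" using bij_betwE[OF b] x by fastforce
   then show ?thesis using inj_onD[OF inj_U, of "T x - l *\<^sub>C x" y] shift_transport(2)[OF x] Y by auto
  qed
  then show "bij_betw (%x. T x - l *\<^sub>C x) D Y" using b bij_betw_comp_iff2[OF inj_on_imp_bij_betw[OF i(1)], of "%x. T x - l *\<^sub>C x" D] by (simp add: image_subset_iff)
 qed (rule bij_betw_trans[OF _ inj_on_imp_bij_betw[OF i(1)]])
 finally show ?thesis ..
qed

lemma inverse_transport:
 assumes b: "bij_betw (%x. T x - l *\<^sub>C x) D Y" and y: "y : Y"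
 shows "the_inv_into (U ` D) (%y. T' y - l *\<^sub>C y) (U y) = U (the_inv_into D (%x. T x - l *\<^sub>C x) y)"
proof -
 have *: "the_inv_into D (%x. T x - l *\<^sub>C x) y : D" using b y by (auto simp: bij_betw_def intro: the_inv_into_into)
 show ?thesis
  by (rule the_inv_into_f_eq)
   (use b bij_transport[of l] y f_the_inv_into_f_bij_betw[OF b, of y] * in "auto simp: shift_transport bij_betw_def")
qed

text \<open>Stated for a domain in an arbitrary subspace \<open>Y\<close>, so that it serves the
  whole space as well as the two restrictions in (S4) and (S5).\<close>

lemma resolvent_set_transport: "resolvent_set nrm Y D T = resolvent_set norm (U ` Y) (U ` D) T'"
proof -
 have "the_inv_into D (%x. T x - l *\<^sub>C x) : bounded_operators nrm Y \<longleftrightarrow>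
   the_inv_into (U ` D) (%y. T' y - l *\<^sub>C y) : bounded_operators norm (U ` Y)"
  if b: "bij_betw (%x. T x - l *\<^sub>C x) D Y" for l
 proof (rule bounded_operators_transport[OF Y(1,3)])
  fix y assume y: "y : Y"
  show "the_inv_into D (%x. T x - l *\<^sub>C x) y : Y" using b y by (intro the_inv_into_into[OF _ _ Y(2)]) (auto simp: bij_betw_def)
 qed (rule inverse_transport[OF b])
 then show ?thesis unfolding resolvent_set_def using bij_transport by blast
qed

end

theorem local_spectral_function_transport:
 assumes D: "D <= X" and T: "!!x. x : D ==> T x : X" "!!x. x : D ==> T' (U x) = U (T x)"
  and E: "local_spectral_function norm UNIV (U ` D) T' Xi E"
 shows "local_spectral_function nrm X D T Xi (%De x. V (E De (U x)))"
proof -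
 define F where "F De x = V (E De (U x))" for De x
 note L = E[unfolded local_spectral_function_def]
 have UF: "U (F De x) = E De (U x)" and FX: "F De x : X" for De x by (simp_all add: F_def U_V V_X)
 have dc: "E De : double_commutant_resolvent norm UNIV (U ` D) T'" if "De : borel0 Xi" for De using L that by blast
 then have Eb: "E De : bounded_operators norm UNIV" if "De : borel0 Xi" for De
  using that by (simp add: double_commutant_resolvent_def commutant_def)
 then have lin: "E De (x + y) = E De x + E De y" "E De (c *\<^sub>C x) = c *\<^sub>C E De x" if "De : borel0 Xi" for De x y c
  using that by (simp_all add: bounded_operators_def clinear_on_def)
 have Flin: "y : X ==> F De (x + y) = F De x + F De y" "F De (c *\<^sub>C x) = c *\<^sub>C F De x" if "De : borel0 Xi" "x : X" for De x y c
  using that by (simp_all add: F_def U_add U_scale lin V_linear)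
 have UD: "x : D" if "x : X" "U x : U ` D" for x using inj_onD[OF inj_U] that D by blast
 have sp: "spectrum nrm Y (D Int Y) T = spectrum norm (U ` Y) (U ` D Int U ` Y) T'" if "complex_vector.subspace Y" "Y <= X" for Y
 proof -
  have "U ` (D Int Y) = U ` D Int U ` Y" by (rule inj_on_image_Int[OF inj_U D that(2)])
  then show ?thesis using resolvent_set_transport[OF that(1) _ that(2), of "D Int Y" T T'] T by (simp add: spectrum_def)
 qed
 have spX: "spectrum nrm X D T = spectrum norm UNIV (U ` D) T'"
  using sp[OF X_subspace order_refl] D by (simp add: U_image Int_absorb2)
 have closed: "closed_operator norm UNIV (U ` D) T'" using L by blast
 have "closed_operator nrm X D T" unfolding closed_operator_def
 proof (intro conjI allI impI)
  have s: "U x + U y : U ` D" "c *\<^sub>C U x : U ` D" "0 : U ` D" if "x : D" "y : D" for x y c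
   using closed that by (simp_all add: closed_operator_def complex_vector.subspace_def)
  have "0 : D" using UD[of 0] U_scale[of 0 0] X_closed closed by (auto simp: closed_operator_def complex_vector.subspace_def)
  moreover have Dc: "x + y : D" "c *\<^sub>C x : D" if "x : D" "y : D" for x y c
   using UD[of "x + y"] UD[of "c *\<^sub>C x"] s[OF that] that D by (auto simp: U_add U_scale X_closed subset_iff)
  ultimately show "complex_vector.subspace D" by (auto simp: complex_vector.subspace_def)
  have "T' (U x + U y) = T' (U x) + T' (U y)" "T' (c *\<^sub>C U x) = c *\<^sub>C T' (U x)" if "x : D" "y : D" for x y c
   using closed that by (simp_all add: closed_operator_def clinear_on_def)
  then have c: "U (T (x + y)) = U (T x + T y)" "U (T (c *\<^sub>C x)) = U (c *\<^sub>C T x)" if "x : D" "y : D" for x y c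
   using that T(2)[OF Dc(1)[OF that]] T(2)[OF Dc(2)[OF that]] D by (simp_all add: T U_add U_scale subset_iff)
  show "clinear_on D T" unfolding clinear_on_def using c inj_onD[OF inj_U] T X_closed Dc by metis
  fix s x y assume *: "range s <= D & x : X & y : X & (%n. nrm (s n - x)) ----> 0 & (%n. nrm (T (s n) - y)) ----> 0"
  then have "s n : D" "s n : X" for n using D by auto
  then have n: "nrm (s n - x) = norm (U (s n) - U x)" "nrm (T (s n) - y) = norm (T' (U (s n)) - U y)" "U (s n) : U ` D" for n
   using * by (simp_all add: U_norm[symmetric] X_closed U_diff T)
  have "!!s x y. range s <= U ` D ==> (%n. norm (s n - x)) ----> 0 ==> (%n. norm (T' (s n) - y)) ----> 0 ==> x : U ` D & T' x = y"
   using closed by (simp add: closed_operator_def)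
  moreover have "range (%n. U (s n)) <= U ` D" using n(3) by (rule image_subsetI)
  ultimately have "U x : U ` D & T' (U x) = U y" using * unfolding n(1,2) by blast
  then show "x : D" using UD * by blast
  then show "T x = y" using \<open>U x : U ` D & _\<close> T[of x] * by (intro inj_onD[OF inj_U]) auto
 qed (use D T in auto)
 moreover have "complex_banach nrm X"
 proof
  show "EX x:X. (%n. nrm (s n - x)) ----> 0" if s: "range s <= X" and C: "!!e. 0 < e ==> EX N. ALL m>=N. ALL n>=N. nrm (s m - s n) < e" for s
  proof -
   have n: "nrm (s n - V y) = norm (U (s n) - y)" "nrm (s m - s n) = norm (U (s m) - U (s n))" for n m y
    using s by (simp_all add: image_subset_iff U_norm[symmetric] X_closed U_diff V_X U_V)
   obtain y where "(%n. U (s n)) ----> y" using Cauchy_convergent[OF CauchyI, of "%n. U (s n)"] C unfolding n by (auto simp: convergent_def)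
   then show ?thesis by (intro bexI[of _ "V y"] V_X) (simp add: n LIM_zero_iff tendsto_norm_zero_iff)
  qed
  fix x y c assume x: "x : X"
  show "nrm (c *\<^sub>C x) = cmod c * nrm x" "0 <= nrm x" using x by (simp_all add: U_norm[symmetric] U_scale X_closed norm_scaleC)
  show "nrm x = 0 \<longleftrightarrow> x = 0" using x inj_onD[OF inj_U, of x 0] U_scale[of 0 0] by (auto simp: U_norm[symmetric] X_closed)
  show "nrm (x + y) <= nrm x + nrm y" if "y : X" using x that by (simp add: U_norm[symmetric] U_add X_closed norm_triangle_ineq)
 qed (rule X_subspace)
 moreover have "F De : double_commutant_resolvent nrm X D T" if d: "De : borel0 Xi" for De
 proof -
  have "F De (B x) = B (F De x)" if B: "B : commutant nrm X (resolvent D T ` resolvent_set nrm X D T)" and x: "x : X" for B x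
  proof -
   have BX: "B y : X" if "y : X" for y using B that by (auto simp: commutant_def bounded_operators_def)
   \<comment> \<open>The double commutant property in the image space is applied to the conjugate of
     \<open>B\<close>; for this the conjugate must commute with the transported resolvents.\<close>
   have "(%y. U (B (V y))) : commutant norm UNIV (resolvent (U ` D) T' ` resolvent_set norm UNIV (U ` D) T')"
    unfolding commutant_def
   proof (intro CollectI conjI ballI)
    show "(%y. U (B (V y))) : bounded_operators norm UNIV"
     using B bounded_operators_transport[OF X_subspace order_refl BX, where B'="%y. U (B (V y))"] by (simp add: V_U U_image commutant_def)
    fix C y assume "C : resolvent (U ` D) T' ` resolvent_set norm UNIV (U ` D) T'"
    then obtain l where l: "l : resolvent_set nrm X D T" "C = resolvent (U ` D) T' l"
     using resolvent_set_transport[where T=T and T'=T', OF X_subspace D order_refl T] by (auto simp: U_image)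
    let ?R = "resolvent D T l"
    have b: "bij_betw (%x. T x - l *\<^sub>C x) D X" using l(1) by (simp add: resolvent_set_def)
    have C: "C (U z) = U (?R z)" if "z : X" for z
     using inverse_transport[where T=T and T'=T', OF X_subspace D order_refl T b that] by (simp add: l(2) resolvent_def)
    have R: "?R z : X" if "z : X" for z using b that D by (auto simp: resolvent_def bij_betw_def intro!: subsetD[OF D] the_inv_into_into)
    have "B (?R (V y)) = ?R (B (V y))" using B l(1) V_X by (auto simp: commutant_def)
    then show "U (B (V (C y))) = C (U (B (V y)))"
     using C[OF V_X, of y] C[OF BX[OF V_X], of y] R[OF V_X, of y] by (simp add: U_V V_U)
   qed
   moreover have "ALL C:commutant norm UNIV (resolvent (U ` D) T' ` resolvent_set norm UNIV (U ` D) T'). ALL x. E De (C x) = C (E De x)"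
    using dc[OF d] unfolding double_commutant_resolvent_def commutant_def[of _ _ "commutant _ _ _"] by simp
   ultimately have "ALL y. E De (U (B (V y))) = U (B (V (E De y)))" by (rule bspec[rotated])
   from spec[OF this, of "U x"] show ?thesis using x BX[of "F De x"] FX by (simp add: F_def V_U)
  qed
  moreover have "F De : bounded_operators nrm X"
   using bounded_operators_transport[OF X_subspace order_refl FX, where B'="E De"] Eb[OF d] by (simp add: UF U_image)
  ultimately show ?thesis by (simp add: double_commutant_resolvent_def commutant_def)
 qed
 moreover have "F De (F De x) = F De x" if "De : borel0 Xi" for De x
  using L that by (simp add: F_def U_V)
 moreover have "F De x : D" if "De : borel0 Xi" "bounded De" for De x
  using L that by (intro UD[OF FX]) (auto simp: UF image_subset_iff)
 moreover have "(%n. nrm ((\<Sum>k<n. F (De k) f) - F (\<Union>k. De k) f)) ----> 0"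
  if "range De <= borel0 Xi & disjoint_family De & (\<Union>k. De k) : borel0 Xi" "f : X" for De :: "nat => complex set" and f
 proof -
  have V0: "V 0 = 0" using V_linear(2)[of 0 0] by simp
  have "(\<Sum>k<n. F (De k) f) = V (\<Sum>k<n. E (De k) (U f))" for n by (induction n) (simp_all add: F_def V_linear V0)
  then show ?thesis using L that by (simp add: F_def V_diff[symmetric] V_norm)
 qed
 moreover have "F (De Int De') x = F De (F De' x)" if "De : borel0 Xi" "De' : borel0 Xi" for De De' x
  using L that by (simp add: F_def U_V)
 moreover have "spectrum nrm (F De ` X) (D Int F De ` X) T <= closure (spectrum nrm X D T Int De)" if d: "De : borel0 Xi" for De
 proof -
  have "complex_vector.subspace (F De ` X)" by (rule image_subspace[OF Flin[OF d]])
  moreover have "U ` F De ` X = E De ` UNIV" by (simp add: image_image UF U_image[symmetric])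
  ultimately show ?thesis using sp[of "F De ` X"] FX L d by (auto simp: spX image_subset_iff)
 qed
 moreover have "spectrum nrm ((%x. x - F De x) ` X) (D Int (%x. x - F De x) ` X) T <= closure (spectrum nrm X D T - De)" if d: "De : borel0 Xi" for De
 proof -
  have "x - F De x + (y - F De y) = (x + y) - F De (x + y)" "c *\<^sub>C (x - F De x) = c *\<^sub>C x - F De (c *\<^sub>C x)" if "x : X" "y : X" for x y c
   using Flin[OF d that(1)] that(2) by (simp_all add: scaleC_algebra)
  then have "complex_vector.subspace ((%x. x - F De x) ` X)" by (intro image_subspace) simp_all
  moreover have "U ` (%x. x - F De x) ` X = (%x. x - E De x) ` UNIV"
   by (simp add: image_image UF U_diff FX U_image[symmetric] cong: image_cong)
  ultimately show ?thesis using sp[of "(%x. x - F De x) ` X"] FX L d by (auto simp: spX image_subset_iff X_closed)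
 qed
 ultimately show ?thesis unfolding local_spectral_function_def F_def[symmetric] using L by auto
qed

end

lemma cls_eqI: "AE x. f x = g x ==> cls f = cls g"
 unfolding cls_def by (rule arg_cong[of _ _ Abs_l2]) (simp add: ae_class_eq_iff)

section \<open>Translations as a unitary shift\<close>

definition translation :: "real => l2 \<Rightarrow>\<^sub>L l2" where
 "translation t = Blinfun (%x. cls (%s. ae_rep (Rep_l2 x) (s + t)))"

lemma square_integrable_shift:
 "f : square_integrable ==> (%s. f (s + t)) : square_integrable"
 using integral_shift(1)[of "%x. (cmod (f x))^2" t] borel_measurable_shift[of f t] by (simp add: sq_integrable_def)

lemma translation_cls: assumes f: "f : square_integrable" shows "translation t (cls f) = cls (%s. f (s + t))"
proof -
 let ?T = "%x. cls (%s. ae_rep (Rep_l2 x) (s + t))"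
 have T: "?T (cls f) = cls (%s. f (s + t))" if "f : square_integrable" for f
  unfolding Rep_cls[OF that] by (rule cls_eqI[OF AE_shift[OF AE_rep_class]])
 have "bounded_linear ?T"
 proof (rule bounded_linear_intro)
  fix x y :: l2 and r
  obtain f g where c: "f : square_integrable" "x = cls f" "g : square_integrable" "y = cls g" by (metis cls_cases)
  show "?T (x + y) = ?T x + ?T y"
   unfolding c cls_arith(1)[OF c(1,3)] T[OF c(1)] T[OF c(3)] T[OF one.sq_integrable_add[OF c(1,3)]]
   using c by (simp add: cls_arith square_integrable_shift)
  show "?T (r *\<^sub>R x) = r *\<^sub>R ?T x"
   unfolding c scaleR_scaleC cls_arith(3)[OF c(1)] T[OF c(1)] T[OF one.sq_integrable_cmult[OF c(1)]]
   using c by (simp add: cls_arith square_integrable_shift)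
  show "norm (?T x) <= norm x * 1" unfolding c T[OF c(1)]
   using c integral_shift(2)[OF sq_integrableD(2)[OF c(1)], of t] by (simp add: norm_cls square_integrable_shift)
 qed
 then show ?thesis using T[OF f] by (simp add: translation_def bounded_linear_Blinfun_apply)
qed

text \<open>Each point is moved into the cell [0, a) by exactly one multiple of \<open>a\<close>.
  Hence 2 N + 1 translated pieces restore \<open>f\<close> on the corresponding cells, and the tail
  tends to 0 by dominated convergence.\<close>

lemma shift_translation:
 assumes a: "0 < a"
 shows "shift (%n. translation (real_of_int n * a)) {cls f |f. f : square_integrable & (ALL x. x ~: {0..<a} --> f x = 0)}"
  (is "shift ?T ?W")
proof
 fix m n :: int and x :: l2 and c :: complex and e :: real
 obtain f where f: "f : square_integrable" "x = cls f" by (rule cls_cases)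
 show "?T (m + n) x = ?T m (?T n x)"
  using f by (simp add: translation_cls square_integrable_shift algebra_simps)
 show "?T 0 x = x" using f by (simp add: translation_cls)
 show "norm (?T n x) = norm x"
  using f integral_shift(2)[OF sq_integrableD(2)[OF f(1)]] by (simp add: translation_cls norm_cls square_integrable_shift)
 show "clin (?T n)" unfolding clin_def
 proof (intro allI)
  fix c x
  obtain f where f: "f : square_integrable" "x = cls f" by (rule cls_cases)
  then show "?T n (c *\<^sub>C x) = c *\<^sub>C ?T n x" by (simp add: cls_arith translation_cls square_integrable_shift one.sq_integrable_cmult)
 qed
 show "w : ?W ==> c *\<^sub>C w : ?W" for w by (force simp: cls_arith one.sq_integrable_cmult)
 have cell: "y + real_of_int n * a : {0..<a} \<longleftrightarrow> n = - \<lfloor>y / a\<rfloor>" for y n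
 proof -
  have "n = - \<lfloor>y / a\<rfloor> \<longleftrightarrow> \<lfloor>y / a\<rfloor> = - n" by auto
  also have "... \<longleftrightarrow> real_of_int (- n) <= y / a & y / a < real_of_int (- n) + 1" by (rule floor_eq_iff)
  finally show ?thesis using a by (auto simp: field_simps)
 qed
 show "inner (?T n w) w' = 0" if ww: "w : ?W" "w' : ?W" "n ~= 0" for w w'
 proof -
  obtain g where g: "g : square_integrable" "w = cls g" "ALL x. x ~: {0..<a} --> g x = 0" using ww(1) by blast
  obtain g' where g': "g' : square_integrable" "w' = cls g'" "ALL x. x ~: {0..<a} --> g' x = 0" using ww(2) by blast
  have "g (y + real_of_int n * a) = 0 | g' y = 0" for y
   using g(3) g'(3) cell[of y n] cell[of y 0] ww(3) by (cases "y : {0..<a}") (simp_all del: atLeastLessThan_iff)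
  then have "(%y. inner (g (y + real_of_int n * a)) (g' y)) = (%_. 0)" by (intro ext) (metis inner_zero_left inner_zero_right)
  then show ?thesis using g g' by (simp add: translation_cls square_integrable_shift inner_cls)
 qed
 define b where "b N y = (if abs(\<lfloor>y / a\<rfloor>) <= int N then 0 else f y)" for N y
 define c where "c n = (%y. indicator {0..<a} (y + real_of_int n * a) * f y)" for n :: int
 have b_eq: "b N = (%y. f y - (\<Sum>n\<in>{-int N..int N}. c n y))" for N
 proof
  fix y
  have "(\<Sum>n\<in>{-int N..int N}. c n y) = (\<Sum>n\<in>{-int N..int N}. if n = - \<lfloor>y / a\<rfloor> then f y else 0)"
   unfolding c_def indicator_def cell by (intro sum.cong) auto
  then show "b N y = f y - (\<Sum>n\<in>{-int N..int N}. c n y)" by (auto simp: b_def abs_le_iff)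
 qed
 have ind: "(%x. indicator {0..<a} (x + t) * f (x + s)) : square_integrable" for s t
 proof (rule one.sq_integrable_bound[OF _ sq_integrableD(2)[OF square_integrable_shift[OF f(1), of s]]])
  show "(%x. indicator {0..<a} (x + t) * f (x + s)) : lmeas"
   by (intro borel_measurable_times borel_measurable_shift[of "indicator {0..<a} :: real => complex"] sq_integrableD(1)[OF square_integrable_shift[OF f(1)]] borel_measurable_indicator) simp
 qed (simp add: indicator_def)
 have c: "c n : square_integrable" for n using ind[of _ 0] by (simp add: c_def)
 define w where "w n = cls (%x. indicator {0..<a} (x + 0) * f (x + - real_of_int n * a))" for n :: int
 have w: "w n : ?W" "?T n (w n) = cls (c n)" for n
  using ind[of 0 "- real_of_int n * a"] unfolding w_def c_def by (auto simp: translation_cls)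
 have sum: "(\<Sum>n\<in>I. ?T n (w n)) = cls (%y. \<Sum>n\<in>I. c n y) & (%y. \<Sum>n\<in>I. c n y) : square_integrable" if "finite I" for I
  using that
 proof (induction I rule: finite_induct)
  case empty show ?case by (simp add: one.sq_integrable_zero cls_def zero_l2_def ae_class_arith(4))
 next
  case (insert n I) then show ?case using c[of n] w(2)[of n] by (simp add: cls_arith one.sq_integrable_add)
 qed
 have b: "x - (\<Sum>n\<in>{-int N..int N}. ?T n (w n)) = cls (b N)" "b N : square_integrable" for N
  using sum[of "{-int N..int N}"] f by (auto simp: cls_arith b_eq square_integrable_diff)
 have "(%N. LEB y. (cmod (b N y))^2) ----> integral\<^sup>L lebesgue (%y::real. 0)"
 proof (rule integral_dominated_convergence[where w="%y. (cmod (f y))^2"])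
  show "(%y. (cmod (b N y))^2) : lmeas" for N using sq_integrableD(1)[OF b(2)] by measurable
  show "lint (%y. (cmod (f y))^2)" using sq_integrableD(2)[OF f(1)] by simp
  have "eventually (%N. (cmod (b N y))^2 = 0) sequentially" for y
   by (rule eventually_sequentiallyI[of "nat (abs(\<lfloor>y / a\<rfloor>))"]) (simp add: b_def)
  then show "AE y. (%N. (cmod (b N y))^2) ----> 0" by (intro AE_I2 tendsto_eventually)
 qed (auto simp: b_def)
 then have "(%N. norm (cls (b N))) ----> 0" using tendsto_real_sqrt by (fastforce simp: norm_cls b(2))
 moreover assume "0 < e"
 ultimately obtain N where "norm (cls (b N)) < e" using LIMSEQ_D[of "%N. norm (cls (b N))" 0 e] by auto
 then show "EX w N. (ALL n. w n : ?W) & norm (x - (\<Sum>n\<in>{-int N..int N}. ?T n (w n))) < e"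
  using w(1) b(1) by (intro exI[of _ w] exI[of _ N]) auto
qed

context weight
begin

abbreviation "rw x == cor (sqrt (abs(w x)))"

lemma rw_measurable [measurable]: "rw : lmeas"
 using w_measurable by measurable

lemma cmod_rw [simp]: "(cmod (rw x * z))^2 = (cmod z)^2 * abs(w x)"
 by (simp add: norm_mult power_mult_distrib mult.commute)

lemma rw_square_integrable: "f : sq_integrable w ==> (%x. rw x * f x) : square_integrable"
 unfolding sq_integrable_def by (auto intro: borel_measurable_times rw_measurable)

definition UU :: "ae_fun => l2" where "UU F = cls (%x. rw x * ae_rep F x)"
definition VV :: "l2 => ae_fun" where "VV y = ae_class (%x. ae_rep (Rep_l2 y) x / rw x)"

lemma UU_class: "UU (ae_class f) = cls (%x. rw x * f x)"
 unfolding UU_def cls_def using AE_rep_class[of f] by (intro arg_cong[of _ _ Abs_l2]) (auto simp: ae_class_eq_iff elim: eventually_mono)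

lemma VV_cls: "f : square_integrable ==> VV (cls f) = ae_class (%x. f x / rw x)"
 unfolding VV_def ae_class_eq_iff Rep_cls using AE_rep_class[of f] by (auto elim: eventually_mono)

lemma div_rw: "f : square_integrable ==> (%x. f x / rw x) : sq_integrable w"
proof (rule sq_integrable_bound[OF _ sq_integrableD(2)])
 show "f : square_integrable ==> (%x. f x / rw x) : lmeas"
  by (intro borel_measurable_divide sq_integrableD(1) rw_measurable)
qed (auto simp: norm_divide power_divide)

sublocale isometric_copy "L2_norm w" "L2 w" UU VV
proof
 fix x y :: ae_fun and z :: l2 and c
 obtain h where h: "h : square_integrable" "z = cls h" by (rule cls_cases)
 show "VV z : L2 w" unfolding h(2) VV_cls[OF h(1)] L2_class by (rule div_rw[OF h(1)])
 show "UU (VV z) = z" unfolding h(2) VV_cls[OF h(1)] UU_class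
  using w_nonzero by (intro cls_eqI) (auto elim: eventually_mono)
 assume "x : L2 w"
 then obtain f where f: "x = ae_class f" "f : sq_integrable w" "f : lmeas" by (rule L2E)
 show "VV (UU x) = x" unfolding f(1) UU_class VV_cls[OF rw_square_integrable[OF f(2)]] ae_class_eq_iff
  using w_nonzero by eventually_elim simp
 show "norm (UU x) = L2_norm w x"
  unfolding f(1) UU_class norm_cls[OF rw_square_integrable[OF f(2)]] L2_norm_class[OF f(3)] by simp
 show "UU (c *\<^sub>C x) = c *\<^sub>C UU x"
  using rw_square_integrable[OF f(2)] by (simp add: f(1) ae_class_arith UU_class cls_arith mult_ac)
 assume "y : L2 w"
 then obtain g where g: "y = ae_class g" "g : sq_integrable w" by (rule L2E)
 show "UU (x + y) = UU x + UU y"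
  using rw_square_integrable[OF f(2)] rw_square_integrable[OF g(2)] by (simp add: f(1) g(1) ae_class_arith UU_class cls_arith distrib_left)
qed (rule L2_subspace)

lemma cauchy_schwarz:
 assumes f: "f : sq_integrable w" and g: "g : sq_integrable w"
 shows "(LEB x. inner (f x) (g x) * abs(w x))^2 <= (LEB x. (cmod (f x))^2 * abs(w x)) * (LEB x. (cmod (g x))^2 * abs(w x))"
proof -
 have "inner (rw x * z) (rw x * v) = inner z v * abs(w x)" for x z v
  using real_sqrt_mult_self[of "w x"] by (simp add: inner_complex_def algebra_simps) 
 then show ?thesis using Cauchy_Schwarz_ineq[of "UU (ae_class f)" "UU (ae_class g)"] f g
  unfolding UU_class by (simp add: inner_cls norm_cls rw_square_integrable dot_square_norm)
qed

end

section \<open>The maximal operator\<close>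

lemma sigma_finite_lebesgue: "sigma_finite_measure (lebesgue :: real measure)"
proof
 show "EX A::real set set. countable A & A <= sets lebesgue & \<Union>A = space lebesgue & (ALL b:A. emeasure lebesgue b ~= \<infinity>)"
 proof (intro exI[of _ "range (%n::nat. {-real n..real n})"] conjI ballI)
  show "\<Union>(range (%n::nat. {-real n..real n})) = space lebesgue"
  proof (intro equalityI subsetI)
   fix x :: real
   obtain n :: nat where "abs x < real n" using reals_Archimedean2 by blast
   then have "x : {-real n..real n}" by auto
   then show "x : \<Union>(range (%n::nat. {-real n..real n}))" by blast
  qed simp
 qed auto
qed

text \<open>With \<open>s = 2 cos \<theta>\<close>, the modulus of \<open>\<xi> (k + 1) - exp (- i \<theta>) \<xi> k\<close> is constant.\<close>

lemma recurrence_decaying_zero: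
 fixes xi :: "nat => complex" and s :: real
 assumes s: "abs s <= 2" and rec: "!!k. xi (k + 2) + xi k = cor s * xi (k + 1)"
  and lim: "(%k. xi (r k)) ----> 0" "(%k. xi (Suc (r k))) ----> 0"
 shows "xi k = 0"
proof -
 define c where "c = cis (arccos (s / 2))"
 have c: "c + inverse c = cor s" "c ~= 0" "cmod c = 1"
  using s by (simp_all add: c_def complex_eq_iff cis_inverse cos_arccos abs_le_iff)
 have n: "cmod (xi (Suc k) - inverse c * xi k) = cmod (xi 1 - inverse c * xi 0)" for k
 proof (induction k)
  case (Suc k)
  have "xi (Suc (Suc k)) - inverse c * xi (Suc k) = c * (xi (Suc k) - inverse c * xi k)"
   using rec[of k] c(2) by (simp add: c(1)[symmetric] algebra_simps mult.assoc[symmetric])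
  then show ?case using Suc c(3) by (simp add: norm_mult)
 qed simp
 have "(%k. xi (Suc (r k)) - inverse c * xi (r k)) ----> 0 - inverse c * 0" by (intro tendsto_intros lim)
 from tendsto_norm[OF this] have "cmod (xi 1 - inverse c * xi 0) = 0" unfolding n by (simp add: LIMSEQ_const_iff)
 then have e: "xi (Suc k) = inverse c * xi k" for k using n[of k] by simp
 have m: "cmod (xi k) = cmod (xi 0)" for k by (induction k) (simp_all add: e norm_mult norm_inverse c(3))
 then have "(%k. cmod (xi (r k))) = (%_. cmod (xi 0))" by blast
 then show ?thesis using tendsto_norm[OF lim(1)] m[of k] by (simp add: LIMSEQ_const_iff)
qed

sublocale periodic_SL \<subseteq> weight w
 by unfold_locales (rule w_meas w_nz)+

context periodic_SL
begin

lemma sq_integrable_translate: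
 assumes f: "f : sq_integrable w" and t: "!!x. w (x + t) = w x"
 shows "(%x. f (x + t)) : sq_integrable w"
 using f integral_shift(1)[of "%x. (cmod (f x))^2 * abs(w x)" t] borel_measurable_shift[of f t] by (simp add: sq_integrable_def t)

definition shift_sum :: "ae_fun => ae_fun" where
 "shift_sum F = ae_class (%x. ae_rep F (x + a) + ae_rep F (x - a))"

lemma shift_sum_class: "shift_sum (ae_class f) = ae_class (%x. f (x + a) + f (x - a))"
 unfolding shift_sum_def ae_class_eq_iff
 using AE_shift[OF AE_rep_class[of f], of a] AE_shift[OF AE_rep_class[of f], of "-a"] by eventually_elim simp

lemma UU_shift_sum:
 assumes f: "f : sq_integrable w"
 shows "UU (shift_sum (ae_class f)) = translation a (UU (ae_class f)) + translation (- a) (UU (ae_class f))"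
 unfolding shift_sum_class UU_class translation_cls[OF rw_square_integrable[OF f]]
 using square_integrable_shift[OF rw_square_integrable[OF f], of a] square_integrable_shift[OF rw_square_integrable[OF f], of "- a"]
 by (simp add: cls_arith w_per w_per' distrib_left)

text \<open>The integral of |f|^2 |w| over the k-th translated cell tends to 0, so a subsequence
  converges pointwise. Two consecutive indices are treated together because the recurrence satisfied
  by solutions is of second order.\<close>

lemma orbit_tendsto_0:
 assumes f: "f : sq_integrable w" and b: "b = a | b = - a"
 obtains r where "AE x. x : {0<..<a} --> (%k. f (x + real (Suc (r k)) * b)) ----> 0 & (%k. f (x + real (Suc (Suc (r k))) * b)) ----> 0"
proof -
 define F where "F x = (cmod (f x))^2 * abs(w x)" for x
 have F: "lint F" using f by (simp add: sq_integrable_def F_def[abs_def])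
 define G where "G k x = indicator {0<..<a} x * F (x + real k * b)" for k x
 have Gpos: "0 <= G k x" for k x by (simp add: G_def F_def)
 have G: "lint (G k)" for k
  using integrable_mult_indicator[OF _ integral_shift(1)[OF F, of "real k * b"], of "{0<..<a}"] by (simp add: G_def[abs_def])
 have "(%k. LEB x. indicator {0<..<a} (x - real k * b) * F x) ----> (LEB x::real. (0::real))"
 proof (rule integral_dominated_convergence[where w=F])
  have Fm: "F : lmeas" using F by auto
  show "(%x. indicator {0<..<a} (x - real k * b) * F x) : lmeas" for k
  proof -
   have "indicator {0<..<a} (x - real k * b) = (indicator {real k * b<..<real k * b + a} x :: real)" for x by (auto simp: indicator_def)
   then show ?thesis using Fm by (auto intro!: borel_measurable_times borel_measurable_indicator)
  qed
  show "AE x. (%k. indicator {0<..<a} (x - real k * b) * F x) ----> 0"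
  proof (rule AE_I2, rule tendsto_eventually)
   fix x
   obtain n where n: "abs x + a < real n * a" using ex_less_of_nat_mult[OF a_pos] by blast
   show "\<forall>\<^sub>F k in sequentially. indicator {0<..<a} (x - real k * b) * F x = 0"
    using eventually_ge_at_top[of n]
   proof eventually_elim
    case (elim k)
    then have "real n * a <= real k * a" using a_pos by simp
    then have "x - real k * b ~: {0<..<a}"
     using n b by (elim disjE) (simp_all only: greaterThanLessThan_iff mult_minus_right, linarith+)
    then show ?case by simp
   qed
  qed
 qed (use F in "auto simp: F_def indicator_def")
 moreover have "(LEB x. indicator {0<..<a} (x - real k * b) * F x) = (LEB x. G k x)" for k
 proof -
  have "(%x. indicator {0<..<a} (x - real k * b) * F x) = (%x. G k (x + - (real k * b)))" by (simp add: G_def)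
  then show ?thesis using integral_shift(2)[OF G, of k "- (real k * b)"] by simp
 qed
 ultimately have l: "(%k. LEB x. G k x) ----> 0" by simp
 have "(%k. LEB x. norm (G (Suc k) x + G (Suc (Suc k)) x)) ----> 0"
  using tendsto_add[OF LIMSEQ_Suc[OF l] LIMSEQ_Suc[OF LIMSEQ_Suc[OF l]]] by (simp add: Gpos G)
 from tendsto_L1_AE_subseq[OF _ this] G obtain r where r: "AE x. (%k. G (Suc (r k)) x + G (Suc (Suc (r k))) x) ----> 0" by auto
 have "w (x + real k * b) = w x" for x k
  using periodic_int_mult[of w a, OF w_per, of x "int k"] periodic_int_mult[of w a, OF w_per, of x "- int k"] b by auto
 then have Gw: "G k x = (cmod (f (x + real k * b)))^2 * abs(w x)" if "x : {0<..<a}" for k x using that by (simp add: G_def F_def)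
 have "AE x. x : {0<..<a} --> (%k. f (x + real (Suc (r k)) * b)) ----> 0 & (%k. f (x + real (Suc (Suc (r k))) * b)) ----> 0"
  using r w_nz
 proof eventually_elim
  case (elim x)
  have "(%k. f (x + real (m k) * b)) ----> 0" if x: "x : {0<..<a}" and m: "!!k. G (m k) x <= G (Suc (r k)) x + G (Suc (Suc (r k))) x" for m
  proof -
   have "(%k. G (m k) x) ----> 0"
    by (rule tendsto_sandwich[OF _ _ tendsto_const elim(1)]) (use m Gpos in auto)
   from tendsto_real_sqrt[OF tendsto_divide[OF this tendsto_const, of "abs(w x)"]]
   show ?thesis using elim(2) by (simp add: Gw[OF x] tendsto_norm_zero_iff)
  qed
  from this[of "%k. Suc (r k)"] this[of "%k. Suc (Suc (r k))"] show ?case by (simp add: Gpos)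
 qed
 then show ?thesis by (rule that)
qed

end

lemma ident_lebesgue_measurable [measurable]: "(%x. x) : borel_measurable (lebesgue :: real measure)"
 by (simp add: measurable_completion)

context periodic_SL
begin

lemma sq_weight_integrable: "h : sq_integrable w ==> lint (%t. (cmod (h t))^2 * abs(w t))"
 by (simp add: sq_integrable_def)

lemma sq_integrable_wint:
 assumes h: "h : sq_integrable w" shows "wint h"
 unfolding wint_def
proof (rule loc_int_bound)
 show "loc_int (%t. abs(w t) + (cmod (h t))^2 * abs(w t))"
  by (intro loc_int_add w_abs_loc) (auto simp: loc_int_def intro: integrable_imp_set_integrable sq_weight_integrable[OF h])
 have "h : lmeas" using h by (rule sq_integrableD)
 then show "(%x. cor (w x) * h x) : lmeas" using w_meas by measurable
 fix c d
 have "cmod (cor (w x) * h x) <= 1 * norm (abs(w x) + (cmod (h x))^2 * abs(w x))" for x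
 proof -
  have "2 * cmod (h x) <= 1 + (cmod (h x))^2" using zero_le_power2[of "cmod (h x) - 1"] by (simp add: power2_diff)
  then have "cmod (h x) <= 1 + (cmod (h x))^2" using norm_ge_zero[of "h x"] by linarith
  from mult_left_mono[OF this, of "abs(w x)"] show ?thesis by (simp add: norm_mult algebra_simps)
 qed
 then show "EX C. AE x. x : {c..d} --> cmod (cor (w x) * h x) <= C * norm (abs(w x) + (cmod (h x))^2 * abs(w x))" by blast
qed

text \<open>A multiple of the period moves every window [x - a, x + a] into [-a, 2 a].\<close>

lemma periodic_window_integral:
 fixes g :: "real => real"
 assumes g: "loc_int g" "!!t. 0 <= g t" and per: "!!x. g (x + a) = g x"
 shows "(LEB t:{x-a..x+a}. g t) <= (LEB t:{-a..2*a}. g t)"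
proof -
 define k where "k = \<lfloor>x / a\<rfloor>"
 have "real_of_int k <= x / a" "x / a < real_of_int k + 1" by (auto simp: k_def)
 then have k: "real_of_int k * a <= x" "x <= (real_of_int k + 1) * a"
  using a_pos pos_le_divide_eq[of a "real_of_int k" x] pos_divide_less_eq[of a x "real_of_int k + 1"] by auto
 have "(LEB t:{x-a..x+a}. g t) <= (LEB t:{-a + real_of_int k * a..2*a + real_of_int k * a}. g t)"
  by (rule set_integral_subset_mono[OF g]) (use k in "simp_all add: algebra_simps")
 also have "... = (LEB t. indicator {-a + real_of_int k * a..2*a + real_of_int k * a} (t + real_of_int k * a) * g (t + real_of_int k * a))"
  using integral_shift(2)[OF loc_intD[OF g(1), of "-a + real_of_int k * a" "2*a + real_of_int k * a", unfolded set_integrable_def], of "real_of_int k * a"]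
  by (simp add: set_lebesgue_integral_def)
 also have "... = (LEB t:{-a..2*a}. g t)"
  unfolding periodic_int_mult[of g, OF per] set_lebesgue_integral_def
  by (intro Bochner_Integration.integral_cong) (auto simp: indicator_def)
 finally show ?thesis .
qed

text \<open>A bound for the integral of |w| over every window [x - a, x + a]; \<open>ee\<close>
  plays the same role for the Gronwall factor.\<close>

definition ww :: real where "ww = (LEB t:{-a..2*a}. abs(w t))"

lemma ww: "0 <= ww" "(LEB t:{x-a..x+a}. abs(w t)) <= ww"
 unfolding ww_def using periodic_window_integral[OF w_abs_loc] w_per by (auto intro: set_integral_nonneg_loc)

definition ee :: "complex => real" where "ee l = exp (LEB t:{-a..2*a}. kk l t)"

lemma ee: "1 <= ee l" "exp (LEB t:{x-a..x+a}. kk l t) <= ee l" "cmod l <= cmod m ==> ee l <= ee m"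
proof -
 have "kk l (x + a) = kk l x" for x by (simp add: kk_def w_per p_per q_per)
 then show "exp (LEB t:{x-a..x+a}. kk l t) <= ee l"
  unfolding ee_def exp_le_cancel_iff by (intro periodic_window_integral kk)
 show "1 <= ee l" unfolding ee_def by (simp add: set_integral_nonneg_loc kk)
 show "cmod l <= cmod m ==> ee l <= ee m" unfolding ee_def by (simp add: kk_integral_mono)
qed

abbreviation window :: "(real => complex) => real => real" where
 "window h x == LEB t:{x-a..x+a}. abs(w t) * cmod (h t)"

lemma window_sq:
 assumes h: "h : sq_integrable w"
 shows "(window h x)^2 <= ww * (LEB t:{x-a..x+a}. (cmod (h t))^2 * abs(w t))"
proof -
 let ?I = "indicator {x-a..x+a} :: real => real"
 have hm: "h : lmeas" using h by (rule sq_integrableD)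
 let ?f = "%t. cor (?I t * cmod (h t))" and ?e = "%t. cor (?I t)"
 have [measurable]: "?I : lmeas" "h : lmeas" using hm by simp_all
 have m: "?f : lmeas" "?e : lmeas" by measurable
 have fe: "?f : sq_integrable w" by (rule sq_integrable_bound[OF m(1) sq_weight_integrable[OF h]]) (simp add: indicator_def)
 have ee: "?e : sq_integrable w"
  by (rule sq_integrable_bound[OF m(2) loc_intD[OF w_abs_loc, of "x-a" "x+a", unfolded set_integrable_def]]) (simp add: indicator_def)
 have c: "(%t. inner (?f t) (?e t) * abs(w t)) = (%t. ?I t *\<^sub>R (abs(w t) * cmod (h t)))" "(%t. (cmod (?e t))^2 * abs(w t)) = (%t. ?I t *\<^sub>R (abs(w t)))"
  "(%t. (cmod (?f t))^2 * abs(w t)) = (%t. ?I t *\<^sub>R ((cmod (h t))^2 * abs(w t)))"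
  by (auto simp: indicator_def fun_eq_iff inner_complex_def)
 have "(window h x)^2 <= (LEB t:{x-a..x+a}. (cmod (h t))^2 * abs(w t)) * (LEB t:{x-a..x+a}. abs(w t))"
  using cauchy_schwarz[OF fe ee] unfolding c set_lebesgue_integral_def .
 also have "... <= (LEB t:{x-a..x+a}. (cmod (h t))^2 * abs(w t)) * ww"
  by (intro mult_left_mono ww set_integral_nonneg_loc) simp
 finally show ?thesis by (simp add: mult.commute)
qed

text \<open>Schur's test for the kernel |w t| on |x - t| <= a: the Cauchy-Schwarz inequality in the
  window, Fubini, and the symmetry of the condition in x and t.\<close>

lemma window_bound:
 assumes h: "h : sq_integrable w" and g: "g : lmeas" and C: "0 <= C"
  and le: "!!x. cmod (g x) <= C * window h x"
 shows "g : sq_integrable w" "L2_norm w (ae_class g) <= C * ww * L2_norm w (ae_class h)"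
proof -
 interpret L: sigma_finite_measure "lebesgue :: real measure" by (rule sigma_finite_lebesgue)
 interpret LL: pair_sigma_finite "lebesgue :: real measure" "lebesgue :: real measure" by unfold_locales
 have hm[measurable]: "h : lmeas" using h by (rule sq_integrableD)
 note [measurable] = w_meas g
 let ?H = "%t. (cmod (h t))^2 * abs(w t)"
 note iH = sq_weight_integrable[OF h]
 have wi: "(\<integral>\<^sup>+t. ennreal (abs(w t)) * indicator {x-a..x+a} t \<partial>lebesgue) <= ennreal ww" for x
 proof -
  have "(\<integral>\<^sup>+t. ennreal (abs(w t)) * indicator {x-a..x+a} t \<partial>lebesgue) = ennreal (LEB t:{x-a..x+a}. abs(w t))"
   using nn_integral_eq_integral[OF loc_intD[OF w_abs_loc, of "x-a" "x+a", unfolded set_integrable_def]]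
   by (simp add: set_lebesgue_integral_def ennreal_mult'' ennreal_indicator mult.commute)
  then show ?thesis using ww by (simp add: ennreal_leI)
 qed
 have pt: "ennreal ((cmod (g x))^2 * abs(w x)) <= ennreal (C^2 * ww) * (\<integral>\<^sup>+t. ennreal (abs(w x)) * (ennreal (?H t) * indicator {x-a..x+a} t) \<partial>lebesgue)" for x
 proof -
  have "0 <= window h x" by (intro set_integral_nonneg_loc) simp
  then have "(cmod (g x))^2 <= (C * window h x)^2" using le by (intro power_mono) auto
  also have "... <= C^2 * (ww * (LEB t:{x-a..x+a}. ?H t))"
   unfolding power_mult_distrib by (intro mult_left_mono window_sq h) simp
  finally have "(cmod (g x))^2 * abs(w x) <= C^2 * ww * (abs(w x) * (LEB t:{x-a..x+a}. ?H t))"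
   using mult_right_mono[of "(cmod (g x))^2" "C^2 * (ww * (LEB t:{x-a..x+a}. ?H t))" "abs(w x)"] by (simp add: mult_ac)
  then have "ennreal ((cmod (g x))^2 * abs(w x)) <= ennreal (C^2 * ww * (abs(w x) * (LEB t:{x-a..x+a}. ?H t)))" by (rule ennreal_leI)
  also have "... = ennreal (C^2 * ww) * (ennreal (abs(w x)) * ennreal (LEB t:{x-a..x+a}. ?H t))"
   using ww by (subst ennreal_mult) (auto simp: ennreal_mult' intro!: mult_nonneg_nonneg set_integral_nonneg_loc)
  also have "ennreal (LEB t:{x-a..x+a}. ?H t) = (\<integral>\<^sup>+t. ennreal (?H t) * indicator {x-a..x+a} t \<partial>lebesgue)"
   using nn_integral_eq_integral[OF integrable_imp_set_integrable[OF iH, of "{x-a..x+a}", unfolded set_integrable_def]]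
   by (simp add: set_lebesgue_integral_def ennreal_mult'' ennreal_indicator mult_ac)
  also have "ennreal (abs(w x)) * (\<integral>\<^sup>+t. ennreal (?H t) * indicator {x-a..x+a} t \<partial>lebesgue)
    = (\<integral>\<^sup>+t. ennreal (abs(w x)) * (ennreal (?H t) * indicator {x-a..x+a} t) \<partial>lebesgue)"
   by (intro nn_integral_cmult[symmetric] borel_measurable_times_ennreal borel_measurable_indicator measurable_compose[OF borel_measurable_integrable[OF iH] measurable_ennreal]) simp
  finally show ?thesis .
 qed
 \<comment> \<open>The indicator of the window is a function of t - x, which yields its joint
   measurability.\<close>
 have pm: "(%(x, t). ennreal (abs(w x)) * (ennreal (?H t) * indicator {x-a..x+a} t)) : borel_measurable (lebesgue \<Otimes>\<^sub>M lebesgue)"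
 proof -
  have i: "(%x. x) : borel_measurable (lebesgue :: real measure)" by (simp add: measurable_completion)
  have "(%z. indicator {z::real. - a <= z & z <= a} (snd z - fst z) :: ennreal) : borel_measurable (lebesgue \<Otimes>\<^sub>M lebesgue)"
   using measurable_compose[OF measurable_fst i] measurable_compose[OF measurable_snd i] by measurable
  moreover have "indicator {z::real. - a <= z & z <= a} (t - x) = (indicator {x-a..x+a} t :: ennreal)" for x t by (auto simp: indicator_def)
  ultimately have [measurable]: "(%z. indicator {fst z-a..fst z+a} (snd z) :: ennreal) : borel_measurable (lebesgue \<Otimes>\<^sub>M lebesgue)" by simp
  show ?thesis unfolding case_prod_beta by measurable
 qed
 have "(\<integral>\<^sup>+x. ennreal ((cmod (g x))^2 * abs(w x)) \<partial>lebesgue) <=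
   (\<integral>\<^sup>+x. ennreal (C^2 * ww) * (\<integral>\<^sup>+t. ennreal (abs(w x)) * (ennreal (?H t) * indicator {x-a..x+a} t) \<partial>lebesgue) \<partial>lebesgue)"
  by (intro nn_integral_mono pt)
 also have "... = ennreal (C^2 * ww) * (\<integral>\<^sup>+x. (\<integral>\<^sup>+t. ennreal (abs(w x)) * (ennreal (?H t) * indicator {x-a..x+a} t) \<partial>lebesgue) \<partial>lebesgue)"
  using L.borel_measurable_nn_integral_fst[OF pm] by (intro nn_integral_cmult) simp
 also have "(\<integral>\<^sup>+x. (\<integral>\<^sup>+t. ennreal (abs(w x)) * (ennreal (?H t) * indicator {x-a..x+a} t) \<partial>lebesgue) \<partial>lebesgue)
   = (\<integral>\<^sup>+t. (\<integral>\<^sup>+x. ennreal (abs(w x)) * (ennreal (?H t) * indicator {x-a..x+a} t) \<partial>lebesgue) \<partial>lebesgue)"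
  using LL.Fubini'[OF pm] by simp
 also have "... = (\<integral>\<^sup>+t. (\<integral>\<^sup>+x. ennreal (?H t) * (ennreal (abs(w x)) * indicator {t-a..t+a} x) \<partial>lebesgue) \<partial>lebesgue)"
  by (intro nn_integral_cong) (auto simp: indicator_def mult_ac)
 also have "... = (\<integral>\<^sup>+t. ennreal (?H t) * (\<integral>\<^sup>+x. (ennreal (abs(w x)) * indicator {t-a..t+a} x) \<partial>lebesgue) \<partial>lebesgue)"
  by (intro nn_integral_cong nn_integral_cmult borel_measurable_times_ennreal borel_measurable_indicator measurable_compose[OF borel_measurable_abs[OF w_meas] measurable_ennreal]) simp
 also have "... <= (\<integral>\<^sup>+t. ennreal (?H t) * ennreal ww \<partial>lebesgue)"
  by (intro nn_integral_mono mult_left_mono wi) simp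
 also have "... = (\<integral>\<^sup>+t. ennreal (?H t) \<partial>lebesgue) * ennreal ww" by (rule nn_integral_multc) measurable
 also have "(\<integral>\<^sup>+t. ennreal (?H t) \<partial>lebesgue) = ennreal ((L2_norm w (ae_class h))^2)"
  unfolding L2_norm_sq[OF hm] using nn_integral_eq_integral[OF iH] by simp
 also have "ennreal (C^2 * ww) * (ennreal ((L2_norm w (ae_class h))^2) * ennreal ww) = ennreal ((C * ww * L2_norm w (ae_class h))^2)"
  using ww C by (simp add: ennreal_mult[symmetric] power_mult_distrib power2_eq_square mult_ac)
 finally have fin: "(\<integral>\<^sup>+x. ennreal ((cmod (g x))^2 * abs(w x)) \<partial>lebesgue) <= ennreal ((C * ww * L2_norm w (ae_class h))^2)"
  by (simp add: mult_left_mono)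
 have ig: "lint (%x. (cmod (g x))^2 * abs(w x))"
  by (rule integrableI_bounded) (use fin in "auto simp: order_le_less_trans")
 then show g2: "g : sq_integrable w" using g by (simp add: sq_integrable_def)
 have "ennreal ((L2_norm w (ae_class g))^2) <= ennreal ((C * ww * L2_norm w (ae_class h))^2)"
  unfolding L2_norm_sq[OF g] using fin nn_integral_eq_integral[OF ig] by simp
 then have "(L2_norm w (ae_class g))^2 <= (C * ww * L2_norm w (ae_class h))^2" by (simp add: ennreal_le_iff)
 then show "L2_norm w (ae_class g) <= C * ww * L2_norm w (ae_class h)"
  by (rule power2_le_imp_le) (use C ww h in "auto intro!: mult_nonneg_nonneg L2_norm_nonneg simp: L2_class")
qed

definition qpair :: "complex => (real => complex) => (real => complex) \<times> (real => complex)" where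
 "qpair l h = (SOME uv. sys l h (fst uv) (snd uv))"

definition qf :: "complex => (real => complex) => real => complex" where
 "qf l h x = fst (qpair l h) (x + a) + fst (qpair l h) (x - a) - disc l * fst (qpair l h) x"

definition qf' :: "complex => (real => complex) => real => complex" where
 "qf' l h x = snd (qpair l h) (x + a) + snd (qpair l h) (x - a) - disc l * snd (qpair l h) x"

lemma qpair: "wint h ==> sys l h (fst (qpair l h)) (snd (qpair l h))"
proof -
 assume "wint h"
 from sys_exists[OF this, of l 0 0 0] obtain u v where "sys l h u v" by blast
 then have "EX uv. sys l h (fst uv) (snd uv)" by (intro exI[of _ "(u, v)"]) auto
 from someI_ex[OF this, folded qpair_def] show ?thesis .
qed

text \<open>Two solutions differ by a solution of the homogeneous equation, on which the combination
  vanishes by \<open>hom_step\<close>.\<close>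

lemma qf_eq:
 assumes s: "sys l h u v"
 shows "qf l h x = u (x + a) + u (x - a) - disc l * u x" "qf' l h x = v (x + a) + v (x - a) - disc l * v x"
proof -
 have "sys l (%_. 0) (%x. u x - fst (qpair l h) x) (%x. v x - snd (qpair l h) x)"
  using sys_diff[OF s qpair[OF sys_wint[OF s]]] by simp
 note d = hom_step[OF this, of x]
 show "qf l h x = u (x + a) + u (x - a) - disc l * u x" using d(1) unfolding qf_def by (simp add: algebra_simps)
 show "qf' l h x = v (x + a) + v (x - a) - disc l * v x" using d(2) unfolding qf'_def by (simp add: algebra_simps)
qed

lemma qf_sys:
 assumes h: "wint h" shows "sys l (%x. h (x + a) + h (x - a) - disc l * h x) (qf l h) (qf' l h)"
 unfolding qf_def[abs_def] qf'_def[abs_def]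
 using sys_diff[OF sys_add[OF sys_translate[OF qpair[OF h]] sys_translate'[OF qpair[OF h]]] sys_cmult[OF qpair[OF h]]] .

lemma qf_measurable: "wint h ==> qf l h : lmeas"
 using sys_continuous(1)[OF qf_sys] by (simp add: borel_measurable_continuous_onI measurable_completion)

lemma qf_add: assumes "wint h" "wint k" shows "qf l (%x. h x + k x) x = qf l h x + qf l k x"
 unfolding qf_eq(1)[OF sys_add[OF qpair[OF assms(1), of l] qpair[OF assms(2), of l]]] qf_eq(1)[OF qpair[OF assms(1), of l]] qf_eq(1)[OF qpair[OF assms(2), of l]]
 by (simp add: algebra_simps)

lemma qf_cmult: assumes "wint h" shows "qf l (%x. c * h x) x = c * qf l h x"
 unfolding qf_eq(1)[OF sys_cmult[OF qpair[OF assms, of l]]] qf_eq(1)[OF qpair[OF assms, of l]]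
 by (simp add: algebra_simps)

text \<open>For each \<open>x\<close> separately, the solution with zero data at x - a may be used.
  The value at \<open>x\<close> is then controlled by \<open>h\<close> on one window, however fast
  solutions grow on the line.\<close>

lemma qf_zero_data:
 assumes h: "wint h"
 shows "EX u v. sys l h u v & u (x - a) = 0 & v (x - a) = 0 &
   (ALL y. x - a <= y --> y <= x + a --> cmod (u y) <= ee l * window h x)"
proof -
 obtain u v where uv: "sys l h u v" "u (x - a) = 0" "v (x - a) = 0"
  using sys_exists[OF h, of l "x - a" 0 0] by (elim exE conjE) (rule that)
 have "cmod (u y) <= ee l * window h x" if "x - a <= y" "y <= x + a" for y
 proof -
  have "cmod (u y) + cmod (v y) <= window h x * exp (LEB t:{x-a..x+a}. kk l t)"
   by (rule sys_bound_zero[OF uv that])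
  also have "... <= window h x * ee l" by (intro mult_left_mono ee set_integral_nonneg_loc) simp
  finally have "cmod (u y) + cmod (v y) <= ee l * window h x" by (simp only: mult.commute)
  then show ?thesis using norm_ge_zero[of "v y"] by linarith
 qed
 then show ?thesis using uv by blast
qed

lemma qf_bound:
 assumes h: "wint h"
 shows "cmod (qf l h x) <= (1 + cmod (disc l)) * ee l * window h x"
proof -
 obtain u v where uv: "sys l h u v" "u (x - a) = 0" "!!y. x - a <= y ==> y <= x + a ==> cmod (u y) <= ee l * window h x"
  using qf_zero_data[OF h, of l x] by (elim exE conjE) (rule that, assumption, assumption, blast)
 have "cmod (qf l h x) <= cmod (u (x + a)) + cmod (disc l) * cmod (u x)"
  unfolding qf_eq(1)[OF uv(1)] using uv(2) norm_triangle_ineq4[of "u (x + a)" "disc l * u x"] by (simp add: norm_mult)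
 also have "... <= ee l * window h x + cmod (disc l) * (ee l * window h x)"
  using a_pos by (intro add_mono mult_left_mono uv(3)) auto
 finally show ?thesis by (simp add: algebra_simps)
qed

text \<open>With zero data at x - a for both parameters, the difference of the solutions solves the
  equation with right-hand side (l - m) u' and is estimated in the same way.\<close>

lemma qf_lipschitz:
 assumes h: "wint h" and l: "cmod l <= R" and m: "cmod m <= R"
 shows "cmod (qf l h x - qf m h x) <=
  ((1 + cmod (disc l)) * (ee (of_real R))^2 * ww * cmod (l - m) + cmod (disc l - disc m) * ee (of_real R)) * window h x"
proof -
 define E where "E = ee (of_real R)"
 have "0 <= R" using order_trans[OF norm_ge_zero l] .
 then have E: "ee l <= E" "ee m <= E" "1 <= E" unfolding E_def using l m by (auto intro!: ee)
 have H: "0 <= window h x" by (intro set_integral_nonneg_loc) simp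
 obtain u v where u: "sys l h u v" "u (x - a) = 0" "v (x - a) = 0"
  using qf_zero_data[OF h, of l x] by (elim exE conjE) (rule that)
 obtain u' v' where u': "sys m h u' v'" "u' (x - a) = 0" "v' (x - a) = 0"
   "!!y. x - a <= y ==> y <= x + a ==> cmod (u' y) <= ee m * window h x"
  using qf_zero_data[OF h, of m x] by (elim exE conjE) (rule that, assumption, assumption, assumption, blast)
 have u'E: "cmod (u' y) <= E * window h x" if "x - a <= y" "y <= x + a" for y
  using u'(4)[OF that] mult_right_mono[OF E(2) H] by linarith
 have s: "sys l (%x. (l - m) * u' x) (%x. u x - u' x) (%x. v x - v' x)"
  using sys_diff[OF u(1) sys_shift_param[OF u'(1), of l]] by (simp add: algebra_simps)
 have d: "cmod (u y - u' y) <= E * (cmod (l - m) * (E * window h x) * ww)" if y: "x - a <= y" "y <= x + a" for y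
 proof -
  have "cmod (u y - u' y) + cmod (v y - v' y) <= (LEB t:{x-a..x+a}. abs(w t) * cmod ((l - m) * u' t)) * exp (LEB t:{x-a..x+a}. kk l t)"
   by (rule sys_bound_zero[OF s _ _ y]) (simp_all add: u u')
  also have "... <= ((cmod (l - m) * (E * window h x)) * ww) * E"
  proof (rule mult_mono)
   have "(LEB t:{x-a..x+a}. abs(w t) * cmod ((l - m) * u' t)) <= (cmod (l - m) * (E * window h x)) * (LEB t:{x-a..x+a}. abs(w t))"
    by (rule weighted_integral_bound[OF sys_wint[OF s]]) (auto simp: norm_mult intro!: mult_left_mono u'E)
   also have "... <= (cmod (l - m) * (E * window h x)) * ww" using E H by (intro mult_left_mono ww mult_nonneg_nonneg) auto
   finally show "(LEB t:{x-a..x+a}. abs(w t) * cmod ((l - m) * u' t)) <= cmod (l - m) * (E * window h x) * ww" .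
   show "exp (LEB t:{x-a..x+a}. kk l t) <= E" using ee(2)[where x=x] E(1) order_trans by blast
  qed (use E H ww in auto)
  finally have "cmod (u y - u' y) + cmod (v y - v' y) <= E * (cmod (l - m) * (E * window h x) * ww)" by (simp only: mult_ac)
  then show ?thesis using norm_ge_zero[of "v y - v' y"] by linarith
 qed
 have e: "qf l h x - qf m h x = ((u (x + a) - u' (x + a)) - disc l * (u x - u' x)) - (disc l - disc m) * u' x"
  unfolding qf_eq(1)[OF u(1)] qf_eq(1)[OF u'(1)] using u(2) u'(2) by (simp add: algebra_simps)
 have "cmod (qf l h x - qf m h x) <= cmod ((u (x + a) - u' (x + a)) - disc l * (u x - u' x)) + cmod ((disc l - disc m) * u' x)"
  unfolding e by (rule norm_triangle_ineq4)
 also have "... <= (cmod (u (x + a) - u' (x + a)) + cmod (disc l) * cmod (u x - u' x)) + cmod (disc l - disc m) * cmod (u' x)"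
  using norm_triangle_ineq4[of "u (x + a) - u' (x + a)" "disc l * (u x - u' x)"] by (simp add: norm_mult)
 also have "... <= (E * (cmod (l - m) * (E * window h x) * ww) + cmod (disc l) * (E * (cmod (l - m) * (E * window h x) * ww))) + cmod (disc l - disc m) * (E * window h x)"
  using a_pos by (intro add_mono mult_left_mono d u'E) auto
 also have "... = ((1 + cmod (disc l)) * E^2 * ww * cmod (l - m) + cmod (disc l - disc m) * E) * window h x"
  by (simp add: algebra_simps power2_eq_square)
 finally show ?thesis unfolding E_def .
qed

definition QQ :: "complex => ae_fun => ae_fun" where "QQ l F = ae_class (qf l (ae_rep F))"

lemma qf_cong_AE:
 assumes h: "wint h" and ae: "AE x. h x = k x"
 shows "qf l h = qf l k"
proof -
 have "sys l k (fst (qpair l h)) (snd (qpair l h))"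
  unfolding sys_def
 proof (rule conjI[OF sysD(1)[OF qpair[OF h]]], rule prim_cong_AE[OF sysD(2)[OF qpair[OF h]]])
  show "AE x. (cor (q x) - l * cor (w x)) * fst (qpair l h) x - cor (w x) * k x =
   (cor (q x) - l * cor (w x)) * fst (qpair l h) x - cor (w x) * h x"
   using ae by eventually_elim simp
 qed
 from qf_eq(1)[OF this] show ?thesis by (auto simp: qf_def)
qed

lemma QQ_class: "h : sq_integrable w ==> QQ l (ae_class h) = ae_class (qf l h)"
proof -
 assume h: "h : sq_integrable w"
 have "AE x. h x = ae_rep (ae_class h) x" using AE_rep_class[of h] by (auto elim: eventually_mono)
 from qf_cong_AE[OF sq_integrable_wint[OF h] this, of l] show ?thesis by (simp add: QQ_def)
qed

end

lemma continuous_AE_zero: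
 fixes f :: "real => complex"
 assumes f: "continuous_on UNIV f" and ae: "AE x. x : {c<..<d} --> f x = 0" and x: "x : {c<..<d}"
 shows "f x = 0"
proof -
 have "{y. f y ~= 0} = - {y. f y = 0}" by auto
 moreover have "closed {y. f y = 0}" using continuous_closed_preimage_constant[OF f closed_UNIV, of 0] by simp
 ultimately have "open ({c<..<d} Int {y. f y ~= 0})" by (auto intro!: open_Int)
 moreover have "negligible ({c<..<d} Int {y. f y ~= 0})"
 proof -
  obtain N where N: "N : null_sets lebesgue" "{x. ~ (x : {c<..<d} --> f x = 0)} <= N" using ae by (auto simp: eventually_ae_filter)
  then have "{c<..<d} Int {y. f y ~= 0} <= N" by auto
  then show ?thesis using N(1) negligible_iff_null_sets negligible_subset by blast
 qed
 ultimately have "{c<..<d} Int {y. f y ~= 0} = {}" using open_not_negligible by blast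
 then show ?thesis using x by blast
qed

context periodic_SL
begin

abbreviation "HH == L2 w"
abbreviation "DD == max_dom w p q"
abbreviation "AA == max_op w p q"

lemma max_op_class:
 assumes u: "u : AC_loc" shows "AA (ae_class u) = ae_class (SL_expr w p q u)"
proof -
 have "(THE f. f : AC_loc & ae_class f = ae_class u) = u"
 proof (rule the_equality)
  fix f assume f: "f : AC_loc & ae_class f = ae_class u"
  then have "AE x. f x = u x" by (simp add: ae_class_eq_iff)
  then show "f = u"
   using continuous_AE_eq[OF prim_continuous prim_continuous, OF AC_prim_vector_derivative AC_prim_vector_derivative] f u by blast
 qed (simp add: u)
 then show ?thesis by (simp add: max_op_def)
qed

lemma max_domI:
 assumes s: "sys l h u v" and u: "u : sq_integrable w" and h: "h : sq_integrable w"
 shows "ae_class u : DD" "AA (ae_class u) - l *\<^sub>C ae_class u = ae_class h"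
proof -
 note e = SL_expr_sys[OF s]
 have e': "AE x. l * u x + h x = SL_expr w p q u x" using e(3) by eventually_elim simp
 have "SL_expr w p q u : sq_integrable w"
  by (rule sq_integrable_cong_AE[OF sq_integrable_add[OF sq_integrable_cmult[OF u] h] e'])
 then show "ae_class u : DD" using u e(1) by (auto simp: max_dom_def)
 have ac: "u : AC_loc" using e(1) by (simp add: SL_domain_def)
 show "AA (ae_class u) - l *\<^sub>C ae_class u = ae_class h"
  unfolding max_op_class[OF ac] ae_class_arith(2,3) ae_class_eq_iff using e(3) by eventually_elim simp
qed

lemma max_domD:
 assumes F: "F : DD"
 shows "EX u v h. F = ae_class u & u : sq_integrable w & h : sq_integrable w & sys l h u v & AA F - l *\<^sub>C F = ae_class h"
proof -
 obtain u where u: "F = ae_class u" "u : sq_integrable w" "u : SL_domain p" "SL_expr w p q u : sq_integrable w"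
  using F by (auto simp: max_dom_def)
 define h where "h x = SL_expr w p q u x - l * u x" for x
 have h: "h : sq_integrable w"
  using sq_integrable_add[OF u(4) sq_integrable_cmult[OF u(2), of "-l"]] by (simp add: h_def[abs_def])
 have s: "sys l h u (quasi_deriv p u)" by (rule sys_SL_expr[OF u(3)]) (simp add: h_def)
 show ?thesis using u(1,2) h s max_domI(2)[OF s u(2) h] by blast
qed

lemma DD_subset: "DD <= HH" by (auto simp: max_dom_def L2_class)

lemma max_op_L2: "F : DD ==> AA F : HH"
proof -
 assume "F : DD"
 then obtain h where "AA F - 0 *\<^sub>C F = ae_class h" "h : sq_integrable w" using max_domD[of F 0] by blast
 then show "AA F : HH" by (simp add: L2_class)
qed

lemma max_dom_add:
 assumes F: "F : DD" and G: "G : DD" shows "F + G : DD" "AA (F + G) = AA F + AA G"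
proof -
 obtain u v h where f: "F = ae_class u" "u : sq_integrable w" "h : sq_integrable w" "sys 0 h u v" "AA F - 0 *\<^sub>C F = ae_class h"
  using max_domD[OF F, of 0] by (elim exE conjE) (rule that)
 obtain u' v' h' where g: "G = ae_class u'" "u' : sq_integrable w" "h' : sq_integrable w" "sys 0 h' u' v'" "AA G - 0 *\<^sub>C G = ae_class h'"
  using max_domD[OF G, of 0] by (elim exE conjE) (rule that)
 note * = max_domI[OF sys_add[OF f(4) g(4)] sq_integrable_add[OF f(2) g(2)] sq_integrable_add[OF f(3) g(3)]]
 show "F + G : DD" using *(1) by (simp add: f(1) g(1) ae_class_arith)
 show "AA (F + G) = AA F + AA G" using *(2)[simplified] f(5)[simplified] g(5)[simplified] by (simp only: f(1) g(1) ae_class_arith(1))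
qed

lemma max_dom_scale:
 assumes F: "F : DD" shows "c *\<^sub>C F : DD" "AA (c *\<^sub>C F) = c *\<^sub>C AA F"
proof -
 obtain u v h where f: "F = ae_class u" "u : sq_integrable w" "h : sq_integrable w" "sys 0 h u v" "AA F - 0 *\<^sub>C F = ae_class h"
  using max_domD[OF F, of 0] by (elim exE conjE) (rule that)
 note * = max_domI[OF sys_cmult[OF f(4), of c] sq_integrable_cmult[OF f(2)] sq_integrable_cmult[OF f(3)]]
 show "c *\<^sub>C F : DD" using *(1) by (simp add: f(1) ae_class_arith)
 show "AA (c *\<^sub>C F) = c *\<^sub>C AA F" using *(2)[simplified] f(5)[simplified] by (simp only: f(1) ae_class_arith(3))
qed

lemma DD_subspace: "complex_vector.subspace DD"
proof -
 have "sys 0 (%_. 0) (%_. 0) (%_. 0)" using sys_cmult[OF hom(1)[of 0 0 0], of 0] by simp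
 from max_domI(1)[OF this sq_integrable_zero sq_integrable_zero] have "0 : DD" by (simp add: zero_ae_fun_def)
 then show ?thesis unfolding complex_vector.subspace_def using max_dom_add max_dom_scale by blast
qed

lemma QQ_bound:
 assumes F: "F : HH"
 shows "QQ l F : HH" "L2_norm w (QQ l F) <= (1 + cmod (disc l)) * ee l * ww * L2_norm w F"
proof -
 obtain f where f: "F = ae_class f" "f : sq_integrable w" "f : lmeas" using L2E[OF F] .
 note fw = sq_integrable_wint[OF f(2)]
 have c: "0 <= (1 + cmod (disc l)) * ee l" using ee(1)[of l] by auto
 note * = window_bound[OF f(2) qf_measurable[OF fw] c qf_bound[OF fw]]
 show "QQ l F : HH" using *(1) by (simp add: f(1) QQ_class f(2) L2_class)
 show "L2_norm w (QQ l F) <= (1 + cmod (disc l)) * ee l * ww * L2_norm w F"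
  using *(2) by (simp add: f(1) QQ_class f(2))
qed

lemma QQ_lipschitz:
 assumes F: "F : HH" and l: "cmod l <= R" and m: "cmod m <= R"
 shows "L2_norm w (QQ l F - QQ m F) <=
  ((1 + cmod (disc l)) * (ee (of_real R))^2 * ww * cmod (l - m) + cmod (disc l - disc m) * ee (of_real R)) * ww * L2_norm w F"
proof -
 obtain f where f: "F = ae_class f" "f : sq_integrable w" "f : lmeas" using L2E[OF F] .
 note fw = sq_integrable_wint[OF f(2)]
 have c: "0 <= (1 + cmod (disc l)) * (ee (of_real R))^2 * ww * cmod (l - m) + cmod (disc l - disc m) * ee (of_real R)"
  using ee(1)[of "of_real R"] ww(1) by (intro add_nonneg_nonneg mult_nonneg_nonneg) auto
 have "(%x. qf l f x - qf m f x) : lmeas" using qf_measurable[OF fw] by measurable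
 from window_bound(2)[OF f(2) this c qf_lipschitz[OF fw l m]]
 show ?thesis by (simp add: f(1) QQ_class f(2) ae_class_arith)
qed

lemma disc_lipschitz: "EX K>=0. ALL l:cball 0 R. ALL m:cball 0 R. cmod (disc l - disc m) <= K * cmod (l - m)"
proof -
 have "continuous_on (cball 0 R) (deriv disc)"
  by (rule continuous_on_subset[OF holomorphic_on_imp_continuous_on[OF holomorphic_deriv[OF disc_holomorphic open_UNIV]]]) simp
 from compact_imp_bounded[OF compact_continuous_image[OF this compact_cball]]
 obtain K where K: "ALL y:deriv disc ` cball 0 R. cmod y <= K" "0 < K" unfolding bounded_pos by blast
 have "cmod (disc l - disc m) <= K * cmod (l - m)" if "l : cball 0 R" "m : cball 0 R" for l m
  by (rule field_differentiable_bound[where S="cball 0 R" and f' = "deriv disc"])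
   (use that K(1) holomorphic_derivI[OF disc_holomorphic open_UNIV] in "auto intro: has_field_derivative_at_within")
 then show ?thesis using K(2) by (intro exI[of _ K]) auto
qed

lemma disc_bounded: "EX K>=0. ALL l:cball 0 R. cmod (disc l) <= K"
proof -
 have "continuous_on (cball 0 R) disc"
  by (rule continuous_on_subset[OF holomorphic_on_imp_continuous_on[OF disc_holomorphic]]) simp
 from compact_imp_bounded[OF compact_continuous_image[OF this compact_cball]]
 obtain K where "ALL y:disc ` cball 0 R. cmod y <= K" "0 < K" unfolding bounded_pos by blast
 then show ?thesis by (intro exI[of _ K]) auto
qed

lemma QQ_locally_lipschitz:
 "EX K>=0. ALL l:cball 0 R. ALL m:cball 0 R. ALL x:HH. L2_norm w (QQ l x) <= K * L2_norm w x & L2_norm w (QQ l x - QQ m x) <= K * cmod (l - m) * L2_norm w x"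
proof (cases "0 <= R")
 case True
 obtain K1 where K1: "0 <= K1" "!!l m. l : cball 0 R ==> m : cball 0 R ==> cmod (disc l - disc m) <= K1 * cmod (l - m)"
  using disc_lipschitz[of R] by blast
 obtain K2 where K2: "0 <= K2" "!!l. l : cball 0 R ==> cmod (disc l) <= K2" using disc_bounded[of R] by blast
 define E where "E = ee (of_real R)"
 have E: "1 <= E" unfolding E_def by (rule ee)
 define L where "L = ((1 + K2) * E^2 * ww + K1 * E) * ww"
 have L: "0 <= L" unfolding L_def using E K1 K2 ww by (intro mult_nonneg_nonneg add_nonneg_nonneg) auto
 have M: "0 <= (1 + K2) * E * ww" using E K1 K2 ww by (intro mult_nonneg_nonneg add_nonneg_nonneg) auto
 show ?thesis
 proof (intro exI[of _ "L + (1 + K2) * E * ww"] conjI ballI)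
  show "0 <= L + (1 + K2) * E * ww" using L M by simp
  fix l m :: complex and x assume l: "l : cball 0 R" and m: "m : cball 0 R" and x: "x : HH"
  have n: "0 <= L2_norm w x" by (rule L2_norm_nonneg[OF x])
  have el: "ee l <= E" unfolding E_def using l True by (intro ee(3)) auto
  have "(1 + cmod (disc l)) * ee l * ww <= (1 + K2) * E * ww"
   using K2(2)[OF l] el ee(1)[of l] ww(1) K2(1) by (intro mult_mono mult_nonneg_nonneg) auto
  then have "(1 + cmod (disc l)) * ee l * ww * L2_norm w x <= (L + (1 + K2) * E * ww) * L2_norm w x"
   using L n by (intro mult_right_mono) auto
  then show "L2_norm w (QQ l x) <= (L + (1 + K2) * E * ww) * L2_norm w x"
   using QQ_bound(2)[OF x, of l] by linarith
  have "((1 + cmod (disc l)) * E^2 * ww * cmod (l - m) + cmod (disc l - disc m) * E) * ww <=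
    ((1 + K2) * E^2 * ww * cmod (l - m) + K1 * cmod (l - m) * E) * ww"
   using K2 K1 l m E ww(1) by (intro mult_right_mono add_mono mult_mono mult_nonneg_nonneg) auto
  also have "... = L * cmod (l - m)" by (simp add: L_def algebra_simps)
  also have "... <= (L + (1 + K2) * E * ww) * cmod (l - m)" using M by (intro mult_right_mono) auto
  finally have "((1 + cmod (disc l)) * E^2 * ww * cmod (l - m) + cmod (disc l - disc m) * E) * ww * L2_norm w x <= (L + (1 + K2) * E * ww) * cmod (l - m) * L2_norm w x"
   using n by (rule mult_right_mono)
  then show "L2_norm w (QQ l x - QQ m x) <= (L + (1 + K2) * E * ww) * cmod (l - m) * L2_norm w x"
   using QQ_lipschitz[OF x, of l R m] l m unfolding E_def by simp
 qed
next
 case False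
 then have "cball (0::complex) R = {}" by simp
 then show ?thesis by (intro exI[of _ 0]) simp
qed

lemma QQ_linear: 
 "F : HH ==> G : HH ==> QQ l (F + G) = QQ l F + QQ l G" "F : HH ==> QQ l (c *\<^sub>C F) = c *\<^sub>C QQ l F"
proof -
 assume F: "F : HH"
 obtain f where f: "F = ae_class f" "f : sq_integrable w" "f : lmeas" using L2E[OF F] .
 show "QQ l (c *\<^sub>C F) = c *\<^sub>C QQ l F"
  unfolding f(1) ae_class_arith(3) QQ_class[OF f(2)] QQ_class[OF sq_integrable_cmult[OF f(2)]]
  by (intro arg_cong[where f=ae_class] ext qf_cmult[OF sq_integrable_wint[OF f(2)]])
 assume G: "G : HH"
 obtain g where g: "G = ae_class g" "g : sq_integrable w" "g : lmeas" using L2E[OF G] .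
 show "QQ l (F + G) = QQ l F + QQ l G"
  unfolding f(1) g(1) ae_class_arith(1) QQ_class[OF f(2)] QQ_class[OF g(2)] QQ_class[OF sq_integrable_add[OF f(2) g(2)]]
  by (intro arg_cong[where f=ae_class] ext qf_add[OF sq_integrable_wint[OF f(2)] sq_integrable_wint[OF g(2)]])
qed

lemma QQ_right_inverse:
 assumes F: "F : HH"
 shows "QQ l F : DD" "AA (QQ l F) - l *\<^sub>C QQ l F = shift_sum F - disc l *\<^sub>C F"
proof -
 obtain f where f: "F = ae_class f" "f : sq_integrable w" "f : lmeas" using L2E[OF F] .
 have q: "qf l f : sq_integrable w" using QQ_bound(1)[OF F, of l] by (simp add: f(1) QQ_class f(2) L2_class)
 have h: "(%x. f (x + a) + f (x - a) - disc l * f x) : sq_integrable w"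
  using sq_integrable_add[OF sq_integrable_add[OF sq_integrable_translate[OF f(2), of a] sq_integrable_translate[OF f(2), of "-a"]] sq_integrable_cmult[OF f(2), of "- disc l"]] w_per w_per' by simp
 show "QQ l F : DD" "AA (QQ l F) - l *\<^sub>C QQ l F = shift_sum F - disc l *\<^sub>C F"
  using max_domI[OF qf_sys[OF sq_integrable_wint[OF f(2)], of l] q h] by (simp_all add: f(1) QQ_class f(2) shift_sum_class ae_class_arith)
qed

lemma QQ_left_inverse:
 assumes F: "F : DD"
 shows "QQ l (AA F - l *\<^sub>C F) = shift_sum F - disc l *\<^sub>C F"
proof -
 obtain u v h where f: "F = ae_class u" "u : sq_integrable w" "h : sq_integrable w" "sys l h u v" "AA F - l *\<^sub>C F = ae_class h"
  using max_domD[OF F, of l] by (elim exE conjE) (rule that)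
 have "qf l h = (%x. u (x + a) + u (x - a) - disc l * u x)" using qf_eq(1)[OF f(4)] by auto
 then have "QQ l (AA F - l *\<^sub>C F) = ae_class (%x. u (x + a) + u (x - a) - disc l * u x)" by (simp only: f(5) QQ_class[OF f(3)])
 also have "... = shift_sum F - disc l *\<^sub>C F" by (simp only: f(1) shift_sum_class ae_class_arith(2,3))
 finally show ?thesis .
qed

text \<open>If \<open>A - l\<close> is onto, then the solution of \<open>(A - l) g = h\<close> for \<open>h\<close> supported in \<open>[0, a]\<close> solves the
  homogeneous equation outside of this interval and is square integrable there, hence vanishes there.\<close>

lemma sys_local_eq:
 assumes s: "sys l h u v" and h: "!!t. c <= t ==> t <= d ==> h t = 0" and z: "u c = 0" "v c = 0" and x: "c <= x" "x <= d"
 shows "u x = 0 & v x = 0"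
proof -
 have "(LEB t:{c..d}. abs(w t) * cmod (h t)) <= 0 * (LEB t:{c..d}. abs(w t))"
  by (rule weighted_integral_bound[OF sys_wint[OF s]]) (simp add: h)
 then have "(LEB t:{c..d}. abs(w t) * cmod (h t)) = 0" using set_integral_nonneg_loc[of c d "%t. abs(w t) * cmod (h t)"] by simp
 then have "cmod (u x) + cmod (v x) <= 0" using sys_bound_zero[OF s z x] by simp
 then show ?thesis by (smt (verit) norm_ge_zero norm_le_zero_iff)
qed

lemma sys_hom_at:
 assumes s: "sys l h u v" and h: "!!t. c <= t ==> t <= d ==> h t = 0" 
 shows "EX u0 v0. sys l (%_. 0) u0 v0 & (ALL x. c <= x --> x <= d --> u0 x = u x & v0 x = v x)"
proof -
 obtain u0 v0 where u0: "sys l (%_. 0) u0 v0" "u0 c = u c" "v0 c = v c"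
  using sys_exists[OF wint_zero, of l c "u c" "v c"] by (elim exE conjE) (rule that)
 have "u0 x - u x = 0 & v0 x - v x = 0" if "c <= x" "x <= d" for x
  by (rule sys_local_eq[OF sys_diff[OF u0(1) s] _ _ _ that]) (use h u0 in auto)
 then show ?thesis using u0(1) by (intro exI[of _ u0] exI[of _ v0]) auto
qed

text \<open>Where \<open>u\<close> vanishes on an interval, so does u' = v / p, and one point with
  zero data suffices.\<close>

lemma sys_hom_zero:
 assumes s: "sys l (%_. 0) u v" and uz: "!!x. x : {0<..<a} ==> u x = 0"
 shows "u x = 0 & v x = 0"
proof -
 define c where "c = a / 3"
 define d where "d = a / 2"
 have cd: "0 < c" "c < d" "d < a" using a_pos by (auto simp: c_def d_def)
 have "v x = 0" if x: "c <= x" "x <= d" for x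
 proof -
  have "AE x. x : {0<..<a} --> v x = 0"
   using prim_derivative_AE[OF sysD(1)[OF s]] p_pos
  proof eventually_elim
   case (elim x)
   show ?case
   proof
    assume x: "x : {0<..<a}"
    have "(u has_vector_derivative v x / cor (p x)) (at x)" using elim(1) .
    moreover have "(u has_vector_derivative 0) (at x)"
     by (rule has_vector_derivative_transform_within_open[OF has_vector_derivative_const, of "{0<..<a}"]) (use x uz in auto)
    ultimately have "v x / cor (p x) = 0" by (rule vector_derivative_unique_at)
    then show "v x = 0" using elim(2) by simp
   qed
  qed
  from continuous_AE_zero[OF sys_continuous(2)[OF s] this, of x] show "v x = 0" using x cd by auto
 qed
 then have "v c = 0" "u c = 0" using cd uz by auto
 then show ?thesis using sys_zero_unique[OF s] by blast
qed

text \<open>Along x + k b the solution satisfies the recurrence of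
  \<open>recurrence_decaying_zero\<close>. It agrees with a square integrable function on all later
  cells, so it decays along a subsequence for almost every \<open>x\<close>.\<close>

lemma hom_decaying_zero:
 assumes s: "sys l (%_. 0) u v" and D: "disc l = cor r" "abs r <= 2"
  and f: "f : sq_integrable w" and b: "b = a | b = -a"
  and eq: "!!x k. x : {0<..<a} ==> u (x + real (Suc k) * b) = f (x + real (Suc k) * b)"
 shows "u x = 0 & v x = 0"
proof -
 obtain r' where r': "AE x. x : {0<..<a} --> (%k. f (x + real (Suc (r' k)) * b)) ----> 0 & (%k. f (x + real (Suc (Suc (r' k))) * b)) ----> 0"
  by (rule orbit_tendsto_0[OF f b])
 have rec: "u (x + real (k + 2) * b) + u (x + real k * b) = cor r * u (x + real (k + 1) * b)" for x k
 proof -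
  have "u (y + b) + u (y - b) = cor r * u y" for y
   using hom_step(1)[OF s, of y] b D(1) by (auto simp: add.commute)
  from this[of "x + real (k + 1) * b"] show ?thesis by (simp add: algebra_simps)
 qed
 have ae: "AE x. x : {0<..<a} --> u x = 0"
  using r'
 proof eventually_elim
  case (elim x)
  show ?case
  proof
   assume x: "x : {0<..<a}"
   have "u (x + real 0 * b) = 0"
    by (rule recurrence_decaying_zero[OF D(2), of "%k. u (x + real k * b)", OF rec, of "%k. Suc (r' k)"])
     (use elim x in "simp_all only: eq[OF x]")
   then show "u x = 0" by simp
  qed
 qed
 have uz: "u x = 0" if "x : {0<..<a}" for x
  by (rule continuous_AE_zero[OF sys_continuous(1)[OF s] ae that])
 show ?thesis by (rule sys_hom_zero[OF s uz])
qed

text \<open>On [0, a] the square integrable solution \<open>g\<close> has zero data at 0 and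
  right-hand side \<open>u\<close>, exactly as \<open>y\<close>; so \<open>y\<close> inherits the
  vanishing data of \<open>g\<close> at \<open>a\<close>.\<close>

lemma surjective_derivative_zero:
 assumes D: "disc l = cor r" "abs r <= 2" and surj: "!!G. G : HH ==> EX F:DD. AA F - l *\<^sub>C F = G"
  and s: "sys l (%_. 0) u v" and y: "sys l u y y'" "y 0 = 0" "y' 0 = 0"
 shows "y a = 0 & y' a = 0"
proof -
 define h where "h x = indicator {0<..<a} x * u x" for x
 have um: "u : lmeas"
  using sys_continuous(1)[OF s] by (simp add: borel_measurable_continuous_onI measurable_completion)
 have "h : sq_integrable w"
 proof -
  have "compact (u ` {0..a})" by (intro compact_continuous_image continuous_on_subset[OF sys_continuous(1)[OF s]]) auto
  from compact_imp_bounded[OF this] obtain B where B: "ALL z:u ` {0..a}. cmod z <= B" unfolding bounded_iff by blast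
  show ?thesis
  proof (rule sq_integrable_bound)
   show "h : lmeas" unfolding h_def[abs_def] by (intro borel_measurable_times um borel_measurable_indicator) simp
   show "lint (%x. B^2 * (indicator {0..a} x *\<^sub>R (abs(w x))))"
    using loc_intD[OF w_abs_loc, of 0 a] by (simp add: set_integrable_def)
   have "(cmod (h x))^2 * abs(w x) <= B^2 * (indicator {0..a} x *\<^sub>R (abs(w x)))" for x
    using B by (auto simp: h_def indicator_def intro!: mult_right_mono power_mono)
   then show "AE x. (cmod (h x))^2 * abs(w x) <= B^2 * (indicator {0..a} x *\<^sub>R (abs(w x)))" by simp
  qed
 qed
 then have "ae_class h : HH" by (simp add: L2_class)
 then obtain F where F: "F : DD" "AA F - l *\<^sub>C F = ae_class h" using surj by blast
 obtain g g' k where g: "F = ae_class g" "g : sq_integrable w" "k : sq_integrable w" "sys l k g g'" "AA F - l *\<^sub>C F = ae_class k"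
  using max_domD[OF F(1), of l] by (elim exE conjE) (rule that)
 have kh: "AE x. cor (w x) * h x = cor (w x) * k x"
  using F(2) g(5) by (auto simp: ae_class_eq_iff elim: eventually_mono)
 have sg: "sys l h g g'"
  unfolding sys_def
 proof (rule conjI[OF sysD(1)[OF g(4)]], rule prim_cong_AE[OF sysD(2)[OF g(4)]])
  show "AE x. (cor (q x) - l * cor (w x)) * g x - cor (w x) * h x =
   (cor (q x) - l * cor (w x)) * g x - cor (w x) * k x"
   using kh by eventually_elim simp
 qed
 have hz: "h t = 0" if "t <= 0 | a <= t" for t using that by (auto simp: h_def)
 have right: "g a = 0 & g' a = 0"
 proof -
  obtain u0 v0 where u0: "sys l (%_. 0) u0 v0" "u0 a = g a" "v0 a = g' a"
   using sys_exists[OF wint_zero, of l a "g a" "g' a"] by (elim exE conjE) (rule that)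
  have e: "u0 x = g x" if "a <= x" for x
   using sys_local_eq[OF sys_diff[OF u0(1) sg] _ _ _ that order_refl] hz u0 by auto
  have "u0 a = 0 & v0 a = 0"
   by (rule hom_decaying_zero[OF u0(1) D g(2), of a]) (auto intro!: e mult_nonneg_nonneg simp: algebra_simps a_pos less_imp_le)
  then show ?thesis using u0 by simp
 qed
 have left: "g 0 = 0 & g' 0 = 0"
 proof -
  obtain u0 v0 where u0: "sys l (%_. 0) u0 v0" "u0 0 = g 0" "v0 0 = g' 0"
   using sys_exists[OF wint_zero, of l 0 "g 0" "g' 0"] by (elim exE conjE) (rule that)
  have e: "u0 x = g x" if "x <= 0" for x
  proof -
   obtain u1 v1 where u1: "sys l (%_. 0) u1 v1" "!!t. x <= t ==> t <= 0 ==> u1 t = g t & v1 t = g' t"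
    using sys_hom_at[OF sg, of x 0] hz by blast
   have "u1 = u0" by (rule sys_unique(1)[OF u1(1) u0(1), of 0]) (use u0 u1(2)[of 0] that in auto)
   then show ?thesis using u1(2)[of x] that by simp
  qed
  have "u0 0 = 0 & v0 0 = 0"
  proof (rule hom_decaying_zero[OF u0(1) D g(2), of "-a"])
   fix x k assume "x : {0<..<a}"
   moreover have "0 <= a * real k" using a_pos by simp
   moreover have "x + real (Suc k) * - a = x - a - a * real k" by (simp add: algebra_simps)
   ultimately have "x + real (Suc k) * - a <= 0" by (simp only: greaterThanLessThan_iff) linarith
   then show "u0 (x + real (Suc k) * - a) = g (x + real (Suc k) * - a)" by (rule e)
  qed simp
  then show ?thesis using u0 by simp
 qed
 have "y a - g a = 0 & y' a - g' a = 0"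
 proof -
  have ae: "AE x. x : {0..a} --> h x = u x"
   using AE_not_eq[of 0] AE_not_eq[of a] by eventually_elim (auto simp: h_def)
  have s': "sys l (%x. u x - h x) (%x. y x - g x) (%x. y' x - g' x)" by (rule sys_diff[OF y(1) sg])
  have "(LEB t:{0..a}. abs(w t) * cmod (u t - h t)) = (LEB t:{0..a}. 0)"
  proof (rule conjunct2[OF set_integral_cong_AE_lebesgue])
   show "AE t. t : {0..a} --> abs(w t) * cmod (u t - h t) = 0" using ae by eventually_elim auto
  qed (simp add: set_integrable_def)
  then have "cmod (y a - g a) + cmod (y' a - g' a) <= 0"
   using sys_bound_zero[OF s', of 0 a a] left y a_pos by (simp add: set_lebesgue_integral_def)
  then show ?thesis by (smt (verit) norm_ge_zero norm_le_zero_iff)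
 qed
 then show ?thesis using right by simp
qed

text \<open>The derivative of the discriminant is a sum of end values at \<open>a\<close> of
  solutions of the differentiated equation, and all these values vanish.\<close>

lemma surjective_disc_deriv:
 assumes D: "disc l = cor r" "abs r <= 2" and surj: "!!G. G : HH ==> EX F:DD. AA F - l *\<^sub>C F = G"
 shows "deriv disc l = 0"
proof -
 obtain y1 y1' where 1: "sys l (ph l) y1 y1'" "y1 0 = 0" "y1' 0 = 0"
  using sys_exists[OF wint_continuous[OF sys_continuous(1)[OF hom(1)[of l 1 0]]], of l 0 0 0] by (elim exE conjE) (rule that)
 obtain y2 y2' where 2: "sys l (ps l) y2 y2'" "y2 0 = 0" "y2' 0 = 0"
  using sys_exists[OF wint_continuous[OF sys_continuous(1)[OF hom(1)[of l 0 1]]], of l 0 0 0] by (elim exE conjE) (rule that)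
 have "deriv disc l = y1 a + y2' a" by (rule DERIV_imp_deriv[OF disc_has_derivative[OF 1 2]])
 then show ?thesis
  using surjective_derivative_zero[OF D surj hom(1) 1] surjective_derivative_zero[OF D surj hom(1) 2] by simp
qed

end

section \<open>Large spectral parameters\<close>

context periodic_SL
begin

definition rr :: "real => real" where "rr x = abs(1 / p x)"

lemma rr: "loc_int rr" "0 <= rr x"
 unfolding rr_def[abs_def] by (intro loc_int_abs p_loc) auto

text \<open>The integral of p |f'|^2 over one period, written with the quasi-derivative v = p
  f'.\<close>

definition kinetic :: "(real => complex) => real" where
 "kinetic v = (LEB t:{0..a}. rr t * (cmod (v t))^2)"

lemma rr_sq_loc: "continuous_on UNIV v ==> loc_int (%t. rr t * (cmod (v t))^2)"
 by (rule loc_int_mult_continuous[OF _ rr(1)]) (intro continuous_intros)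

lemma sub_interval_integral:
 fixes g :: "real => real"
 assumes g: "loc_int g" "!!t. 0 <= g t" and "0 <= x" "y <= a"
 shows "(LEB t:{x..y}. g t) <= (LEB t:{0..a}. g t)"
 by (rule set_integral_subset_mono[OF g]) (use assms in auto)

lemma rr_pos: assumes "x < y" shows "0 < (LEB t:{x..y}. rr t)"
proof -
 have nn: "0 <= (LEB t:{x..y}. rr t)" by (intro set_integral_nonneg_loc rr)
 moreover have "(LEB t:{x..y}. rr t) ~= 0"
 proof
  assume "(LEB t:{x..y}. rr t) = 0"
  then have "AE t. indicator {x..y} t *\<^sub>R rr t = 0"
   using integral_nonneg_eq_0_iff_AE[OF loc_intD[OF rr(1), of x y, unfolded set_integrable_def]] rr(2)
   by (auto simp: set_lebesgue_integral_def indicator_def)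
  then have "AE t. t : {x<..<y} --> (%_. 1::complex) t = 0" using p_pos
  proof eventually_elim
   case (elim t)
   then show ?case by (auto simp: indicator_def rr_def split: if_splits)
  qed
  from continuous_AE_zero[OF continuous_on_const this, of "(x + y) / 2"] assms show False by auto
 qed
 ultimately show ?thesis by linarith
qed

text \<open>Young's inequality for f' = v / p; the parameter \<open>ta\<close> trades the energy
  term against the length term.\<close>

lemma hom_modulus:
 assumes s: "sys l (%_. 0) f v" and xy: "0 <= x" "x <= y" "y <= a" and ta: "0 < ta" and B: "kinetic v <= B"
 shows "cmod (f y - f x) <= ta / 2 * B + 1 / (2 * ta) * (LEB t:{x..y}. rr t)"
proof -
 note c = rr_sq_loc[OF sys_continuous(2)[OF s]]
 have "cmod (f y - f x) <= (LEB t:{x..y}. ta / 2 * (rr t * (cmod (v t))^2) + 1 / (2 * ta) * rr t)"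
 proof (rule prim_norm_le[OF sysD(1)[OF s] xy(2)])
  show "loc_int (%t. ta / 2 * (rr t * (cmod (v t))^2) + 1 / (2 * ta) * rr t)" by (intro loc_int_add loc_int_cmult c rr)
  have "cmod (v t / cor (p t)) <= ta / 2 * (rr t * (cmod (v t))^2) + 1 / (2 * ta) * rr t" for t
  proof -
   have "0 <= (ta * cmod (v t))^2 + 1^2 - 2 * (ta * cmod (v t)) * 1" unfolding power2_diff[symmetric] by simp
   then have "2 * ta * cmod (v t) <= ta * ta * (cmod (v t))^2 + 1" by (simp add: power_mult_distrib power2_eq_square mult_ac)
   then have "cmod (v t) <= ta / 2 * (cmod (v t))^2 + 1 / (2 * ta)" using ta by (simp add: field_simps)
   from mult_left_mono[OF this rr(2)[of t]] show ?thesis by (simp add: rr_def norm_divide algebra_simps)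
  qed
  then show "AE t. t : {x..y} --> cmod (v t / cor (p t)) <= ta / 2 * (rr t * (cmod (v t))^2) + 1 / (2 * ta) * rr t" by simp
 qed
 also have "... = ta / 2 * (LEB t:{x..y}. rr t * (cmod (v t))^2) + 1 / (2 * ta) * (LEB t:{x..y}. rr t)"
  by (subst set_integral_add(2)) (simp_all add: loc_intD loc_int_cmult c rr)
 also have "(LEB t:{x..y}. rr t * (cmod (v t))^2) <= B"
  using sub_interval_integral[OF c _ xy(1,3)] rr(2) B by (simp add: kinetic_def)
 finally show ?thesis using ta by simp
qed

definition W :: "real => complex" where "W x = 0 + oriented_integral 0 x (%t. cor (w t))"
definition V :: "real => complex" where "V x = 0 + oriented_integral 0 x (%t. cor (abs(w t)))"

lemma W: "prim W (%t. cor (w t))" and V: "prim V (%t. cor (abs(w t)))"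
 unfolding W_def V_def by (intro prim_oriented_integral loc_int_of_real w_loc loc_int_abs)+

lemma V_diff: "s <= t ==> cmod (V t - V s) = (LEB r:{s..t}. abs(w r))"
 using primD[OF V, of s t] set_integral_nonneg_loc[of s t "%r. abs(w r)"]
 by (simp add: set_integral_complex_of_real)

text \<open>At a point \<open>t\<close> with w t nonzero where \<open>W\<close> and \<open>V\<close>
  have the derivatives w t and |w t|, both increments over a short interval are close to |w t| times
  its length.\<close>

lemma weight_not_cancelling:
 assumes cd: "c < d" shows "EX u v. c < u & u < v & v < d & cmod (V v - V u) < 4 * cmod (W v - W u)"
proof (rule ccontr)
 assume "~ ?thesis"
 then have le: "4 * cmod (W v - W u) <= cmod (V v - V u)" if "c < u" "u < v" "v < d" for u v using that by (meson not_less)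
 have "AE t. t : {c<..<d} --> (1 :: complex) = 0"
  using prim_derivative_AE[OF W] prim_derivative_AE[OF V] w_nz
 proof eventually_elim
  case (elim t)
  show ?case
  proof
   assume t: "t : {c<..<d}"
   define e where "e = abs(w t) / 4"
   have e: "0 < e" using elim(3) by (simp add: e_def)
   obtain d1 where d1: "0 < d1" "!!y. norm (y - t) < d1 ==> cmod (W y - W t - (y - t) *\<^sub>R cor (w t)) <= e * norm (y - t)"
    using elim(1) e unfolding has_vector_derivative_def has_derivative_at_alt by blast
   obtain d2 where d2: "0 < d2" "!!y. norm (y - t) < d2 ==> cmod (V y - V t - (y - t) *\<^sub>R cor (abs(w t))) <= e * norm (y - t)"
    using elim(2) e unfolding has_vector_derivative_def has_derivative_at_alt by blast
   define h where "h = min (min d1 d2) (d - t) / 2"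
   have "2 * h <= d1" "2 * h <= d2" "2 * h <= d - t" "0 < h" using d1(1) d2(1) t by (auto simp: h_def)
   then have h: "0 < h" "h < d1" "h < d2" "t + h < d" by linarith+
   have "4 * (h * e) = cmod (h *\<^sub>R cor (w t))" "4 * (h * e) = cmod (h *\<^sub>R cor (abs(w t)))"
    using h by (simp_all add: e_def)
   moreover have "cmod (W (t + h) - W t - h *\<^sub>R cor (w t)) <= h * e" "cmod (V (t + h) - V t - h *\<^sub>R cor (abs(w t))) <= h * e"
    using d1(2)[of "t + h"] d2(2)[of "t + h"] h by (simp_all add: mult.commute)
   ultimately have "3 * (h * e) <= cmod (W (t + h) - W t)" "cmod (V (t + h) - V t) <= 5 * (h * e)"
    using norm_triangle_ineq2[of "h *\<^sub>R cor (w t)" "h *\<^sub>R cor (w t) - (W (t + h) - W t)"]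
     norm_triangle_ineq2[of "V (t + h) - V t" "h *\<^sub>R cor (abs(w t))"]
    by (simp_all add: norm_minus_commute)
   moreover have "0 < h * e" using h e by simp
   ultimately show "(1 :: complex) = 0" using le[of t "t + h"] t h by simp
  qed
 qed
 from continuous_AE_zero[OF continuous_on_const this, of "(c + d) / 2"] cd show False by simp
qed

text \<open>If |v| exceeded this value throughout [c, d], the kinetic energy would be at least |B| +
  1.\<close>

lemma small_momentum:
 assumes s: "sys l (%_. 0) f v" and k: "kinetic v <= B" and cd: "0 <= c" "c < d" "d <= a"
 shows "EX s:{c..d}. cmod (v s) <= sqrt ((abs B + 1) / (LEB t:{c..d}. rr t))" (is "EX s:_. _ <= ?M")
proof (rule ccontr)
 assume n: "~ ?thesis"
 note rh = rr_pos[OF cd(2)]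
 have "abs B + 1 = ?M^2 * (LEB t:{c..d}. rr t)" using rh by simp
 also have "... = (LEB t:{c..d}. ?M^2 * rr t)" by simp
 also have "... <= (LEB t:{c..d}. rr t * (cmod (v t))^2)"
 proof (rule set_integral_mono_loc[OF loc_int_cmult[OF rr(1)] rr_sq_loc[OF sys_continuous(2)[OF s]]])
  fix t assume "c <= t" "t <= d"
  then have "?M^2 <= (cmod (v t))^2" using n rh by (intro power_mono) (auto simp: not_le intro: less_imp_le)
  from mult_left_mono[OF this rr(2)[of t]] show "?M^2 * rr t <= rr t * (cmod (v t))^2" by (simp only: mult.commute)
 qed
 also have "... <= kinetic v" unfolding kinetic_def
  by (rule sub_interval_integral[OF rr_sq_loc[OF sys_continuous(2)[OF s]]]) (use cd rr(2) in auto)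
 finally show False using k by simp
qed

text \<open>A solution with bounded kinetic energy does not oscillate much, so near a maximum \<open>x\<^sub>0\<close> of its modulus
  \<open>\<integral> w f\<close> is about \<open>f x\<^sub>0 \<integral> w\<close>, while for large spectral parameter the equation forces \<open>\<integral> w f\<close> to be small
  on every interval.\<close>

lemma bounded_energy_bounded_parameter:
 "EX R. ALL l f v. sys l (%_. 0) f v & (ALL x:{0..a}. cmod (f x) <= 1) & (EX x:{0..a}. cmod (f x) = 1) & kinetic v <= B --> cmod l <= R"
proof -
 define H where "H l f v \<longleftrightarrow> sys l (%_. 0) f v & (ALL x:{0..a}. cmod (f x) <= 1) & kinetic v <= B" for l f v
 define J where "J x = 0 + oriented_integral 0 x (%t. cor (rr t))" for x
 have J: "prim J (%t. cor (rr t))" unfolding J_def[abs_def] by (rule prim_oriented_integral[OF loc_int_of_real[OF rr(1)]])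
 have Jd: "cmod (J y - J x) = (LEB t:{x..y}. rr t)" if "x <= y" for x y
  unfolding primD[OF J that] using set_integral_complex_of_real[of lebesgue "{x..y}" rr] set_integral_nonneg_loc[of x y rr] rr(2) by simp
 \<comment> \<open>The energy term in \<open>hom_modulus\<close> is then at most 1/8, and
   \<open>h\<close> is chosen to make the length term at most 1/8.\<close>
 define ta where "ta = 1 / (4 * (abs B + 1))"
 have ta: "0 < ta" "ta / 2 * B <= 1 / 8" by (simp_all add: ta_def pos_divide_le_eq)
 have "uniformly_continuous_on {0..a} J"
  by (rule compact_uniformly_continuous[OF continuous_on_subset[OF prim_continuous[OF J]]]) auto
 then obtain h where h: "0 < h" "!!x y. x : {0..a} ==> y : {0..a} ==> dist y x < h ==> dist (J y) (J x) < ta / 4"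
  by (rule uniformly_continuous_onE[of _ _ "ta / 4"]) (use ta in auto)
 have osc0: "cmod (f y - f x) <= 1 / 4" if H: "H l f v" and xy: "x : {0..a}" "y : {0..a}" "x <= y" "y - x < h" for l f v x y
 proof -
  have "cmod (f y - f x) <= ta / 2 * B + 1 / (2 * ta) * cmod (J y - J x)"
   using hom_modulus[OF _ _ xy(3) _ ta(1), of l f v B] H xy Jd[OF xy(3)] by (auto simp: H_def)
  moreover have "1 / (2 * ta) * cmod (J y - J x) <= 1 / (2 * ta) * (ta / 4)"
   using h(2)[OF xy(1,2)] xy ta by (intro mult_left_mono) (auto simp: dist_norm)
  moreover have "1 / (2 * ta) * (ta / 4) = 1 / 8" using ta by simp
  ultimately show ?thesis using ta(2) by linarith
 qed
 have osc: "cmod (f y - f x) <= 1 / 4" if "H l f v" "x : {0..a}" "y : {0..a}" "abs(y - x) < h" for l f v x y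
  using osc0[OF that(1-3)] osc0[OF that(1,3,2)] that(4) by (cases "x <= y") (auto simp: norm_minus_commute)
 \<comment> \<open>The bound found below depends on where the maximum is attained;
   \<open>Bolzano\<close> makes it uniform over [0, a].\<close>
 define P where "P c d \<longleftrightarrow> (EX R. ALL l f v. H l f v & (EX x:{c..d} Int {0..a}. cmod (f x) = 1) --> cmod l <= R)" for c d
 have "P 0 a"
 proof (rule Bolzano)
  show "0 <= a" using a_pos by simp
  show "P c e" if p: "P c d" "P d e" for c d e
  proof -
   obtain R R' where R: "!!l f v. H l f v & (EX x:{c..d} Int {0..a}. cmod (f x) = 1) ==> cmod l <= R"
    "!!l f v. H l f v & (EX x:{d..e} Int {0..a}. cmod (f x) = 1) ==> cmod l <= R'" using p unfolding P_def by blast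
   have "cmod l <= max R R'" if "H l f v" "x : {c..e} Int {0..a}" "cmod (f x) = 1" for l f v x
    using R[of l f v] that by (cases "x <= d") (force simp: le_max_iff_disj)+
   then show ?thesis unfolding P_def by blast
  qed
  fix x assume x: "0 <= x" "x <= a"
  define c d where "c = max 0 (x - h / 2)" and "d = min a (x + h / 2)"
  have cd: "0 <= c" "c < d" "d <= a" using x h(1) a_pos by (auto simp: c_def d_def)
  obtain u r where ur: "c < u" "u < r" "r < d" "cmod (V r - V u) < 4 * cmod (W r - W u)" using weight_not_cancelling[OF cd(2)] by blast
  \<comment> \<open>The quasi-derivative is controlled only at some point of a short interval, so
    the ends of the interval of integration cannot be prescribed. The lower bound \<open>et\<close>
    for \<open>G\<close> persists under small changes of both ends.\<close>
  define G where "G z = cmod (W (snd z) - W (fst z)) - cmod (V (snd z) - V (fst z)) / 4" for z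
  have WV: "continuous_on UNIV (%z. W (g z))" "continuous_on UNIV (%z. V (g z))" if "continuous_on UNIV g" for g :: "real \<times> real => real"
   by (rule continuous_on_compose2[OF prim_continuous[OF W] that] continuous_on_compose2[OF prim_continuous[OF V] that]; simp)+
  define et where "et = G (u, r) / 2"
  have et: "0 < et" using ur(4) by (simp add: et_def G_def)
  have "open {z. et < G z}" unfolding G_def by (intro open_Collect_less continuous_intros WV) auto
  moreover have "(u, r) : {z. et < G z}" using et by (simp add: et_def)
  ultimately obtain A A' where A: "open A" "open A'" "(u, r) : A \<times> A'" "A \<times> A' <= {z. et < G z}"
   by (rule open_prod_elim)
  obtain e e' where e: "0 < e" "cball u e <= A" "0 < e'" "cball r e' <= A'" using A by (metis open_contains_cball mem_Sigma_iff)
  define de where "de = min (min e e') (min (r - u) (d - r))"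
  have de: "0 < de" "u + de <= r" "r + de <= d" "de <= e" "de <= e'" using e ur by (auto simp: de_def)
  have G: "et < G (s, t)" if "s : {u..u + de}" "t : {r..r + de}" for s t
  proof -
   have "s : cball u e" "t : cball r e'" using that de by (auto simp: dist_real_def)
   then show ?thesis using e A(4) by blast
  qed
  define M where "M c d = sqrt ((abs B + 1) / (LEB t:{c..d}. rr t))" for c d
  define Q0 where "Q0 = (LEB t:{0..a}. abs(q t))"
  have bound: "cmod l <= (Q0 + M u (u + de) + M r (r + de)) / et"
   if H: "H l f v" and x0: "x0 : {0..a}" "cmod (f x0) = 1" "abs(x0 - x) < h / 2" for l f v x0
  proof -
   have s: "sys l (%_. 0) f v" and f1: "!!t. t : {0..a} ==> cmod (f t) <= 1" and k: "kinetic v <= B" using H by (auto simp: H_def)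
   obtain s' where s': "s' : {u..u + de}" "cmod (v s') <= M u (u + de)"
    using small_momentum[OF s k, of u "u + de"] cd ur de unfolding M_def by auto
   obtain t' where t': "t' : {r..r + de}" "cmod (v t') <= M r (r + de)"
    using small_momentum[OF s k, of r "r + de"] cd ur de unfolding M_def by auto
   have st: "s' <= t'" "c <= s'" "t' <= d" using s' t' de ur by auto
   have sub: "t : {0..a}" "abs(t - x0) < h" if "t : {s'..t'}" for t 
   proof -
    have "x - h / 2 <= c" "d <= x + h / 2" by (auto simp: c_def d_def)
    then show "t : {0..a}" "abs(t - x0) < h" using that st cd x0 by (auto simp: abs_if split: if_splits)
   qed
   define Fi where "Fi x = 0 + oriented_integral 0 x (%t. cor (w t) * f t)" for x
   have Fi: "prim Fi (%t. cor (w t) * f t)"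
    unfolding Fi_def[abs_def] by (rule prim_oriented_integral) (use wint_continuous[OF sys_continuous(1)[OF s]] in "simp add: wint_def")
   \<comment> \<open>The equation reads (v + l Fi)' = q f. So \<open>l\<close> times the integral of
     w f is bounded by \<open>Q0\<close> and the values of \<open>v\<close> at the two ends.\<close>
   have "cmod ((v t' + l * Fi t') - (v s' + l * Fi s')) <= (LEB t:{s'..t'}. abs(q t))"
   proof (rule prim_norm_le[OF prim_add[OF sysD(2)[OF s] prim_cmult[OF Fi]] st(1) loc_int_abs[OF q_loc]])
    show "AE t. t : {s'..t'} --> cmod ((cor (q t) - l * cor (w t)) * f t - cor (w t) * 0 + l * (cor (w t) * f t)) <= abs(q t)"
     using f1 sub(1) by (intro AE_I2) (simp add: algebra_simps norm_mult mult_left_le)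
   qed
   also have "... <= Q0" unfolding Q0_def by (rule sub_interval_integral) (use st cd in "auto intro: loc_int_abs q_loc")
   finally have 1: "cmod (v t' - v s' + l * (Fi t' - Fi s')) <= Q0" by (simp add: algebra_simps)
   have "cmod ((Fi t' - f x0 * W t') - (Fi s' - f x0 * W s')) <= (LEB t:{s'..t'}. 1 / 4 * abs(w t))"
   proof (rule prim_norm_le[OF prim_diff[OF Fi prim_cmult[OF W]] st(1) loc_int_cmult[OF loc_int_abs[OF w_loc]]])
    have "cmod (cor (w t) * f t - f x0 * cor (w t)) <= 1 / 4 * abs(w t)" if t: "t : {s'..t'}" for t
    proof -
     have "cor (w t) * f t - f x0 * cor (w t) = cor (w t) * (f t - f x0)" by (simp add: algebra_simps)
     then show ?thesis using mult_left_mono[OF osc[OF H x0(1) sub[OF t]], of "abs(w t)"] by (simp add: norm_mult)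
    qed
    then show "AE t. t : {s'..t'} --> cmod (cor (w t) * f t - f x0 * cor (w t)) <= 1 / 4 * abs(w t)" by simp
   qed
   also have "... = cmod (V t' - V s') / 4" unfolding V_diff[OF st(1)] by simp
   finally have "cmod ((Fi t' - Fi s') - f x0 * (W t' - W s')) <= cmod (V t' - V s') / 4" by (simp add: algebra_simps)
   moreover have "cmod (f x0 * (W t' - W s')) = cmod (W t' - W s')" using x0(2) by (simp add: norm_mult)
   ultimately have "G (s', t') <= cmod (Fi t' - Fi s')"
    using norm_triangle_ineq2[of "f x0 * (W t' - W s')" "f x0 * (W t' - W s') - (Fi t' - Fi s')"] by (simp add: G_def norm_minus_commute)
   then have "cmod l * et <= cmod l * cmod (Fi t' - Fi s')" using G[OF s'(1) t'(1)] by (intro mult_left_mono) auto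
   also have "... <= Q0 + cmod (v t' - v s')"
    using 1 norm_triangle_ineq4[of "v t' - v s' + l * (Fi t' - Fi s')" "v t' - v s'"] by (simp add: norm_mult)
   also have "... <= Q0 + M u (u + de) + M r (r + de)" using norm_triangle_ineq4[of "v t'" "v s'"] s' t' by simp
   finally show ?thesis using et by (simp add: pos_le_divide_eq)
  qed
  show "EX d>0. ALL a b. a <= x & x <= b & b - a < d --> P a b"
  proof (intro exI[of _ "h / 2"] conjI allI impI)
   fix c d assume c: "c <= x & x <= d & d - c < h / 2"
   show "P c d" unfolding P_def
   proof (intro exI allI impI)
    fix l f v assume "H l f v & (EX x:{c..d} Int {0..a}. cmod (f x) = 1)"
    then obtain x0 where "H l f v" "x0 : {c..d}" "x0 : {0..a}" "cmod (f x0) = 1" by blast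
    then show "cmod l <= (Q0 + M u (u + de) + M r (r + de)) / et" using c by (intro bound[of l f v x0]) (auto simp: abs_if)
   qed
  qed (use h in simp)
 qed
 then obtain R where R: "!!l f v. H l f v & (EX x:{0..a} Int {0..a}. cmod (f x) = 1) ==> cmod l <= R" unfolding P_def by blast
 then show ?thesis by (intro exI[of _ R]) (auto simp: H_def)
qed

end

context periodic_SL
begin

text \<open>With \<open>th\<close> chosen by 2 cos th = r, the recurrence factors, and the translate
  of \<open>ph l\<close> minus exp (- i th) times \<open>ph l\<close> has multiplier exp (i th). If
  this function vanishes, \<open>ph l\<close> itself has multiplier exp (- i th).\<close>

lemma floquet_exists:
 assumes D: "disc l = cor r" "abs r <= 2"
 shows "EX f v th. sys l (%_. 0) f v & (EX x:{0<..<a}. f x ~= 0) & (ALL x. f (x + a) = cis th * f x & v (x + a) = cis th * v x) & r = 2 * cos th"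
proof -
 define th where "th = arccos (r / 2)"
 have r: "r = 2 * cos th" using D(2) by (simp add: th_def cos_arccos abs_le_iff)
 have step: "EX f v th. sys l (%_. 0) f v & (EX x:{0<..<a}. f x ~= 0) & (ALL x. f (x + a) = cis th * f x & v (x + a) = cis th * v x) & r = 2 * cos th"
  if s: "sys l (%_. 0) f v" and nz: "f y ~= 0 | v y ~= 0" and fl: "!!x. f (x + a) = cis th * f x & v (x + a) = cis th * v x" and r: "r = 2 * cos th" for f v y th
 proof -
  have "EX x:{0<..<a}. f x ~= 0" using sys_hom_zero[OF s, of y] nz by blast
  then show ?thesis using s fl r by blast
 qed
 define f where "f x = ph l (x + a) - cis (- th) * ph l x" for x
 define v where "v x = ph' l (x + a) - cis (- th) * ph' l x" for x
 have sh: "sys l (%_. 0) (%x. ph l (x + a)) (%x. ph' l (x + a))" using sys_translate[OF hom(1)] by simp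
 have s: "sys l (%_. 0) f v"
  using sys_diff[OF sh sys_cmult[OF hom(1)[of l 1 0], of "cis (- th)"]] by (simp add: f_def[abs_def] v_def[abs_def])
 have sum: "cis th + cis (- th) = disc l" unfolding D(1) r by (simp add: complex_eq_iff)
 have prod: "cis th * cis (- th) = 1" by (simp add: cis_mult)
 have fl: "f (x + a) = cis th * f x & v (x + a) = cis th * v x" for x
 proof -
  have g: "A2 - cis (- th) * A1 = cis th * (A1 - cis (- th) * A0)" if "A2 + A0 = disc l * A1" for A0 A1 A2
  proof -
   have "A2 = (cis th + cis (- th)) * A1 - A0" using that unfolding sum by (simp add: algebra_simps)
   then have "A2 - cis (- th) * A1 = cis th * A1 - (cis th * cis (- th)) * A0" unfolding prod by (simp add: algebra_simps)
   then show ?thesis by (simp only: right_diff_distrib mult.assoc)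
  qed
  show ?thesis unfolding f_def v_def using hom_step[OF hom(1), of l 1 0 "x + a"] by (intro conjI g) simp_all
 qed
 show ?thesis
 proof (cases "EX y. f y ~= 0 | v y ~= 0")
  case True
  then show ?thesis using step[OF s _ fl r] by blast
 next
  case False
  then have "ph l (x + a) = cis (- th) * ph l x & ph' l (x + a) = cis (- th) * ph' l x" for x
   by (auto simp: f_def v_def)
  then show ?thesis using step[OF hom(1)[of l 1 0], of 0 "- th"] r by (simp add: hom)
 qed
qed

lemma sys_cnj: assumes s: "sys l h u v" shows "sys (cnj l) (%x. cnj (h x)) (%x. cnj (u x)) (%x. cnj (v x))"
 by (rule sysI[OF prim_cnj[OF sysD(1)[OF s]] _ prim_cnj[OF sysD(2)[OF s]]]) simp_all

definition mass :: "(real => complex) => real" where "mass f = (LEB t:{0..a}. w t * (cmod (f t))^2)"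

definition potential :: "(real => complex) => real" where "potential f = (LEB t:{0..a}. q t * (cmod (f t))^2)"

lemma sq_loc: "continuous_on UNIV f ==> loc_int g ==> loc_int (%t. g t * (cmod (f t))^2)"
 by (rule loc_int_mult_continuous) (intro continuous_intros)

text \<open>Integrate the derivative of v cnj f over one period; the boundary terms cancel because
  the multiplier has modulus 1.\<close>

lemma energy_identity:
 assumes s: "sys l (%_. 0) f v" and fl: "f a = rh * f 0" "v a = rh * v 0" "cmod rh = 1"
 shows "cor (kinetic v + potential f) = l * cor (mass f)"
proof -
 note c = sys_continuous[OF s]
 let ?k = "%t. cor (rr t * (cmod (v t))^2)" and ?q = "%t. cor (q t * (cmod (f t))^2)"
  and ?w = "%t. cor (w t * (cmod (f t))^2)"
 have i: "loc_int ?k" "loc_int ?q" "loc_int ?w"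
  by (intro loc_int_of_real sq_loc c rr q_loc w_loc)+
 let ?g = "%x. v x * cnj (v x / cor (p x)) + ((cor (q x) - l * cor (w x)) * f x - cor (w x) * 0) * cnj (f x)"
 have P: "prim (%x. v x * cnj (f x)) ?g" by (rule prim_mult[OF sysD(2)[OF s] prim_cnj[OF sysD(1)[OF s]]])
 have "rh * cnj rh = 1" using fl(3) by (simp add: complex_norm_square[symmetric])
 moreover have "v a * cnj (f a) = (rh * cnj rh) * (v 0 * cnj (f 0))" unfolding fl(1,2) by (simp add: mult_ac)
 ultimately have "v a * cnj (f a) = v 0 * cnj (f 0)" by simp
 then have "(LEB t:{0..a}. ?g t) = 0" using primD[OF P, of 0 a] a_pos by simp
 also have "(LEB t:{0..a}. ?g t) = (LEB t:{0..a}. ?k t + (?q t - l * ?w t))"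
 proof (rule conjunct2[OF set_integral_cong_AE_lebesgue])
  show "sint {0..a} (%t. ?k t + (?q t - l * ?w t))" by (intro loc_intD loc_int_add loc_int_diff loc_int_cmult i)
  show "AE t. t : {0..a} --> ?g t = ?k t + (?q t - l * ?w t)"
   using p_pos
  proof eventually_elim
   case (elim t)
   have 1: "v t * cnj (v t / cor (p t)) = ?k t"
    using elim complex_norm_square[of "v t"] by (simp add: rr_def)
   have 2: "f t * cnj (f t) = cor ((cmod (f t))^2)" by (rule complex_norm_square[symmetric])
   have "((cor (q t) - l * cor (w t)) * f t - cor (w t) * 0) * cnj (f t)
     = (cor (q t) - l * cor (w t)) * (f t * cnj (f t))" by simp
   also have "... = ?q t - l * ?w t" unfolding 2 by (simp add: algebra_simps)
   finally show ?case unfolding 1 by simp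
  qed
 qed
 also have "... = (LEB t:{0..a}. ?k t) + (LEB t:{0..a}. ?q t - l * ?w t)"
  by (rule set_integral_add(2)) (intro loc_intD loc_int_diff loc_int_cmult i)+
 also have "(LEB t:{0..a}. ?q t - l * ?w t) = (LEB t:{0..a}. ?q t) - (LEB t:{0..a}. l * ?w t)"
  by (rule set_integral_diff(2)) (intro loc_intD loc_int_cmult i)+
 also have "(LEB t:{0..a}. l * ?w t) = l * (LEB t:{0..a}. ?w t)" by (rule set_integral_mult_right)
 finally show ?thesis
  unfolding set_integral_complex_of_real kinetic_def mass_def potential_def by (simp add: algebra_simps)
qed

text \<open>For fixed initial data, differentiate the recurrence of \<open>hom_step\<close> at the
  points 0, a, 2 a with respect to the parameter.\<close>

lemma hom_derivative_step:
 assumes s: "sys l (%_. 0) f v" and y: "sys l f y z" "y 0 = 0" "z 0 = 0"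
 shows "y (2 * a) - disc l * y a = deriv disc l * f a" "z (2 * a) - disc l * z a = deriv disc l * v a"
proof -
 let ?F = "%m. fst (hom m (f 0) (v 0))" and ?V = "%m. snd (hom m (f 0) (v 0))"
 have fv: "?F l = f" "?V l = v" by (rule sys_unique[OF hom(1)[of l "f 0" "v 0"] s, of 0]; rule hom)+
 have y': "sys l (?F l) y z" using y(1) fv by simp
 note d = hom_has_derivative[OF y' y(2,3)]
 have dd: "(disc has_field_derivative deriv disc l) (at l)" by (rule holomorphic_derivI[OF disc_holomorphic open_UNIV UNIV_I])
 have e: "?F m (2 * a) + ?F m 0 = disc m * ?F m a" "?V m (2 * a) + ?V m 0 = disc m * ?V m a" for m
  using hom_step[OF hom(1)[of m "f 0" "v 0"], of a] by (simp_all only: mult_2 diff_self)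
 have a0: "0 <= 2 * a" "0 <= a" using a_pos by auto
 have "((%m. ?F m (2 * a) + ?F m 0) has_field_derivative y (2 * a) + y 0) (at l)"
  by (intro DERIV_add d(1)) (use a0 in auto)
 moreover have "((%m. disc m * ?F m a) has_field_derivative deriv disc l * ?F l a + y a * disc l) (at l)"
  by (rule DERIV_mult[OF dd d(1)[OF a0(2)]])
 ultimately have "y (2 * a) + y 0 = deriv disc l * ?F l a + y a * disc l" unfolding e by (rule DERIV_unique)
 then show "y (2 * a) - disc l * y a = deriv disc l * f a" by (simp add: fv y algebra_simps)
 have "((%m. ?V m (2 * a) + ?V m 0) has_field_derivative z (2 * a) + z 0) (at l)"
  by (intro DERIV_add d(2)) (use a0 in auto)
 moreover have "((%m. disc m * ?V m a) has_field_derivative deriv disc l * ?V l a + z a * disc l) (at l)"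
  by (rule DERIV_mult[OF dd d(2)[OF a0(2)]])
 ultimately have "z (2 * a) + z 0 = deriv disc l * ?V l a + z a * disc l" unfolding e by (rule DERIV_unique)
 then show "z (2 * a) - disc l * z a = deriv disc l * v a" by (simp add: fv y algebra_simps)
qed

text \<open>Lagrange's identity for a Floquet solution \<open>f\<close> and the solution \<open>y\<close> of \<open>(A - l) y = f\<close>.\<close>

lemma deriv_disc_floquet:
 assumes s: "sys l (%_. 0) f v" and l: "cnj l = l" and D: "disc l = cor (2 * cos th)"
  and fl: "!!x. f (x + a) = cis th * f x" "!!x. v (x + a) = cis th * v x"
 shows "abs(sin th) * abs(mass f) = cmod (deriv disc l) * abs(Im (v 0 * cnj (f 0)))"
proof -
 define rh where "rh = cis th"
 have rh: "rh * cnj rh = 1" by (simp add: rh_def cis_cnj cis_mult)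
 have Drh: "disc l = rh + cnj rh" unfolding D rh_def by (simp add: complex_eq_iff)
 obtain y z where y: "sys l f y z" "y 0 = 0" "z 0 = 0"
  using sys_exists[OF wint_continuous[OF sys_continuous(1)[OF s]], of l 0 0 0] by (elim exE conjE) (rule that)
 define W where "W x = y x * cnj (v x) - z x * cnj (f x)" for x
 have sc: "sys l (%_. 0) (%x. cnj (f x)) (%x. cnj (v x))" using sys_cnj[OF s] l by simp
 let ?w = "%t. cor (w t * (cmod (f t))^2)"
 have W: "prim W ?w"
 proof -
  have "prim W (%x. (y x * ((cor (q x) - l * cor (w x)) * cnj (f x) - cor (w x) * 0) + z x / cor (p x) * cnj (v x))
    - (z x * (cnj (v x) / cor (p x)) + ((cor (q x) - l * cor (w x)) * y x - cor (w x) * f x) * cnj (f x)))"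
   unfolding W_def[abs_def] by (rule prim_diff[OF prim_mult[OF sysD(1)[OF y(1)] sysD(2)[OF sc]] prim_mult[OF sysD(2)[OF y(1)] sysD(1)[OF sc]]])
  moreover have "(y x * ((cor (q x) - l * cor (w x)) * cnj (f x) - cor (w x) * 0) + z x / cor (p x) * cnj (v x))
    - (z x * (cnj (v x) / cor (p x)) + ((cor (q x) - l * cor (w x)) * y x - cor (w x) * f x) * cnj (f x)) = ?w x" for x
  proof -
   have "?w x = cor (w x) * (f x * cnj (f x))" by (simp only: of_real_mult complex_norm_square[symmetric])
   then show ?thesis by (simp only:) (simp add: algebra_simps)
  qed
  ultimately show ?thesis by simp
 qed
 define F where "F = cor (mass f)"
 have Wa: "W a = F" using primD[OF W, of 0 a] a_pos y unfolding set_integral_complex_of_real by (simp add: W_def F_def mass_def)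
 \<comment> \<open>|f| is periodic, so the second period adds the same amount
   \<open>F\<close>.\<close>
 have W2a: "W (2 * a) = 2 * F"
 proof -
  have cm: "cmod (f (t + a)) = cmod (f t)" for t by (simp add: fl norm_mult)
  have i: "lint (%t. indicator {a..2*a} t *\<^sub>R ?w t)"
   using loc_intD[OF prim_loc_int[OF W], of a "2*a"] by (simp add: set_integrable_def)
  have "W (2 * a) - W a = (LEB t. indicator {a..2*a} t *\<^sub>R ?w t)" using primD[OF W, of a "2 * a"] a_pos by (simp add: set_lebesgue_integral_def)
  also have "... = (LEB t. indicator {a..2*a} (t + a) *\<^sub>R ?w (t + a))" by (rule integral_shift(2)[OF i, symmetric])
  also have "... = (LEB t:{0..a}. ?w t)" unfolding set_lebesgue_integral_def
   by (intro Bochner_Integration.integral_cong) (auto simp: indicator_def w_per cm)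
  also have "... = F" unfolding set_integral_complex_of_real by (simp add: F_def mass_def)
  finally show ?thesis using Wa by (simp add: algebra_simps)
 qed
 have fa: "f a = rh * f 0" "v a = rh * v 0" using fl[of 0] by (simp_all add: rh_def)
 have f2a: "f (2 * a) = rh * (rh * f 0)" "v (2 * a) = rh * (rh * v 0)" using fl[of a] fa by (simp_all only: rh_def mult_2)
 define al where "al = y a * cnj (v 0) - z a * cnj (f 0)"
 define bt where "bt = y (2 * a) * cnj (v 0) - z (2 * a) * cnj (f 0)"
 have cancel: "x = rh * y" if "cnj rh * x = y" for x y
  unfolding that[symmetric] mult.assoc[symmetric] rh by simp
 have "cnj rh * al = W a" unfolding W_def fa al_def by (simp add: algebra_simps)
 then have al: "al = rh * F" unfolding Wa by (rule cancel)
 have "cnj rh * (cnj rh * bt) = W (2 * a)" unfolding W_def f2a bt_def by (simp add: algebra_simps)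
 then have "cnj rh * bt = rh * (2 * F)" unfolding W2a by (rule cancel)
 then have bt: "bt = rh * (rh * (2 * F))" by (rule cancel)
 note h = hom_derivative_step[OF s y]
 define c0 where "c0 = Im (v 0 * cnj (f 0))"
 have c0: "f 0 * cnj (v 0) - v 0 * cnj (f 0) = - (2 * \<i> * cor c0)" by (simp add: c0_def complex_eq_iff)
 \<comment> \<open>This quantity is evaluated in two ways: here through
   \<open>hom_derivative_step\<close>, and below from W a = F and W (2 a) = 2 F.\<close>
 have "bt - disc l * al = (y (2 * a) - disc l * y a) * cnj (v 0) - (z (2 * a) - disc l * z a) * cnj (f 0)"
  unfolding al_def bt_def by (simp only: left_diff_distrib right_diff_distrib mult.assoc) simp
 also have "... = rh * (deriv disc l * (f 0 * cnj (v 0) - v 0 * cnj (f 0)))" unfolding h fa by (simp only: right_diff_distrib mult_ac)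
 finally have 1: "bt - disc l * al = rh * (deriv disc l * - (2 * \<i> * cor c0))" unfolding c0 .
 have "bt - disc l * al = rh * ((rh - cnj rh) * F)" unfolding al bt Drh by (simp add: algebra_simps)
 also have "rh - cnj rh = 2 * \<i> * cor (sin th)" by (simp add: rh_def complex_eq_iff)
 finally have "cmod (rh * (2 * \<i> * cor (sin th) * F)) = cmod (rh * (deriv disc l * - (2 * \<i> * cor c0)))" using 1 by (simp only:)
 then show ?thesis unfolding c0_def[symmetric] by (simp add: norm_mult rh_def F_def)
qed

text \<open>For large |l| the kinetic energy dominates the potential one, so l times
  \<open>mass f\<close> is real and nonzero, and l is real. The Wronskian of \<open>f\<close> and
  its conjugate is bounded by the energy, hence by |l| |mass f|; in
  \<open>deriv_disc_floquet\<close> the factor |mass f| then cancels.\<close>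

lemma large_parameter:
 "EX R C. 0 < R & 0 < C & (ALL l r. R < cmod l --> disc l = cor r --> abs r <= 2 --> 
   Im l = 0 & sqrt (4 - r^2) <= C * cmod l * cmod (deriv disc l))"
proof -
 define Q0 where "Q0 = (LEB t:{0..a}. abs(q t))"
 have Q00: "0 <= Q0" unfolding Q0_def by (intro set_integral_nonneg_loc) simp
 define P where "P = (LEB t:{0..a}. rr t)"
 have P: "0 < P" unfolding P_def by (rule rr_pos[OF a_pos])
 \<comment> \<open>Above the bound 2 Q0 + 1 for normalized solutions, the kinetic energy exceeds
   both twice the potential energy and the squared maximum of |f|.\<close>
 obtain R where R: "!!l f v. sys l (%_. 0) f v ==> (ALL x:{0..a}. cmod (f x) <= 1) ==> (EX x:{0..a}. cmod (f x) = 1) ==> kinetic v <= 2 * Q0 + 1 ==> cmod l <= R"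
  using bounded_energy_bounded_parameter[of "2 * Q0 + 1"] by blast
 have "Im l = 0 & sqrt (4 - r^2) <= (2 * ((1 + P) / P)) * cmod l * cmod (deriv disc l)"
  if l: "max R 1 < cmod l" and D: "disc l = cor r" "abs r <= 2" for l r
 proof -
  obtain f v th where f: "sys l (%_. 0) f v" "EX x:{0<..<a}. f x ~= 0" "ALL x. f (x + a) = cis th * f x & v (x + a) = cis th * v x" "r = 2 * cos th"
   using floquet_exists[OF D] by (elim exE conjE) (rule that)
  note c = sys_continuous[OF f(1)]
  have "continuous_on {0..a} (%x. cmod (f x))" by (intro continuous_on_norm continuous_on_subset[OF c(1)]) simp
  then obtain x0 where x0: "x0 : {0..a}" "ALL x:{0..a}. cmod (f x) <= cmod (f x0)"
   using continuous_attains_sup[OF compact_Icc, of 0 a "%x. cmod (f x)"] a_pos by auto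
  define M where "M = cmod (f x0)"
  have M: "0 < M"
  proof -
   obtain x where "x : {0<..<a}" "f x ~= 0" using f(2) by blast
   then have "0 < cmod (f x)" "cmod (f x) <= M" using x0(2) by (auto simp: M_def)
   then show ?thesis by linarith
  qed
  define K where "K = kinetic v"
  have K: "(2 * Q0 + 1) * M^2 < K"
  proof (rule ccontr)
   assume n: "~ ?thesis"
   have s: "sys l (%_. 0) (%x. cor (1 / M) * f x) (%x. cor (1 / M) * v x)"
    using sys_cmult[OF f(1), of "cor (1 / M)"] by simp
   have "kinetic (%x. cor (1 / M) * v x) = (LEB t:{0..a}. (1 / M^2) * (rr t * (cmod (v t))^2))"
    unfolding kinetic_def using M by (intro set_lebesgue_integral_cong) (auto simp: norm_divide norm_mult power_divide)
   also have "... = (1 / M^2) * K" unfolding K_def kinetic_def by simp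
   also have "... <= 2 * Q0 + 1" using n M by (simp add: field_simps)
   finally have "kinetic (%x. cor (1 / M) * v x) <= 2 * Q0 + 1" .
   moreover have "ALL x:{0..a}. cmod (cor (1 / M) * f x) <= 1" using x0(2) M by (simp add: norm_divide M_def)
   moreover have "EX x:{0..a}. cmod (cor (1 / M) * f x) = 1" using x0(1) M by (intro bexI[of _ x0]) (simp_all add: norm_divide M_def)
   ultimately have "cmod l <= R" using R[OF s] by blast
   then show False using l by simp
  qed
  have pot: "abs(potential f) <= Q0 * M^2"
  proof -
   have i: "loc_int (%t. q t * (cmod (f t))^2)" by (rule sq_loc[OF c(1) q_loc])
   have "abs(potential f) <= (LEB t:{0..a}. abs(q t * (cmod (f t))^2))"
    unfolding potential_def using set_integral_norm_bound[OF loc_intD[OF i], of 0 a] by simp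
   also have "... <= (LEB t:{0..a}. M^2 * abs(q t))"
   proof (rule set_integral_mono_loc)
    fix t assume "0 <= t" "t <= a"
    then have "(cmod (f t))^2 <= M^2" using x0(2) by (intro power_mono) (auto simp: M_def)
    from mult_left_mono[OF this, of "abs(q t)"] show "abs(q t * (cmod (f t))^2) <= M^2 * abs(q t)" by (simp add: abs_mult mult.commute)
   qed (intro loc_int_abs i loc_int_cmult q_loc)+
   finally show ?thesis by (simp add: Q0_def mult.commute)
  qed
  have M2: "0 < M^2" using M by simp
  have QM: "0 <= Q0 * M^2" using Q00 by simp
  have K': "2 * (Q0 * M^2) + M^2 < K" using K by (simp add: algebra_simps)
  have Kp: "K / 2 < K + potential f" "0 < K" "M^2 < K" using K' abs_le_D2[OF pot] M2 QM by linarith+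
  have fl: "f (x + a) = cis th * f x" "v (x + a) = cis th * v x" for x using f(3) by auto
  have en: "cor (K + potential f) = l * cor (mass f)"
   unfolding K_def by (rule energy_identity[OF f(1), where rh="cis th"]) (use fl[of 0] in simp_all)
  have F: "mass f ~= 0"
  proof
   assume "mass f = 0"
   then have "cor (K + potential f) = cor 0" unfolding en by simp
   then have "K + potential f = 0" unfolding of_real_eq_iff .
   then show False using Kp by linarith
  qed
  have "Im (l * cor (mass f)) = 0" unfolding en[symmetric] by simp
  then have Iml: "Im l = 0" using F by simp
  then have lc: "cnj l = l" by (simp add: complex_eq_iff)
  have lF: "K / 2 < cmod l * abs(mass f)"
  proof -
   have "cmod (cor (K + potential f)) = cmod l * abs(mass f)" unfolding en by (simp add: norm_mult)
   then show ?thesis using Kp(1,2) unfolding norm_of_real by linarith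
  qed
  define c0 where "c0 = Im (v 0 * cnj (f 0))"
  have sc: "sys l (%_. 0) (%x. cnj (f x)) (%x. cnj (v x))" using sys_cnj[OF f(1)] lc by simp
  have cc: "Im (v t * cnj (f t)) = c0" for t
  proof -
   have e: "f x * cnj (v x) - v x * cnj (f x) = - (2 * \<i> * cor (Im (v x * cnj (f x))))" for x by (simp add: complex_eq_iff)
   have "f t * cnj (v t) - v t * cnj (f t) = f 0 * cnj (v 0) - v 0 * cnj (f 0)" by (rule wronskian_const[OF f(1) sc])
   then have "cor (Im (v t * cnj (f t))) = cor (Im (v 0 * cnj (f 0)))" unfolding e by simp
   then show ?thesis unfolding c0_def of_real_eq_iff .
  qed
  \<comment> \<open>Im (v cnj f) does not depend on the point, so its modulus can be integrated
    against 1 / p and estimated by |v|^2 and M^2.\<close>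
  have cP: "abs c0 * P <= (K + M^2 * P) / 2"
  proof -
   note i = rr_sq_loc[OF c(2)]
   have "abs c0 * P = (LEB t:{0..a}. abs c0 * rr t)" by (simp add: P_def)
   also have "... <= (LEB t:{0..a}. 1 / 2 * (rr t * (cmod (v t))^2) + M^2 / 2 * rr t)"
   proof (rule set_integral_mono_loc)
    fix t assume t: "0 <= t" "t <= a"
    have "abs c0 <= cmod (v t * cnj (f t))" unfolding cc[of t, symmetric] by (rule abs_Im_le_cmod)
    also have "... <= cmod (v t) * M" unfolding norm_mult using x0(2) t by (intro mult_left_mono) (auto simp: M_def)
    also have "... <= 1 / 2 * (cmod (v t))^2 + M^2 / 2" using sum_squares_bound[of "cmod (v t)" M] by simp
    finally show "abs c0 * rr t <= 1 / 2 * (rr t * (cmod (v t))^2) + M^2 / 2 * rr t"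
     using mult_right_mono[OF _ rr(2)[of t]] by (fastforce simp: algebra_simps)
   qed (intro loc_int_cmult loc_int_add rr i)+
   also have "... = 1 / 2 * K + M^2 / 2 * P" unfolding K_def kinetic_def P_def
    by (subst set_integral_add(2)) (simp_all add: loc_intD loc_int_cmult rr i)
   finally show ?thesis by (simp add: field_simps)
  qed
  have "M^2 * P <= K * P" using Kp(3) P by (intro mult_right_mono) auto
  then have "abs c0 * P <= K / 2 * (1 + P)" using cP by (simp add: algebra_simps)
  also have "... <= (cmod l * abs(mass f)) * (1 + P)" using lF P by (intro mult_right_mono) auto
  finally have c1: "abs c0 <= (cmod l * abs(mass f)) * ((1 + P) / P)" using P by (simp add: pos_le_divide_eq)
  have "abs(sin th) * abs(mass f) = cmod (deriv disc l) * abs c0"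
   unfolding c0_def by (rule deriv_disc_floquet[OF f(1) lc _ fl]) (use D(1) f(4) in simp)
  also have "... <= cmod (deriv disc l) * ((cmod l * abs(mass f)) * ((1 + P) / P))" by (intro mult_left_mono c1) simp
  finally have "abs(sin th) * abs(mass f) <= (((1 + P) / P) * cmod l * cmod (deriv disc l)) * abs(mass f)" by (simp only: mult_ac)
  then have sn: "abs(sin th) <= ((1 + P) / P) * cmod l * cmod (deriv disc l)" using F by (simp only: mult_le_cancel_right)
  have "4 - r^2 = (2 * abs(sin th))^2" unfolding f(4) by (simp add: power_mult_distrib sin_squared_eq)
  then have "sqrt (4 - r^2) = 2 * abs(sin th)" by (simp add: real_sqrt_unique)
  moreover have "2 * abs(sin th) <= 2 * (((1 + P) / P) * cmod l * cmod (deriv disc l))" using sn by simp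
  ultimately show ?thesis using Iml by (simp only: mult.assoc)
 qed
 moreover have "0 < 2 * ((1 + P) / P)" using P by simp
 moreover have "0 < max R 1" by simp
 ultimately show ?thesis by blast
qed

end

section \<open>Regular spectral curves\<close>

text \<open>Equal values at two points force an extremum between them, possibly of a constant
  function, whereas \<open>f\<close> is strictly monotone near interior points.\<close>

lemma locally_injective_continuous_inj:
 fixes f :: "real => real"
 assumes J: "is_interval J" and f: "continuous_on J f"
  and loc: "!!x. x : J ==> EX e>0. inj_on f (J Int ball x e)"
 shows "inj_on f J"
proof (rule ccontr)
 assume "~ ?thesis"
 then obtain x y where xy: "x : J" "y : J" "x < y" "f x = f y" by (metis inj_onI linorder_neqE_linordered_idom)
 have sub: "{x..y} <= J" using J xy unfolding is_interval_1 by (meson atLeastAtMost_iff subsetI)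
 have c: "continuous_on {x..y} f" by (rule continuous_on_subset[OF f sub])
 have no_ext: False if z: "z : {x<..<y}" and ext: "(ALL s:{x..y}. f s <= f z) | (ALL s:{x..y}. f z <= f s)" for z
 proof -
  have "z : J" using sub z by auto
  from loc[OF this] obtain e where e: "0 < e" "inj_on f (J Int ball z e)" by blast
  define d where "d = min e (min (z - x) (y - z)) / 2"
  have "2 * d <= e" "2 * d <= z - x" "2 * d <= y - z" "0 < d" using e(1) z by (simp_all add: d_def)
  then have d: "0 < d" "d < e" "x < z - d" "z + d < y" by linarith+
  have s: "{z-d..z+d} <= J Int ball z e" using sub d by (auto simp: dist_real_def)
  have "f (z - d) < f z & f z < f (z + d) | f (z + d) < f z & f z < f (z - d)"
   using continuous_inj_imp_mono[of "z - d" z "z + d" f] d(1) continuous_on_subset[OF f, of "{z-d..z+d}"] inj_on_subset[OF e(2) s] s by auto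
  moreover have "z - d : {x..y}" "z + d : {x..y}" using d by auto
  ultimately show False using ext by fastforce
 qed
 have ne: "{x..y} ~= {}" using xy by simp
 obtain M where M: "M : {x..y}" "ALL s:{x..y}. f s <= f M" using continuous_attains_sup[OF compact_Icc ne c] by blast
 obtain m where m: "m : {x..y}" "ALL s:{x..y}. f m <= f s" using continuous_attains_inf[OF compact_Icc ne c] by blast
 have "f M = f x"
 proof (cases "M = x | M = y")
  case False
  then show ?thesis using no_ext[of M] M by force
 qed (use xy(4) in auto)
 moreover have "f m = f x"
 proof (cases "m = x | m = y")
  case False
  then show ?thesis using no_ext[of m] m by force
 qed (use xy(4) in auto)
 moreover have "f m <= f ((x + y) / 2)" using m(2) xy(3) by auto
 ultimately have "ALL s:{x..y}. f s <= f ((x + y) / 2)" using M(2) by auto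
 then show False using no_ext[of "(x + y) / 2"] xy(3) by auto
qed

context periodic_SL
begin

text \<open>Along the path the discriminant is real, and its nonzero derivative makes it locally
  injective; for real functions on an interval this implies injectivity.\<close>

lemma disc_injective_on_path:
 fixes J :: "real set" and gm :: "real => complex"
 assumes J: "is_interval J" and gm: "continuous_on J gm" "inj_on gm J"
  and D: "!!t. t : J ==> disc (gm t) : cor ` {-2..2} & deriv disc (gm t) ~= 0"
 shows "inj_on disc (gm ` J)"
proof -
 define f where "f t = Re (disc (gm t))" for t
 have fr: "disc (gm t) = cor (f t)" if "t : J" for t using D[OF that] by (auto simp: f_def)
 have "inj_on f J"
 proof (rule locally_injective_continuous_inj[OF J])
  have "continuous_on J (%t. disc (gm t))"
   by (rule continuous_on_compose2[OF holomorphic_on_imp_continuous_on[OF disc_holomorphic] gm(1)]) simp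
  then show "continuous_on J f" unfolding f_def[abs_def] by (intro continuous_intros)
  fix x assume x: "x : J"
  have "deriv disc (gm x) ~= 0" using D[OF x] by simp
  from holomorphic_local_inverse[OF disc_holomorphic this zero_less_one]
  obtain r where r: "0 < r" "inj_on disc (ball (gm x) r)" by blast
  have "ALL e>0. EX d>0. ALL t:J. dist t x < d --> dist (gm t) (gm x) < e" using gm(1) x unfolding continuous_on_iff by blast
  then obtain d where d: "0 < d" "!!t. t : J ==> dist t x < d ==> dist (gm t) (gm x) < r" using r(1) by blast
  show "EX e>0. inj_on f (J Int ball x e)"
  proof (intro exI[of _ d] conjI d(1) inj_onI)
   fix s t assume st: "s : J Int ball x d" "t : J Int ball x d" "f s = f t"
   then have "disc (gm s) = disc (gm t)" using fr by simp
   moreover have "gm s : ball (gm x) r" "gm t : ball (gm x) r" using d(2) st by (auto simp: dist_commute)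
   ultimately have "gm s = gm t" using r(2) by (auto dest: inj_onD)
   then show "s = t" using gm(2) st by (auto dest: inj_onD)
  qed
 qed
 then show ?thesis using fr by (intro inj_onI) (auto dest: inj_onD)
qed

text \<open>A piece of the path is reparametrized so that the discriminant becomes an affine
  function \<open>s\<close> of \<open>u\<close>. The new parametrization \<open>h\<close> is
  differentiable because it is locally the composition of \<open>s\<close> with a holomorphic
  inverse of the discriminant.\<close>

lemma spectral_path_bounded:
 fixes J :: "real set" and gm :: "real => complex"
 assumes J: "is_interval J" and gm: "continuous_on J gm" "inj_on gm J"
  and D: "!!t. t : J ==> disc (gm t) : cor ` {-2..2} & deriv disc (gm t) ~= 0"
 shows "bounded (gm ` J)"
proof (cases "J = {}")
 case False
 then obtain t0 where t0: "t0 : J" by blast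
 obtain R C where RC: "0 < R" "0 < C" "!!l r. R < cmod l ==> disc l = cor r ==> abs r <= 2 ==>
   Im l = 0 & sqrt (4 - r^2) <= C * cmod l * cmod (deriv disc l)" using large_parameter by blast
 define R1 where "R1 = max R (cmod (gm t0)) + 1"
 have R1: "R < R1" "cmod (gm t0) < R1" "0 < R1" using RC(1) by (auto simp: R1_def)
 have E: "1 <= exp (C * pi)" using RC(2) by simp
 have "cmod (gm t1) <= R1 * exp (C * pi)" if t1: "t1 : J" for t1
 proof (rule ccontr)
  assume "~ ?thesis"
  then have big: "R1 * exp (C * pi) < cmod (gm t1)" by simp
  have "R1 * 1 <= R1 * exp (C * pi)" using E R1(3) by (intro mult_left_mono) auto
  then have big1: "R1 < cmod (gm t1)" using big by simp
  define f where "f t = Re (disc (gm t))" for t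
  have f: "disc (gm t) = cor (f t)" "abs(f t) <= 2" if "t : J" for t using D[OF that] by (auto simp: f_def abs_le_iff)
  define K where "K = closed_segment t0 t1"
  have K: "K <= J" "compact K" "connected K" "t0 : K" "t1 : K"
   using closed_segment_subset[OF t0 t1 is_interval_convex[OF J]] by (simp_all add: K_def)
  have fi: "inj_on f K"
  proof (rule inj_onI)
   fix x y assume "x : K" "y : K" and e: "f x = f y"
   then have xy: "x : J" "y : J" using K(1) by auto
   have "disc (gm x) = disc (gm y)" using f(1)[OF xy(1)] f(1)[OF xy(2)] e by simp
   from inj_onD[OF disc_injective_on_path[OF J gm D] this imageI[OF xy(1)] imageI[OF xy(2)]]
   show "x = y" by (rule inj_onD[OF gm(2) _ xy])
  qed
  have fc: "continuous_on K f" unfolding f_def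
   by (intro continuous_intros continuous_on_compose2[OF holomorphic_on_imp_continuous_on[OF disc_holomorphic] continuous_on_subset[OF gm(1) K(1)]]) simp
  define g where "g = the_inv_into K f"
  have g: "g (f t) = t" if "t : K" for t unfolding g_def by (rule the_inv_into_f_f[OF fi that])
  have gc: "continuous_on (f ` K) g" by (rule continuous_on_inv[OF fc K(2)]) (simp add: g)
  define De where "De = f t1 - f t0"
  define s where "s u = f t0 + u * De" for u
  have De: "De ~= 0" using big1 R1(2) inj_onD[OF fi _ K(5,4)] by (auto simp: De_def)
  have sK: "s u : f ` K" if "u : {0..1}" for u
  proof -
   have "convex (f ` K)" using connected_continuous_image[OF fc K(3)] by (simp add: is_interval_connected_1[symmetric] is_interval_convex_1[symmetric])
   then show ?thesis using convexD_alt[of "f ` K" "f t0" "f t1" u] K(4,5) that by (simp add: s_def De_def algebra_simps)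
  qed
  define h where "h u = gm (g (s u))" for u
  have gK: "g (s u) : K" if "u : {0..1}" for u using sK[OF that] g by auto
  have hs: "disc (h u) = cor (s u)" "abs(s u) <= 2" "deriv disc (h u) ~= 0" if "u : {0..1}" for u
   using sK[OF that] g f D K(1) by (auto simp: h_def)
  have h01: "h 0 = gm t0" "h 1 = gm t1" by (simp_all add: h_def s_def De_def g K)
  have hc: "continuous_on {0..1} h" unfolding h_def
   by (rule continuous_on_compose2[OF gm(1) continuous_on_compose2[OF gc]]) (use sK gK K(1) in "auto intro!: continuous_intros simp: s_def")
  have s2: "abs(s u) < 2" if u: "0 < u" "u < 1" for u
  proof -
   have *: "abs(f t0) <= 2" "abs(f t0 + De) <= 2" using hs(2)[of 0] hs(2)[of 1] by (simp_all add: s_def)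
   show ?thesis
   proof (cases "0 < De")
    case True
    then have "0 < u * De" "u * De < De" using u by auto
    then show ?thesis using * unfolding s_def by linarith
   next
    case False
    then have "u * De < 0" "De < u * De" using u De by (auto simp: mult_less_0_iff)
    then show ?thesis using * unfolding s_def by linarith
   qed
  qed
  have dh: "(h has_vector_derivative cor De * inverse (deriv disc (h u))) (at u)" if u: "u : {0<..<1}" for u
  proof -
   have u': "u : {0..1}" using u by simp
   from holomorphic_local_inverse[OF disc_holomorphic hs(3)[OF u'] zero_less_one]
   obtain r where r: "0 < r" "inj_on disc (ball (h u) r)" by blast
   obtain k where k: "k holomorphic_on disc ` ball (h u) r" "!!z. z : ball (h u) r ==> deriv disc z * deriv k (disc z) = 1"
    "!!z. z : ball (h u) r ==> k (disc z) = z"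
    using holomorphic_has_inverse[OF holomorphic_on_subset[OF disc_holomorphic subset_UNIV] open_ball r(2)] by metis
   have op: "open (disc ` ball (h u) r)"
    by (rule open_mapping_thm3[OF holomorphic_on_subset[OF disc_holomorphic subset_UNIV] open_ball r(2)])
   have "(s has_real_derivative De) (at u)" unfolding s_def by (auto intro!: derivative_eq_intros)
   then have "((%y. cor (s y)) has_vector_derivative cor De) (at u)"
    by (intro has_vector_derivative_of_real) (simp add: has_real_derivative_iff_has_vector_derivative)
   moreover have "(k has_field_derivative inverse (deriv disc (h u))) (at (cor (s u)))"
    using holomorphic_derivI[OF k(1) op imageI[of "h u"]] inverse_unique[OF k(2)[of "h u"]] r(1) hs(1)[OF u'] by simp
   ultimately have "((%y. k (cor (s y))) has_vector_derivative cor De * inverse (deriv disc (h u))) (at u)"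
    by (rule field_vector_diff_chain_at[unfolded comp_def])
   moreover have "open ({0<..<1} Int h -` ball (h u) r)"
    by (rule continuous_open_preimage[OF continuous_on_subset[OF hc]]) auto
   ultimately show ?thesis
    by (rule has_vector_derivative_transform_within_open) (use u r(1) k(3) in "auto simp: hs(1)[symmetric]")
  qed
  have hn: "continuous_on {0..1} (%u. cmod (h u))" by (intro continuous_intros hc)
  \<comment> \<open>Its largest element is the last parameter with modulus at most
    \<open>R1\<close>; beyond it the estimate for large parameters applies throughout.\<close>
  define Z where "Z = {0..1} Int (%u. cmod (h u)) -` {..R1}"
  have "compact Z" using continuous_closed_preimage[OF hn, of "{..R1}"] compact_Int_closed[of "{0..1::real}" Z] by (simp add: Z_def Int_absorb1)
  moreover have "0 : Z" using R1(2) by (simp add: Z_def h01)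
  ultimately obtain u where u: "u : Z" "!!s. s : Z ==> s <= u" using compact_attains_sup[of Z] by blast
  have "u ~= 1" using u(1) big1 by (auto simp: Z_def h01)
  then have u01: "0 <= u" "u < 1" "cmod (h u) <= R1" using u(1) by (auto simp: Z_def)
  have above: "R1 < cmod (h y)" if "u < y" "y <= 1" for y using u(2)[of y] that u01 by (force simp: Z_def)
  have hu: "R1 = cmod (h u)"
  proof (rule ccontr)
   assume "~ ?thesis"
   then have *: "cmod (h u) <= (cmod (h u) + R1) / 2" "(cmod (h u) + R1) / 2 < R1" "(cmod (h u) + R1) / 2 <= cmod (h 1)" "cmod (h u) ~= (cmod (h u) + R1) / 2"
    using u01 above[of 1] by auto
   from IVT'[OF *(1,3) _ continuous_on_subset[OF hn]] u01 obtain y where "u <= y" "y <= 1" "cmod (h y) = (cmod (h u) + R1) / 2" by auto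
   then show False using above[of y] *(2,4) by (cases "y = u") auto
  qed
  define N where "N y = (Re (h y))^2 + (Im (h y))^2" for y
  have N: "N y = (cmod (h y))^2" for y by (simp add: N_def cmod_power2)
  have Npos: "0 < N y" if "y : {u..1}" for y
   using above[of y] hu R1(3) that by (cases "y = u") (auto simp: N)
  \<comment> \<open>arcsin (s / 2) has the derivative De / sqrt (4 - s^2), so the first term grows
    at least as fast as ln (N y), and \<open>L\<close> increases. As arcsin changes by at most pi,
    |h| grows at most by the factor exp (C pi).\<close>
  define L where "L y = 2 * (C * sgn De * arcsin (s y / 2)) - ln (N y)" for y
  have "L u <= L 1"
  proof (rule DERIV_nonneg_imp_increasing_open[OF less_imp_le[OF u01(2)]])
   fix y assume y: "u < y" "y < 1"
   then have y': "y : {0<..<1}" "y : {0..1}" "y : {u..1}" "0 < y" using u01 by auto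
   define h' where "h' = cor De * inverse (deriv disc (h y))"
   have dh': "(h has_vector_derivative h') (at y)" unfolding h'_def by (rule dh[OF y'(1)])
   have dRI: "((%y. Re (h y)) has_real_derivative Re h') (at y)" "((%y. Im (h y)) has_real_derivative Im h') (at y)"
    unfolding has_real_derivative_iff_has_vector_derivative
    by (rule bounded_linear.has_vector_derivative[OF bounded_linear_Re dh'], rule bounded_linear.has_vector_derivative[OF bounded_linear_Im dh'])
   have dN: "(N has_real_derivative 2 * inner (h y) h') (at y)"
    unfolding N_def by (auto intro!: derivative_eq_intros dh' dRI simp: inner_complex_def algebra_simps)
   define Q where "Q = sqrt (4 - (s y)^2)"
   have s4: "0 < 4 - (s y)^2" using power_strict_mono[OF s2[OF y'(4) y(2)], of 2] by simp
   then have Q: "0 < Q" by (simp add: Q_def)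
   have sq: "sqrt (1 - (s y / 2)^2) = Q / 2"
    using s4 by (intro real_sqrt_unique) (simp_all add: Q_def power_divide field_simps)
   have "(s has_real_derivative De) (at y)" unfolding s_def by (auto intro!: derivative_eq_intros)
   then have da: "((%y. arcsin (s y / 2)) has_real_derivative inverse (sqrt (1 - (s y / 2)^2)) * (De / 2)) (at y)"
    using s2[OF y'(4) y(2)] by (intro DERIV_chain2[where f=arcsin, OF DERIV_arcsin DERIV_cdivide]) (auto simp: abs_less_iff)
   have dL: "(L has_real_derivative 2 * (C * sgn De * (inverse (sqrt (1 - (s y / 2)^2)) * (De / 2))) - inverse (N y) * (2 * inner (h y) h')) (at y)"
    unfolding L_def by (intro DERIV_diff DERIV_cmult da DERIV_chain2[where f=ln, OF DERIV_ln dN] Npos y')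
   have hy: "R < cmod (h y)" "0 < cmod (h y)" using above[OF y(1)] y(2) R1 by auto
   have "Q <= C * cmod (h y) * cmod (deriv disc (h y))"
    unfolding Q_def by (rule RC(3)[OF hy(1) hs(1,2)[OF y'(2)], THEN conjunct2])
   then have "abs(De) * Q <= abs(De) * (C * cmod (h y) * cmod (deriv disc (h y)))" by (intro mult_left_mono) auto
   then have b: "cmod h' / cmod (h y) <= C * abs(De) / Q" using Q hy(2) hs(3)[OF y'(2)]
    by (simp add: h'_def norm_mult norm_divide norm_inverse field_simps)
   have "inverse (N y) * (2 * inner (h y) h') <= inverse (N y) * (2 * (cmod (h y) * cmod h'))"
    using norm_cauchy_schwarz[of "h y" h'] Npos[OF y'(3)] by (intro mult_left_mono) auto
   also have "... = 2 * (cmod h' / cmod (h y))" using hy(2) by (simp add: N power2_eq_square field_simps)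
   also have "... <= 2 * (C * abs(De) / Q)" using b by simp
   also have "... = 2 * (C * sgn De * (inverse (sqrt (1 - (s y / 2)^2)) * (De / 2)))"
    unfolding sq using Q by (simp add: abs_sgn field_simps)
   finally show "EX z. (L has_real_derivative z) (at y) & 0 <= z" using dL by fastforce
  next
   have "{u..1} <= {0..1}" using u01(1) by auto
   moreover from this have "ALL y:{u..1}. - 1 <= s y / 2 & s y / 2 <= 1" using hs(2) by (fastforce simp: abs_le_iff)
   moreover have "ALL y:{u..1}. N y ~= 0" using Npos by force
   moreover have "continuous_on {u..1} s" unfolding s_def by (intro continuous_intros)
   moreover have "continuous_on {u..1} N" unfolding N_def by (intro continuous_intros continuous_on_subset[OF hc]) (use u01(1) in auto)
   ultimately show "continuous_on {u..1} L" unfolding L_def by (intro continuous_intros) auto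
  qed
  moreover have "sgn De * arcsin (s 1 / 2) - sgn De * arcsin (s u / 2) <= pi"
   using hs(2)[of 1] hs(2)[of u] u01 arcsin_bounded[of "s 1 / 2"] arcsin_bounded[of "s u / 2"] by (auto simp: sgn_if abs_le_iff)
  then have "2 * (C * (sgn De * arcsin (s 1 / 2) - sgn De * arcsin (s u / 2))) <= 2 * (C * pi)"
   using RC(2) by (intro mult_left_mono) auto
  ultimately have "ln (N 1) <= ln (N u) + 2 * (C * pi)" by (simp add: L_def algebra_simps)
  also have "... = ln ((R1 * exp (C * pi))^2)" using R1(3) by (simp add: N hu[symmetric] ln_mult ln_realpow power_mult_distrib)
  finally have "(cmod (h 1))^2 <= (R1 * exp (C * pi))^2" using Npos[of 1] u01 R1(3) by (subst (asm) ln_le_cancel_iff) (auto simp: N)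
  then have "cmod (h 1) <= R1 * exp (C * pi)" by (rule power2_le_imp_le) (use R1(3) in simp)
  then show False using big by (simp add: h01)
 qed
 then show ?thesis unfolding bounded_iff by blast
qed simp

end

text \<open>An interval of any kind is a countable union of compact intervals. Their ends are taken
  from a countable dense subset, joined by those end points that belong to \<open>J\<close>.\<close>

lemma borel_continuous_image_interval:
 fixes gm :: "real => complex"
 assumes J: "is_interval J" and c: "continuous_on J gm"
 shows "gm ` J : sets borel"
proof -
 obtain T where T: "countable T" "T <= J" "J <= closure T" using separable by blast
 define E where "E = {x:J. (ALL y:J. x <= y) | (ALL y:J. y <= x)}"
 have "finite E"
 proof -
  have one: "finite A" if "!!x y. x : A ==> y : A ==> x = y" for A :: "real set"
  proof (cases "A = {}")
   case False
   then obtain x where "x : A" by blast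
   then have "A <= {x}" using that by blast
   then show ?thesis by (rule finite_subset) simp
  qed simp
  have "finite {x:J. ALL y:J. x <= y}" "finite {x:J. ALL y:J. y <= x}"
   by (rule one; auto intro: order_antisym)+
  moreover have "E = {x:J. ALL y:J. x <= y} Un {x:J. ALL y:J. y <= x}" by (auto simp: E_def)
  ultimately show ?thesis by simp
 qed
 define U where "U = T Un E"
 have U: "countable U" "U <= J" using T `finite E` by (auto simp: U_def E_def uncountable_infinite countable_finite)
 have lower: "EX t:U. t <= x" if x: "x : J" for x
 proof (rule ccontr)
  assume n: "~ ?thesis"
  then have "T <= {x..}" by (auto simp: U_def not_le intro: less_imp_le)
  then have "J <= {x..}" using T(3) closure_minimal[of T "{x..}"] by auto
  then have "x : E" using x by (auto simp: E_def)
  then show False using n by (auto simp: U_def)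
 qed
 have upper: "EX t:U. x <= t" if x: "x : J" for x
 proof (rule ccontr)
  assume n: "~ ?thesis"
  then have "T <= {..x}" by (auto simp: U_def not_le intro: less_imp_le)
  then have "J <= {..x}" using T(3) closure_minimal[of T "{..x}"] by auto
  then have "x : E" using x by (auto simp: E_def)
  then show False using n by (auto simp: U_def)
 qed
 have sub: "{s..t} <= J" if "s : U" "t : U" for s t using J that U(2) unfolding is_interval_1 by (meson atLeastAtMost_iff subsetD subsetI)
 have "gm ` J = (\<Union>(s, t)\<in>U \<times> U. gm ` {s..t})"
 proof
  show "gm ` J <= (\<Union>(s, t)\<in>U \<times> U. gm ` {s..t})" using lower upper by fastforce
  show "(\<Union>(s, t)\<in>U \<times> U. gm ` {s..t}) <= gm ` J" using sub by blast
 qed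
 also have "... : sets borel"
 proof (rule sets.countable_UN'')
  show "countable (U \<times> U)" using U(1) by simp
  fix st assume "st : U \<times> U"
  then obtain s t where st: "st = (s, t)" "s : U" "t : U" by auto
  have "compact (gm ` {s..t})" by (rule compact_continuous_image[OF continuous_on_subset[OF c sub[OF st(2,3)]] compact_Icc])
  then show "(case st of (s, t) => gm ` {s..t}) : sets borel" by (simp add: st(1) borel_compact)
 qed
 finally show ?thesis .
qed

section \<open>The periodic operator as an instance of the construction\<close>

context periodic_SL
begin

definition lift_op :: "(ae_fun => ae_fun) => l2 \<Rightarrow>\<^sub>L l2" where "lift_op B = Blinfun (%y. UU (B (VV y)))"

lemma lift_op:
 assumes B: "!!F. F : HH ==> B F : HH" "!!F G. F : HH ==> G : HH ==> B (F + G) = B F + B G"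
  "!!F c. F : HH ==> B (c *\<^sub>C F) = c *\<^sub>C B F" "!!F. F : HH ==> L2_norm w (B F) <= K * L2_norm w F"
 shows "lift_op B y = UU (B (VV y))" "clin (lift_op B)"
proof -
 have s: "UU (B (VV (c *\<^sub>C y))) = c *\<^sub>C UU (B (VV y))" for c y by (simp add: V_linear B V_X U_scale)
 have "bounded_linear (%y. UU (B (VV y)))"
  by (rule bounded_linear_intro[of _ K])
   (use B(4)[OF V_X] in "simp_all add: V_linear B(1-3) V_X U_add U_scale scaleR_scaleC U_norm V_norm mult.commute")
 then show e: "lift_op B y = UU (B (VV y))" for y by (simp add: lift_op_def bounded_linear_Blinfun_apply)
 show "clin (lift_op B)" by (simp add: clin_def e s)
qed

definition "QU l = lift_op (QQ l)"

lemma QU: "QU l y = UU (QQ l (VV y))" "clin (QU l)"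
 unfolding QU_def using lift_op[OF QQ_bound(1) QQ_linear QQ_bound(2)] by blast+

abbreviation "AU y == UU (AA (VV y))"

end

sublocale periodic_SL \<subseteq> cell: shift "%n. translation (real_of_int n * a)" "{cls f |f. f : square_integrable & (ALL x. x ~: {0..<a} --> f x = 0)}"
 by (rule shift_translation[OF a_pos])

sublocale periodic_SL \<subseteq> sp: shift_pencil "%n. translation (real_of_int n * a)" "{cls f |f. f : square_integrable & (ALL x. x ~: {0..<a} --> f x = 0)}"
 "UU ` DD" AU QU disc
proof unfold_locales
 have X: "F : DD ==> F : HH" for F using DD_subset by blast
 have S: "cell.S y = UU (shift_sum (VV y))" for y
 proof -
  obtain f where f: "VV y = ae_class f" "f : sq_integrable w" using L2E[OF V_X] by metis
  then show ?thesis using UU_shift_sum[OF f(2)] U_V[of y] by (simp add: cell.S_apply)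
 qed
 have SX: "shift_sum F : HH" if F: "F : HH" for F
 proof -
  have "shift_sum F = (AA (QQ 0 F) - 0 *\<^sub>C QQ 0 F) + disc 0 *\<^sub>C F" using QQ_right_inverse(2)[OF F, of 0] by simp
  then show ?thesis using max_op_L2[OF QQ_right_inverse(1)[OF F, of 0]] F by (simp add: X_closed)
 qed
 have sh: "UU (shift_sum (VV y) - c *\<^sub>C VV y) = cell.S y - c *\<^sub>C y" for y c
  by (simp add: U_diff U_scale SX V_X X_closed S U_V)
 have AU: "AU (UU F) = UU (AA F)" if "F : DD" for F using X[OF that] by (simp add: V_U)
 show "complex_vector.subspace (UU ` DD)"
  unfolding complex_vector.subspace_def using DD_subspace[unfolded complex_vector.subspace_def] X
  by (auto simp flip: U_add U_scale) (metis U_scale X_closed(4) complex_vector.scale_zero_left imageI)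
 show "EX K>=0. ALL l:cball 0 R. ALL m:cball 0 R. norm (QU l - QU m) <= K * cmod (l - m)" for R
 proof -
  obtain K where K: "0 <= K" "!!l m x. l : cball 0 R ==> m : cball 0 R ==> x : HH ==> L2_norm w (QQ l x - QQ m x) <= K * cmod (l - m) * L2_norm w x"
   using QQ_locally_lipschitz[of R] by blast
  have "norm (QU l - QU m) <= K * cmod (l - m)" if "l : cball 0 R" "m : cball 0 R" for l m
  proof (rule norm_blinfun_bound)
   show "norm ((QU l - QU m) y) <= K * cmod (l - m) * norm y" for y
    using K(2)[OF that V_X] by (simp add: blinfun.diff_left QU U_diff[symmetric] QQ_bound V_X U_norm V_norm X_closed)
  qed (simp add: K)
  then show ?thesis using K(1) by blast
 qed
 show "disc holomorphic_on UNIV" by (rule disc_holomorphic)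
 show "EX l. disc l ~: spec"
 proof -
  obtain R C where RC: "0 < R" "!!l r. R < cmod l ==> disc l = cor r ==> abs r <= 2 ==> Im l = 0"
   using large_parameter by blast
  \<comment> \<open>For |l| > R only real l have a discriminant in [-2, 2], so this point of the
    imaginary axis is regular.\<close>
  have "R < cmod (\<i> * cor (R + 1))" unfolding norm_mult norm_of_real using RC(1) by simp
  from RC(2)[OF this] have "disc (\<i> * cor (R + 1)) ~: spec" using RC(1) by (auto simp: spec_iff)
  then show ?thesis by blast
 qed
 fix x y :: l2 and l c :: complex
 show "clin (QU l)" by (rule QU)
 show "QU l x : UU ` DD" unfolding QU(1) using QQ_right_inverse(1)[OF V_X] by blast
 show "AU (QU l x) - l *\<^sub>C QU l x = cell.S x - disc l *\<^sub>C x"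
  unfolding QU(1) AU[OF QQ_right_inverse(1)[OF V_X]] sh[symmetric] QQ_right_inverse(2)[OF V_X, symmetric]
  using QQ_right_inverse(1)[OF V_X, of l x] by (simp add: U_diff U_scale X X_closed max_op_L2)
 show "AU (x + y) = AU x + AU y" if "x : UU ` DD" "y : UU ` DD"
  using that max_dom_add by (auto simp: U_add[symmetric] AU X max_op_L2)
 show "AU (c *\<^sub>C x) = c *\<^sub>C AU x" if "x : UU ` DD"
  using that max_dom_scale by (auto simp: U_scale[symmetric] AU X max_op_L2)
 show "QU l (AU x - l *\<^sub>C x) = cell.S x - disc l *\<^sub>C x" if "x : UU ` DD"
 proof -
  obtain F where F: "F : DD" "x = UU F" using \<open>x : UU ` DD\<close> by blast
  then have "AU x - l *\<^sub>C x = UU (AA F - l *\<^sub>C F)" by (simp add: AU U_diff U_scale X max_op_L2 X_closed)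
  then show ?thesis using F QQ_left_inverse[OF F(1), of l] sh[of x "disc l"] by (simp add: QU(1) V_U X X_closed max_op_L2)
 qed
 show "deriv disc l = 0" if "disc l : spec" and surj: "!!y. EX x:UU ` DD. AU x - l *\<^sub>C x = y"
 proof -
  obtain r where r: "disc l = cor r" "abs r <= 2" using `disc l : spec` by (auto simp: spec_iff)
  show ?thesis
  proof (rule surjective_disc_deriv[OF r])
   fix G assume G: "G : HH"
   obtain F where F: "F : DD" "AU (UU F) - l *\<^sub>C UU F = UU G" using surj[of "UU G"] by blast
   then have "UU (AA F - l *\<^sub>C F) = UU G" by (simp add: AU U_diff U_scale X max_op_L2 X_closed)
   then show "EX F:DD. AA F - l *\<^sub>C F = G" using F(1) G inj_onD[OF inj_U] X max_op_L2 X_closed by metis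
  qed
 qed
qed

context periodic_SL
begin

theorem regular_curve_spectral_function:
 assumes "regular_spectral_curve a w p q J gm"
 shows "EX E. local_spectral_function (L2_norm w) (L2 w) (max_dom w p q) (max_op w p q) (gm ` J) E"
proof -
 have J: "is_interval J" "continuous_on J gm" "inj_on gm J" using assms by (auto simp: regular_spectral_curve_def analytic_curve_def)
 have sp: "gm ` J <= spectrum (L2_norm w) (L2 w) (max_dom w p q) (max_op w p q)"
  using assms by (simp add: regular_spectral_curve_def max_spectrum_def)
 have "discriminant a w p q = disc" using discriminant_eq by blast
 then have dv: "!!t. t : J ==> deriv disc (gm t) ~= 0" using assms by (simp add: regular_spectral_curve_def)
 have T: "F : DD ==> AA F : HH" "F : DD ==> AU (UU F) = UU (AA F)" for F using DD_subset by (auto simp: V_U max_op_L2)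
 have spU: "gm ` J <= spectrum norm UNIV (UU ` DD) AU"
  using sp resolvent_set_transport[where T=AA and T'=AU, OF L2_subspace DD_subset order_refl T] by (simp add: spectrum_def U_image)
 have D: "disc (gm t) : cor ` {-2..2} & deriv disc (gm t) ~= 0" if "t : J" for t
  using sp.spectrum_disc[of "gm t"] spU dv[OF that] that unfolding spec_def by blast
 interpret regular_arc "%n. translation (real_of_int n * a)" "{cls f |f. f : square_integrable & (ALL x. x ~: {0..<a} --> f x = 0)}"
  "UU ` DD" AU QU disc "gm ` J"
 proof unfold_locales
  show "gm ` J : sets borel" by (rule borel_continuous_image_interval[OF J(1,2)])
  show "bounded (gm ` J)" by (rule spectral_path_bounded[OF J D])
  show "gm ` J <= spectrum norm UNIV (UU ` DD) AU" by (rule spU)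
  show "inj_on disc (gm ` J)" by (rule disc_injective_on_path[OF J D])
  show "!!l. l : gm ` J ==> deriv disc l ~= 0" using dv by blast
 qed
 show ?thesis using local_spectral_function_transport[where T=AA and T'=AU, OF DD_subset T local_spectral_function_E] by blast
qed

end

theorem theorem4p1:
  fixes a :: real and w p q :: "real \<Rightarrow> real" and J :: "real set" and \<gamma> :: "real \<Rightarrow> complex"
  assumes "a > 0"
    and "w \<in> borel_measurable lebesgue" and "p \<in> borel_measurable lebesgue"
    and "q \<in> borel_measurable lebesgue"
    and "\<And>x. w (x + a) = w x" and "\<And>x. p (x + a) = p x" and "\<And>x. q (x + a) = q x"
    and "set_integrable lebesgue {0<..<a} w"
    and "set_integrable lebesgue {0<..<a} q"
    and "set_integrable lebesgue {0<..<a} (\<lambda>x. 1 / p x)"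
    and "AE x in lebesgue. w x \<noteq> 0"
    and "AE x in lebesgue. p x > 0"
    and "regular_spectral_curve a w p q J \<gamma>"
  shows "\<exists>E. local_spectral_function (L2_norm w) (L2 w) (max_dom w p q) (max_op w p q) (\<gamma> ` J) E"
proof -
 interpret periodic_SL a w p q by unfold_locales (use assms in auto)
 show ?thesis by (rule regular_curve_spectral_function[OF assms(13)])
qed

end
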